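(* Let $\Omega\subset\mathbb{R}^2\simeq\mathbb{C}$ be a bounded simply connected Jordan domain whose boundary contains a line segment $I$. Let $\varphi$ be a solution of the minimal surface equation over $\Omega$, let $\psi$ be its dual solution of the maximal surface equation, and let $f\colon\mathbb{D}\to\Omega$ be the corresponding harmonic mapping. Then the following statements are equivalent. (i) $\varphi$ tends to plus infinity on $I$. (ii) $\psi$ tamely degenerates to a future-directed lightlike line segment on $I$. Moreover, in this case, the following condition holds. (iii) There exists a discontinuous point $w_0\in\partial\mathbb{D}$ of the boundary function $\hat f$ of $f$ such that $I\subset C(f,w_0)$.
   Context: Conventions: line segments are open; $\mathbb{D}$ is the open unit disk in $\mathbb{C}$; $\mathbb{E}^3$ is Euclidean space and $\mathbb{L}^3$ is $\mathbb{R}^3$ with the Lorentzian inner product of signature $(+,+,-)$; both are identified with $\mathbb{C}\times\mathbb{R}$. Minimal surface equation: $\mathrm{div}\big(\nabla\varphi/\sqrt{1+|\nabla\varphi|^2}\big)=0$. Maximal surface equation: $\mathrm{div}\big(\nabla\psi/\sqrt{1-|\nabla\psi|^2}\big)=0$ with $|\nabla\psi|<1$. Dual: for a solution $\varphi$ of the minimal surface equation over a simply connected domain $\Omega$, its dual $\psi$ (unique up to an additive constant, and a solution of the maximal surface equation) is defined by $d\psi=-\frac{\varphi_y}{\sqrt{1+|\nabla\varphi|^2}}dx+\frac{\varphi_x}{\sqrt{1+|\nabla\varphi|^2}}dy$. Corresponding harmonic mapping: the orientation-preserving univalent (injective) complex-valued harmonic mapping $f$ from $\mathbb{D}$ onto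 $\Omega$ such that $(f,\varphi\circ f)\colon\mathbb{D}\to\mathbb{E}^3$ is an isothermal (conformal) parametrization of $\mathrm{graph}(\varphi)$; it exists and is unique up to precomposition with a M\"obius automorphism of $\mathbb{D}$, and $(f,\psi\circ f)$ is then an isothermal parametrization of $\mathrm{graph}(\psi)\subset\mathbb{L}^3$. "$\varphi$ tends to plus infinity on $I$" means $\varphi(z)\to+\infty$ as $z\in\Omega$ tends to any point of $I$. Tame degeneration: let $\nu$ be the outward unit normal of $\Omega$ along $I$ and $\tau=i\nu$ (the positively oriented unit tangent). $\psi$ tamely degenerates to a future-directed lightlike line segment on $I$ if for each closed segment $J\subset I$, $\frac{\partial\psi}{\partial\tau}(z)=1+O(\mathrm{dist}(z,J)^2)$ as $z\to J$, $z\in\Omega$. Boundary function: for such $f$ onto a bounded Jordan domain there is a countable set $E\subset\partial\mathbb{D}$ such that for each $\zeta\in\partial\mathbb{D}\setminus E$ the unrestricted limit $\hat f(\zeta)=\lim_{w\to\zeta}f(w)$ exists and lies in $\partial\Omega$, $\hat f$ is continuous on $\partial\mathbb{D}\setminus E$, and at each point of $E$ the two one-sided limits of $\hat f$ (taken along $\partial\mathbb{D}\setminus E$) exist, lie in $\partial\Omega$ and are different. $\hat f$ is the boundary function of $f$ and the points of $E$ are its discontinuous points. Cluster set: $C(f,w_0)$ is the set of all $z$ with $z=\lim f(w_n)$ for some sequence $w_n\in\mathbb{D}$, $w_n\to w_0$. *)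

theory Defs
  imports "HOL-Analysis.Analysis"
begin

section \<open>Partial derivatives in the plane, identified with the complex numbers\<close>

definition dir_deriv :: "complex \<Rightarrow> (complex \<Rightarrow> 'a::real_normed_vector) \<Rightarrow> complex \<Rightarrow> 'a" where
  "dir_deriv v F z = vector_derivative (\<lambda>t::real. F (z + t *\<^sub>R v)) (at 0)"

definition dx :: "(complex \<Rightarrow> 'a::real_normed_vector) \<Rightarrow> complex \<Rightarrow> 'a" where
  "dx F = dir_deriv 1 F"

definition dy :: "(complex \<Rightarrow> 'a::real_normed_vector) \<Rightarrow> complex \<Rightarrow> 'a" where
  "dy F = dir_deriv \<i> F"

text \<open>The following two notions are only used for open sets \<open>S\<close>.\<close>

definition C1_on :: "(complex \<Rightarrow> 'a::real_normed_vector) \<Rightarrow> complex set \<Rightarrow> bool" where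
  "C1_on F S \<longleftrightarrow> (\<forall>z\<in>S. F differentiable (at z)) \<and>
     continuous_on S (dx F) \<and> continuous_on S (dy F)"

definition C2_on :: "(complex \<Rightarrow> 'a::real_normed_vector) \<Rightarrow> complex set \<Rightarrow> bool" where
  "C2_on F S \<longleftrightarrow> C1_on F S \<and> C1_on (dx F) S \<and> C1_on (dy F) S"

definition grad :: "(complex \<Rightarrow> real) \<Rightarrow> complex \<Rightarrow> complex" where
  "grad u z = Complex (dx u z) (dy u z)"

definition divergence :: "(complex \<Rightarrow> complex) \<Rightarrow> complex \<Rightarrow> real" where
  "divergence V z = dx (\<lambda>w. Re (V w)) z + dy (\<lambda>w. Im (V w)) z"

definition harmonic_on :: "(complex \<Rightarrow> complex) \<Rightarrow> complex set \<Rightarrow> bool" where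
  "harmonic_on F S \<longleftrightarrow> C2_on F S \<and> (\<forall>z\<in>S. dx (dx F) z + dy (dy F) z = 0)"


section \<open>Minimal and maximal surface equations, duality\<close>

definition minimal_surface_solution :: "complex set \<Rightarrow> (complex \<Rightarrow> real) \<Rightarrow> bool" where
  "minimal_surface_solution \<Omega> \<phi> \<longleftrightarrow> C2_on \<phi> \<Omega> \<and>
     (\<forall>z\<in>\<Omega>. divergence (\<lambda>w. grad \<phi> w /\<^sub>R sqrt (1 + (norm (grad \<phi> w))\<^sup>2)) z = 0)"

definition maximal_surface_solution :: "complex set \<Rightarrow> (complex \<Rightarrow> real) \<Rightarrow> bool" where
  "maximal_surface_solution \<Omega> \<psi> \<longleftrightarrow> C2_on \<psi> \<Omega> \<and> (\<forall>z\<in>\<Omega>. norm (grad \<psi> z) < 1) \<and>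
     (\<forall>z\<in>\<Omega>. divergence (\<lambda>w. grad \<psi> w /\<^sub>R sqrt (1 - (norm (grad \<psi> w))\<^sup>2)) z = 0)"

text \<open>
  The two components of the increment \<open>h\<close> play the roles of \<open>dx\<close> and \<open>dy\<close>. That \<open>\<psi>\<close> solves the
  maximal surface equation is a consequence, see \<open>dual_imp_maximal\<close> below.
\<close>

definition is_dual :: "complex set \<Rightarrow> (complex \<Rightarrow> real) \<Rightarrow> (complex \<Rightarrow> real) \<Rightarrow> bool" where
  "is_dual \<Omega> \<phi> \<psi> \<longleftrightarrow> (\<forall>z\<in>\<Omega>.
     (\<psi> has_derivative
       (\<lambda>h. - (dy \<phi> z / sqrt (1 + (norm (grad \<phi> z))\<^sup>2)) * Re h
            + dx \<phi> z / sqrt (1 + (norm (grad \<phi> z))\<^sup>2) * Im h)) (at z))"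

lemma dir_deriv_eq:
  assumes "(F has_derivative F') (at z)"
  shows "dir_deriv v F z = F' v"
proof -
  have "((\<lambda>t::real. F (z + t *\<^sub>R v)) has_derivative (\<lambda>t. F' (t *\<^sub>R v))) (at 0)"
    by (rule has_derivative_compose[where f = "\<lambda>t. z + t *\<^sub>R v" and g = F])
       (auto intro!: derivative_eq_intros assms)
  moreover have "F' (t *\<^sub>R v) = t *\<^sub>R F' v" for t
    using assms has_derivative_bounded_linear linear_simps(5) by blast
  ultimately show ?thesis
    unfolding dir_deriv_def
    by (intro vector_derivative_at) (simp add: has_vector_derivative_def)
qed

lemma C1_onI:
  assumes "\<And>z. z \<in> S \<Longrightarrow> (F has_derivative F' z) (at z)"
    and "continuous_on S (\<lambda>z. F' z 1)" "continuous_on S (\<lambda>z. F' z \<i>)"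
  shows "C1_on F S"
proof -
  have "dx F z = F' z 1" "dy F z = F' z \<i>" if "z \<in> S" for z
    using dir_deriv_eq[OF assms(1)[OF that]] by (auto simp: dx_def dy_def)
  moreover have "F differentiable (at z)" if "z \<in> S" for z
    using assms(1)[OF that] by (auto simp: differentiable_def)
  ultimately show ?thesis
    using assms(2,3) by (auto simp: C1_on_def cong: continuous_on_cong)
qed

lemma C1_onD:
  fixes F :: "complex \<Rightarrow> real"
  assumes "C1_on F S" "z \<in> S"
  shows "(F has_derivative (\<lambda>h. Re h * dx F z + Im h * dy F z)) (at z)"
proof -
  obtain F' where F': "(F has_derivative F') (at z)"
    using assms by (auto simp: C1_on_def differentiable_def)
  interpret bounded_linear F' using F' by (rule has_derivative_bounded_linear)
  have "F' h = Re h * dx F z + Im h * dy F z" for h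
  proof -
    have "h = Re h *\<^sub>R 1 + Im h *\<^sub>R \<i>"
      by (simp add: complex_eq_iff)
    then have "F' h = Re h *\<^sub>R F' 1 + Im h *\<^sub>R F' \<i>"
      by (metis add scaleR)
    then show ?thesis by (simp add: dx_def dy_def dir_deriv_eq[OF F'])
  qed
  then show ?thesis using F' by presburger
qed

lemma norm_grad: "(norm (grad u z))\<^sup>2 = (dx u z)\<^sup>2 + (dy u z)\<^sup>2"
  by (simp add: grad_def cmod_power2)

lemma dir_deriv_cong:
  assumes "open S" "z \<in> S" "\<And>w. w \<in> S \<Longrightarrow> F w = G w"
  shows "dir_deriv v F z = dir_deriv v G z"
proof -
  have "open ((\<lambda>t::real. z + t *\<^sub>R v) -` S)"
    by (intro open_vimage assms(1) continuous_intros)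
  then have "\<forall>\<^sub>F t::real in nhds 0. z + t *\<^sub>R v \<in> S"
    using eventually_nhds_in_open[of _ "0::real"] assms(2) by fastforce
  then have "\<forall>\<^sub>F t::real in nhds 0. t \<in> UNIV \<longrightarrow> F (z + t *\<^sub>R v) = G (z + t *\<^sub>R v)"
    by (rule eventually_mono) (use assms(3) in auto)
  then show ?thesis
    unfolding dir_deriv_def by (intro vector_derivative_cong_eq) auto
qed

lemma C1_on_cong:
  assumes "open S" "\<And>w. w \<in> S \<Longrightarrow> F w = G w" "C1_on G S"
  shows "C1_on F S"
proof -
  have "dx F w = dx G w" "dy F w = dy G w" if "w \<in> S" for w
    using dir_deriv_cong[OF assms(1) that assms(2)] by (auto simp: dx_def dy_def)
  moreover have "F differentiable (at w)" if "w \<in> S" for w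
  proof -
    have "G differentiable (at w)"
      using assms(3) that by (simp add: C1_on_def)
    then obtain G' where "(G has_derivative G') (at w)"
      unfolding differentiable_def ..
    then have "(F has_derivative G') (at w)"
      by (rule has_derivative_transform_within_open[OF _ assms(1) that]) (simp add: assms(2))
    then show ?thesis by (auto simp: differentiable_def)
  qed
  ultimately show ?thesis
    using assms(3) by (auto simp: C1_on_def cong: continuous_on_cong)
qed

lemma C1_on_continuous:
  assumes "C1_on F S" shows "continuous_on S F"
  using assms unfolding C1_on_def
  by (meson continuous_at_imp_continuous_on differentiable_imp_continuous_within)

lemma C1_on_quotient:
  fixes p q :: "complex \<Rightarrow> real"
  assumes "C1_on p S" "C1_on q S"
  shows "C1_on (\<lambda>z. c * (p z / sqrt (1 + ((p z)\<^sup>2 + (q z)\<^sup>2)))) S"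
proof -
  let ?W = "\<lambda>z. sqrt (1 + ((p z)\<^sup>2 + (q z)\<^sup>2))"
  have pos: "1 + ((p z)\<^sup>2 + (q z)\<^sup>2) > 0" for z
    by (simp add: add_pos_nonneg)
  define P where "P = (\<lambda>z h. Re h * dx p z + Im h * dy p z)"
  define Q where "Q = (\<lambda>z h. Re h * dx q z + Im h * dy q z)"
  have dp: "(p has_derivative P z) (at z)" and dq: "(q has_derivative Q z) (at z)"
    if "z \<in> S" for z
    using C1_onD[OF assms(1) that] C1_onD[OF assms(2) that] by (auto simp: P_def Q_def)
  have cP: "continuous_on S (\<lambda>z. P z v)" and cQ: "continuous_on S (\<lambda>z. Q z v)" for v
    using assms unfolding P_def Q_def C1_on_def by (auto intro!: continuous_intros)
  have cp: "continuous_on S p" and cq: "continuous_on S q"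
    using assms C1_on_continuous by auto
  define D where "D = (\<lambda>z h. c * ((P z h * ?W z
      - p z * ((2 * p z * P z h + 2 * q z * Q z h) * inverse (?W z) / 2)) / (?W z * ?W z)))"
  have ne: "?W z \<noteq> 0" for z using pos[of z] by auto
  have "continuous_on S (\<lambda>z. D z v)" for v
    unfolding D_def using ne by (intro continuous_intros cp cq cP cQ) auto
  moreover have "((\<lambda>z. c * (p z / ?W z)) has_derivative D z) (at z)" if "z \<in> S" for z
    unfolding D_def using ne[of z] pos[of z]
    by (auto intro!: derivative_eq_intros dp[OF that] dq[OF that]
        simp: fun_eq_iff field_simps power2_eq_square)
  ultimately show ?thesis by (intro C1_onI[where F' = D])
qed

lemma DERIV_along:
  fixes F :: "complex \<Rightarrow> real"
  assumes "F differentiable (at (z + t *\<^sub>R v))"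
  shows "((\<lambda>t::real. F (z + t *\<^sub>R v)) has_real_derivative dir_deriv v F (z + t *\<^sub>R v)) (at t)"
proof -
  obtain F' where F': "(F has_derivative F') (at (z + t *\<^sub>R v))"
    using assms by (auto simp: differentiable_def)
  have "((\<lambda>t::real. F (z + t *\<^sub>R v)) has_derivative (\<lambda>s. F' (s *\<^sub>R v))) (at t)"
    by (rule has_derivative_compose[where f = "\<lambda>t. z + t *\<^sub>R v" and g = F])
       (auto intro!: derivative_eq_intros F')
  moreover have "F' (s *\<^sub>R v) = dir_deriv v F (z + t *\<^sub>R v) * s" for s
    using linear_simps(5)[OF has_derivative_bounded_linear[OF F']] dir_deriv_eq[OF F', of v] by simp
  ultimately show ?thesis by (simp add: has_field_derivative_def)
qed

lemma second_difference:
  fixes u :: "complex \<Rightarrow> real"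
  assumes "h > 0"
    and S: "\<And>s t. \<lbrakk>0 \<le> s; s \<le> h; 0 \<le> t; t \<le> h\<rbrakk> \<Longrightarrow> z + s *\<^sub>R v + t *\<^sub>R w \<in> S"
    and d1: "\<And>x. x \<in> S \<Longrightarrow> u differentiable (at x)"
    and d2: "\<And>x. x \<in> S \<Longrightarrow> dir_deriv v u differentiable (at x)"
  shows "\<exists>s t. 0 < s \<and> s < h \<and> 0 < t \<and> t < h \<and>
    u (z + h *\<^sub>R v + h *\<^sub>R w) - u (z + h *\<^sub>R v) - u (z + h *\<^sub>R w) + u z
      = h * h * dir_deriv w (dir_deriv v u) (z + s *\<^sub>R v + t *\<^sub>R w)"
proof -
  have "((\<lambda>s. u ((z + h *\<^sub>R w) + s *\<^sub>R v) - u (z + s *\<^sub>R v)) has_real_derivative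
      dir_deriv v u ((z + h *\<^sub>R w) + s *\<^sub>R v) - dir_deriv v u (z + s *\<^sub>R v)) (at s)"
    if "0 \<le> s" "s \<le> h" for s
    using S[of s h] S[of s 0] that assms(1)
    by (intro DERIV_diff DERIV_along d1) (auto simp: algebra_simps)
  from MVT2[OF assms(1) this] obtain s where s: "0 < s" "s < h"
    and 1: "u ((z + h *\<^sub>R w) + h *\<^sub>R v) - u (z + h *\<^sub>R v) - (u (z + h *\<^sub>R w) - u z)
      = h * (dir_deriv v u ((z + h *\<^sub>R w) + s *\<^sub>R v) - dir_deriv v u (z + s *\<^sub>R v))"
    by auto
  have "((\<lambda>t. dir_deriv v u ((z + s *\<^sub>R v) + t *\<^sub>R w)) has_real_derivative
      dir_deriv w (dir_deriv v u) ((z + s *\<^sub>R v) + t *\<^sub>R w)) (at t)" if "0 \<le> t" "t \<le> h" for t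
    using S[of s t] s that by (intro DERIV_along d2) auto
  from MVT2[OF assms(1) this] obtain t where t: "0 < t" "t < h"
    and 2: "dir_deriv v u ((z + s *\<^sub>R v) + h *\<^sub>R w) - dir_deriv v u (z + s *\<^sub>R v)
      = h * dir_deriv w (dir_deriv v u) ((z + s *\<^sub>R v) + t *\<^sub>R w)"
    by auto
  have swap: "z + h *\<^sub>R w + h *\<^sub>R v = z + h *\<^sub>R v + h *\<^sub>R w" "z + h *\<^sub>R w + s *\<^sub>R v = z + s *\<^sub>R v + h *\<^sub>R w"
    by (simp_all add: algebra_simps)
  have "u (z + h *\<^sub>R v + h *\<^sub>R w) - u (z + h *\<^sub>R v) - u (z + h *\<^sub>R w) + u z
      = h * h * dir_deriv w (dir_deriv v u) (z + s *\<^sub>R v + t *\<^sub>R w)"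
    using 1 unfolding swap 2 by simp
  with s t show ?thesis by blast
qed

lemma mixed_partials_eq:
  fixes u :: "complex \<Rightarrow> real"
  assumes "open S" "C2_on u S" "z \<in> S"
  shows "dx (dy u) z = dy (dx u) z"
proof (rule ccontr)
  assume ne: "dx (dy u) z \<noteq> dy (dx u) z"
  define e where "e = \<bar>dx (dy u) z - dy (dx u) z\<bar> / 2"
  have e: "e > 0" using ne by (simp add: e_def)
  have "isCont (dx (dy u)) z" "isCont (dy (dx u)) z"
    using assms by (auto simp: C2_on_def C1_on_def continuous_on_eq_continuous_at)
  then obtain d1 d2 where d: "d1 > 0" "d2 > 0"
    and c1: "\<And>w. dist w z < d1 \<Longrightarrow> \<bar>dx (dy u) w - dx (dy u) z\<bar> < e"
    and c2: "\<And>w. dist w z < d2 \<Longrightarrow> \<bar>dy (dx u) w - dy (dx u) z\<bar> < e"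
    using e unfolding continuous_at_eps_delta dist_real_def by metis
  obtain d3 where d3: "d3 > 0" "ball z d3 \<subseteq> S"
    using assms(1,3) openE by blast
  define h where "h = min d1 (min d2 d3) / 3"
  have h: "h > 0" "3 * h \<le> d1" "3 * h \<le> d2" "3 * h \<le> d3"
    using d d3 by (auto simp: h_def)
  have near: "dist (z + s *\<^sub>R v + t *\<^sub>R w) z < 3 * h"
    if "0 \<le> s" "s \<le> h" "0 \<le> t" "t \<le> h" "norm v = 1" "norm w = 1" for s t and v w :: complex
  proof -
    have "dist (z + s *\<^sub>R v + t *\<^sub>R w) z = norm (s *\<^sub>R v + t *\<^sub>R w)"
      by (simp add: dist_norm algebra_simps)
    also have "\<dots> \<le> s + t"
      using norm_triangle_ineq[of "s *\<^sub>R v" "t *\<^sub>R w"] that by simp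
    finally show ?thesis using that h by simp
  qed
  have inS: "z + s *\<^sub>R v + t *\<^sub>R w \<in> S"
    if "0 \<le> s" "s \<le> h" "0 \<le> t" "t \<le> h" "norm v = 1" "norm w = 1" for s t and v w :: complex
    using near[OF that] h(4) d3(2) by (force simp: dist_commute)
  have diff: "u differentiable (at x)" "dir_deriv 1 u differentiable (at x)"
    "dir_deriv \<i> u differentiable (at x)" if "x \<in> S" for x
    using assms(2) that by (auto simp: C2_on_def C1_on_def dx_def dy_def)
  obtain s t where st: "0 < s" "s < h" "0 < t" "t < h"
    and 1: "u (z + h *\<^sub>R 1 + h *\<^sub>R \<i>) - u (z + h *\<^sub>R 1) - u (z + h *\<^sub>R \<i>) + u z
      = h * h * dir_deriv \<i> (dir_deriv 1 u) (z + s *\<^sub>R 1 + t *\<^sub>R \<i>)"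
    using second_difference[OF h(1) inS[of _ _ 1 \<i>] diff(1,2)] by auto
  obtain s' t' where st': "0 < s'" "s' < h" "0 < t'" "t' < h"
    and 2: "u (z + h *\<^sub>R \<i> + h *\<^sub>R 1) - u (z + h *\<^sub>R \<i>) - u (z + h *\<^sub>R 1) + u z
      = h * h * dir_deriv 1 (dir_deriv \<i> u) (z + s' *\<^sub>R \<i> + t' *\<^sub>R 1)"
    using second_difference[OF h(1) inS[of _ _ \<i> 1] diff(1,3)] by auto
  have swap: "z + h *\<^sub>R \<i> + h *\<^sub>R 1 = z + h *\<^sub>R 1 + h *\<^sub>R \<i>"
    by (simp add: algebra_simps)
  have comm: "p - q - r + k = p - r - q + k" for p q r k :: real
    by simp
  have "h * h * dir_deriv \<i> (dir_deriv 1 u) (z + s *\<^sub>R 1 + t *\<^sub>R \<i>)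
      = h * h * dir_deriv 1 (dir_deriv \<i> u) (z + s' *\<^sub>R \<i> + t' *\<^sub>R 1)"
    by (rule trans[OF 1[symmetric] trans[OF comm 2[unfolded swap]]])
  then have "dy (dx u) (z + s *\<^sub>R 1 + t *\<^sub>R \<i>) = dx (dy u) (z + s' *\<^sub>R \<i> + t' *\<^sub>R 1)"
    using h(1) by (simp add: dx_def dy_def)
  moreover have "\<bar>dy (dx u) (z + s *\<^sub>R 1 + t *\<^sub>R \<i>) - dy (dx u) z\<bar> < e"
    using near[of s t 1 \<i>] st h by (intro c2) auto
  moreover have "\<bar>dx (dy u) (z + s' *\<^sub>R \<i> + t' *\<^sub>R 1) - dx (dy u) z\<bar> < e"
    using near[of s' t' \<i> 1] st' h by (intro c1) auto
  moreover have False if "p = q" "\<bar>p - dy (dx u) z\<bar> < e" "\<bar>q - dx (dy u) z\<bar> < e" for p q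
  proof -
    have "\<bar>dx (dy u) z - dy (dx u) z\<bar> \<le> \<bar>q - dx (dy u) z\<bar> + \<bar>p - dy (dx u) z\<bar>"
      using that(1) by (simp add: abs_if)
    with that show False unfolding e_def by simp
  qed
  ultimately show False by blast
qed

lemma dual_imp_maximal:
  assumes "open \<Omega>" "minimal_surface_solution \<Omega> \<phi>" "is_dual \<Omega> \<phi> \<psi>"
  shows "maximal_surface_solution \<Omega> \<psi>"
proof -
  let ?W = "\<lambda>z. sqrt (1 + (norm (grad \<phi> z))\<^sup>2)"
  have W: "?W z > 0" for z by (simp add: add_pos_nonneg)
  have C2: "C1_on (dx \<phi>) \<Omega>" "C1_on (dy \<phi>) \<Omega>"
    using assms(2) by (auto simp: minimal_surface_solution_def C2_on_def)
  have px: "dx \<psi> z = - 1 * (dy \<phi> z / sqrt (1 + ((dy \<phi> z)\<^sup>2 + (dx \<phi> z)\<^sup>2)))"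
    and py: "dy \<psi> z = 1 * (dx \<phi> z / sqrt (1 + ((dx \<phi> z)\<^sup>2 + (dy \<phi> z)\<^sup>2)))"
    if "z \<in> \<Omega>" for z
    using assms(3)[unfolded is_dual_def, rule_format, OF that, THEN dir_deriv_eq]
    by (auto simp: dx_def[of \<psi>] dy_def[of \<psi>] norm_grad add.commute)
  have C1x: "C1_on (dx \<psi>) \<Omega>" 
    by (rule C1_on_cong[OF assms(1) px C1_on_quotient[OF C2(2,1)]])
  have C1y: "C1_on (dy \<psi>) \<Omega>" 
    by (rule C1_on_cong[OF assms(1) py C1_on_quotient[OF C2(1,2)]])
  have "\<psi> differentiable (at z)" if "z \<in> \<Omega>" for z
    using assms(3) that by (auto simp: is_dual_def differentiable_def)
  then have "C2_on \<psi> \<Omega>"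
    using C1x C1y C1_on_continuous by (auto simp: C2_on_def C1_on_def[of \<psi>])
  moreover have ng: "1 - (norm (grad \<psi> z))\<^sup>2 = 1 / (?W z)\<^sup>2" if "z \<in> \<Omega>" for z
  proof -
    have "(norm (grad \<psi> z))\<^sup>2 = (norm (grad \<phi> z))\<^sup>2 / (?W z)\<^sup>2"
      unfolding norm_grad px[OF that] py[OF that]
      by (simp add: power_divide add_divide_distrib add.commute)
    moreover have "(?W z)\<^sup>2 = 1 + (norm (grad \<phi> z))\<^sup>2"
      by (simp add: add_nonneg_nonneg)
    ultimately show ?thesis using W[of z]
      by (simp add: field_simps)
  qed
  moreover have "norm (grad \<psi> z) < 1" if "z \<in> \<Omega>" for z
  proof -
    have "(norm (grad \<psi> z))\<^sup>2 < 1\<^sup>2"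
    proof -
      have "1 / (?W z)\<^sup>2 > 0" using W[of z] by (intro divide_pos_pos zero_less_power) auto
      then show ?thesis unfolding ng[OF that, symmetric] by simp
    qed
    then show ?thesis by (rule power2_less_imp_less) simp
  qed
  moreover have "divergence (\<lambda>w. grad \<psi> w /\<^sub>R sqrt (1 - (norm (grad \<psi> w))\<^sup>2)) z = 0"
    if z: "z \<in> \<Omega>" for z
  proof -
    have eq: "grad \<psi> w /\<^sub>R sqrt (1 - (norm (grad \<psi> w))\<^sup>2) = Complex (- dy \<phi> w) (dx \<phi> w)"
      if "w \<in> \<Omega>" for w
    proof -
      have s: "sqrt (1 - (norm (grad \<psi> w))\<^sup>2) = 1 / ?W w"
        using W[of w] unfolding ng[OF that] real_sqrt_divide
        by (simp only: real_sqrt_one real_sqrt_abs abs_of_pos)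
      have "dx \<psi> w = - (dy \<phi> w / ?W w)" "dy \<psi> w = dx \<phi> w / ?W w"
        using px[OF that] py[OF that] by (simp_all add: norm_grad add.commute)
      then show ?thesis using W[of w] unfolding s
        by (simp add: grad_def[of \<psi>] complex_eq_iff)
    qed
    have "divergence (\<lambda>w. grad \<psi> w /\<^sub>R sqrt (1 - (norm (grad \<psi> w))\<^sup>2)) z
        = dx (\<lambda>w. - dy \<phi> w) z + dy (dx \<phi>) z"
      unfolding divergence_def dx_def[of "\<lambda>w. Re (_ w)"] dy_def[of "\<lambda>w. Im (_ w)"]
        dx_def[of "\<lambda>w. - _ w"] dy_def[of "dx \<phi>"]
      by (intro arg_cong2[where f = "(+)"] dir_deriv_cong[OF assms(1) z]) (simp_all only: eq complex.sel)
    also have "dx (\<lambda>w. - dy \<phi> w) z = - dx (dy \<phi>) z"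
      using dir_deriv_eq[OF has_derivative_minus[OF C1_onD[OF C2(2) z]], of 1]
      by (simp add: dx_def[of "\<lambda>w. - _ w"])
    also have "dx (dy \<phi>) z = dy (dx \<phi>) z"
      using assms(2) by (intro mixed_partials_eq[OF assms(1) _ z]) (simp add: minimal_surface_solution_def)
    finally show ?thesis by simp
  qed
  ultimately show ?thesis unfolding maximal_surface_solution_def by blast
qed


section \<open>Isothermal parametrizations and the corresponding harmonic mapping\<close>

definition graph_over :: "complex set \<Rightarrow> (complex \<Rightarrow> real) \<Rightarrow> (complex \<times> real) set" where
  "graph_over \<Omega> u = (\<lambda>z. (z, u z)) ` \<Omega>"

text \<open>
  The inner product of the product type \<^typ>\<open>complex \<times> real\<close> is the Euclidean one.
\<close>

definition isothermal_parametrization ::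
    "(complex \<Rightarrow> complex \<times> real) \<Rightarrow> complex set \<Rightarrow> (complex \<times> real) set \<Rightarrow> bool" where
  "isothermal_parametrization X S M \<longleftrightarrow>
     C1_on X S \<and> inj_on X S \<and> X ` S = M \<and>
     (\<forall>w\<in>S. dx X w \<bullet> dx X w = dy X w \<bullet> dy X w \<and> dx X w \<bullet> dy X w = 0 \<and> dx X w \<noteq> 0)"

definition orientation_preserving_on :: "(complex \<Rightarrow> complex) \<Rightarrow> complex set \<Rightarrow> bool" where
  "orientation_preserving_on f S \<longleftrightarrow>
     (\<forall>w\<in>S. Re (dx f w) * Im (dy f w) - Im (dx f w) * Re (dy f w) > 0)"

definition corresponding_harmonic_mapping ::
    "complex set \<Rightarrow> (complex \<Rightarrow> real) \<Rightarrow> (complex \<Rightarrow> complex) \<Rightarrow> bool" where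
  "corresponding_harmonic_mapping \<Omega> \<phi> f \<longleftrightarrow>
     harmonic_on f (ball 0 1) \<and> orientation_preserving_on f (ball 0 1) \<and>
     inj_on f (ball 0 1) \<and> f ` ball 0 1 = \<Omega> \<and>
     isothermal_parametrization (\<lambda>w. (f w, \<phi> (f w))) (ball 0 1) (graph_over \<Omega> \<phi>)"


section \<open>Jordan domains and boundary behaviour\<close>

definition jordan_domain :: "complex set \<Rightarrow> bool" where
  "jordan_domain \<Omega> \<longleftrightarrow> open \<Omega> \<and> connected \<Omega> \<and>
     (\<exists>\<gamma>. simple_path \<gamma> \<and> pathfinish \<gamma> = pathstart \<gamma> \<and> frontier \<Omega> = path_image \<gamma>)"

definition tends_to_plus_infinity_on :: "complex set \<Rightarrow> (complex \<Rightarrow> real) \<Rightarrow> complex set \<Rightarrow> bool" where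
  "tends_to_plus_infinity_on \<Omega> \<phi> I \<longleftrightarrow> (\<forall>p\<in>I. filterlim \<phi> at_top (at p within \<Omega>))"

text \<open>
  Near each point of an open segment \<open>I\<close> in its boundary, a Jordan domain is one of the two half
  disks cut off by \<open>I\<close>; hence a vector with the following property exists and is unique.
\<close>

definition outward_unit_normal :: "complex set \<Rightarrow> complex set \<Rightarrow> complex \<Rightarrow> bool" where
  "outward_unit_normal \<Omega> I \<nu> \<longleftrightarrow> norm \<nu> = 1 \<and>
     (\<forall>p\<in>I. \<forall>q\<in>I. \<nu> \<bullet> (q - p) = 0) \<and>
     (\<forall>p\<in>I. \<forall>\<^sub>F t::real in at_right 0. p - t *\<^sub>R \<nu> \<in> \<Omega> \<and> p + t *\<^sub>R \<nu> \<notin> closure \<Omega>)"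

definition tamely_degenerates_on :: "complex set \<Rightarrow> (complex \<Rightarrow> real) \<Rightarrow> complex set \<Rightarrow> bool" where
  "tamely_degenerates_on \<Omega> \<psi> I \<longleftrightarrow>
     (\<exists>\<nu>. outward_unit_normal \<Omega> I \<nu> \<and>
       (\<forall>c d. c \<noteq> d \<and> closed_segment c d \<subseteq> I \<longrightarrow>
         (\<exists>C. \<exists>\<delta>>0. \<forall>z\<in>\<Omega>. infdist z (closed_segment c d) < \<delta> \<longrightarrow>
            \<bar>dir_deriv (\<i> * \<nu>) \<psi> z - 1\<bar> \<le> C * (infdist z (closed_segment c d))\<^sup>2)))"

text \<open>
  \<open>F\<close> is the boundary function of \<open>f\<close> and \<open>E\<close> its set of discontinuous points. The values of
  \<open>F\<close> on \<open>E\<close> are irrelevant. One-sided limits at \<open>\<zeta>\<close> are taken as \<open>\<zeta> * cis t\<close> tends to \<open>\<zeta>\<close> with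
  \<open>t > 0\<close> resp. \<open>t < 0\<close> and \<open>\<zeta> * cis t\<close> outside \<open>E\<close>; the filters are proper as \<open>E\<close> is countable.
\<close>

definition is_boundary_function ::
    "complex set \<Rightarrow> (complex \<Rightarrow> complex) \<Rightarrow> complex set \<Rightarrow> (complex \<Rightarrow> complex) \<Rightarrow> bool" where
  "is_boundary_function \<Omega> f E F \<longleftrightarrow>
     countable E \<and> E \<subseteq> sphere 0 1 \<and>
     (\<forall>\<zeta>\<in>sphere 0 1 - E. (f \<longlongrightarrow> F \<zeta>) (at \<zeta> within ball 0 1) \<and> F \<zeta> \<in> frontier \<Omega>) \<and>
     continuous_on (sphere 0 1 - E) F \<and>
     (\<forall>\<zeta>\<in>E. \<exists>l r. l \<in> frontier \<Omega> \<and> r \<in> frontier \<Omega> \<and> l \<noteq> r \<and>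
        ((\<lambda>t::real. F (\<zeta> * cis t)) \<longlongrightarrow> l) (at 0 within {t. t > 0 \<and> \<zeta> * cis t \<notin> E}) \<and>
        ((\<lambda>t::real. F (\<zeta> * cis t)) \<longlongrightarrow> r) (at 0 within {t. t < 0 \<and> \<zeta> * cis t \<notin> E}))"

definition cluster_set :: "(complex \<Rightarrow> complex) \<Rightarrow> complex \<Rightarrow> complex set" where
  "cluster_set f w\<^sub>0 = {z. \<exists>w::nat \<Rightarrow> complex. (\<forall>n. w n \<in> ball 0 1) \<and>
     w \<longlonglongrightarrow> w\<^sub>0 \<and> (\<lambda>n. f (w n)) \<longlonglongrightarrow> z}"

end

theory Submission
  imports Defs "HOL-Complex_Analysis.Complex_Analysis"
begin

text \<open>
  Write \<open>f\<close> as a bounded harmonic map on the upper half plane, lifting by \<open>w = exp (\<i> * \<xi>)\<close>. Since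
  \<open>\<Omega>\<close> is locally connected at its boundary and \<open>f\<close> is injective, if \<open>p\<close> lies in the cluster sets
  of two boundary points, these are nearly joined by paths in the disc on which \<open>f\<close> is close to \<open>p\<close>,
  and \<open>f\<close> tends to \<open>p\<close> on a whole arc between them. So two cluster sets share at most two points, and only
  countably many are nondegenerate. Crossing of paths in the plane rules out oscillation, whence
  one-sided limits \<open>l\<close>, \<open>r\<close> exist everywhere. By a maximum principle that ignores countably many
  points, \<open>f\<close> behaves near a jump like \<open>r + (l - r) * arg / pi\<close>, and its cluster set there is the
  segment from \<open>l\<close> to \<open>r\<close>.

  If \<open>\<phi>\<close> tends to infinity on \<open>I\<close>, the harmonic function \<open>\<phi> \<circ> f\<close> would tend to infinity on any arc
  that \<open>f\<close> maps into \<open>I\<close>, which is impossible; hence \<open>I\<close> comes from a single jump. At distance \<open>y\<close>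
  from \<open>I\<close>, Harnack's inequality bounds the gradient of the distance to \<open>I\<close> by \<open>C * y / cmod \<xi>\<close>, while
  the tangential derivative of \<open>f\<close> is at least \<open>c / cmod \<xi>\<close>. By conformality the tangential derivative
  of \<open>\<psi>\<close> differs from 1 by at most the square of the ratio. Conversely, such a quadratic
  bound makes the normal derivative of \<open>\<phi>\<close> at least \<open>k / y\<close>, and \<open>\<phi>\<close> diverges logarithmically.
\<close>

section \<open>Jordan domains with a segment in the boundary\<close>

text \<open>The map \<open>f\<close> is only harmonic, so the boundary correspondence of conformal
  maps does not apply: an arc of the circle may collapse to a point, and a point may blow up to a
  segment. Hence the existence of the boundary function and of its one-sided limits is part of the
  task. Two tools remain: injectivity, which forbids crossings, and the maximum principle for the
  coordinates of \<open>f\<close> with either sign, as real parts of holomorphic functions. In the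
  half plane, translations make the box and its barrier the same at all boundary points, and the
  argument models a jump; the price is that lifts are determined only modulo \<open>2 * pi\<close>.

  In the slope estimate the factors \<open>1 / cmod \<xi>\<close> cancel, so that the bound depends
  on the distance to \<open>I\<close> alone. Conformality is a quadratic relation between the
  complex derivatives of the coordinates and of the height. It produces the square in the definition
  of tameness but leaves the sign of the normal slope of \<phi> open; this sign comes from the limit
  being plus infinity.\<close>

lemma connected_subset_simple_loop:
  fixes g :: "real \<Rightarrow> 'a::t2_space"
  assumes g: "simple_path g" "pathfinish g = pathstart g"
    and C: "connected C" "C \<subseteq> path_image g"
    and st: "0 \<le> s" "s < t" "t \<le> 1" "g s \<in> C" "g t \<in> C" "g s \<noteq> g t"
  shows "g ` {s..t} \<subseteq> C \<or> g ` ({0..s} \<union> {t..1}) \<subseteq> C"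
proof (rule ccontr)
  assume "\<not> ?thesis"
  then obtain c d where c: "c \<in> {s..t}" "g c \<notin> C" and d: "d \<in> {0..s} \<union> {t..1}" "g d \<notin> C"
    by blast
  have cont: "continuous_on {0..1} g"
    using g(1) by (simp add: simple_path_def path_def)
  \<comment> \<open>The missed points \<open>g c\<close> and \<open>g d\<close> cut the loop into
    \<open>A\<close> and \<open>B\<close>, with \<open>g s\<close> in one and \<open>g t\<close> in
    the other. The pieces meet only at these two points, outside \<open>C\<close>, so they would
    disconnect \<open>C\<close>.\<close>
  define lo hi where "lo = min c d" and "hi = max c d"
  define A B where "A = g ` {lo..hi}" and "B = g ` ({0..lo} \<union> {hi..1})"
  have ne: "c \<noteq> s" "c \<noteq> t" "d \<noteq> s" "d \<noteq> t" using c d st by auto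
  have lh: "0 \<le> lo" "lo < hi" "hi \<le> 1"
    using ne c(1) d(1) st by (auto simp: lo_def hi_def min_def max_def)
  have "compact A" "compact B"
    unfolding A_def B_def using lh
    by (intro compact_continuous_image continuous_on_subset[OF cont]; auto)+
  then have cl: "closed A" "closed B" by (auto intro: compact_imp_closed)
  have "path_image g = A \<union> B"
    using lh unfolding A_def B_def path_image_def image_Un[symmetric]
    by (intro arg_cong[where f = "image g"]) auto
  then have "C \<subseteq> A \<union> B" using C by simp
  moreover have "A \<inter> B \<inter> C = {}"
  proof -
    have "x \<in> {g lo, g hi}" if x: "x \<in> A" "x \<in> B" for x
    proof -
      obtain u v where u: "u \<in> {lo..hi}" "x = g u" and v: "v \<in> {0..lo} \<union> {hi..1}" "x = g v"
        using x by (auto simp: A_def B_def)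
      have "u \<in> {0..1}" "v \<in> {0..1}" using u v lh by auto
      then have "u = v \<or> u = 0 \<and> v = 1 \<or> u = 1 \<and> v = 0"
        using g(1) u v by (auto simp: simple_path_def loop_free_def)
      then show ?thesis using u v lh by auto
    qed
    moreover have "g lo \<notin> C" "g hi \<notin> C"
      using c d by (auto simp: lo_def hi_def min_def max_def)
    ultimately show ?thesis by blast
  qed
  moreover have "A \<inter> C \<noteq> {} \<and> B \<inter> C \<noteq> {}"
  proof -
    have "s \<in> {lo..hi} \<and> t \<in> {0..lo} \<union> {hi..1} \<or> t \<in> {lo..hi} \<and> s \<in> {0..lo} \<union> {hi..1}"
      using ne c(1) d(1) st lh by (auto simp: lo_def hi_def min_def max_def)
    then show ?thesis using st(4,5) unfolding A_def B_def by blast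
  qed
  ultimately show False
    using C(1) cl unfolding connected_closed by blast
qed

lemma connected_subset_segment_eq:
  fixes c d :: "'a::euclidean_space"
  assumes "connected X" "X \<subseteq> closed_segment c d" "c \<in> X" "d \<in> X"
  shows "X = closed_segment c d"
proof
  show "closed_segment c d \<subseteq> X"
  proof
    fix z assume z: "z \<in> closed_segment c d"
    then obtain u where u: "0 \<le> u" "u \<le> 1" "z = (1 - u) *\<^sub>R c + u *\<^sub>R d"
      by (auto simp: in_segment)
    let ?h = "\<lambda>y. (y - c) \<bullet> (d - c)"
    have *: "?h ((1 - v) *\<^sub>R c + v *\<^sub>R d) = v * ((d - c) \<bullet> (d - c))" for v
    proof -
      have "(1 - v) *\<^sub>R c + v *\<^sub>R d - c = v *\<^sub>R (d - c)" by (simp add: algebra_simps)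
      then show ?thesis by simp
    qed
    have "connected (?h ` X)"
      by (intro connected_continuous_image continuous_intros assms)
    moreover have "?h c \<in> ?h ` X" "?h d \<in> ?h ` X" using assms(3,4) by blast+
    moreover have "?h c \<le> ?h z" "?h z \<le> ?h d"
      using u mult_right_mono[of u 1 "(d - c) \<bullet> (d - c)"] by (auto simp: *)
    ultimately have "?h z \<in> ?h ` X"
      using connected_contains_Icc[of "?h ` X" "?h c" "?h d"] by (metis atLeastAtMost_iff subsetD)
    then obtain y where y: "y \<in> X" "?h y = ?h z" by auto
    have "y \<in> closed_segment c d" using y(1) assms(2) by blast
    then obtain v where v: "y = (1 - v) *\<^sub>R c + v *\<^sub>R d" unfolding in_segment by blast
    have "d = c \<or> v = u" using y(2) unfolding u(3) v * by auto
    then show "z \<in> X" using y u(3) v by (auto simp flip: scaleR_add_left)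
  qed
qed fact

text \<open>The rest of the loop cannot accumulate at a point \<open>x\<close> of the segment. Take
  a subsegment from \<open>c\<close> to \<open>d\<close> around \<open>x\<close>: one of the two
  arcs of the loop between \<open>c\<close> and \<open>d\<close> lies in it and, being connected,
  fills it. So \<open>x\<close> is an inner point of that arc, and the other arc is a compact set
  missing \<open>x\<close>. Later proofs use this to isolate a point of the segment from the
  remaining boundary by a ball.\<close>

lemma closed_loop_minus_open_segment:
  fixes g :: "real \<Rightarrow> 'a::euclidean_space"
  assumes g: "simple_path g" "pathfinish g = pathstart g"
    and I: "open_segment a b \<subseteq> path_image g" and ab: "a \<noteq> b"
  shows "closed (path_image g - open_segment a b)"
proof -
  let ?I = "open_segment a b"
  have cont: "continuous_on {0..1} g"
    using g(1) by (simp add: simple_path_def path_def)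
  have clg: "closed (path_image g)"
    using g(1) by (simp add: closed_path_image simple_path_imp_path)
  have "x \<notin> ?I" if appr: "\<And>e. e > 0 \<Longrightarrow> \<exists>y\<in>path_image g - ?I. dist y x < e" for x
  proof
    assume "x \<in> ?I"
    then obtain u where u: "0 < u" "u < 1" "x = (1 - u) *\<^sub>R a + u *\<^sub>R b"
      by (auto simp: in_segment)
    define P where "P v = (1 - v) *\<^sub>R a + v *\<^sub>R b" for v
    have P: "P v = P w \<longleftrightarrow> v = w" for v w
    proof -
      have "P v - P w = (v - w) *\<^sub>R (b - a)" by (simp add: P_def algebra_simps)
      then show ?thesis using ab by (metis eq_iff_diff_eq_0 scaleR_eq_0_iff)
    qed
    have PI: "P v \<in> ?I" if "0 < v" "v < 1" for v
      using that ab by (auto simp: in_segment P_def)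
    define c d where "c = P (u/2)" and "d = P ((1 + u)/2)"
    have cd: "c \<noteq> d" "x \<noteq> c" "x \<noteq> d" "c \<in> ?I" "d \<in> ?I"
      using u PI by (auto simp: c_def d_def P P_def[symmetric])
    have cdI: "closed_segment c d \<subseteq> ?I"
      using cd(4,5) convex_open_segment by (intro closed_segment_subset) auto
    have "(1 - u) *\<^sub>R c + u *\<^sub>R d = P ((1 - u) * (u / 2) + u * ((1 + u) / 2))"
      by (simp add: c_def d_def P_def algebra_simps scaleR_2 flip: scaleR_add_left)
    also have "(1 - u) * (u / 2) + u * ((1 + u) / 2) = u" by (simp add: field_simps)
    finally have xcd: "x \<in> closed_segment c d"
      using u unfolding in_segment P_def by (intro exI[of _ u]) auto
    have "\<exists>s t. 0 \<le> s \<and> s < t \<and> t \<le> 1 \<and> {g s, g t} = {c, d}"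
    proof -
      obtain s t where st: "s \<in> {0..1}" "t \<in> {0..1}" "g s = c" "g t = d"
        using cd I unfolding path_image_def by blast
      then have "s \<noteq> t" using cd by auto
      then consider "s < t" | "t < s" by linarith
      then show ?thesis
      proof cases
        case 1 then show ?thesis using st by (intro exI[of _ s] exI[of _ t]) auto
      next
        case 2 then show ?thesis using st by (intro exI[of _ t] exI[of _ s]) auto
      qed
    qed
    then obtain s t where st: "0 \<le> s" "s < t" "t \<le> 1" and gst: "{g s, g t} = {c, d}" by blast
    have gin: "g s \<in> closed_segment c d" "g t \<in> closed_segment c d" "g s \<noteq> g t"
      using gst cd by (auto simp: doubleton_eq_iff)
    have key: "closed K2 \<and> x \<notin> K2 \<and> path_image g \<subseteq> closed_segment c d \<union> K2 \<Longrightarrow> False" for K2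
    proof -
      assume K2: "closed K2 \<and> x \<notin> K2 \<and> path_image g \<subseteq> closed_segment c d \<union> K2"
      then have "open (- K2)" "x \<in> - K2" by auto
      then obtain e where e: "e > 0" "ball x e \<subseteq> - K2" using openE by blast
      obtain y where "y \<in> path_image g - ?I" "dist y x < e" using appr[OF e(1)] by blast
      then show False using e K2 cdI by (auto simp: dist_commute subset_eq)
    qed
    have inj: "u = v \<or> u = 0 \<and> v = 1 \<or> u = 1 \<and> v = 0"
      if "g u = g v" "u \<in> {0..1}" "v \<in> {0..1}" for u v
      using g(1) that by (auto simp: simple_path_def loop_free_def)
    have cover: "path_image g = g ` {s..t} \<union> g ` ({0..s} \<union> {t..1})"
      using st unfolding path_image_def image_Un[symmetric]
      by (intro arg_cong[where f = "image g"]) auto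
    have comp: "compact (g ` {s..t})" "compact (g ` ({0..s} \<union> {t..1}))"
      using st by (intro compact_continuous_image continuous_on_subset[OF cont]; auto)+
    from connected_subset_simple_loop[OF g connected_segment(1) _ st gin]
    consider "g ` {s..t} \<subseteq> closed_segment c d" | "g ` ({0..s} \<union> {t..1}) \<subseteq> closed_segment c d"
      using cdI I by blast
    then show False
    proof cases
      case 1
      have "connected (g ` {s..t})"
        using st by (intro connected_continuous_image continuous_on_subset[OF cont]) auto
      moreover have "c \<in> g ` {s..t}" "d \<in> g ` {s..t}"
        using gst st by (auto simp: doubleton_eq_iff)
      ultimately have "g ` {s..t} = closed_segment c d"
        using 1 by (intro connected_subset_segment_eq) auto
      then obtain w where w: "w \<in> {s..t}" "x = g w" using xcd by blast
      have "w \<noteq> s" "w \<noteq> t" using w cd gst by (auto simp: doubleton_eq_iff)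
      then have "x \<notin> g ` ({0..s} \<union> {t..1})"
        using inj[of w] w st by fastforce
      then show False
        using key[of "g ` ({0..s} \<union> {t..1})"] cover 1 compact_imp_closed[OF comp(2)] by blast
    next
      case 2
      have g01: "g 0 = g 1" using g(2) by (simp add: pathfinish_def pathstart_def)
      have "g 0 \<in> g ` {0..s}" "g 1 \<in> g ` {t..1}"
        using st by auto
      then have "g 0 \<in> g ` {0..s}" "g 0 \<in> g ` {t..1}" by (simp_all only: g01)
      then have "g ` {0..s} \<inter> g ` {t..1} \<noteq> {}" by blast
      then have "connected (g ` {0..s} \<union> g ` {t..1})"
        using st by (intro connected_Un connected_continuous_image continuous_on_subset[OF cont]) auto
      then have "connected (g ` ({0..s} \<union> {t..1}))" by (simp add: image_Un)
      moreover have "c \<in> g ` ({0..s} \<union> {t..1})" "d \<in> g ` ({0..s} \<union> {t..1})"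
        using gst st by (auto simp: doubleton_eq_iff)
      ultimately have "g ` ({0..s} \<union> {t..1}) = closed_segment c d"
        using 2 by (intro connected_subset_segment_eq) auto
      then obtain w where w: "w \<in> {0..s} \<union> {t..1}" "x = g w" using xcd by blast
      have ws: "w \<noteq> s" "w \<noteq> t" using w cd gst by (auto simp: doubleton_eq_iff)
      have "x \<notin> g ` {s..t}"
      proof
        assume "x \<in> g ` {s..t}"
        then obtain v where v: "v \<in> {s..t}" "x = g v" by blast
        have "w = v \<or> w = 0 \<and> v = 1 \<or> w = 1 \<and> v = 0" using inj[of w v] w v st by auto
        then have "v = s \<or> v = t" using v w ws st by auto
        then show False using v cd gst by (auto simp: doubleton_eq_iff)
      qed
      then show False
        using key[of "g ` {s..t}"] cover 2 compact_imp_closed[OF comp(1)] by blast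
    qed
  qed
  note notI = this
  have "closure (path_image g - ?I) \<subseteq> path_image g - ?I"
  proof
    fix x assume "x \<in> closure (path_image g - ?I)"
    then have *: "\<forall>e>0. \<exists>y\<in>path_image g - ?I. dist y x < e" by (simp add: closure_approachable)
    then have "\<forall>e>0. \<exists>y\<in>path_image g. dist y x < e" by blast
    then have "x \<in> path_image g" using clg closed_approachable by blast
    then show "x \<in> path_image g - ?I" using notI[of x] * by blast
  qed
  then show ?thesis by (simp add: closure_subset_eq)
qed

text \<open>Janiszewski's theorem. Shifting the loop to start at \<open>p\<close> makes its part
  \<tau> away from \<open>p\<close> a single arc. With \<open>B\<close> the outside of the ball
  together with \<tau>, the loop meets \<open>B\<close> exactly in the connected set \<tau>. Points
  near \<open>p\<close> that are separated neither by the loop nor by \<open>B\<close> are then not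
  separated by the union, and a path avoiding the union stays both in \<Omega> and in the
  ball.\<close>

lemma simple_loop_locally_connected_side:
  fixes g :: "real \<Rightarrow> complex"
  assumes g: "simple_path g" "pathfinish g = pathstart g"
    and \<Omega>: "open \<Omega>" "connected \<Omega>" "frontier \<Omega> = path_image g"
    and p: "p \<in> frontier \<Omega>" and "e > 0"
  obtains d where "d > 0" "\<And>x y. x \<in> \<Omega> \<inter> ball p d \<Longrightarrow> y \<in> \<Omega> \<inter> ball p d \<Longrightarrow>
     \<exists>q. path q \<and> path_image q \<subseteq> \<Omega> \<inter> ball p e \<and> pathstart q = x \<and> pathfinish q = y"
proof -
  obtain u where u: "0 \<le> u" "u \<le> 1" "g u = p"
    using p \<Omega> by (auto simp: path_image_def)
  define h where "h = shiftpath u g"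
  have h: "simple_path h" "path_image h = path_image g"
    unfolding h_def using u g by (intro simple_path_shiftpath path_image_shiftpath; simp)+
  have h01: "h 0 = p" "h 1 = p"
    using u g by (auto simp: h_def shiftpath_def pathstart_def pathfinish_def)
  have cont: "continuous_on {0..1} h"
    using h(1) by (simp add: simple_path_def path_def)
  obtain d0 where d0: "d0 > 0" "\<And>t. t \<in> {0..1} \<Longrightarrow> dist t 0 < d0 \<Longrightarrow> dist (h t) p < e"
    using cont \<open>e > 0\<close> h01 unfolding continuous_on_iff by (metis atLeastAtMost_iff order_refl zero_le_one)
  obtain d1 where d1: "d1 > 0" "\<And>t. t \<in> {0..1} \<Longrightarrow> dist t 1 < d1 \<Longrightarrow> dist (h t) p < e"
    using cont \<open>e > 0\<close> h01 unfolding continuous_on_iff by (metis atLeastAtMost_iff order_refl zero_le_one)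
  define r where "r = min (min d0 d1) (1/2) / 2"
  have r: "0 < r" "r < d0" "r < d1" "r < 1/2"
    using d0 d1 by (auto simp: r_def min_def)
  define \<tau> where "\<tau> = h ` {r..1-r}"
  have \<tau>: "compact \<tau>" "connected \<tau>"
    unfolding \<tau>_def using r
    by (auto intro!: compact_continuous_image connected_continuous_image continuous_on_subset[OF cont])
  have "p \<notin> \<tau>"
  proof
    assume "p \<in> \<tau>"
    then obtain t where t: "t \<in> {r..1-r}" "h t = h 0" by (auto simp: \<tau>_def h01)
    then show False using h(1) r unfolding simple_path_def loop_free_def by fastforce
  qed
  then obtain d' where d': "d' > 0" "ball p d' \<subseteq> - \<tau>"
    using \<tau>(1) compact_imp_closed open_Compl openE by blast
  define d where "d = min d' e"
  define B where "B = (- ball p e) \<union> \<tau>"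
  have "closed B" unfolding B_def using \<tau> by (auto intro: compact_imp_closed)
  have near: "h t \<in> ball p e" if "t \<in> {0..1}" "t \<notin> {r..1-r}" for t
    using that d0(2)[of t] d1(2)[of t] r by (auto simp: dist_real_def dist_commute)
  have "{r..1-r} \<subseteq> {0..1}" using r by auto
  then have "\<tau> \<subseteq> path_image h" unfolding \<tau>_def path_image_def by (rule image_mono)
  then have "\<tau> \<subseteq> path_image g" unfolding h(2).
  moreover have "x \<in> \<tau>" if "x \<in> path_image g" "x \<notin> ball p e" for x
    using that near unfolding h(2)[symmetric] unfolding path_image_def \<tau>_def by blast
  ultimately have "path_image g \<inter> B = \<tau>" unfolding B_def by blast
  then have conn: "connected (path_image g \<inter> B)" using \<tau> by simp
  have cpt: "compact (path_image g)"
    using g by (simp add: compact_simple_path_image)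
  have "\<exists>q. path q \<and> path_image q \<subseteq> \<Omega> \<inter> ball p e \<and> pathstart q = x \<and> pathfinish q = y"
    if x: "x \<in> \<Omega> \<inter> ball p d" and y: "y \<in> \<Omega> \<inter> ball p d" for x y
  proof -
    have disj: "\<Omega> \<inter> path_image g = {}"
      using \<Omega> by (metis frontier_disjoint_eq inf_commute)
    have 1: "connected_component (- path_image g) x y"
      unfolding connected_component_def using \<Omega> disj x y by (intro exI[of _ \<Omega>]) auto
    have "ball p d \<subseteq> - B" using d' by (auto simp: B_def d_def)
    then have 2: "connected_component (- B) x y"
      unfolding connected_component_def using x y by (intro exI[of _ "ball p d"]) auto
    have "connected_component (- (path_image g \<union> B)) x y"
      by (rule Janiszewski[OF cpt \<open>closed B\<close> conn 1 2])
    then have "path_component (- (path_image g \<union> B)) x y"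
      using cpt \<open>closed B\<close> by (subst open_path_connected_component) (auto simp: Compl_Un intro!: open_Int open_Compl compact_imp_closed)
    then obtain q where q: "path q" "path_image q \<subseteq> - (path_image g \<union> B)" "pathstart q = x" "pathfinish q = y"
      by (auto simp: path_component_def)
    have "path_image q \<subseteq> \<Omega>"
    proof (rule ccontr)
      assume "\<not> path_image q \<subseteq> \<Omega>"
      moreover have "path_image q \<inter> \<Omega> \<noteq> {}" using q x by (metis IntD1 disjoint_iff pathstart_in_path_image)
      ultimately have "path_image q \<inter> frontier \<Omega> \<noteq> {}"
        by (intro connected_Int_frontier connected_path_image q) auto
      then show False using q \<Omega> by auto
    qed
    then show ?thesis using q by (intro exI[of _ q]) (auto simp: B_def)
  qed
  moreover have "d > 0" using d' \<open>e > 0\<close> by (simp add: d_def)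
  ultimately show ?thesis using that by blast
qed

text \<open>Each of the two components of the complement of the loop has every point of the loop in
  its closure, and the connected set \<Omega> misses one of them. If \<Omega> filled
  \<open>N\<close> up to \<open>X\<close>, the missed component would meet \<open>N\<close> in a
  nonempty open subset of \<open>X\<close>. This excludes a domain lying on both sides of a boundary
  segment.\<close>

lemma simple_loop_domain_frontier_closure:
  fixes g :: "real \<Rightarrow> complex"
  assumes g: "simple_path g" "pathfinish g = pathstart g"
    and \<Omega>: "open \<Omega>" "connected \<Omega>" "frontier \<Omega> = path_image g" "p \<in> frontier \<Omega>" "open N" "p \<in> N"
    and X: "interior X = {}"
  shows "\<not> N - X \<subseteq> \<Omega>"
proof
  assume N: "N - X \<subseteq> \<Omega>"
  obtain V W where VW: "open V" "open W" "connected V" "connected W" "V \<inter> W = {}"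
      "V \<union> W = - path_image g" "frontier V = path_image g" "frontier W = path_image g"
    using Jordan_curve[OF g] by metis
  have disj: "\<Omega> \<inter> path_image g = {}" using \<Omega> by (metis frontier_disjoint_eq inf_commute)
  have False if VW: "open W" "V \<inter> W = {}" "V \<union> W = - path_image g" "frontier W = path_image g" "\<Omega> \<inter> V \<noteq> {}" "open V" for V W
  proof -
    have "\<Omega> \<inter> W = {}"
      using connectedD[OF \<Omega>(2) \<open>open V\<close> \<open>open W\<close>] that disj by blast
    have "p \<in> closure W" using VW \<Omega> by (metis DiffD1 frontier_def)
    then have "W \<inter> N \<noteq> {}" using \<Omega>(5,6) by (metis closure_iff_nhds_not_empty inf_commute order_refl)
    moreover have "open (W \<inter> N)" using VW \<Omega> by auto
    moreover have "W \<inter> N \<subseteq> X" using N \<open>\<Omega> \<inter> W = {}\<close> by auto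
    ultimately show False using X interior_maximal by blast
  qed
  note * = this
  have "\<Omega> \<noteq> {}" using \<Omega> by auto
  then have "\<Omega> \<inter> V \<noteq> {} \<or> \<Omega> \<inter> W \<noteq> {}" using VW(6) disj by blast
  then show False using *[of W V] *[of V W] VW by (auto simp: Un_commute Int_commute)
qed

lemma parallel_of_common_normal:
  fixes v w \<nu> :: complex
  assumes "v \<bullet> \<nu> = 0" "w \<bullet> \<nu> = 0" "\<nu> \<noteq> 0" "w \<noteq> 0"
  shows "\<exists>s. v = s *\<^sub>R w"
proof -
  have "(Re v * Im w - Im v * Re w) * Re \<nu> = 0" "(Re v * Im w - Im v * Re w) * Im \<nu> = 0"
    using assms(1,2) unfolding inner_complex_def by algebra+
  then have cr: "Re v * Im w = Im v * Re w" using assms(3) by (auto simp: complex_eq_iff)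
  have n: "(Re w)\<^sup>2 + (Im w)\<^sup>2 \<noteq> 0" using assms(4) by (simp add: complex_eq_iff sum_power2_eq_zero_iff)
  have "v = ((Re v * Re w + Im v * Im w) / ((Re w)\<^sup>2 + (Im w)\<^sup>2)) *\<^sub>R w"
    using n cr by (simp add: complex_eq_iff field_simps power2_eq_square)
  then show ?thesis by blast
qed

lemma infdist_less_iff:
  fixes J :: "'a::heine_borel set"
  assumes "compact J" "J \<noteq> {}"
  shows "infdist z J < r \<longleftrightarrow> (\<exists>x\<in>J. dist z x < r)"
proof
  assume "infdist z J < r"
  then show "\<exists>x\<in>J. dist z x < r"
    using infdist_attains_inf[of J z] compact_imp_closed[OF assms(1)] assms(2) by metis
next
  assume "\<exists>x\<in>J. dist z x < r"
  then show "infdist z J < r" using infdist_le le_less_trans by metis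
qed

lemma convex_infdist_less:
  fixes J :: "'a::euclidean_space set"
  assumes "compact J" "J \<noteq> {}" "convex J"
  shows "convex {z. infdist z J < r}"
proof -
  have "{z. infdist z J < r} = (\<Union>x\<in>J. \<Union>y\<in>ball 0 r. {x + y})"
  proof (intro set_eqI iffI)
    fix z assume "z \<in> {z. infdist z J < r}"
    then obtain x where "x \<in> J" "dist z x < r" using infdist_less_iff[OF assms(1,2)] by auto
    then have "z = x + (z - x)" "z - x \<in> ball 0 r" unfolding mem_ball_0 by (auto simp: dist_norm)
    then show "z \<in> (\<Union>x\<in>J. \<Union>y\<in>ball 0 r. {x + y})" using \<open>x \<in> J\<close> by blast
  next
    fix z assume "z \<in> (\<Union>x\<in>J. \<Union>y\<in>ball 0 r. {x + y})"
    then obtain x y where "x \<in> J" "norm y < r" "z = x + y" by auto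
    then show "z \<in> {z. infdist z J < r}" 
      using infdist_less_iff[OF assms(1,2)] by (auto simp: dist_norm intro!: bexI[of _ x])
  qed
  then show ?thesis using convex_sums[OF assms(3) convex_ball] by simp
qed

text \<open>Close to \<open>closed_segment c d\<close> the boundary consists of points of the open
  segment only. Each half of a convex neighbourhood, cut along the line, is therefore free of
  boundary points and lies entirely inside or entirely outside \<Omega>. Both inside is impossible
  for a Jordan domain, and both outside contradicts that \<open>c\<close> is a boundary
  point.\<close>

lemma segment_boundary_sides:
  fixes g :: "real \<Rightarrow> complex"
  assumes g: "simple_path g" "pathfinish g = pathstart g"
    and \<Omega>: "open \<Omega>" "connected \<Omega>" "frontier \<Omega> = path_image g"
    and I: "open_segment a b \<subseteq> frontier \<Omega>" "a \<noteq> b"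
    and \<nu>: "norm \<nu> = 1" "\<nu> \<bullet> (b - a) = 0"
    and J: "closed_segment c d \<subseteq> open_segment a b"
  obtains r where "r > 0"
    "\<forall>z. infdist z (closed_segment c d) < r \<longrightarrow> (z - a) \<bullet> \<nu> = 0 \<longrightarrow> z \<in> open_segment a b"
    "(\<forall>z. infdist z (closed_segment c d) < r \<longrightarrow> (z \<in> \<Omega> \<longleftrightarrow> (z - a) \<bullet> \<nu> < 0)) \<or>
     (\<forall>z. infdist z (closed_segment c d) < r \<longrightarrow> (z \<in> \<Omega> \<longleftrightarrow> (z - a) \<bullet> \<nu> > 0))"
proof -
  let ?I = "open_segment a b" let ?J = "closed_segment c d"
  define K where "K = path_image g - ?I"
  have clK: "closed K" unfolding K_def
    by (rule closed_loop_minus_open_segment[OF g I(1)[unfolded \<Omega>(3)] I(2)])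
  have clF: "closed (frontier \<Omega>)" by simp
  have "closure ?I \<subseteq> frontier \<Omega>" using I closure_minimal clF by blast
  moreover have "closure ?I = closed_segment a b" using I(2) by simp
  ultimately have ab: "a \<in> frontier \<Omega>" "b \<in> frontier \<Omega>" by auto
  then have abK: "a \<in> K" "b \<in> K" using \<Omega> by (auto simp: K_def open_segment_def)
  \<comment> \<open>Since \<open>a\<close> and \<open>b\<close> belong to \<open>K\<close>, a
    neighbourhood of this radius also meets the line through them only between \<open>a\<close> and
    \<open>b\<close>.\<close>
  define r where "r = setdist ?J K"
  have r: "r > 0" unfolding r_def
    using J abK clK by (subst setdist_gt_0_compact_closed) (auto simp: K_def)
  have Jne: "?J \<noteq> {}" "compact ?J" by auto
  have near_pt: "\<exists>x\<in>?J. dist z x < r" if "infdist z ?J < r" for z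
    using iffD1[OF infdist_less_iff[OF Jne(2,1)] that] .
  have notK: "z \<notin> K" if zr: "infdist z ?J < r" for z
  proof
    assume "z \<in> K"
    obtain x where "x \<in> ?J" "dist z x < r" using near_pt[OF zr] by blast
    then show False using setdist_le_dist[of x ?J z K] \<open>z \<in> K\<close> unfolding r_def by (simp add: dist_commute)
  qed
  define N where "N = {z. infdist z ?J < r}"
  have opN: "open N" unfolding N_def by (intro open_Collect_less continuous_intros)
  have cvN: "convex N" unfolding N_def by (intro convex_infdist_less Jne) auto
  have Iperp: "(z - a) \<bullet> \<nu> = 0" if z: "z \<in> ?I" for z
  proof -
    obtain u where "z = (1 - u) *\<^sub>R a + u *\<^sub>R b" using z by (auto simp: in_segment)
    then have "z - a = u *\<^sub>R (b - a)" by (simp add: algebra_simps)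
    then show ?thesis using \<nu> by (simp add: inner_commute)
  qed
  have line: "z \<in> ?I" if z: "infdist z ?J < r" "(z - a) \<bullet> \<nu> = 0" for z
  proof -
    have "\<nu> \<noteq> 0" using \<nu> by auto
    then obtain s where s: "z - a = s *\<^sub>R (b - a)"
      using parallel_of_common_normal[of "z - a" \<nu> "b - a"] z \<nu> I(2) by (auto simp: inner_commute)
    then have zs: "z = a + s *\<^sub>R (b - a)" by (simp add: algebra_simps)
    obtain x where x: "x \<in> ?J" "dist z x < r" using near_pt[OF z(1)] by blast
    then obtain u where u: "0 < u" "u < 1" "x = (1 - u) *\<^sub>R a + u *\<^sub>R b" using subsetD[OF J] unfolding in_segment(2) by blast
    then have xu: "x = a + u *\<^sub>R (b - a)" by (simp add: algebra_simps)
    have dzx: "dist z x = \<bar>s - u\<bar> * norm (b - a)"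
    proof -
      have "z - x = (s - u) *\<^sub>R (b - a)" unfolding zs xu by (simp add: algebra_simps)
      then show ?thesis by (simp add: dist_norm)
    qed
    have "s > 0"
    proof (rule ccontr)
      assume "\<not> s > 0"
      have "dist x a = u * norm (b - a)" unfolding xu using u by (simp add: dist_norm)
      also have "\<dots> \<le> dist z x" unfolding dzx using \<open>\<not> s > 0\<close> u by (intro mult_right_mono) auto
      finally have "dist x a < r" using x by simp
      then show False using setdist_le_dist[OF x(1) abK(1)] unfolding r_def by simp
    qed
    moreover have "s < 1"
    proof (rule ccontr)
      assume "\<not> s < 1"
      have "x - b = (u - 1) *\<^sub>R (b - a)" unfolding xu by (simp add: algebra_simps)
      then have "dist x b = (1 - u) * norm (b - a)" using u by (simp add: dist_norm)
      also have "\<dots> \<le> dist z x" unfolding dzx using \<open>\<not> s < 1\<close> u by (intro mult_right_mono) auto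
      finally have "dist x b < r" using x by simp
      then show False using setdist_le_dist[OF x(1) abK(2)] unfolding r_def by simp
    qed
    ultimately show ?thesis unfolding zs in_segment using I(2)
      by (auto intro!: exI[of _ s] simp: algebra_simps)
  qed
  have disj: "\<Omega> \<inter> frontier \<Omega> = {}" using \<Omega> by (metis frontier_disjoint_eq inf_commute)
  have side: "M \<subseteq> \<Omega> \<or> M \<inter> \<Omega> = {}" if "convex M" "M \<subseteq> N" "\<And>z. z \<in> M \<Longrightarrow> (z - a) \<bullet> \<nu> \<noteq> 0" for M
  proof (rule ccontr)
    assume "\<not> ?thesis"
    then have "M \<inter> frontier \<Omega> \<noteq> {}"
      using that(1) by (intro connected_Int_frontier convex_connected) auto
    then obtain z where z: "z \<in> M" "z \<in> frontier \<Omega>" by blast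
    then have "z \<in> ?I" using notK[of z] that \<Omega> by (auto simp: K_def N_def)
    then show False using Iperp that z by blast
  qed
  have eqs: "{z. (z - a) \<bullet> \<nu> < 0} = {z. \<nu> \<bullet> z < \<nu> \<bullet> a}" "{z. (z - a) \<bullet> \<nu> > 0} = {z. \<nu> \<bullet> z > \<nu> \<bullet> a}"
     "{z. (z - a) \<bullet> \<nu> = 0} = {z. \<nu> \<bullet> z = \<nu> \<bullet> a}"
    by (auto simp: inner_diff_left inner_commute[of \<nu>])
  define M1 M2 where "M1 = N \<inter> {z. (z - a) \<bullet> \<nu> < 0}" and "M2 = N \<inter> {z. (z - a) \<bullet> \<nu> > 0}"
  have "M1 \<subseteq> \<Omega> \<or> M1 \<inter> \<Omega> = {}" 
    by (rule side) (auto simp: M1_def intro: convex_Int cvN convex_halfspace_lt[of \<nu> "\<nu> \<bullet> a", folded eqs])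
  moreover have "M2 \<subseteq> \<Omega> \<or> M2 \<inter> \<Omega> = {}" 
    by (rule side) (auto simp: M2_def intro: convex_Int cvN convex_halfspace_gt[of "\<nu> \<bullet> a" \<nu>, folded eqs])
  moreover have cN: "c \<in> N" "c \<in> frontier \<Omega>" using r J I by (auto simp: N_def infdist_zero)
  have "\<not> (M1 \<subseteq> \<Omega> \<and> M2 \<subseteq> \<Omega>)"
  proof
    assume *: "M1 \<subseteq> \<Omega> \<and> M2 \<subseteq> \<Omega>"
    have "interior {z. (z - a) \<bullet> \<nu> = 0} = {}"
      unfolding eqs using \<nu> by (intro interior_hyperplane) auto
    moreover have "N - {z. (z - a) \<bullet> \<nu> = 0} \<subseteq> M1 \<union> M2" by (auto simp: M1_def M2_def)
    ultimately show False
      using simple_loop_domain_frontier_closure[OF g \<Omega> cN(2) opN cN(1)] * by blast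
  qed
  moreover have noline: "z \<notin> \<Omega>" if "z \<in> N" "(z - a) \<bullet> \<nu> = 0" for z
    using line[of z] that I disj by (auto simp: N_def)
  have "\<not> (M1 \<inter> \<Omega> = {} \<and> M2 \<inter> \<Omega> = {})"
  proof
    assume *: "M1 \<inter> \<Omega> = {} \<and> M2 \<inter> \<Omega> = {}"
    have "c \<in> closure \<Omega>" using cN by (simp add: frontier_def)
    then have "\<Omega> \<inter> N \<noteq> {}" using opN cN by (metis closure_iff_nhds_not_empty order_refl)
    then obtain z where z: "z \<in> \<Omega>" "z \<in> N" by blast
    then have "(z - a) \<bullet> \<nu> \<noteq> 0" using noline by blast
    then have "(z - a) \<bullet> \<nu> < 0 \<or> (z - a) \<bullet> \<nu> > 0" by linarith
    then have "z \<in> M1 \<union> M2" using z(2) by (auto simp: M1_def M2_def)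
    then show False using z(1) * by blast
  qed
  ultimately have cases: "M1 \<subseteq> \<Omega> \<and> M2 \<inter> \<Omega> = {} \<or> M2 \<subseteq> \<Omega> \<and> M1 \<inter> \<Omega> = {}" by blast
  have "(\<forall>z. infdist z ?J < r \<longrightarrow> (z \<in> \<Omega> \<longleftrightarrow> (z - a) \<bullet> \<nu> < 0)) \<or>
     (\<forall>z. infdist z ?J < r \<longrightarrow> (z \<in> \<Omega> \<longleftrightarrow> (z - a) \<bullet> \<nu> > 0))"
  proof (rule disj_forward[OF cases]; intro allI impI)
    fix z assume a: "M1 \<subseteq> \<Omega> \<and> M2 \<inter> \<Omega> = {}" "infdist z ?J < r"
    then have "z \<in> N" by (simp add: N_def)
    then show "z \<in> \<Omega> \<longleftrightarrow> (z - a) \<bullet> \<nu> < 0" using noline[of z] a(1) by (cases "(z - a) \<bullet> \<nu>" "0::real" rule: linorder_cases) (auto simp: M1_def M2_def)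
  next
    fix z assume a: "M2 \<subseteq> \<Omega> \<and> M1 \<inter> \<Omega> = {}" "infdist z ?J < r"
    then have "z \<in> N" by (simp add: N_def)
    then show "z \<in> \<Omega> \<longleftrightarrow> (z - a) \<bullet> \<nu> > 0" using noline[of z] a(1) by (cases "(z - a) \<bullet> \<nu>" "0::real" rule: linorder_cases) (auto simp: M1_def M2_def)
  qed
  then show ?thesis using that[of r] r line by blast
qed

lemma outward_unit_normal_perp:
  assumes "outward_unit_normal \<Omega> (open_segment a b) \<nu>" "a \<noteq> b"
  shows "\<nu> \<bullet> (b - a) = 0"
proof -
  have "(1 - u) *\<^sub>R a + u *\<^sub>R b \<in> open_segment a b" if "0 < u" "u < 1" for u
    using that assms(2) by (auto simp: in_segment)
  from this[of "1/2"] this[of "1/3"]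
  have "\<nu> \<bullet> (((1 - 1/2) *\<^sub>R a + (1/2) *\<^sub>R b) - ((1 - 1/3) *\<^sub>R a + (1/3) *\<^sub>R b)) = 0"
    using assms(1) unfolding outward_unit_normal_def by simp
  then show ?thesis by (simp add: inner_diff_right inner_add_right field_simps)
qed

text \<open>One point \<open>c - t *\<^sub>R \<nu>\<close> of \<Omega>, supplied by the definition
  of the normal, decides between the two alternatives of
  \<open>segment_boundary_sides\<close>.\<close>

lemma outward_unit_normal_side:
  fixes g :: "real \<Rightarrow> complex"
  assumes g: "simple_path g" "pathfinish g = pathstart g"
    and \<Omega>: "open \<Omega>" "connected \<Omega>" "frontier \<Omega> = path_image g"
    and I: "open_segment a b \<subseteq> frontier \<Omega>" "a \<noteq> b"
    and \<nu>: "outward_unit_normal \<Omega> (open_segment a b) \<nu>"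
    and J: "closed_segment c d \<subseteq> open_segment a b"
  obtains r where "r > 0"
    "\<forall>z. infdist z (closed_segment c d) < r \<longrightarrow> (z - a) \<bullet> \<nu> = 0 \<longrightarrow> z \<in> open_segment a b"
    "\<forall>z. infdist z (closed_segment c d) < r \<longrightarrow> (z \<in> \<Omega> \<longleftrightarrow> (z - a) \<bullet> \<nu> < 0)"
proof -
  have n: "norm \<nu> = 1" "\<nu> \<bullet> (b - a) = 0"
    using \<nu> outward_unit_normal_perp[OF \<nu> I(2)] by (auto simp: outward_unit_normal_def)
  obtain r where r: "r > 0"
    "\<forall>z. infdist z (closed_segment c d) < r \<longrightarrow> (z - a) \<bullet> \<nu> = 0 \<longrightarrow> z \<in> open_segment a b"
    "(\<forall>z. infdist z (closed_segment c d) < r \<longrightarrow> (z \<in> \<Omega> \<longleftrightarrow> (z - a) \<bullet> \<nu> < 0)) \<or>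
     (\<forall>z. infdist z (closed_segment c d) < r \<longrightarrow> (z \<in> \<Omega> \<longleftrightarrow> (z - a) \<bullet> \<nu> > 0))"
    by (rule segment_boundary_sides[OF g \<Omega> I n J])
  have cI: "c \<in> open_segment a b" using J by auto
  then obtain u where "c = (1 - u) *\<^sub>R a + u *\<^sub>R b" by (auto simp: in_segment)
  then have "c - a = u *\<^sub>R (b - a)" by (simp add: algebra_simps)
  then have c0: "(c - a) \<bullet> \<nu> = 0" using n by (simp add: inner_commute)
  have "\<forall>\<^sub>F t::real in at_right 0. c - t *\<^sub>R \<nu> \<in> \<Omega> \<and> c + t *\<^sub>R \<nu> \<notin> closure \<Omega>"
    using \<nu> cI by (auto simp: outward_unit_normal_def)
  moreover have "\<forall>\<^sub>F t::real in at_right 0. t \<in> {0<..<r}"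
    using r(1) eventually_at_right_real by blast
  ultimately have "\<forall>\<^sub>F t::real in at_right 0. c - t *\<^sub>R \<nu> \<in> \<Omega> \<and> t \<in> {0<..<r}"
    by eventually_elim auto
  then obtain t where t: "c - t *\<^sub>R \<nu> \<in> \<Omega>" "0 < t" "t < r"
    using eventually_happens'[OF trivial_limit_at_right_real] by fastforce
  have "infdist (c - t *\<^sub>R \<nu>) (closed_segment c d) \<le> dist (c - t *\<^sub>R \<nu>) c" by (intro infdist_le) auto
  also have "\<dots> < r" using t n by (simp add: dist_norm)
  finally have near: "infdist (c - t *\<^sub>R \<nu>) (closed_segment c d) < r" .
  have "c - t *\<^sub>R \<nu> - a = (c - a) - t *\<^sub>R \<nu>" by simp
  then have "(c - t *\<^sub>R \<nu> - a) \<bullet> \<nu> = - t"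
    using c0 n by (simp only: inner_diff_left) (simp add: dot_square_norm)
  then have "\<not> (c - t *\<^sub>R \<nu> - a) \<bullet> \<nu> > 0" using t by simp
  then have "\<forall>z. infdist z (closed_segment c d) < r \<longrightarrow> (z \<in> \<Omega> \<longleftrightarrow> (z - a) \<bullet> \<nu> < 0)"
    using r(3) near t(1) by blast
  then show ?thesis using that r by blast
qed

text \<open>The sign of the normal is fixed at the midpoint \<open>m\<close>. For any other
  \<open>p\<close>, a neighbourhood of the whole segment from \<open>p\<close> to \<open>m\<close>
  carries the side from \<open>m\<close> to \<open>p\<close>, so a single \<nu> serves all of the
  segment.\<close>

lemma outward_unit_normal_exists:
  fixes g :: "real \<Rightarrow> complex"
  assumes g: "simple_path g" "pathfinish g = pathstart g"
    and \<Omega>: "open \<Omega>" "connected \<Omega>" "frontier \<Omega> = path_image g"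
    and I: "open_segment a b \<subseteq> frontier \<Omega>" "a \<noteq> b"
  shows "\<exists>\<nu>. outward_unit_normal \<Omega> (open_segment a b) \<nu>"
proof -
  define \<mu> where "\<mu> = \<i> * sgn (b - a)"
  have \<mu>: "norm \<mu> = 1" "\<mu> \<bullet> (b - a) = 0"
    using I(2) unfolding \<mu>_def norm_mult norm_sgn by (auto simp: sgn_div_norm inner_complex_def algebra_simps)
  have Iperp: "(z - a) \<bullet> \<mu> = 0" if z: "z \<in> open_segment a b" for z
  proof -
    obtain u where "z = (1 - u) *\<^sub>R a + u *\<^sub>R b" using z by (auto simp: in_segment)
    then have "z - a = u *\<^sub>R (b - a)" by (simp add: algebra_simps)
    then show ?thesis using \<mu> by (simp add: inner_commute)
  qed
  define m where "m = midpoint a b"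
  have m: "m \<in> open_segment a b" using I(2) by (simp add: m_def)
  have mm: "closed_segment m m \<subseteq> open_segment a b" using m by simp
  obtain r where r0: "r > 0"
    "\<forall>z. infdist z (closed_segment m m) < r \<longrightarrow> (z - a) \<bullet> \<mu> = 0 \<longrightarrow> z \<in> open_segment a b"
    "(\<forall>z. infdist z (closed_segment m m) < r \<longrightarrow> (z \<in> \<Omega> \<longleftrightarrow> (z - a) \<bullet> \<mu> < 0)) \<or>
     (\<forall>z. infdist z (closed_segment m m) < r \<longrightarrow> (z \<in> \<Omega> \<longleftrightarrow> (z - a) \<bullet> \<mu> > 0))"
    by (rule segment_boundary_sides[OF g \<Omega> I \<mu> mm])
  note r = r0(1,3)
  have main: "outward_unit_normal \<Omega> (open_segment a b) \<nu>"
    if \<nu>: "\<nu> = \<mu> \<or> \<nu> = - \<mu>" and side: "\<And>z. infdist z {m} < r \<Longrightarrow> z \<in> \<Omega> \<longleftrightarrow> (z - a) \<bullet> \<nu> < 0" for \<nu>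
  proof -
    have n: "norm \<nu> = 1" "\<nu> \<bullet> (b - a) = 0" using \<mu> \<nu> by auto
    have perp: "(z - a) \<bullet> \<nu> = 0" if "z \<in> open_segment a b" for z using Iperp[OF that] \<nu> by auto
    have shift: "(p + t *\<^sub>R \<nu> - a) \<bullet> \<nu> = t" if "p \<in> open_segment a b" for p t
    proof -
      have "p + t *\<^sub>R \<nu> - a = (p - a) + t *\<^sub>R \<nu>" by simp
      then show ?thesis using perp[OF that] n by (simp only: inner_add_left) (simp add: dot_square_norm)
    qed
    have "\<forall>\<^sub>F t::real in at_right 0. p - t *\<^sub>R \<nu> \<in> \<Omega> \<and> p + t *\<^sub>R \<nu> \<notin> closure \<Omega>"
      if p: "p \<in> open_segment a b" for p
    proof -
      have pm: "closed_segment p m \<subseteq> open_segment a b"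
        using p m convex_open_segment by (intro closed_segment_subset) auto
      obtain q where q0: "q > 0"
        "\<forall>z. infdist z (closed_segment p m) < q \<longrightarrow> (z - a) \<bullet> \<nu> = 0 \<longrightarrow> z \<in> open_segment a b"
        "(\<forall>z. infdist z (closed_segment p m) < q \<longrightarrow> (z \<in> \<Omega> \<longleftrightarrow> (z - a) \<bullet> \<nu> < 0)) \<or>
         (\<forall>z. infdist z (closed_segment p m) < q \<longrightarrow> (z \<in> \<Omega> \<longleftrightarrow> (z - a) \<bullet> \<nu> > 0))"
        by (rule segment_boundary_sides[OF g \<Omega> I n pm])
      note q = q0(1,3)
      have near: "infdist (x + t *\<^sub>R \<nu>) (closed_segment p m) < q" if "x \<in> closed_segment p m" "\<bar>t\<bar> < q" for x t
      proof -
        have "infdist (x + t *\<^sub>R \<nu>) (closed_segment p m) \<le> dist (x + t *\<^sub>R \<nu>) x" using that by (intro infdist_le)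
        then show ?thesis using that n by (simp add: dist_norm)
      qed
      define s where "s = min q r / 2"
      have s: "0 < s" "s < q" "s < r" using q r by (auto simp: s_def)
      have "m + (- s) *\<^sub>R \<nu> \<in> \<Omega>" using side[of "m + (- s) *\<^sub>R \<nu>"] shift[OF m, of "-s"] s n
        by (simp add: dist_norm)
      moreover have "\<not> (m + (- s) *\<^sub>R \<nu> - a) \<bullet> \<nu> > 0" using shift[OF m, of "-s"] s by simp
      ultimately have *: "\<forall>z. infdist z (closed_segment p m) < q \<longrightarrow> (z \<in> \<Omega> \<longleftrightarrow> (z - a) \<bullet> \<nu> < 0)"
        using q(2) near[of m "-s"] s by force
      have "\<forall>\<^sub>F t::real in at_right 0. t \<in> {0<..<q}"
        using q(1) eventually_at_right_real by blast
      then show ?thesis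
      proof eventually_elim
        fix t assume t: "t \<in> {0<..<q}"
        have "p - t *\<^sub>R \<nu> \<in> \<Omega>" using *[rule_format, of "p + (-t) *\<^sub>R \<nu>"] near[of p "-t"] shift[OF p, of "-t"] t by auto
        moreover have "p + t *\<^sub>R \<nu> \<notin> closure \<Omega>"
        proof
          assume cl: "p + t *\<^sub>R \<nu> \<in> closure \<Omega>"
          let ?O = "{z. infdist z (closed_segment p m) < q} \<inter> {z. (z - a) \<bullet> \<nu> > 0}"
          have "open ?O" by (intro open_Int open_Collect_less continuous_intros)
          moreover have "p + t *\<^sub>R \<nu> \<in> ?O" using near[of p t] shift[OF p, of t] t by auto
          ultimately have "\<Omega> \<inter> ?O \<noteq> {}" using cl by (metis closure_iff_nhds_not_empty order_refl)
          then obtain z where z: "z \<in> \<Omega>" "z \<in> ?O" by blast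
          then have "(z - a) \<bullet> \<nu> < 0" using * by blast
          then show False using z by simp
        qed
        ultimately show "p - t *\<^sub>R \<nu> \<in> \<Omega> \<and> p + t *\<^sub>R \<nu> \<notin> closure \<Omega>" ..
      qed
    qed
    moreover have "\<nu> \<bullet> (q - p) = 0" if "p \<in> open_segment a b" "q \<in> open_segment a b" for p q
    proof -
      have "q - p = (q - a) - (p - a)" by simp
      then show ?thesis using perp[OF that(1)] perp[OF that(2)]
        by (simp only: inner_diff_right) (simp add: inner_commute inner_diff_right)
    qed
    ultimately show ?thesis using n unfolding outward_unit_normal_def by blast
  qed
  show ?thesis using r(2)
  proof
    assume "\<forall>z. infdist z (closed_segment m m) < r \<longrightarrow> (z \<in> \<Omega> \<longleftrightarrow> (z - a) \<bullet> \<mu> < 0)"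
    then show ?thesis using main[of \<mu>] by auto
  next
    assume "\<forall>z. infdist z (closed_segment m m) < r \<longrightarrow> (z \<in> \<Omega> \<longleftrightarrow> (z - a) \<bullet> \<mu> > 0)"
    then show ?thesis using main[of "- \<mu>"] by auto
  qed
qed

section \<open>Maximum principles in a box of the upper half plane\<close>

text \<open>\<open>H\<close> need not extend to the frontier; only upper limits are known there.
  They force the closure of the set where \<open>Re (H x)\<close> exceeds \<eta> into
  \<open>S\<close>, and there the maximum principle with continuous boundary values applies.\<close>

lemma Re_le_of_frontier_limsup:
  assumes S: "open S" "bounded S" and H: "H holomorphic_on S"
    and bd: "\<And>b. b \<in> frontier S \<Longrightarrow> \<forall>\<^sub>F x in at b within S. Re (H x) < \<eta>"
    and z: "z \<in> S"
  shows "Re (H z) \<le> \<eta>"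
proof (rule ccontr)
  assume gt: "\<not> ?thesis"
  define S' where "S' = {x \<in> S. Re (H x) > \<eta>}"
  have zS': "z \<in> S'" using z gt by (simp add: S'_def)
  have cH: "continuous_on S H" using H by (rule holomorphic_on_imp_continuous_on)
  have opS': "open S'"
  proof -
    have "open (S \<inter> (\<lambda>x. Re (H x)) -` {\<eta><..})"
      by (intro continuous_open_preimage continuous_intros cH S)
    moreover have "S' = S \<inter> (\<lambda>x. Re (H x)) -` {\<eta><..}" by (auto simp: S'_def)
    ultimately show ?thesis by simp
  qed
  have clS': "closure S' \<subseteq> S"
  proof
    fix b assume b: "b \<in> closure S'"
    show "b \<in> S"
    proof (rule ccontr)
      assume nb: "b \<notin> S"
      have "b \<in> closure S" using b closure_mono[of S' S] by (auto simp: S'_def)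
      then have "b \<in> frontier S" using nb S by (simp add: frontier_def interior_open)
      from bd[OF this] obtain d where d: "d > 0" "\<And>x. x \<in> S \<Longrightarrow> x \<noteq> b \<Longrightarrow> dist x b < d \<Longrightarrow> Re (H x) < \<eta>"
        unfolding eventually_at by blast
      obtain x where "x \<in> S'" "dist x b < d" using b d(1) closure_approachable by blast
      then show False using d(2)[of x] nb by (auto simp: S'_def)
    qed
  qed
  have "Re (H z) \<le> \<eta>"
  proof (rule maximum_real_frontier[of H S'])
    show "H holomorphic_on interior S'"
      using H holomorphic_on_subset interior_subset[of S'] by (force simp: S'_def)
    show "continuous_on (closure S') H" using cH clS' continuous_on_subset by blast
    show "bounded S'" using S bounded_subset by (force simp: S'_def)
    show "z \<in> S'" by fact
    fix b assume b: "b \<in> frontier S'"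
    then have "b \<in> S" "b \<notin> S'" using clS' opS' by (auto simp: frontier_def interior_open)
    then show "Re (H b) \<le> \<eta>" by (auto simp: S'_def)
  qed
  then show False using zS' by (simp add: S'_def)
qed

abbreviation HH :: "complex set" where "HH \<equiv> {z. Im z > 0}"

definition hbox :: "real \<Rightarrow> real \<Rightarrow> complex set" where
  "hbox c L = {z. \<bar>Re z - c\<bar> < L \<and> 0 < Im z \<and> Im z < L}"

text \<open>
  On the closed box the real part is nonnegative, at least 1 on the three non-real sides, and it
  vanishes at \<open>c\<close>.
\<close>

definition barrier :: "real \<Rightarrow> real \<Rightarrow> complex \<Rightarrow> complex" where
  "barrier c L z = ((z - of_real c) / of_real L)\<^sup>2 - \<i> * of_real (2 / L) * z"

lemma barrier_holomorphic [holomorphic_intros]: "L \<noteq> 0 \<Longrightarrow> barrier c L holomorphic_on S"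
  unfolding barrier_def by (intro holomorphic_intros) auto

lemma Re_barrier: "Re (barrier c L z) = (Re z - c)\<^sup>2 / L\<^sup>2 - (Im z)\<^sup>2 / L\<^sup>2 + 2 * Im z / L"
  unfolding barrier_def power_divide
  by (simp add: power2_eq_square Re_divide_of_real diff_divide_distrib flip: of_real_mult)

lemma isCont_barrier: "L \<noteq> 0 \<Longrightarrow> isCont (barrier c L) z"
  unfolding barrier_def by (intro continuous_intros) auto

lemma barrier_nonneg:
  assumes "L > 0" "0 \<le> Im z" "Im z \<le> L"
  shows "Re (barrier c L z) \<ge> 0"
proof -
  have "Im z / L \<le> 1" "0 \<le> Im z / L" using assms by auto
  then have "(Im z / L)\<^sup>2 \<le> 2 * (Im z / L)" using power_le_one_iff
    by (smt (verit, best) mult_left_le power2_eq_square)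
  then show ?thesis unfolding Re_barrier
    by (simp add: power_divide) (smt (verit) zero_le_divide_iff zero_le_power2)
qed

lemma barrier_ge_1:
  assumes "L > 0" "0 \<le> Im z" "Im z \<le> L" "\<bar>Re z - c\<bar> = L \<or> Im z = L"
  shows "Re (barrier c L z) \<ge> 1"
  using assms(4)
proof
  assume "\<bar>Re z - c\<bar> = L"
  then have 1: "(Re z - c)\<^sup>2 / L\<^sup>2 = 1" using assms(1) by (metis divide_self less_irrefl power2_abs power_not_zero)
  have "Im z / L \<le> 1" "0 \<le> Im z / L" using assms by auto
  then have "(Im z / L)\<^sup>2 \<le> 2 * (Im z / L)" 
    by (smt (verit, best) mult_left_le power2_eq_square)
  then show ?thesis unfolding Re_barrier 1 by (simp add: power_divide)
next
  assume "Im z = L"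
  then have "Re (barrier c L z) = (Re z - c)\<^sup>2 / L\<^sup>2 + 1" using assms(1) by (simp add: Re_barrier)
  then show ?thesis by simp
qed

lemma open_hbox: "open (hbox c L)"
proof -
  have "hbox c L = {z. \<bar>Re z - c\<bar> < L} \<inter> ({z. 0 < Im z} \<inter> {z. Im z < L})" by (auto simp: hbox_def)
  moreover have "open \<dots>" by (intro open_Int open_Collect_less continuous_intros)
  ultimately show ?thesis by simp
qed

lemma hbox_subset_HH: "hbox c L \<subseteq> HH" by (auto simp: hbox_def)

lemma closure_hbox_subset: "closure (hbox c L) \<subseteq> {z. \<bar>Re z - c\<bar> \<le> L \<and> 0 \<le> Im z \<and> Im z \<le> L}"
proof (rule closure_minimal)
  have "{z. \<bar>Re z - c\<bar> \<le> L \<and> 0 \<le> Im z \<and> Im z \<le> L} = {z. \<bar>Re z - c\<bar> \<le> L} \<inter> ({z. 0 \<le> Im z} \<inter> {z. Im z \<le> L})" by auto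
  moreover have "closed \<dots>" by (intro closed_Int closed_Collect_le continuous_intros)
  ultimately show "closed {z. \<bar>Re z - c\<bar> \<le> L \<and> 0 \<le> Im z \<and> Im z \<le> L}" by simp
qed (auto simp: hbox_def)

lemma bounded_hbox: "bounded (hbox c L)"
proof (rule bounded_subset)
  show "bounded (cbox (Complex (c - L) 0) (Complex (c + L) L))" by simp
  show "hbox c L \<subseteq> cbox (Complex (c - L) 0) (Complex (c + L) L)"
    by (auto simp: hbox_def in_cbox_complex_iff)
qed

lemma frontier_hboxD:
  assumes "b \<in> frontier (hbox c L)"
  shows "\<bar>Re b - c\<bar> \<le> L" "0 \<le> Im b" "Im b \<le> L" "\<bar>Re b - c\<bar> = L \<or> Im b = L \<or> Im b = 0"
proof -
  have "b \<in> closure (hbox c L)" "b \<notin> hbox c L"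
    using assms by (auto simp: frontier_def interior_open open_hbox)
  then show "\<bar>Re b - c\<bar> \<le> L" "0 \<le> Im b" "Im b \<le> L" "\<bar>Re b - c\<bar> = L \<or> Im b = L \<or> Im b = 0"
    using closure_hbox_subset[of c L] by (auto simp: hbox_def)
qed

text \<open>The poles of \<open>\<Lambda>\<close> absorb the exceptional points in the maximum principle.\<close>

lemma log_barrier_exists:
  fixes e :: "nat \<Rightarrow> real"
  assumes e: "\<And>n. \<bar>e n - c\<bar> \<le> L" and L: "L > 0"
  shows "\<exists>\<Lambda>. \<Lambda> holomorphic_on hbox c L \<and> (\<forall>z\<in>hbox c L. Re (\<Lambda> z) \<ge> 0 \<and>
    (\<forall>n. Re (\<Lambda> z) \<ge> (1/2)^n * ln (4 * L / cmod (z - of_real (e n)))))"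
proof -
  \<comment> \<open>The factor \<open>- \<i>\<close> turns the box into the right half plane, where
    \<open>Ln\<close> is holomorphic. In the box the distance to \<open>e n\<close> is below
    \<open>4 * L\<close>, so all terms have nonnegative real part.\<close>
  define lam where "lam n z = - Ln (- \<i> * (z - of_real (e n)) / of_real (4 * L))" for n z
  have hol: "lam n holomorphic_on hbox c L" for n
    unfolding lam_def using L
    by (intro holomorphic_intros) (auto simp: complex_nonpos_Reals_iff hbox_def Re_divide_of_real divide_le_0_iff)
  have ne: "z - of_real (e n) \<noteq> 0" if "z \<in> hbox c L" for z n
    using that by (auto simp: hbox_def complex_eq_iff)
  have Relam: "Re (lam n z) = ln (4 * L / cmod (z - of_real (e n)))" if "z \<in> hbox c L" for n z
    using ne[OF that, of n] L by (simp add: lam_def norm_mult norm_divide ln_div ln_mult)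
  have small: "cmod (z - of_real (e n)) \<le> 4 * L" if "z \<in> hbox c L" for n z
  proof -
    have "cmod (z - of_real (e n)) \<le> \<bar>Re z - e n\<bar> + \<bar>Im z\<bar>"
      using cmod_le[of "z - of_real (e n)"] by simp
    then show ?thesis using that e[of n] L by (auto simp: hbox_def)
  qed
  have nonneg: "Re (lam n z) \<ge> 0" if "z \<in> hbox c L" for n z
    unfolding Relam[OF that] using small[OF that, of n] ne[OF that, of n] L
    by (intro ln_ge_zero) (auto simp: field_simps)
  have bnd: "norm (lam n z) \<le> ln (4 * L / Im z) + pi" if "z \<in> hbox c L" for n z
  proof -
    have "Im z \<le> cmod (z - of_real (e n))" using abs_Im_le_cmod[of "z - of_real (e n)"] by simp
    then have "Re (lam n z) \<le> ln (4 * L / Im z)"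
      unfolding Relam[OF that] using that L ne[OF that, of n]
      by (auto simp: hbox_def intro!: divide_left_mono mult_pos_pos divide_pos_pos)
    moreover have "\<bar>Im (lam n z)\<bar> \<le> pi"
    proof -
      define w where "w = - \<i> * (z - of_real (e n)) / of_real (4 * L)"
      have "w \<noteq> 0" using ne[OF that, of n] L by (simp add: w_def)
      then have "- pi < Im (Ln w)" "Im (Ln w) \<le> pi" by (rule mpi_less_Im_Ln, rule Im_Ln_le_pi)
      moreover have "Im (lam n z) = - Im (Ln w)" by (simp add: lam_def w_def)
      ultimately show ?thesis by linarith
    qed
    ultimately show ?thesis using cmod_le[of "lam n z"] nonneg[OF that, of n] by linarith
  qed
  define \<Lambda> where "\<Lambda> z = (\<Sum>n. (1/2)^n * lam n z)" for z
  have summ: "summable (\<lambda>n. (1/2)^n * lam n z)" if "z \<in> hbox c L" for z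
  proof (rule summable_comparison_test')
    show "summable (\<lambda>n. (1/2)^n * (ln (4 * L / Im z) + pi))" by (intro summable_mult2) simp
    show "norm ((1/2)^n * lam n z) \<le> (1/2)^n * (ln (4 * L / Im z) + pi)" for n
      using bnd[OF that, of n] by (auto simp: norm_mult norm_power intro!: mult_left_mono)
  qed
  have "\<Lambda> holomorphic_on hbox c L"
  proof (rule holomorphic_uniform_sequence[OF open_hbox])
    show "(\<lambda>z. \<Sum>n<N. (1/2)^n * lam n z) holomorphic_on hbox c L" for N
      by (intro holomorphic_intros hol)
    fix x assume x: "x \<in> hbox c L"
    then have "x \<in> hbox c L \<inter> {z. Im z > Im x / 2}" by (auto simp: hbox_def)
    moreover have "open (hbox c L \<inter> {z. Im z > Im x / 2})"
      by (intro open_Int open_hbox open_Collect_less continuous_intros)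
    ultimately obtain d where d: "d > 0" "cball x d \<subseteq> hbox c L \<inter> {z. Im z > Im x / 2}"
      using open_contains_cball by blast
    have "uniform_limit (cball x d) (\<lambda>N z. \<Sum>n<N. (1/2)^n * lam n z) \<Lambda> sequentially"
      unfolding \<Lambda>_def
    proof (rule Weierstrass_m_test)
      show "summable (\<lambda>n. (1/2)^n * (ln (4 * L / (Im x / 2)) + pi))" by (intro summable_mult2) simp
      fix n z assume "z \<in> cball x d"
      then have z: "z \<in> hbox c L" "Im z > Im x / 2" using d by auto
      have "Im x > 0" using x by (simp add: hbox_def)
      have "ln (4 * L / Im z) \<le> ln (4 * L / (Im x / 2))"
        using z L \<open>Im x > 0\<close> by (subst ln_le_cancel_iff) (auto simp: hbox_def field_simps)
      then show "norm ((1/2)^n * lam n z) \<le> (1/2)^n * (ln (4 * L / (Im x / 2)) + pi)"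
        using bnd[OF z(1), of n] by (auto simp: norm_mult norm_power intro!: mult_left_mono)
    qed
    then show "\<exists>d>0. cball x d \<subseteq> hbox c L \<and>
        uniform_limit (cball x d) (\<lambda>N z. \<Sum>n<N. (1/2)^n * lam n z) \<Lambda> sequentially"
      using d by blast
  qed
  moreover have "Re (\<Lambda> z) \<ge> (1/2)^n * ln (4 * L / cmod (z - of_real (e n)))" if z: "z \<in> hbox c L" for n z
  proof -
    have *: "summable (\<lambda>n. Re ((1/2)^n * lam n z))" using summ[OF z] by (rule summable_Re)
    have Re: "Re ((1/2)^n * lam n z) = (1/2)^n * Re (lam n z)" for n
    proof -
      have "((1/2)^n * lam n z) = of_real ((1/2)^n) * lam n z" by simp
      then show ?thesis by (simp only: times_complex.sel Re_complex_of_real Im_complex_of_real)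
    qed
    have "(\<Sum>k\<in>{n}. Re ((1/2)^k * lam k z)) \<le> (\<Sum>k. Re ((1/2)^k * lam k z))"
      by (rule sum_le_suminf[OF *]) (auto simp: Re intro!: mult_nonneg_nonneg nonneg[OF z])
    also have "\<dots> = Re (\<Lambda> z)" unfolding \<Lambda>_def using summ[OF z] by (simp add: Re_suminf)
    finally show ?thesis by (simp add: Re Relam[OF z])
  qed
  moreover have "Re (\<Lambda> z) \<ge> 0" if z: "z \<in> hbox c L" for z
  proof -
    have "0 \<le> (1/2)^0 * ln (4 * L / cmod (z - of_real (e 0)))" using nonneg[OF z, of 0] Relam[OF z, of 0] by simp
    then show ?thesis using calculation(2)[OF z, of 0] by linarith
  qed
  ultimately show ?thesis by (intro exI[of _ \<Lambda>]) blast
qed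

text \<open>The function \<open>G\<close> inherits nonpositive upper limits from the barrier on the
  three sides off the axis and from \<open>bd\<close> at real points outside \<open>E\<close>. At
  the exceptional points only \<open>Re (G x) \<le> M\<close> is known, and subtracting a small
  multiple \<eta> of \<Lambda>, which blows up there, repairs this. Letting \<eta> tend to 0 removes
  \<Lambda> again.\<close>

lemma Re_le_barrier_countable:
  assumes L: "L > 0" and H: "H holomorphic_on hbox c L" and M: "M \<ge> 0" "\<And>z. z \<in> hbox c L \<Longrightarrow> Re (H z) \<le> M"
    and E: "countable E"
    and bd: "\<And>t \<eta>. \<bar>t - c\<bar> < L \<Longrightarrow> t \<notin> E \<Longrightarrow> \<eta> > 0 \<Longrightarrow> \<forall>\<^sub>F z in at (of_real t) within HH. Re (H z) < \<eta>"
    and z: "z \<in> hbox c L"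
  shows "Re (H z) \<le> M * Re (barrier c L z)"
proof -
  \<comment> \<open>Inserting \<open>c\<close> makes the set nonempty, so that it is the range of a
    sequence.\<close>
  define E' where "E' = insert c (E \<inter> {c-L..c+L})"
  have E': "countable E'" "E' \<noteq> {}" "\<And>x. x \<in> E' \<Longrightarrow> \<bar>x - c\<bar> \<le> L"
    using E L by (auto simp: E'_def)
  define e where "e = from_nat_into E'"
  have re: "range e = E'" unfolding e_def using E' by (simp add: range_from_nat_into)
  have eL: "\<bar>e n - c\<bar> \<le> L" for n using E'(3) re by blast
  from log_barrier_exists[OF eL L] obtain \<Lambda> where \<Lambda>0: "\<Lambda> holomorphic_on hbox c L \<and> (\<forall>z\<in>hbox c L. Re (\<Lambda> z) \<ge> 0 \<and>
    (\<forall>n. Re (\<Lambda> z) \<ge> (1/2)^n * ln (4 * L / cmod (z - of_real (e n)))))" ..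
  have \<Lambda>: "\<Lambda> holomorphic_on hbox c L" "\<And>z. z \<in> hbox c L \<Longrightarrow> Re (\<Lambda> z) \<ge> 0"
    "\<And>n z. z \<in> hbox c L \<Longrightarrow> Re (\<Lambda> z) \<ge> (1/2)^n * ln (4 * L / cmod (z - of_real (e n)))"
    using \<Lambda>0 by blast+
  define G where "G z = H z - of_real M * barrier c L z" for z
  have GM: "Re (G x) \<le> M" if "x \<in> hbox c L" for x
  proof -
    have "Re (barrier c L x) \<ge> 0" using that L by (intro barrier_nonneg) (auto simp: hbox_def)
    then have "M * Re (barrier c L x) \<ge> 0" using M by simp
    then show ?thesis using M(2)[OF that] by (simp add: G_def)
  qed
  have key: "Re (G z) \<le> \<eta> * (1 + Re (\<Lambda> z))" if \<eta>: "\<eta> > 0" for \<eta>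
  proof -
    have "Re (G z - of_real \<eta> * \<Lambda> z) \<le> \<eta>"
    proof (rule Re_le_of_frontier_limsup[OF open_hbox bounded_hbox _ _ z])
      show "(\<lambda>z. G z - of_real \<eta> * \<Lambda> z) holomorphic_on hbox c L"
        unfolding G_def using L by (intro holomorphic_intros H \<Lambda>) auto
      fix b assume b: "b \<in> frontier (hbox c L)"
      note bd' = frontier_hboxD[OF b]
      have cont: "((\<lambda>z. M * Re (barrier c L z)) \<longlongrightarrow> M * Re (barrier c L b)) (at b within hbox c L)"
        using isCont_barrier[where c = c and z = b and L = L] L 
        by (intro tendsto_intros) (auto simp: continuous_within isCont_def intro: tendsto_within_subset)
      have inb: "\<forall>\<^sub>F x in at b within hbox c L. x \<in> hbox c L" by (simp add: eventually_at_filter)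
      show "\<forall>\<^sub>F x in at b within hbox c L. Re (G x - of_real \<eta> * \<Lambda> x) < \<eta>"
      proof (cases "\<exists>n. b = of_real (e n)")
        case True
        then obtain n where n: "b = of_real (e n)" by blast
        \<comment> \<open>The radius at which the \<open>n\<close>-th logarithmic pole, weighted by
          \<open>\<eta> * (1/2)^n\<close>, reaches \<open>M\<close>.\<close>
        define d where "d = 4 * L * exp (- (2^n * (M / \<eta>)))"
        have d: "d > 0" using L by (simp add: d_def)
        have "\<forall>\<^sub>F x in at b within hbox c L. dist x b < d"
          unfolding eventually_at using d by blast
        moreover have "\<forall>\<^sub>F x in at b within hbox c L. x \<noteq> b" by (simp add: eventually_at_filter)
        ultimately show ?thesis using inb
        proof eventually_elim
          fix x assume x: "dist x b < d" "x \<noteq> b" "x \<in> hbox c L"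
          have pos: "cmod (x - of_real (e n)) > 0" using x n by simp
          have "4 * L / d < 4 * L / cmod (x - of_real (e n))"
            using x(1) n pos d L by (intro divide_strict_left_mono) (auto simp: dist_norm)
          then have "ln (4 * L / d) < ln (4 * L / cmod (x - of_real (e n)))"
            using d L pos by (subst ln_less_cancel_iff) auto
          moreover have "4 * L / d = exp (2^n * (M / \<eta>))" using L by (simp add: d_def exp_minus field_simps)
          ultimately have "2^n * (M / \<eta>) < ln (4 * L / cmod (x - of_real (e n)))" by simp
          then have "(1/2)^n * (2^n * (M / \<eta>)) < (1/2)^n * ln (4 * L / cmod (x - of_real (e n)))"
            by (intro mult_strict_left_mono) auto
          then have "M / \<eta> < Re (\<Lambda> x)" using \<Lambda>(3)[OF x(3), of n] by (simp add: power_divide)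
          then have "M < \<eta> * Re (\<Lambda> x)" using \<eta> by (simp add: field_simps)
          then show "Re (G x - of_real \<eta> * \<Lambda> x) < \<eta>" using GM[OF x(3)] \<eta> by simp
        qed
      next
        case False
        have "\<forall>\<^sub>F x in at b within hbox c L. Re (G x) < \<eta>"
        proof (cases "\<bar>Re b - c\<bar> = L \<or> Im b = L")
          case True
          then have "M * Re (barrier c L b) \<ge> M * 1" using barrier_ge_1[of L b c] bd' L M by (intro mult_left_mono) auto
          then have "M * Re (barrier c L b) > M - \<eta>" using \<eta> by simp
          then have "\<forall>\<^sub>F x in at b within hbox c L. M * Re (barrier c L x) > M - \<eta>"
            by (rule order_tendstoD(1)[OF cont])
          then show ?thesis using inb
            by eventually_elim (use M(2) in \<open>force simp: G_def\<close>)
        next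
          case False
          then have im: "Im b = 0" "\<bar>Re b - c\<bar> < L" using bd' by auto
          then have b': "b = of_real (Re b)" by (simp add: complex_eq_iff)
          have "Re b \<notin> E"
          proof
            assume "Re b \<in> E"
            then have "Re b \<in> range e" unfolding re E'_def using im by auto
            then show False using b' \<open>\<not> (\<exists>n. b = of_real (e n))\<close> by auto
          qed
          from bd[OF im(2) this \<eta>] have "\<forall>\<^sub>F z in at b within HH. Re (H z) < \<eta>" using b' by simp
          then have "\<forall>\<^sub>F z in at b within hbox c L. Re (H z) < \<eta>"
            using filter_leD[OF at_le[OF hbox_subset_HH]] by blast
          then show ?thesis using inb
          proof eventually_elim
            fix x assume x: "Re (H x) < \<eta>" "x \<in> hbox c L"
            have "Re (barrier c L x) \<ge> 0" using x L by (intro barrier_nonneg) (auto simp: hbox_def)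
            then show "Re (G x) < \<eta>" using x M by (simp add: G_def) (smt (verit) mult_nonneg_nonneg)
          qed
        qed
        then show ?thesis using inb
        proof eventually_elim
          fix x assume x: "Re (G x) < \<eta>" "x \<in> hbox c L"
          then have "\<eta> * Re (\<Lambda> x) \<ge> 0" using \<Lambda>(2) \<eta> by simp
          then show "Re (G x - of_real \<eta> * \<Lambda> x) < \<eta>" using x by simp
        qed
      qed
    qed
    then show ?thesis by (simp add: algebra_simps)
  qed
  have "Re (G z) \<le> 0"
  proof (rule ccontr)
    assume "\<not> ?thesis"
    then have p: "Re (G z) > 0" by simp
    define q where "q = 1 + Re (\<Lambda> z)"
    have q: "q > 0" using \<Lambda>(2)[OF z] by (simp add: q_def)
    then show False using key[of "Re (G z) / (2 * q)"] p by (simp add: q_def[symmetric])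
  qed
  then show ?thesis by (simp add: G_def)
qed

text \<open>By compactness \<open>Re (T z)\<close> is bounded below by some \<open>- M\<close> in
  the box. For every \<open>N\<close> the function \<open>N - T\<close> is then at most
  \<open>N + M\<close> with upper limits below any positive number on the axis, and the barrier
  gives \<open>Re (T z) \<ge> N / 2 - M\<close> at one fixed point, for all
  \<open>N\<close>.\<close>

lemma no_infinite_limit_on_interval:
  assumes T: "T holomorphic_on HH" and L: "L > 0"
    and lim: "\<And>t. \<bar>t - c\<bar> \<le> L \<Longrightarrow> filterlim (\<lambda>z. Re (T z)) at_top (at (of_real t) within HH)"
  shows False
proof -
  have "\<exists>M\<ge>0. \<forall>z\<in>hbox c L. Re (T z) \<ge> - M"
  proof (rule ccontr)
    assume *: "\<not> ?thesis"
    have "\<exists>z\<in>hbox c L. Re (T z) < - real n" for n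
      using * by (metis not_le of_nat_0_le_iff)
    then obtain w where w: "\<And>n. w n \<in> hbox c L" "\<And>n. Re (T (w n)) < - real n" by metis
    have "compact (closure (hbox c L))" using bounded_hbox by simp
    moreover have "\<forall>n. w n \<in> closure (hbox c L)" using w closure_subset by blast
    ultimately obtain b r where b: "b \<in> closure (hbox c L)" "strict_mono r" "(w \<circ> r) \<longlonglongrightarrow> b"
      unfolding compact_def by metis
    have b': "\<bar>Re b - c\<bar> \<le> L" "0 \<le> Im b" "Im b \<le> L" using b(1) closure_hbox_subset[of c L] by auto
    have lowlim: "\<forall>\<^sub>F n in sequentially. Re (T (w (r n))) < K" for K
    proof -
      obtain N where "- real N < K" using reals_Archimedean2[of "- K"] by (auto simp: minus_less_iff)
      have "\<forall>\<^sub>F n in sequentially. n \<ge> N" by (rule eventually_ge_at_top)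
      then show ?thesis
      proof eventually_elim
        fix n assume "n \<ge> N"
        then have "real N \<le> real (r n)" using seq_suble[OF b(2), of n] by linarith
        then show "Re (T (w (r n))) < K" using w(2)[of "r n"] \<open>- real N < K\<close> by linarith
      qed
    qed
    have "\<exists>K. \<forall>\<^sub>F n in sequentially. Re (T (w (r n))) > K"
    proof (cases "Im b > 0")
      case True
      have "open HH" by (simp add: open_halfspace_Im_gt)
      then have "isCont T b" using T True
        by (metis (no_types, lifting) continuous_on_eq_continuous_at holomorphic_on_imp_continuous_on mem_Collect_eq)
      then have "(\<lambda>n. T ((w \<circ> r) n)) \<longlonglongrightarrow> T b" using b(3) isCont_tendsto_compose by blast
      then have "(\<lambda>n. Re (T ((w \<circ> r) n))) \<longlonglongrightarrow> Re (T b)" by (rule tendsto_Re)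
      then show ?thesis using order_tendstoD(1)[of _ "Re (T b)" sequentially "Re (T b) - 1"] by auto
    next
      case False
      then have bb: "b = of_real (Re b)" using b' by (simp add: complex_eq_iff)
      have "filterlim (\<lambda>z. Re (T z)) at_top (at b within HH)" using lim[OF b'(1)] bb by simp
      moreover have "filterlim (w \<circ> r) (at b within HH) sequentially"
        unfolding filterlim_at using b(3) w(1) hbox_subset_HH[of c L] False
        by (intro conjI always_eventually) (auto simp: hbox_def)
      ultimately have "filterlim (\<lambda>n. Re (T ((w \<circ> r) n))) at_top sequentially"
        by (rule filterlim_compose)
      then show ?thesis by (auto simp: filterlim_at_top_dense)
    qed
    then obtain K where "\<forall>\<^sub>F n in sequentially. Re (T (w (r n))) > K" by blast
    then have "\<forall>\<^sub>F n in sequentially. False" using lowlim[of K] by eventually_elim simp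
    then show False by simp
  qed
  then obtain M where M: "M \<ge> 0" "\<And>z. z \<in> hbox c L \<Longrightarrow> Re (T z) \<ge> - M" by blast
  \<comment> \<open>Here the barrier equals \<open>0.19\<close>; what matters is a value bounded
    away from 1.\<close>
  define z where "z = Complex c (L / 10)"
  have z: "z \<in> hbox c L" using L by (simp add: hbox_def z_def)
  have Bz: "Re (barrier c L z) \<le> 1/2" using L by (simp add: Re_barrier z_def power_divide)
  have bound: "Re (T z) \<ge> N / 2 - M" if N: "N \<ge> 0" for N :: real
  proof -
    have "Re (of_real N - T z) \<le> (N + M) * Re (barrier c L z)"
    proof (rule Re_le_barrier_countable[where E = "{}", OF L _ _ _ _ _ z])
      show "(\<lambda>z. of_real N - T z) holomorphic_on hbox c L"
        using T hbox_subset_HH holomorphic_on_subset by (intro holomorphic_intros) blast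
      show "Re (of_real N - T x) \<le> N + M" if "x \<in> hbox c L" for x using M(2)[OF that] by simp
      fix t \<eta> :: real assume t: "\<bar>t - c\<bar> < L" and "\<eta> > 0"
      have "\<forall>\<^sub>F z in at (of_real t) within HH. Re (T z) > N - \<eta>"
        using lim[of t] t by (auto simp: filterlim_at_top_dense)
      then show "\<forall>\<^sub>F z in at (of_real t) within HH. Re (of_real N - T z) < \<eta>"
        by eventually_elim auto
    qed (use N M in auto)
    also have "\<dots> \<le> (N + M) * (1/2)" using Bz N M by (intro mult_left_mono) auto
    finally show ?thesis using M by (simp add: field_simps)
  qed
  have "(2 * (\<bar>Re (T z)\<bar> + M + 1)) / 2 - M \<le> Re (T z)" by (rule bound) (use M in auto)
  moreover have "(2 * (\<bar>Re (T z)\<bar> + M + 1)) / 2 = \<bar>Re (T z)\<bar> + M + 1" by simp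
  ultimately show False by linarith
qed

section \<open>Gradient bounds for holomorphic functions with controlled real part\<close>

text \<open>The gradient form of Harnack's inequality. Composing \<open>Y\<close> with the Moebius
  map of the right half plane to the disc that sends \<open>Y z\<close> to 0 gives a self-map
  \<open>W\<close> of the disc fixing 0, and the Schwarz lemma bounds its derivative. The bound is
  proportional to the value \<open>Re (Y z)\<close>, which is what makes it useful for a distance to
  the boundary.\<close>

lemma norm_deriv_le_of_Re_pos:
  assumes Y: "Y holomorphic_on ball z r" and r: "r > 0" and pos: "\<And>x. x \<in> ball z r \<Longrightarrow> Re (Y x) > 0"
  shows "norm (deriv Y z) \<le> 2 * Re (Y z) / r"
proof -
  define W where "W \<zeta> = (Y (z + of_real r * \<zeta>) - Y z) / (Y (z + of_real r * \<zeta>) + cnj (Y z))" for \<zeta>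
  have zin: "z \<in> ball z r" using r by simp
  have inb: "z + of_real r * \<zeta> \<in> ball z r" if "norm \<zeta> < 1" for \<zeta>
    using that r by (simp add: dist_norm norm_mult)
  have den: "Y x + cnj (Y z) \<noteq> 0" if "x \<in> ball z r" for x
    using pos[OF that] pos[OF zin] by (auto simp: complex_eq_iff)
  have hol1: "(\<lambda>\<zeta>. Y (z + of_real r * \<zeta>)) holomorphic_on ball 0 1"
  proof -
    have "(Y \<circ> (\<lambda>\<zeta>. z + of_real r * \<zeta>)) holomorphic_on ball 0 1"
      using inb by (intro holomorphic_on_compose_gen[OF _ Y] holomorphic_intros) auto
    then show ?thesis by (simp add: o_def)
  qed
  have hol: "W holomorphic_on ball 0 1"
    unfolding W_def using den inb by (intro holomorphic_intros hol1) auto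
  have W0: "W 0 = 0" by (simp add: W_def)
  have W1: "norm (W \<zeta>) < 1" if "norm \<zeta> < 1" for \<zeta>
  proof -
    let ?p = "Y (z + of_real r * \<zeta>)" let ?q = "Y z"
    have p: "Re ?p > 0" "Re ?q > 0" using pos inb[OF that] zin by auto
    have "(norm (?p - ?q))\<^sup>2 < (norm (?p + cnj ?q))\<^sup>2"
    proof -
      have "(norm (?p + cnj ?q))\<^sup>2 - (norm (?p - ?q))\<^sup>2 = 4 * (Re ?p * Re ?q)"
        by (simp add: cmod_power2) (simp add: power2_eq_square algebra_simps)
      then show ?thesis using mult_pos_pos[OF p] by linarith
    qed
    then have "norm (?p - ?q) < norm (?p + cnj ?q)" by (rule power2_less_imp_less) simp
    then show ?thesis using den[OF inb[OF that]] by (simp add: W_def norm_divide)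
  qed
  have "norm (deriv W 0) \<le> 1" using Schwarz_Lemma(2)[OF hol W0 W1] by (metis norm_zero zero_less_one)
  moreover have "(W has_field_derivative (of_real r * deriv Y z / (Y z + cnj (Y z)))) (at 0)"
  proof -
    have "(Y has_field_derivative deriv Y z) (at (z + of_real r * 0))"
      using Y zin holomorphic_derivI[OF Y open_ball] by simp
    then have d: "((\<lambda>\<zeta>. Y (z + of_real r * \<zeta>)) has_field_derivative (deriv Y z * of_real r)) (at 0)"
      by (rule DERIV_chain2) (auto intro!: derivative_eq_intros)
    have "(W has_field_derivative
        ((deriv Y z * of_real r - 0) * (Y (z + of_real r * 0) + cnj (Y z)) - (Y (z + of_real r * 0) - Y z) * (deriv Y z * of_real r + 0))
        / ((Y (z + of_real r * 0) + cnj (Y z)) * (Y (z + of_real r * 0) + cnj (Y z)))) (at 0)"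
      unfolding W_def using den[OF zin]
      by (intro DERIV_divide DERIV_diff DERIV_add DERIV_const d) simp
    then show ?thesis using den[OF zin] by (simp add: mult.commute)
  qed
  ultimately have "norm (of_real r * deriv Y z / (Y z + cnj (Y z))) \<le> 1" by (simp add: DERIV_imp_deriv)
  moreover have "Y z + cnj (Y z) = of_real (2 * Re (Y z))" by (simp add: complex_add_cnj)
  ultimately show ?thesis using r pos[OF zin] by (simp add: norm_mult norm_divide field_simps)
qed

text \<open>Adding \<open>2 * \<epsilon>\<close> makes the real part positive and at most
  \<open>3 * \<epsilon>\<close>.\<close>

lemma norm_deriv_le_of_abs_Re:
  assumes D: "D holomorphic_on ball z r" and r: "r > 0" "\<epsilon> > 0" and le: "\<And>x. x \<in> ball z r \<Longrightarrow> \<bar>Re (D x)\<bar> \<le> \<epsilon>"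
  shows "norm (deriv D z) \<le> 6 * \<epsilon> / r"
proof -
  have zin: "z \<in> ball z r" using r by simp
  have "norm (deriv (\<lambda>x. D x + of_real (2 * \<epsilon>)) z) \<le> 2 * Re (D z + of_real (2 * \<epsilon>)) / r"
  proof (rule norm_deriv_le_of_Re_pos[OF _ r(1)])
    show "(\<lambda>x. D x + of_real (2 * \<epsilon>)) holomorphic_on ball z r" by (intro holomorphic_intros D)
    show "0 < Re (D x + of_real (2 * \<epsilon>))" if "x \<in> ball z r" for x using le[OF that] r by simp
  qed
  also have "deriv (\<lambda>x. D x + of_real (2 * \<epsilon>)) z = deriv D z"
    using holomorphic_derivI[OF D open_ball zin] by (intro DERIV_imp_deriv) (auto intro!: derivative_eq_intros)
  also have "2 * Re (D z + of_real (2 * \<epsilon>)) / r \<le> 6 * \<epsilon> / r"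
    using le[OF zin] r by (intro divide_right_mono) auto
  finally show ?thesis .
qed

section \<open>Crossing paths and a maximum principle above a crossing path\<close>

text \<open>The library states the crossing theorem \<open>fashoda\<close> for \<open>real^2\<close> only.\<close>

definition vec2 :: "complex \<Rightarrow> real^2" where
  "vec2 z = (\<chi> i. if i = 1 then Re z else Im z)"

lemma vec2_nth [simp]: "vec2 z $ 1 = Re z" "vec2 z $ 2 = Im z"
  by (simp_all add: vec2_def)

lemma vec2_inj: "vec2 z = vec2 w \<longleftrightarrow> z = w"
  by (metis complex_eqI vec2_nth)

lemma continuous_on_vec2: "continuous_on S vec2"
  unfolding vec2_def proof (rule continuous_on_vec_lambda)
  show "continuous_on S (\<lambda>z. if i = 1 then Re z else Im z)" for i :: 2
    by (cases "i = 1") (auto intro: continuous_intros)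
qed

lemma path_vec2: "path p \<Longrightarrow> path (vec2 \<circ> p)"
  unfolding path_def by (intro continuous_on_compose continuous_on_vec2)

lemma complex_paths_cross:
  assumes "path f" "path g"
    and "path_image f \<subseteq> {z. a \<le> Re z \<and> Re z \<le> b \<and> c \<le> Im z \<and> Im z \<le> d}"
    and "path_image g \<subseteq> {z. a \<le> Re z \<and> Re z \<le> b \<and> c \<le> Im z \<and> Im z \<le> d}"
    and "Re (pathstart f) = a" "Re (pathfinish f) = b" "Im (pathstart g) = c" "Im (pathfinish g) = d"
  shows "\<exists>z. z \<in> path_image f \<and> z \<in> path_image g"
proof -
  have "path_image (vec2 \<circ> f) \<subseteq> cbox (vec2 (Complex a c)) (vec2 (Complex b d))"
    "path_image (vec2 \<circ> g) \<subseteq> cbox (vec2 (Complex a c)) (vec2 (Complex b d))"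
    using assms(3,4) by (auto simp: mem_box_cart forall_2 path_image_compose)
  then obtain z where "z \<in> path_image (vec2 \<circ> f)" "z \<in> path_image (vec2 \<circ> g)"
    using assms by (elim fashoda[OF path_vec2[OF assms(1)] path_vec2[OF assms(2)]])
      (auto simp: pathstart_def pathfinish_def)
  then show ?thesis by (auto simp: path_image_compose vec2_inj)
qed

lemma complex_paths_interlace:
  assumes "path f" "path g"
    and "path_image f \<subseteq> {z. a \<le> Re z \<and> Re z \<le> b \<and> c \<le> Im z \<and> Im z \<le> d}"
    and "path_image g \<subseteq> {z. a \<le> Re z \<and> Re z \<le> b \<and> c \<le> Im z \<and> Im z \<le> d}"
    and "Im (pathstart f) = c" "Im (pathfinish f) = c" "Im (pathstart g) = c" "Im (pathfinish g) = c"
    and "Re (pathstart f) < Re (pathstart g)" "Re (pathstart g) < Re (pathfinish f)"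
      "Re (pathfinish f) < Re (pathfinish g)"
  shows "\<exists>z. z \<in> path_image f \<and> z \<in> path_image g"
proof -
  have "path_image (vec2 \<circ> f) \<subseteq> cbox (vec2 (Complex a c)) (vec2 (Complex b d))"
    "path_image (vec2 \<circ> g) \<subseteq> cbox (vec2 (Complex a c)) (vec2 (Complex b d))"
    using assms(3,4) by (auto simp: mem_box_cart forall_2 path_image_compose)
  then obtain z where "z \<in> path_image (vec2 \<circ> f)" "z \<in> path_image (vec2 \<circ> g)"
    using assms by (elim fashoda_interlace[OF path_vec2[OF assms(1)] path_vec2[OF assms(2)]])
      (auto simp: pathstart_def pathfinish_def)
  then show ?thesis by (auto simp: path_image_compose vec2_inj)
qed

text \<open>The component \<open>S\<close> of the box minus the path that contains \<open>z\<close>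
  cannot reach below the lowest height \<open>m\<close> of the path: a connection from such a low
  point to \<open>z\<close>, prolonged vertically to the bottom and the top of the box, would have
  to cross \<alpha>. So \<open>S\<close> stays away from the real axis, where nothing is known about
  \<open>H\<close>. Its frontier consists of points of \<alpha>, where \<epsilon> bounds the real
  part, and of points of the other three sides, where the barrier is at least 1.\<close>

lemma Re_le_below_crossing_path:
  assumes L: "L > 0" and H: "H holomorphic_on HH"
    and M: "M \<ge> 0" "\<And>x. x \<in> hbox c L \<Longrightarrow> Re (H x) \<le> M"
    and \<alpha>: "path \<alpha>" "path_image \<alpha> \<subseteq> HH" "Re (pathstart \<alpha>) \<le> c - L" "Re (pathfinish \<alpha>) \<ge> c + L"
    and \<epsilon>: "\<epsilon> \<ge> 0" "\<And>x. x \<in> path_image \<alpha> \<Longrightarrow> Re (H x) \<le> \<epsilon>"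
    and z: "z \<in> hbox c L" "\<And>w. w \<in> path_image \<alpha> \<Longrightarrow> \<bar>Re w - c\<bar> < L \<Longrightarrow> Im w < Im z"
  shows "Re (H z) \<le> \<epsilon> + M * Re (barrier c L z)"
proof -
  have cpt: "compact (path_image \<alpha>)" using \<alpha>(1) by (rule compact_path_image)
  have clo: "closed (path_image \<alpha>)" using cpt by (rule compact_imp_closed)
  obtain m where m: "m > 0" "\<And>x. x \<in> path_image \<alpha> \<Longrightarrow> m \<le> Im x"
  proof -
    have "continuous_on (path_image \<alpha>) Im" by (intro continuous_intros)
    from continuous_attains_inf[OF cpt _ this] obtain x where "x \<in> path_image \<alpha>" "\<And>y. y \<in> path_image \<alpha> \<Longrightarrow> Im x \<le> Im y"
      by auto
    then show ?thesis using that[of "Im x"] \<alpha>(2) by auto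
  qed
  define U where "U = hbox c L - path_image \<alpha>"
  have opU: "open U" unfolding U_def by (intro open_Diff open_hbox clo)
  have z\<alpha>: "z \<notin> path_image \<alpha>" using z by (force simp: hbox_def)
  define S where "S = connected_component_set U z"
  have zU: "z \<in> U" using z z\<alpha> by (simp add: U_def)
  have opS: "open S" unfolding S_def by (intro open_connected_component opU)
  have SU: "S \<subseteq> U" unfolding S_def by (rule connected_component_subset)
  have high: "Im w \<ge> m" if w: "w \<in> S" for w
  proof (rule ccontr)
    assume low: "\<not> Im w \<ge> m"
    have wU: "w \<in> U" using w SU by blast
    have "path_component U w z"
      using w opU unfolding S_def by (simp add: open_path_connected_component connected_component_sym)
    then obtain q where q: "path q" "path_image q \<subseteq> U" "pathstart q = w" "pathfinish q = z"
      by (auto simp: path_component_def)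
    \<comment> \<open>The lower prolongation stays below height \<open>m\<close> and the upper one
      starts at \<open>z\<close>, above \<alpha>; \<open>q\<close> avoids \<alpha> by its choice. So
      \<beta> crosses the box without meeting \<alpha>.\<close>
    define \<beta> where "\<beta> = (linepath (of_real (Re w)) w +++ q) +++ linepath z (Complex (Re z) L)"
    have \<beta>: "path \<beta>" "pathstart \<beta> = of_real (Re w)" "pathfinish \<beta> = Complex (Re z) L"
      using q by (auto simp: \<beta>_def)
    have wb: "\<bar>Re w - c\<bar> < L" "0 < Im w" "Im w < L" using wU by (auto simp: U_def hbox_def)
    have zb: "\<bar>Re z - c\<bar> < L" "0 < Im z" "Im z < L" using z by (auto simp: hbox_def)
    have seg1: "Re x = Re w \<and> 0 \<le> Im x \<and> Im x \<le> Im w" if x: "x \<in> closed_segment (of_real (Re w)) w" for x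
    proof -
      obtain u where u: "0 \<le> u" "u \<le> 1" "x = (1 - u) *\<^sub>R of_real (Re w) + u *\<^sub>R w"
        using x[unfolded in_segment] by blast
      have "Re x = (1 - u) * Re w + u * Re w" "Im x = u * Im w" by (simp_all add: u(3))
      moreover have "u * Im w \<le> Im w" "u * Im w \<ge> 0" using u wb by (auto intro: mult_left_le_one_le)
      ultimately show ?thesis by (simp add: algebra_simps)
    qed
    have seg2: "Re x = Re z \<and> Im z \<le> Im x \<and> Im x \<le> L" if x: "x \<in> closed_segment z (Complex (Re z) L)" for x
    proof -
      obtain u where u: "0 \<le> u" "u \<le> 1" "x = (1 - u) *\<^sub>R z + u *\<^sub>R Complex (Re z) L"
        using x[unfolded in_segment] by blast
      have "u * Im z \<le> u * L" "(1 - u) * Im z \<le> (1 - u) * L" using u zb by (auto intro!: mult_left_mono)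
      moreover have "Re x = (1 - u) * Re z + u * Re z" "Im x = (1 - u) * Im z + u * L" by (simp_all add: u(3))
      ultimately show ?thesis by (auto simp: algebra_simps)
    qed
    have \<beta>im: "path_image \<beta> \<subseteq> closed_segment (of_real (Re w)) w \<union> path_image q \<union> closed_segment z (Complex (Re z) L)"
      unfolding \<beta>_def using path_image_join_subset[of "linepath (of_real (Re w)) w +++ q" "linepath z (Complex (Re z) L)"]
        path_image_join_subset[of "linepath (of_real (Re w)) w" q] by (auto simp: subset_eq)
    \<comment> \<open>The path \<alpha> may leave the box, so it is clamped to the closed box.
      Points with real part strictly inside the strip are not moved, because \<alpha> runs there
      between the heights \<open>m\<close> and \<open>Im z\<close>.\<close>
    define K where "K x = Complex (max (c - L) (min (c + L) (Re x))) (max 0 (min L (Im x)))" for x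
    have contK: "continuous_on T K" for T
      unfolding K_def Complex_eq by (intro continuous_intros)
    have pK: "path (K \<circ> \<alpha>)" using \<alpha>(1) unfolding path_def by (intro continuous_on_compose contK)
    have Kin: "K x \<in> {x. c - L \<le> Re x \<and> Re x \<le> c + L \<and> 0 \<le> Im x \<and> Im x \<le> L}" for x
      using L by (auto simp: K_def)
    have bbox: "\<bar>Re x - c\<bar> < L \<and> 0 \<le> Im x \<and> Im x \<le> L" if "x \<in> path_image \<beta>" for x
    proof -
      have "x \<in> closed_segment (of_real (Re w)) w \<or> x \<in> path_image q \<or> x \<in> closed_segment z (Complex (Re z) L)"
        using that \<beta>im by blast
      then show ?thesis using seg1[of x] seg2[of x] q(2) wb zb by (auto simp: U_def hbox_def)
    qed
    have "\<exists>x. x \<in> path_image (K \<circ> \<alpha>) \<and> x \<in> path_image \<beta>"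
    proof (rule complex_paths_cross[of _ _ "c - L" "c + L" 0 L])
      show "path_image (K \<circ> \<alpha>) \<subseteq> {x. c - L \<le> Re x \<and> Re x \<le> c + L \<and> 0 \<le> Im x \<and> Im x \<le> L}"
        unfolding path_image_compose using Kin by blast
      show "path_image \<beta> \<subseteq> {x. c - L \<le> Re x \<and> Re x \<le> c + L \<and> 0 \<le> Im x \<and> Im x \<le> L}"
        using bbox by fastforce
      show "Re (pathstart (K \<circ> \<alpha>)) = c - L" using \<alpha>(3) L by (simp add: pathstart_def K_def)
      show "Re (pathfinish (K \<circ> \<alpha>)) = c + L" using \<alpha>(4) L by (simp add: pathfinish_def K_def)
    qed (use pK \<beta> in auto)
    then obtain x y where xy: "y \<in> path_image \<alpha>" "x = K y" "x \<in> path_image \<beta>"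
      unfolding path_image_compose by blast
    have xb: "\<bar>Re x - c\<bar> < L" using bbox[OF xy(3)] by simp
    then have Ry: "Re y = Re x" "\<bar>Re y - c\<bar> < L" using xy(2) by (auto simp: K_def max_def min_def split: if_splits)
    then have "Im y < Im z" "m \<le> Im y" using z(2) xy(1) m(2) by auto
    then have "x = y" using xy(2) Ry zb m(1) by (auto simp: K_def complex_eq_iff)
    have "x \<in> closed_segment (of_real (Re w)) w \<or> x \<in> path_image q \<or> x \<in> closed_segment z (Complex (Re z) L)"
      using xy(3) \<beta>im by blast
    then show False
    proof (elim disjE)
      assume "x \<in> closed_segment (of_real (Re w)) w"
      then show False using seg1[of x] low \<open>m \<le> Im y\<close> \<open>x = y\<close> by auto
    next
      assume "x \<in> path_image q"
      then show False using q(2) xy(1) \<open>x = y\<close> by (auto simp: U_def)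
    next
      assume "x \<in> closed_segment z (Complex (Re z) L)"
      then show False using seg2[of x] \<open>Im y < Im z\<close> \<open>x = y\<close> by auto
    qed
  qed
  have clS: "closure S \<subseteq> {x. \<bar>Re x - c\<bar> \<le> L \<and> m \<le> Im x \<and> Im x \<le> L}"
  proof -
    have "closure S \<subseteq> {x. m \<le> Im x}"
      using high by (intro closure_minimal closed_halfspace_Im_ge) auto
    moreover have "closure S \<subseteq> closure (hbox c L)" using SU by (intro closure_mono) (auto simp: U_def)
    ultimately show ?thesis using closure_hbox_subset[of c L] by blast
  qed
  define G where "G x = H x - of_real \<epsilon> - of_real M * barrier c L x" for x
  have opHH: "open HH" by (simp add: open_halfspace_Im_gt)
  have holG: "G holomorphic_on HH" unfolding G_def using L by (intro holomorphic_intros H) auto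
  then have contG: "continuous_on HH G" by (rule holomorphic_on_imp_continuous_on)
  have "Re (G z) \<le> 0"
  proof (rule maximum_real_frontier[of G S _ z])
    have "S \<subseteq> HH" using SU hbox_subset_HH by (auto simp: U_def)
    then show "G holomorphic_on interior S"
      using holG holomorphic_on_subset interior_subset by (metis subset_trans)
    show "continuous_on (closure S) G" using clS m(1) by (intro continuous_on_subset[OF contG]) fastforce
    show "bounded S" using bounded_subset[OF bounded_hbox[of c L]] SU by (auto simp: U_def)
    show "z \<in> S" using zU by (simp add: S_def)
    fix b assume b: "b \<in> frontier S"
    then have bcl: "b \<in> closure S" "b \<notin> S" using opS by (auto simp: frontier_def interior_open)
    have bb: "\<bar>Re b - c\<bar> \<le> L" "m \<le> Im b" "Im b \<le> L" using clS bcl by auto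
    have nonneg: "M * Re (barrier c L b) \<ge> 0" using bb m L M by (intro mult_nonneg_nonneg barrier_nonneg) auto
    show "Re (G b) \<le> 0"
    proof (cases "b \<in> path_image \<alpha>")
      case True
      then show ?thesis using \<epsilon>(2)[of b] nonneg by (simp add: G_def)
    next
      case False
      \<comment> \<open>Otherwise the component of \<open>b\<close> in \<open>U\<close> would be an
        open neighbourhood of \<open>b\<close> meeting \<open>S\<close>, hence would be
        \<open>S\<close> itself.\<close>
      have "b \<notin> hbox c L"
      proof
        assume "b \<in> hbox c L"
        then have bU: "b \<in> U" using False by (simp add: U_def)
        then have "connected_component_set U b \<inter> S \<noteq> {}"
          using bcl(1) open_connected_component[OF opU, of b]
          by (metis closure_iff_nhds_not_empty connected_component_refl_eq inf_commute mem_Collect_eq order_refl)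
        then have "connected_component_set U b = S"
          unfolding S_def by (metis connected_component_disjoint connected_component_eq disjoint_iff)
        then show False using bcl(2) bU by (metis connected_component_refl_eq mem_Collect_eq)
      qed
      then have edge: "\<bar>Re b - c\<bar> = L \<or> Im b = L" using bb m(1) by (auto simp: hbox_def)
      have "M * Re (barrier c L b) \<ge> M * 1" using bb m L M edge by (intro mult_left_mono barrier_ge_1) auto
      moreover have "Re (H b) \<le> M"
      proof -
        have "b \<in> closure (hbox c L)" using bcl(1) closure_mono[of S "hbox c L"] SU by (auto simp: U_def)
        then have "b islimpt hbox c L" using \<open>b \<notin> hbox c L\<close> by (simp add: closure_def)
        then have ntriv: "at b within hbox c L \<noteq> bot" by (simp add: trivial_limit_within)
        have "isCont H b" using holomorphic_on_imp_differentiable_at[OF H opHH, of b] bb m(1)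
          by (intro field_differentiable_imp_continuous_at) simp
        then have "((\<lambda>x. Re (H x)) \<longlongrightarrow> Re (H b)) (at b within hbox c L)"
          by (intro tendsto_Re) (auto simp: isCont_def intro: tendsto_within_subset)
        moreover have "\<forall>\<^sub>F x in at b within hbox c L. Re (H x) \<le> M"
          using M(2) by (simp add: eventually_at_filter)
        ultimately show ?thesis using ntriv by (intro tendsto_upperbound)
      qed
      ultimately show ?thesis using \<epsilon>(1) by (simp add: G_def)
    qed
  qed
  then show ?thesis by (simp add: G_def)
qed

lemma at_within_HH_nontrivial [simp]: "at (of_real t) within HH \<noteq> bot"
proof -
  have "of_real t \<in> closure HH"
    unfolding closure_approachable
  proof (intro allI impI)
    fix e :: real assume "e > 0"
    then show "\<exists>y\<in>HH. dist y (of_real t) < e"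
      by (intro bexI[of _ "Complex t (e / 2)"]) (auto simp: dist_norm cmod_def)
  qed
  then show ?thesis by (simp add: trivial_limit_within islimpt_in_closure)
qed

section \<open>The lift to the upper half plane\<close>

lemma norm_exp_i: "cmod (exp (\<i> * \<xi>)) = exp (- Im \<xi>)"
  by (simp add: norm_exp_eq_Re)

text \<open>The heights \<phi> and \<psi> are left out: the boundary behaviour depends only on
  injectivity and on the coordinates being real parts of holomorphic functions. Keeping
  \<open>U\<close> and \<open>V\<close> turns every estimate for harmonic functions into one for
  holomorphic functions.\<close>

locale harmonic_jordan_map =
  fixes f U V :: "complex \<Rightarrow> complex" and \<Omega> :: "complex set" and g :: "real \<Rightarrow> complex"
  assumes loop: "simple_path g" "pathfinish g = pathstart g"
    and dom: "open \<Omega>" "connected \<Omega>" "frontier \<Omega> = path_image g" "bounded \<Omega>"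
    and hol: "U holomorphic_on ball 0 1" "V holomorphic_on ball 0 1"
    and f_eq: "\<And>w. w \<in> ball 0 1 \<Longrightarrow> f w = Complex (Re (U w)) (Re (V w))"
    and inj: "inj_on f (ball 0 1)" and img: "f ` ball 0 1 = \<Omega>"
begin

definition ft :: "complex \<Rightarrow> complex" where "ft \<xi> = f (exp (\<i> * \<xi>))"
definition Ut :: "complex \<Rightarrow> complex" where "Ut \<xi> = U (exp (\<i> * \<xi>))"
definition Vt :: "complex \<Rightarrow> complex" where "Vt \<xi> = V (exp (\<i> * \<xi>))"

lemma exp_in_ball: "Im \<xi> > 0 \<Longrightarrow> exp (\<i> * \<xi>) \<in> ball 0 1"
  by (simp add: norm_exp_i)

lemma hol_t: "Ut holomorphic_on HH" "Vt holomorphic_on HH"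
proof -
  have "(U \<circ> (\<lambda>\<xi>. exp (\<i> * \<xi>))) holomorphic_on HH" "(V \<circ> (\<lambda>\<xi>. exp (\<i> * \<xi>))) holomorphic_on HH"
    using exp_in_ball by (auto intro!: holomorphic_on_compose_gen[OF _ hol(1)] holomorphic_on_compose_gen[OF _ hol(2)] holomorphic_intros)
  then show "Ut holomorphic_on HH" "Vt holomorphic_on HH" by (simp_all add: Ut_def[abs_def] Vt_def[abs_def] o_def)
qed

lemma ft_eq: "Im \<xi> > 0 \<Longrightarrow> ft \<xi> = Complex (Re (Ut \<xi>)) (Re (Vt \<xi>))"
  unfolding ft_def Ut_def Vt_def by (rule f_eq[OF exp_in_ball])

lemma ft_in: "Im \<xi> > 0 \<Longrightarrow> ft \<xi> \<in> \<Omega>"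
  unfolding ft_def using exp_in_ball img by blast

lemma cont_f: "continuous_on (ball 0 1) f"
proof -
  have "continuous_on (ball 0 1) (\<lambda>w. Complex (Re (U w)) (Re (V w)))"
    unfolding Complex_eq by (intro continuous_intros holomorphic_on_imp_continuous_on hol)
  then show ?thesis by (subst continuous_on_cong[OF refl f_eq]) auto
qed

lemma isCont_ft:
  assumes "Im \<xi> > 0" shows "isCont ft \<xi>"
proof -
  have "isCont f (exp (\<i> * \<xi>))"
    using cont_f exp_in_ball[OF assms] by (meson continuous_on_eq_continuous_at open_ball)
  moreover have "isCont (\<lambda>\<xi>. exp (\<i> * \<xi>)) \<xi>" by (intro continuous_intros)
  ultimately have "isCont (\<lambda>\<xi>. f (exp (\<i> * \<xi>))) \<xi>" by (rule isCont_o2[rotated])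
  then show ?thesis by (simp only: ft_def[abs_def])
qed

lemma \<Omega>_disjoint_frontier: "\<Omega> \<inter> frontier \<Omega> = {}"
  using dom by (metis frontier_disjoint_eq inf_commute)

lemma ft_bounded: "\<exists>M>0. \<forall>\<xi>. Im \<xi> > 0 \<longrightarrow> cmod (ft \<xi>) \<le> M"
proof -
  obtain M where "M > 0" "\<And>x. x \<in> \<Omega> \<Longrightarrow> norm x \<le> M" using dom(4) unfolding bounded_pos by auto
  then show ?thesis using ft_in by (intro exI[of _ M]) auto
qed

lemma inverse_exists: "\<exists>fi. homeomorphism (ball 0 1) \<Omega> f fi"
  using invariance_of_domain_homeomorphism[OF open_ball cont_f _ inj] img by auto

lemma pullback_path:
  assumes "path q" "path_image q \<subseteq> \<Omega>"
  obtains p where "path p" "path_image p \<subseteq> ball 0 1" "\<forall>s\<in>{0..1}. f (p s) = q s"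
proof -
  obtain fi where fi: "homeomorphism (ball 0 1) \<Omega> f fi" using inverse_exists ..
  show ?thesis
  proof (rule that[of "fi \<circ> q"])
    show "path (fi \<circ> q)"
      by (rule path_continuous_image[OF assms(1) continuous_on_subset[OF homeomorphism_cont2[OF fi] assms(2)]])
    show "path_image (fi \<circ> q) \<subseteq> ball 0 1"
      using assms(2) homeomorphism_image2[OF fi] unfolding path_image_compose by blast
    show "\<forall>s\<in>{0..1}. f ((fi \<circ> q) s) = q s"
      using assms(2) homeomorphism_apply2[OF fi] unfolding path_image_def by auto
  qed
qed

text \<open>A homeomorphism onto \<Omega> is proper: if \<open>z\<close> were in \<Omega>,
  continuity of the inverse would make the \<open>w n\<close> converge to an inner point of the
  disc.\<close>

lemma limit_in_frontier:
  assumes w: "\<And>n. w n \<in> ball 0 1" "w \<longlonglongrightarrow> \<zeta>" "cmod \<zeta> = 1" and z: "(\<lambda>n. f (w n)) \<longlonglongrightarrow> z"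
  shows "z \<in> frontier \<Omega>"
proof -
  have fw: "f (w n) \<in> \<Omega>" for n using w(1) img by blast
  then have "f (w n) \<in> closure \<Omega>" for n using closure_subset by blast
  then have "z \<in> closure \<Omega>"
    by (intro Lim_in_closed_set[OF closed_closure _ sequentially_bot z]) simp
  moreover have "z \<notin> \<Omega>"
  proof
    assume zO: "z \<in> \<Omega>"
    obtain fi where fi: "homeomorphism (ball 0 1) \<Omega> f fi" using inverse_exists ..
    have "(\<lambda>n. fi (f (w n))) \<longlonglongrightarrow> fi z"
      by (rule continuous_on_tendsto_compose[OF homeomorphism_cont2[OF fi] z zO]) (simp add: fw)
    moreover have "fi (f (w n)) = w n" for n by (rule homeomorphism_apply1[OF fi w(1)])
    ultimately have "w \<longlonglongrightarrow> fi z" by simp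
    then have "\<zeta> = fi z" using w(2) LIMSEQ_unique by blast
    moreover have "fi z \<in> ball 0 1" using homeomorphism_image2[OF fi] zO by blast
    ultimately show False using w(3) by simp
  qed
  ultimately show ?thesis using dom(1) by (simp add: frontier_def interior_open)
qed

text \<open>The exponential maps all points of height at least \<open>y\<close> into a fixed compact
  disc. The bound has two uses: paths on which \<open>ft\<close> is close to \<open>p\<close> must
  run low, and their images avoid \<open>f 0\<close>, so that they can be lifted.\<close>

lemma far_from_frontier:
  assumes "p \<notin> \<Omega>" "y > 0"
  obtains \<epsilon> where "\<epsilon> > 0" "\<forall>\<xi>. Im \<xi> \<ge> y \<longrightarrow> \<epsilon> \<le> dist (ft \<xi>) p" "\<epsilon> \<le> dist (f 0) p"
proof -
  define r where "r = exp (- y)"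
  have r: "r < 1" "r > 0" using assms by (auto simp: r_def)
  have sub: "cball (0::complex) r \<subseteq> ball 0 1" using r by auto
  have "compact (f ` cball 0 r)"
    by (intro compact_continuous_image continuous_on_subset[OF cont_f sub]) simp
  then have "closed (f ` cball 0 r)" by (rule compact_imp_closed)
  moreover have "p \<notin> f ` cball 0 r" using assms(1) img sub by blast
  ultimately have "\<exists>d>0. \<forall>x\<in>f ` cball 0 r. d \<le> dist p x" by (rule separate_point_closed)
  then obtain d where d: "d > 0" "\<And>x. x \<in> f ` cball 0 r \<Longrightarrow> d \<le> dist p x" by metis
  show ?thesis
  proof (rule that[OF d(1)])
    show "\<forall>\<xi>. Im \<xi> \<ge> y \<longrightarrow> d \<le> dist (ft \<xi>) p"
    proof (intro allI impI)
      fix \<xi> assume "Im \<xi> \<ge> y"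
      then have "exp (\<i> * \<xi>) \<in> cball 0 r" by (simp add: norm_exp_i r_def)
      then show "d \<le> dist (ft \<xi>) p" using d(2) unfolding ft_def by (metis dist_commute imageI)
    qed
    show "d \<le> dist (f 0) p" using d(2)[of "f 0"] r by (simp add: dist_commute)
  qed
qed

text \<open>The covering \<open>exp (\<i> * \<xi>)\<close> omits 0, hence the path must avoid
  \<open>f 0\<close>; a continuous logarithm of the preimage in the disc then gives the lift. The
  starting point can be prescribed by a shift, but the end is fixed only up to the winding
  \<open>k\<close>.\<close>

lemma lift_path:
  assumes q: "path q" "path_image q \<subseteq> \<Omega> - {f 0}"
    and \<xi>: "Im \<xi>1 > 0" "Im \<xi>2 > 0" "pathstart q = ft \<xi>1" "pathfinish q = ft \<xi>2"
  obtains \<alpha> and k :: int where "path \<alpha>" "path_image \<alpha> \<subseteq> HH" "pathstart \<alpha> = \<xi>1"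
    "pathfinish \<alpha> = \<xi>2 + 2 * of_real pi * of_int k" "\<forall>s\<in>{0..1}. ft (\<alpha> s) = q s"
proof -
  have q': "path_image q \<subseteq> \<Omega>" using q by blast
  obtain p where p: "path p" "path_image p \<subseteq> ball 0 1" "\<forall>s\<in>{0..1}. f (p s) = q s"
    by (rule pullback_path[OF q(1) q'])
  have pb: "p s \<in> ball 0 1" if "s \<in> {0..1}" for s using p(2) that unfolding path_image_def by blast
  have p0: "p s \<noteq> 0" if "s \<in> {0..1}" for s
    using p(3) q(2) that by (force simp: path_image_def)
  obtain l where l: "continuous_on {0..1} l" "\<And>s. s \<in> {0..1} \<Longrightarrow> p s = exp (l s)"
    using continuous_logarithm_on_contractible[of "{0..1}" p] p(1) p0
    by (auto simp: path_def convex_imp_contractible)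
  have e1: "p 0 = exp (\<i> * \<xi>1)"
    using inj pb[of 0] exp_in_ball[OF \<xi>(1)] p(3) \<xi>(3) by (auto simp: inj_on_def ft_def pathstart_def)
  have e2: "p 1 = exp (\<i> * \<xi>2)"
    using inj pb[of 1] exp_in_ball[OF \<xi>(2)] p(3) \<xi>(4) by (auto simp: inj_on_def ft_def pathfinish_def)
  have "exp (\<i> * \<xi>1) = exp (l 0)" using e1 l(2)[of 0] by simp
  then obtain m :: int where m: "\<i> * \<xi>1 = l 0 + complex_of_real (real_of_int (2 * m) * pi) * \<i>" unfolding exp_eq by blast
  define \<alpha> where "\<alpha> s = - \<i> * l s + of_int (2 * m) * of_real pi" for s
  have ex: "exp (\<i> * \<alpha> s) = p s" if "s \<in> {0..1}" for s
  proof -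
    have "exp (\<i> * \<alpha> s) = exp (l s)"
      unfolding exp_eq \<alpha>_def by (intro exI[of _ m]) (simp add: algebra_simps)
    then show ?thesis using l(2)[OF that] by simp
  qed
  have "exp (\<i> * \<alpha> 1) = exp (\<i> * \<xi>2)" using ex[of 1] e2 by simp
  then obtain k :: int where k: "\<i> * \<alpha> 1 = \<i> * \<xi>2 + complex_of_real (real_of_int (2 * k) * pi) * \<i>" unfolding exp_eq by blast
  then have "\<i> * \<alpha> 1 = \<i> * (\<xi>2 + 2 * of_real pi * of_int k)" by (simp add: algebra_simps)
  then have a1: "\<alpha> 1 = \<xi>2 + 2 * of_real pi * of_int k" by (simp only: mult_cancel_left) simp
  have "- \<i> * (\<i> * \<xi>1) = \<alpha> 0" unfolding m \<alpha>_def by (simp add: algebra_simps)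
  then have a0: "\<alpha> 0 = \<xi>1" by simp
  show ?thesis
  proof (rule that[of \<alpha> k])
    show "path \<alpha>" unfolding path_def \<alpha>_def by (intro continuous_intros l)
    show "path_image \<alpha> \<subseteq> HH"
    proof
      fix x assume "x \<in> path_image \<alpha>"
      then obtain s where s: "s \<in> {0..1}" "x = \<alpha> s" by (auto simp: path_image_def)
      have "exp (- Im x) < 1" using ex[OF s(1)] pb[OF s(1)] s(2) by (simp flip: norm_exp_i)
      then show "x \<in> HH" by simp
    qed
    show "\<forall>s\<in>{0..1}. ft (\<alpha> s) = q s" using ex p(3) by (simp add: ft_def)
  qed (use a0 a1 in \<open>simp_all add: pathstart_def pathfinish_def\<close>)
qed

lemma filterlim_exp:
  "filterlim (\<lambda>\<xi>. exp (\<i> * \<xi>)) (at (cis t) within ball 0 1) (at (of_real t) within HH)"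
  unfolding filterlim_at
proof
  show "\<forall>\<^sub>F x in at (of_real t) within HH. exp (\<i> * x) \<in> ball 0 1 \<and> exp (\<i> * x) \<noteq> cis t"
  proof -
    have "\<forall>\<^sub>F x in at (complex_of_real t) within HH. x \<in> HH" by (simp add: eventually_at_filter)
    then show ?thesis
    proof eventually_elim
      fix x assume "x \<in> HH"
      then have "exp (\<i> * x) \<in> ball 0 1" by (intro exp_in_ball) simp
      moreover have "cis t \<notin> ball 0 1" by simp
      ultimately show "exp (\<i> * x) \<in> ball 0 1 \<and> exp (\<i> * x) \<noteq> cis t" by metis
    qed
  qed
  have "((\<lambda>\<xi>. exp (\<i> * \<xi>)) \<longlongrightarrow> exp (\<i> * of_real t)) (at (of_real t) within HH)"
    by (intro tendsto_intros)
  then show "((\<lambda>\<xi>. exp (\<i> * \<xi>)) \<longlongrightarrow> cis t) (at (of_real t) within HH)" by (simp add: cis_conv_exp)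
qed

text \<open>The branch of the inverse of \<open>exp (\<i> * \<xi>)\<close> that sends
  \<open>cis t\<close> to \<open>t\<close>. Dividing by \<open>cis t\<close> moves the relevant
  point to 1, away from the cut of \<open>Ln\<close>.\<close>

definition lift_at :: "real \<Rightarrow> complex \<Rightarrow> complex" where
  "lift_at t w = of_real t - \<i> * Ln (w / cis t)"

lemma exp_lift_at: "w \<noteq> 0 \<Longrightarrow> exp (\<i> * lift_at t w) = w"
  by (simp add: lift_at_def algebra_simps exp_add flip: cis_conv_exp)

lemma Im_lift_at: "w \<in> ball 0 1 \<Longrightarrow> w \<noteq> 0 \<Longrightarrow> Im (lift_at t w) > 0"
  by (simp add: lift_at_def norm_divide)

lemma ft_lift_at: "w \<noteq> 0 \<Longrightarrow> ft (lift_at t w) = f w"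
  by (simp add: ft_def exp_lift_at)

lemma filterlim_lift_at:
  "filterlim (lift_at t) (at (of_real t) within HH) (at (cis t) within ball 0 1)"
  unfolding filterlim_at
proof
  have "((\<lambda>w. of_real t - \<i> * Ln (w / cis t)) \<longlongrightarrow> of_real t - \<i> * Ln (cis t / cis t)) (at (cis t) within ball 0 1)"
    by (intro tendsto_intros) auto
  then show "(lift_at t \<longlongrightarrow> of_real t) (at (cis t) within ball 0 1)"
    by (simp add: lift_at_def[abs_def])
  have "\<forall>\<^sub>F x in at (cis t) within ball 0 1. x \<in> ball 0 1" by (simp add: eventually_at_filter)
  moreover have "\<forall>\<^sub>F x in at (cis t) within ball 0 1. x \<noteq> 0"
    using tendsto_imp_eventually_ne[OF tendsto_ident_at[of "cis t" "ball 0 1"], of 0] by simp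
  ultimately show "\<forall>\<^sub>F x in at (cis t) within ball 0 1. lift_at t x \<in> HH \<and> lift_at t x \<noteq> of_real t"
  proof eventually_elim
    fix x :: complex assume "x \<in> ball 0 1" "x \<noteq> 0"
    then have "Im (lift_at t x) > 0" by (rule Im_lift_at)
    then show "lift_at t x \<in> HH \<and> lift_at t x \<noteq> of_real t" by auto
  qed
qed

lemma tendsto_ft_iff:
  "(ft \<longlongrightarrow> L) (at (of_real t) within HH) \<longleftrightarrow> (f \<longlongrightarrow> L) (at (cis t) within ball 0 1)"
proof
  assume "(f \<longlongrightarrow> L) (at (cis t) within ball 0 1)"
  then show "(ft \<longlongrightarrow> L) (at (of_real t) within HH)"
    unfolding ft_def[abs_def] using filterlim_exp by (rule filterlim_compose)
next
  assume "(ft \<longlongrightarrow> L) (at (of_real t) within HH)"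
  then have "((\<lambda>w. ft (lift_at t w)) \<longlongrightarrow> L) (at (cis t) within ball 0 1)"
    using filterlim_lift_at by (rule filterlim_compose)
  moreover have "\<forall>\<^sub>F x in at (cis t) within ball 0 1. x \<noteq> 0"
    using tendsto_imp_eventually_ne[OF tendsto_ident_at[of "cis t" "ball 0 1"], of 0] by simp
  then have "\<forall>\<^sub>F x in at (cis t) within ball 0 1. ft (lift_at t x) = f x"
    by eventually_elim (rule ft_lift_at)
  ultimately show "(f \<longlongrightarrow> L) (at (cis t) within ball 0 1)"
    by (rule Lim_transform_eventually)
qed

abbreviation cl :: "real \<Rightarrow> complex set" where "cl t \<equiv> cluster_set f (cis t)"

lemma cl_iff:
  "p \<in> cl t \<longleftrightarrow> (\<forall>\<epsilon>>0. \<exists>\<xi>. Im \<xi> > 0 \<and> dist \<xi> (of_real t) < \<epsilon> \<and> dist (ft \<xi>) p < \<epsilon>)"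
proof
  assume "p \<in> cl t"
  then obtain w where w: "\<And>n. w n \<in> ball 0 1" "w \<longlonglongrightarrow> cis t" "(\<lambda>n. f (w n)) \<longlonglongrightarrow> p"
    unfolding cluster_set_def by blast
  have fl: "filterlim w (at (cis t) within ball 0 1) sequentially"
    unfolding filterlim_at
  proof (intro conjI w always_eventually allI)
    fix n have "cis t \<notin> ball 0 1" by simp
    then show "w n \<noteq> cis t" using w(1)[of n] by metis
  qed
  show "\<forall>\<epsilon>>0. \<exists>\<xi>. Im \<xi> > 0 \<and> dist \<xi> (of_real t) < \<epsilon> \<and> dist (ft \<xi>) p < \<epsilon>"
  proof (intro allI impI)
    fix \<epsilon> :: real assume \<epsilon>: "\<epsilon> > 0"
    have "(\<lambda>n. lift_at t (w n)) \<longlonglongrightarrow> of_real t"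
      using filterlim_compose[OF filterlim_lift_at fl] by (auto simp: filterlim_at)
    then have "\<forall>\<^sub>F n in sequentially. dist (lift_at t (w n)) (of_real t) < \<epsilon>"
      using \<epsilon> by (rule tendstoD)
    moreover have "\<forall>\<^sub>F n in sequentially. dist (f (w n)) p < \<epsilon>" using w(3) \<epsilon> by (rule tendstoD)
    moreover have "\<forall>\<^sub>F n in sequentially. w n \<noteq> 0"
      using tendsto_imp_eventually_ne[OF w(2), of 0] by simp
    ultimately have "\<forall>\<^sub>F n in sequentially. dist (lift_at t (w n)) (of_real t) < \<epsilon> \<and> dist (f (w n)) p < \<epsilon> \<and> w n \<noteq> 0"
      by eventually_elim auto
    then obtain n where "dist (lift_at t (w n)) (of_real t) < \<epsilon>" "dist (f (w n)) p < \<epsilon>" "w n \<noteq> 0"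
      using eventually_happens'[OF sequentially_bot] by blast
    then show "\<exists>\<xi>. Im \<xi> > 0 \<and> dist \<xi> (of_real t) < \<epsilon> \<and> dist (ft \<xi>) p < \<epsilon>"
      using ft_lift_at Im_lift_at[OF w(1)] by (intro exI[of _ "lift_at t (w n)"]) auto
  qed
next
  assume *: "\<forall>\<epsilon>>0. \<exists>\<xi>. Im \<xi> > 0 \<and> dist \<xi> (of_real t) < \<epsilon> \<and> dist (ft \<xi>) p < \<epsilon>"
  have "\<exists>\<xi>. Im \<xi> > 0 \<and> dist \<xi> (of_real t) < inverse (real (Suc n)) \<and> dist (ft \<xi>) p < inverse (real (Suc n))" for n
    using * by simp
  then obtain x where x: "\<And>n. Im (x n) > 0" "\<And>n. dist (x n) (of_real t) < inverse (real (Suc n))"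
    "\<And>n. dist (ft (x n)) p < inverse (real (Suc n))" by metis
  have "x \<longlonglongrightarrow> of_real t" "(\<lambda>n. ft (x n)) \<longlonglongrightarrow> p"
    using x LIMSEQ_norm_0[of "\<lambda>n. x n - of_real t"] LIMSEQ_norm_0[of "\<lambda>n. ft (x n) - p"]
    by (auto simp: dist_norm inverse_eq_divide intro: LIM_zero_cancel)
  then have "(\<lambda>n. exp (\<i> * x n)) \<longlonglongrightarrow> exp (\<i> * of_real t)" by (intro tendsto_intros)
  then show "p \<in> cl t" unfolding cluster_set_def
    using \<open>(\<lambda>n. ft (x n)) \<longlonglongrightarrow> p\<close> exp_in_ball[OF x(1)]
    by (auto simp: ft_def cis_conv_exp intro!: exI[of _ "\<lambda>n. exp (\<i> * x n)"])
qed

lemma cl_subset_frontier: "cl t \<subseteq> frontier \<Omega>"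
  unfolding cluster_set_def using limit_in_frontier[of _ "cis t"] by auto

lemma limit_point_in_cl:
  assumes x: "\<And>n. Im (x n) > 0" "x \<longlonglongrightarrow> of_real t"
  obtains r p where "strict_mono (r :: nat \<Rightarrow> nat)" "(\<lambda>n. ft (x (r n))) \<longlonglongrightarrow> p" "p \<in> cl t"
proof -
  have "bounded (range (\<lambda>n. ft (x n)))"
    by (rule bounded_subset[OF dom(4)]) (use ft_in x(1) in auto)
  then obtain p r where r: "strict_mono (r :: nat \<Rightarrow> nat)" "((\<lambda>n. ft (x n)) \<circ> r) \<longlonglongrightarrow> p"
    using bounded_imp_convergent_subsequence by blast
  have "p \<in> cl t" unfolding cl_iff
  proof (intro allI impI)
    fix \<epsilon> :: real assume "\<epsilon> > 0"
    then have "\<forall>\<^sub>F n in sequentially. dist (((\<lambda>n. ft (x n)) \<circ> r) n) p < \<epsilon>" by (rule tendstoD[OF r(2)])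
    moreover have "\<forall>\<^sub>F n in sequentially. dist ((x \<circ> r) n) (of_real t) < \<epsilon>"
      by (rule tendstoD[OF LIMSEQ_subseq_LIMSEQ[OF x(2) r(1)] \<open>\<epsilon> > 0\<close>])
    ultimately have "\<forall>\<^sub>F n in sequentially. dist (ft (x (r n))) p < \<epsilon> \<and> dist (x (r n)) (of_real t) < \<epsilon>"
      by eventually_elim auto
    then obtain n where "dist (ft (x (r n))) p < \<epsilon>" "dist (x (r n)) (of_real t) < \<epsilon>"
      using eventually_happens'[OF sequentially_bot] by blast
    then show "\<exists>\<xi>. Im \<xi> > 0 \<and> dist \<xi> (of_real t) < \<epsilon> \<and> dist (ft \<xi>) p < \<epsilon>" using x(1) by blast
  qed
  then show ?thesis using that r by (auto simp: o_def)
qed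

lemma eventually_near_cl:
  assumes "\<And>p. p \<in> cl t \<Longrightarrow> \<exists>\<epsilon>>0. \<forall>z\<in>\<Omega>. dist z p < \<epsilon> \<longrightarrow> P z"
  shows "\<forall>\<^sub>F \<xi> in at (of_real t) within HH. P (ft \<xi>)"
proof (rule ccontr)
  assume "\<not> ?thesis"
  then have *: "\<exists>\<xi>. Im \<xi> > 0 \<and> dist \<xi> (of_real t) < d \<and> \<not> P (ft \<xi>)" if "d > 0" for d
    using that unfolding eventually_at by auto
  have "\<exists>\<xi>. Im \<xi> > 0 \<and> dist \<xi> (of_real t) < inverse (real (Suc n)) \<and> \<not> P (ft \<xi>)" for n
    by (rule *) simp
  then obtain x where x: "\<And>n. Im (x n) > 0" "\<And>n. dist (x n) (of_real t) < inverse (real (Suc n))"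
    "\<And>n. \<not> P (ft (x n))" by metis
  have "x \<longlonglongrightarrow> of_real t"
    using x LIMSEQ_norm_0[of "\<lambda>n. x n - of_real t"]
    by (auto simp: dist_norm inverse_eq_divide intro: LIM_zero_cancel)
  then obtain r p where r: "strict_mono (r :: nat \<Rightarrow> nat)" "(\<lambda>n. ft (x (r n))) \<longlonglongrightarrow> p" "p \<in> cl t"
    by (rule limit_point_in_cl[OF x(1)])
  obtain \<epsilon> where \<epsilon>: "\<epsilon> > 0" "\<And>z. z \<in> \<Omega> \<Longrightarrow> dist z p < \<epsilon> \<Longrightarrow> P z" using assms[OF r(3)] by blast
  have "\<forall>\<^sub>F n in sequentially. dist (ft (x (r n))) p < \<epsilon>" using r(2) \<epsilon>(1) by (rule tendstoD)
  then obtain n where "dist (ft (x (r n))) p < \<epsilon>" using eventually_happens'[OF sequentially_bot] by blast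
  then show False using \<epsilon>(2) ft_in[OF x(1)] x(3) by blast
qed

lemma cl_nonempty: "cl t \<noteq> {}"
proof
  assume "cl t = {}"
  then have "\<forall>\<^sub>F \<xi> in at (of_real t) within HH. False" using eventually_near_cl[of t "\<lambda>_. False"] by simp
  then show False by simp
qed

lemma tendsto_if_cl_singleton:
  assumes "cl t = {p}"
  shows "(ft \<longlongrightarrow> p) (at (of_real t) within HH)"
proof (rule tendstoI)
  fix e :: real assume "e > 0"
  then show "\<forall>\<^sub>F \<xi> in at (of_real t) within HH. dist (ft \<xi>) p < e"
    using assms by (intro eventually_near_cl[where P = "\<lambda>z. dist z p < e"]) auto
qed

lemma cl_singleton_if_tendsto:
  assumes "(ft \<longlongrightarrow> p) (at (of_real t) within HH)"
  shows "cl t = {p}"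
proof -
  have "q = p" if q: "q \<in> cl t" for q
  proof (rule ccontr)
    assume "q \<noteq> p"
    define e where "e = dist q p / 2"
    have e: "e > 0" using \<open>q \<noteq> p\<close> by (simp add: e_def)
    have "\<forall>\<^sub>F \<xi> in at (of_real t) within HH. dist (ft \<xi>) p < e" using assms e by (rule tendstoD)
    then obtain d where d: "d > 0" "\<And>\<xi>. Im \<xi> > 0 \<Longrightarrow> \<xi> \<noteq> of_real t \<Longrightarrow> dist \<xi> (of_real t) < d \<Longrightarrow> dist (ft \<xi>) p < e"
      unfolding eventually_at by auto
    obtain \<xi> where \<xi>: "Im \<xi> > 0" "dist \<xi> (of_real t) < min d e" "dist (ft \<xi>) q < min d e"
      using q[unfolded cl_iff, rule_format, of "min d e"] d(1) e by auto
    have "\<xi> \<noteq> of_real t" using \<xi>(1) by auto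
    then have "dist (ft \<xi>) p < e" using d(2) \<xi> by simp
    then show False using \<xi>(3) dist_triangle2[of q p "ft \<xi>"] unfolding e_def by (simp add: dist_commute)
  qed
  then show ?thesis using cl_nonempty[of t] by blast
qed

text \<open>Half discs shrinking to \<open>t\<close> are convex, so the closures of their images
  form a decreasing sequence of compact connected sets; the cluster set is the intersection.\<close>

lemma connected_cl: "connected (cl t)"
proof -
  define S where "S n = closure (ft ` (HH \<inter> ball (of_real t) (inverse (real (Suc n)))))" for n
  have con: "continuous_on HH ft" using isCont_ft by (intro continuous_at_imp_continuous_on) auto
  have "connected (\<Inter> (range S))"
  proof (rule connected_nest)
    fix n
    have "ft ` (HH \<inter> ball (of_real t) (inverse (real (Suc n)))) \<subseteq> \<Omega>" using ft_in by blast
    then show "compact (S n)" unfolding S_def compact_closure using bounded_subset[OF dom(4)] by blast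
    have "convex (HH \<inter> ball (of_real t) (inverse (real (Suc n))))"
      by (intro convex_Int convex_ball) (simp add: convex_halfspace_Im_gt)
    then show "connected (S n)" unfolding S_def
      by (intro connected_imp_connected_closure connected_continuous_image convex_connected continuous_on_subset[OF con]) auto
  next
    fix m n :: nat assume "m \<le> n"
    then have "inverse (real (Suc n)) \<le> inverse (real (Suc m))" by (intro le_imp_inverse_le) auto
    then show "S n \<subseteq> S m" unfolding S_def by (intro closure_mono image_mono Int_mono subset_ball order_refl)
  qed
  moreover have "\<Inter> (range S) = cl t"
  proof (intro equalityI subsetI)
    fix p assume "p \<in> cl t"
    have "p \<in> S n" for n unfolding S_def closure_approachable
    proof (intro allI impI)
      fix e :: real assume "e > 0"
      then obtain \<xi> where \<xi>: "Im \<xi> > 0" "dist \<xi> (of_real t) < min e (inverse (real (Suc n)))" "dist (ft \<xi>) p < min e (inverse (real (Suc n)))"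
        using \<open>p \<in> cl t\<close>[unfolded cl_iff, rule_format, of "min e (inverse (real (Suc n)))"] by auto
      then show "\<exists>y\<in>ft ` (HH \<inter> ball (of_real t) (inverse (real (Suc n)))). dist y p < e"
        by (intro bexI[of _ "ft \<xi>"] imageI) (auto simp: dist_commute)
    qed
    then show "p \<in> \<Inter> (range S)" by blast
  next
    fix p assume p: "p \<in> \<Inter> (range S)"
    show "p \<in> cl t" unfolding cl_iff
    proof (intro allI impI)
      fix \<epsilon> :: real assume "\<epsilon> > 0"
      then obtain n where n: "inverse (real (Suc n)) < \<epsilon>" using reals_Archimedean by blast
      have "p \<in> S n" using p by blast
      then obtain \<xi> where "\<xi> \<in> HH \<inter> ball (of_real t) (inverse (real (Suc n)))" "dist (ft \<xi>) p < \<epsilon>"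
        unfolding S_def closure_approachable using \<open>\<epsilon> > 0\<close> by blast
      then show "\<exists>\<xi>. Im \<xi> > 0 \<and> dist \<xi> (of_real t) < \<epsilon> \<and> dist (ft \<xi>) p < \<epsilon>"
        using n by (intro exI[of _ \<xi>]) (auto simp: dist_commute)
    qed
  qed
  ultimately show ?thesis by simp
qed

end

lemma eventually_hbox:
  assumes "L > 0" shows "\<forall>\<^sub>F z in at (of_real t) within HH. z \<in> hbox t L"
  unfolding eventually_at
proof (intro exI[of _ L] conjI ballI impI assms)
  fix z assume z: "z \<in> HH" "z \<noteq> of_real t \<and> dist z (of_real t) < L"
  have "\<bar>Re (z - of_real t)\<bar> < L" "\<bar>Im (z - of_real t)\<bar> < L"
    using z abs_Re_le_cmod[of "z - of_real t"] abs_Im_le_cmod[of "z - of_real t"] by (auto simp: dist_norm)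
  then show "z \<in> hbox t L" using z by (auto simp: hbox_def)
qed

lemma tendsto_Re_barrier:
  assumes "L > 0" shows "((\<lambda>z. Re (barrier t L z)) \<longlongrightarrow> 0) (at (of_real t) within HH)"
proof -
  have "isCont (barrier t L) (of_real t)" using assms by (intro isCont_barrier) auto
  then have "(barrier t L \<longlongrightarrow> barrier t L (of_real t)) (at (of_real t) within HH)"
    unfolding isCont_def by (rule tendsto_within_subset) simp
  then have "((\<lambda>z. Re (barrier t L z)) \<longlongrightarrow> Re (barrier t L (of_real t))) (at (of_real t) within HH)"
    by (rule tendsto_Re)
  then show ?thesis by (simp add: Re_barrier)
qed

lemma tendsto_0_barrier:
  assumes "L > 0" "\<And>z. z \<in> hbox t L \<Longrightarrow> cmod (d z) \<le> K * Re (barrier t L z)"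
  shows "(d \<longlongrightarrow> 0) (at (of_real t) within HH)"
proof (rule Lim_null_comparison)
  show "\<forall>\<^sub>F z in at (of_real t) within HH. cmod (d z) \<le> K * Re (barrier t L z)"
    using eventually_hbox[OF assms(1)] by eventually_elim (rule assms(2))
  show "((\<lambda>z. K * Re (barrier t L z)) \<longlongrightarrow> 0) (at (of_real t) within HH)"
    using tendsto_mult_right_zero[OF tendsto_Re_barrier[OF assms(1)]] .
qed

section \<open>Cluster sets shared by two boundary points\<close>

context harmonic_jordan_map
begin

lemma connecting_paths:
  assumes "p \<in> frontier \<Omega>" "\<epsilon> > 0"
  obtains \<delta> where "\<delta> > 0" "\<delta> \<le> \<epsilon>" "\<forall>x\<in>\<Omega> \<inter> ball p \<delta>. \<forall>y\<in>\<Omega> \<inter> ball p \<delta>.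
     \<exists>q. path q \<and> path_image q \<subseteq> \<Omega> \<inter> ball p \<epsilon> \<and> pathstart q = x \<and> pathfinish q = y"
proof -
  obtain \<delta> where \<delta>: "\<delta> > 0" "\<And>x y. x \<in> \<Omega> \<inter> ball p \<delta> \<Longrightarrow> y \<in> \<Omega> \<inter> ball p \<delta> \<Longrightarrow>
     \<exists>q. path q \<and> path_image q \<subseteq> \<Omega> \<inter> ball p \<epsilon> \<and> pathstart q = x \<and> pathfinish q = y"
    using simple_loop_locally_connected_side[OF loop dom(1,2,3) assms] by metis
  show ?thesis
    by (rule that[of "min \<delta> \<epsilon>"]) (use \<delta> assms in auto)
qed

lemma frontier_notin: "p \<in> frontier \<Omega> \<Longrightarrow> p \<notin> \<Omega>"
  using \<Omega>_disjoint_frontier by blast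

text \<open>
  Since \<open>p\<close> is not a value of \<open>f\<close>, the paths must approach the boundary as \<open>\<eta>\<close> tends to 0, so every
  point of the half plane finally lies above them.
\<close>

lemma tendsto_of_crossing_paths:
  assumes p: "p \<notin> \<Omega>"
    and paths: "\<And>\<eta>. \<eta> > 0 \<Longrightarrow> \<exists>\<alpha>. path \<alpha> \<and> path_image \<alpha> \<subseteq> HH \<and> Re (pathstart \<alpha>) \<le> a + \<eta> \<and>
       Re (pathfinish \<alpha>) \<ge> b - \<eta> \<and> (\<forall>x\<in>path_image \<alpha>. dist (ft x) p < \<eta>)"
    and t: "a < t" "t < b"
  shows "(ft \<longlongrightarrow> p) (at (of_real t) within HH)"
proof -
  define L where "L = min (t - a) (b - t) / 2"
  have L: "L > 0" "a + L \<le> t - L" "b - L \<ge> t + L" using t by (auto simp: L_def min_def)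
  obtain M0 where M0: "M0 > 0" "\<forall>\<xi>. Im \<xi> > 0 \<longrightarrow> cmod (ft \<xi>) \<le> M0" using ft_bounded by auto
  define M where "M = M0 + cmod p"
  have M: "M \<ge> 0" "cmod (ft \<xi> - p) \<le> M" if "Im \<xi> > 0" for \<xi>
    using M0 that norm_triangle_ineq4[of "ft \<xi>" p] by (force simp: M_def)+
  have M': "M \<ge> 0" using M0 by (simp add: M_def)
  \<comment> \<open>To be used for the two coordinates of \<open>ft - p\<close>, each with either
    sign.\<close>
  have key: "Re (H z) \<le> M * Re (barrier t L z)"
    if H: "H holomorphic_on HH" and le: "\<And>\<xi>. Im \<xi> > 0 \<Longrightarrow> Re (H \<xi>) \<le> cmod (ft \<xi> - p)" and z: "z \<in> hbox t L" for H z
  proof (rule field_le_epsilon)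
    fix e :: real assume e: "e > 0"
    have Imz: "Im z > 0" using z by (simp add: hbox_def)
    obtain \<epsilon> where \<epsilon>: "\<epsilon> > 0" "\<forall>\<xi>. Im \<xi> \<ge> Im z \<longrightarrow> \<epsilon> \<le> dist (ft \<xi>) p" "\<epsilon> \<le> dist (f 0) p"
      by (rule far_from_frontier[OF p Imz])
    \<comment> \<open>The bound \<open>L\<close> makes the path span the box around
      \<open>t\<close>, \<epsilon> keeps the path below \<open>z\<close>, and \<open>e\<close> is
      the error allowed in the estimate.\<close>
    define \<eta> where "\<eta> = min e (min L \<epsilon>)"
    have \<eta>: "\<eta> > 0" "\<eta> \<le> e" "\<eta> \<le> L" "\<eta> \<le> \<epsilon>" using e L \<epsilon> by (auto simp: \<eta>_def)
    obtain \<alpha> where \<alpha>: "path \<alpha>" "path_image \<alpha> \<subseteq> HH" "Re (pathstart \<alpha>) \<le> a + \<eta>"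
       "Re (pathfinish \<alpha>) \<ge> b - \<eta>" "\<forall>x\<in>path_image \<alpha>. dist (ft x) p < \<eta>"
      using paths[OF \<eta>(1)] by blast
    have "Re (H z) \<le> \<eta> + M * Re (barrier t L z)"
    proof (rule Re_le_below_crossing_path[OF L(1) H M' _ \<alpha>(1,2) _ _ _ _ z])
      show "Re (H x) \<le> M" if "x \<in> hbox t L" for x
      proof -
        have "Im x > 0" using that by (simp add: hbox_def)
        then show ?thesis using le[of x] M(2)[of x] by linarith
      qed
      show "Re (H x) \<le> \<eta>" if x: "x \<in> path_image \<alpha>" for x
      proof -
        have "Im x > 0" "dist (ft x) p < \<eta>" using x \<alpha> by auto
        then show ?thesis using le[of x] by (simp add: dist_norm)
      qed
      show "Im w < Im z" if w: "w \<in> path_image \<alpha>" for w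
      proof (rule ccontr)
        assume "\<not> Im w < Im z"
        then have "\<epsilon> \<le> dist (ft w) p" using \<epsilon>(2) by auto
        moreover have "dist (ft w) p < \<eta>" using \<alpha>(5) w by blast
        ultimately show False using \<eta>(4) by linarith
      qed
    qed (use \<alpha> \<eta> L in auto)
    then show "Re (H z) \<le> M * Re (barrier t L z) + e" using \<eta>(2) by linarith
  qed
  have "((\<lambda>z. ft z - p) \<longlongrightarrow> 0) (at (of_real t) within HH)"
  proof (rule tendsto_0_barrier[OF L(1)])
    fix z assume z: "z \<in> hbox t L"
    have Imz: "Im z > 0" using z by (simp add: hbox_def)
    have re: "Re (Ut \<xi>) - Re p \<le> cmod (ft \<xi> - p)" "Re p - Re (Ut \<xi>) \<le> cmod (ft \<xi> - p)"
       "Re (Vt \<xi>) - Im p \<le> cmod (ft \<xi> - p)" "Im p - Re (Vt \<xi>) \<le> cmod (ft \<xi> - p)" if "Im \<xi> > 0" for \<xi>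
      using abs_Re_le_cmod[of "ft \<xi> - p"] abs_Im_le_cmod[of "ft \<xi> - p"] ft_eq[OF that] by auto
    have "Re (Ut z - of_real (Re p)) \<le> M * Re (barrier t L z)"
      by (rule key[OF _ _ z]) (use re(1) in \<open>auto intro!: holomorphic_intros hol_t\<close>)
    moreover have "Re (of_real (Re p) - Ut z) \<le> M * Re (barrier t L z)"
      by (rule key[OF _ _ z]) (use re(2) in \<open>auto intro!: holomorphic_intros hol_t\<close>)
    moreover have "Re (Vt z - of_real (Im p)) \<le> M * Re (barrier t L z)"
      by (rule key[OF _ _ z]) (use re(3) in \<open>auto intro!: holomorphic_intros hol_t\<close>)
    moreover have "Re (of_real (Im p) - Vt z) \<le> M * Re (barrier t L z)"
      by (rule key[OF _ _ z]) (use re(4) in \<open>auto intro!: holomorphic_intros hol_t\<close>)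
    ultimately have "\<bar>Re (ft z - p)\<bar> \<le> M * Re (barrier t L z)" "\<bar>Im (ft z - p)\<bar> \<le> M * Re (barrier t L z)"
      using Imz by (auto simp: ft_eq)
    then show "cmod (ft z - p) \<le> (2 * M) * Re (barrier t L z)"
      using cmod_le[of "ft z - p"] by linarith
  qed
  then show ?thesis by (rule LIM_zero_cancel)
qed

text \<open>
  Paths in \<open>\<Omega>\<close> near \<open>p\<close> are lifted to the half plane, where they end near \<open>t1\<close> and near
  some \<open>t2 + 2 * pi * k\<close>; the sign of the winding \<open>k\<close> decides which of the two arcs they cover.
\<close>

lemma common_cluster_point_arc:
  assumes p: "p \<in> cl t1" "p \<in> cl t2" and t: "t1 < t2"
  shows "(\<forall>t. t1 < t \<and> t < t2 \<longrightarrow> (ft \<longlongrightarrow> p) (at (of_real t) within HH)) \<or>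
         (\<forall>t. t2 - 2 * pi < t \<and> t < t1 \<longrightarrow> (ft \<longlongrightarrow> p) (at (of_real t) within HH))"
proof -
  have pf: "p \<in> frontier \<Omega>" using p(1) cl_subset_frontier by blast
  then have pn: "p \<notin> \<Omega>" by (rule frontier_notin)
  define Q where "Q \<eta> \<alpha> \<longleftrightarrow> path \<alpha> \<and> path_image \<alpha> \<subseteq> HH \<and> (\<forall>x\<in>path_image \<alpha>. dist (ft x) p < \<eta>)" for \<eta> \<alpha>
  have main: "\<exists>\<alpha> (k::int). Q \<eta> \<alpha> \<and> \<bar>Re (pathstart \<alpha>) - t1\<bar> < \<eta> \<and> \<bar>Re (pathfinish \<alpha>) - (t2 + 2 * pi * k)\<bar> < \<eta>"
    if \<eta>: "\<eta> > 0" for \<eta>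
  proof -
    obtain \<epsilon>0 where \<epsilon>0: "\<epsilon>0 > 0" "\<forall>\<xi>. Im \<xi> \<ge> 1 \<longrightarrow> \<epsilon>0 \<le> dist (ft \<xi>) p" "\<epsilon>0 \<le> dist (f 0) p"
      by (rule far_from_frontier[OF pn zero_less_one])
    \<comment> \<open>The bound \<epsilon>0 keeps \<open>f 0\<close> out of the ball around
      \<open>p\<close>, so that the connecting path can be lifted.\<close>
    define \<epsilon> where "\<epsilon> = min \<eta> \<epsilon>0"
    have \<epsilon>: "\<epsilon> > 0" using \<eta> \<epsilon>0 by (simp add: \<epsilon>_def)
    obtain \<delta> where \<delta>: "\<delta> > 0" "\<delta> \<le> \<epsilon>" "\<forall>x\<in>\<Omega> \<inter> ball p \<delta>. \<forall>y\<in>\<Omega> \<inter> ball p \<delta>.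
       \<exists>q. path q \<and> path_image q \<subseteq> \<Omega> \<inter> ball p \<epsilon> \<and> pathstart q = x \<and> pathfinish q = y"
      by (rule connecting_paths[OF pf \<epsilon>])
    obtain \<xi>1 where \<xi>1: "Im \<xi>1 > 0" "dist \<xi>1 (of_real t1) < \<delta>" "dist (ft \<xi>1) p < \<delta>"
      using p(1)[unfolded cl_iff, rule_format, OF \<delta>(1)] by blast
    obtain \<xi>2 where \<xi>2: "Im \<xi>2 > 0" "dist \<xi>2 (of_real t2) < \<delta>" "dist (ft \<xi>2) p < \<delta>"
      using p(2)[unfolded cl_iff, rule_format, OF \<delta>(1)] by blast
    have "ft \<xi>1 \<in> \<Omega> \<inter> ball p \<delta>" "ft \<xi>2 \<in> \<Omega> \<inter> ball p \<delta>"
      using \<xi>1 \<xi>2 ft_in by (auto simp: dist_commute)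
    then obtain q where q: "path q" "path_image q \<subseteq> \<Omega> \<inter> ball p \<epsilon>" "pathstart q = ft \<xi>1" "pathfinish q = ft \<xi>2"
      using \<delta>(3) by blast
    have "f 0 \<notin> ball p \<epsilon>" using \<epsilon>0(3) by (simp add: \<epsilon>_def dist_commute)
    then have q': "path_image q \<subseteq> \<Omega> - {f 0}" using q(2) by blast
    obtain \<alpha> and k :: int where \<alpha>: "path \<alpha>" "path_image \<alpha> \<subseteq> HH" "pathstart \<alpha> = \<xi>1"
      "pathfinish \<alpha> = \<xi>2 + 2 * of_real pi * of_int k" "\<forall>s\<in>{0..1}. ft (\<alpha> s) = q s"
      by (rule lift_path[OF q(1) q' \<xi>1(1) \<xi>2(1) q(3,4)])
    have "dist (ft x) p < \<eta>" if "x \<in> path_image \<alpha>" for x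
    proof -
      from that have "\<exists>s\<in>{0..1}. x = \<alpha> s" by (auto simp: path_image_def)
      then have "ft x \<in> path_image q" using \<alpha>(5) by (auto simp: path_image_def)
      then show ?thesis using q(2) by (auto simp: \<epsilon>_def dist_commute)
    qed
    then have "Q \<eta> \<alpha>" using \<alpha> by (simp add: Q_def)
    moreover have "\<bar>Re \<xi>1 - t1\<bar> < \<eta>" "\<bar>Re \<xi>2 - t2\<bar> < \<eta>"
      using \<xi>1(2) \<xi>2(2) \<delta>(2) abs_Re_le_cmod[of "\<xi>1 - of_real t1"] abs_Re_le_cmod[of "\<xi>2 - of_real t2"]
      by (auto simp: dist_norm \<epsilon>_def)
    ultimately show ?thesis using \<alpha>(3,4) by (intro exI[of _ \<alpha>] exI[of _ k]) simp
  qed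
  have Qmono: "Q \<eta>' \<alpha>" if "Q \<eta> \<alpha>" "\<eta> \<le> \<eta>'" for \<eta> \<eta>' \<alpha> using that unfolding Q_def by force
  \<comment> \<open>For nonnegative winding the lifted path covers the arc from \<open>t1\<close> to
    \<open>t2\<close>; for negative winding its reversal covers the complementary arc from
    \<open>t2 - 2 * pi\<close> to \<open>t1\<close>.\<close>
  define A where "A \<eta> \<longleftrightarrow> (\<exists>\<alpha>. Q \<eta> \<alpha> \<and> Re (pathstart \<alpha>) \<le> t1 + \<eta> \<and> Re (pathfinish \<alpha>) \<ge> t2 - \<eta>)" for \<eta>
  define B where "B \<eta> \<longleftrightarrow> (\<exists>\<alpha>. Q \<eta> \<alpha> \<and> Re (pathstart \<alpha>) \<le> (t2 - 2 * pi) + \<eta> \<and> Re (pathfinish \<alpha>) \<ge> t1 - \<eta>)" for \<eta>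
  have AB: "A \<eta> \<or> B \<eta>" if \<eta>: "\<eta> > 0" for \<eta>
  proof -
    obtain \<alpha> and k :: int where \<alpha>: "Q \<eta> \<alpha>" "\<bar>Re (pathstart \<alpha>) - t1\<bar> < \<eta>" "\<bar>Re (pathfinish \<alpha>) - (t2 + 2 * pi * k)\<bar> < \<eta>"
      using main[OF \<eta>] by blast
    show ?thesis
    proof (cases "k \<ge> 0")
      case True
      then have "2 * pi * k \<ge> 0" by simp
      then have "A \<eta>" unfolding A_def using \<alpha> by (intro exI[of _ \<alpha>]) auto
      then show ?thesis ..
    next
      case False
      then have "real_of_int k \<le> -1" by linarith
      then have "2 * pi * k \<le> 2 * pi * (-1)" by (intro mult_left_mono) auto
      then have "B \<eta>" unfolding B_def using \<alpha> unfolding Q_def by (intro exI[of _ "reversepath \<alpha>"]) auto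
      then show ?thesis ..
    qed
  qed
  have Amono: "A \<eta>'" if "A \<eta>" "\<eta> \<le> \<eta>'" for \<eta> \<eta>'
  proof -
    obtain \<alpha> where "Q \<eta> \<alpha>" "Re (pathstart \<alpha>) \<le> t1 + \<eta>" "Re (pathfinish \<alpha>) \<ge> t2 - \<eta>" using \<open>A \<eta>\<close> unfolding A_def by blast
    then show ?thesis unfolding A_def using Qmono \<open>\<eta> \<le> \<eta>'\<close> by (intro exI[of _ \<alpha>]) auto
  qed
  have Bmono: "B \<eta>'" if "B \<eta>" "\<eta> \<le> \<eta>'" for \<eta> \<eta>'
  proof -
    obtain \<alpha> where "Q \<eta> \<alpha>" "Re (pathstart \<alpha>) \<le> (t2 - 2 * pi) + \<eta>" "Re (pathfinish \<alpha>) \<ge> t1 - \<eta>" using \<open>B \<eta>\<close> unfolding B_def by blast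
    then show ?thesis unfolding B_def using Qmono \<open>\<eta> \<le> \<eta>'\<close> by (intro exI[of _ \<alpha>]) auto
  qed
  \<comment> \<open>The alternative may depend on \<eta>, but both are inherited by larger \<eta>,
    so one of them holds throughout.\<close>
  have "(\<forall>\<eta>>0. A \<eta>) \<or> (\<forall>\<eta>>0. B \<eta>)"
  proof (rule ccontr)
    assume "\<not> ?thesis"
    then obtain \<eta>1 \<eta>2 where "\<eta>1 > 0" "\<not> A \<eta>1" "\<eta>2 > 0" "\<not> B \<eta>2" by blast
    then show False using AB[of "min \<eta>1 \<eta>2"] Amono[of "min \<eta>1 \<eta>2" \<eta>1] Bmono[of "min \<eta>1 \<eta>2" \<eta>2] by auto
  qed
  then show ?thesis
  proof
    assume A: "\<forall>\<eta>>0. A \<eta>"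
    have "(ft \<longlongrightarrow> p) (at (of_real t) within HH)" if "t1 < t" "t < t2" for t
      by (rule tendsto_of_crossing_paths[OF pn _ that]) (use A in \<open>auto simp: A_def Q_def\<close>)
    then show ?thesis by blast
  next
    assume B: "\<forall>\<eta>>0. B \<eta>"
    have "(ft \<longlongrightarrow> p) (at (of_real t) within HH)" if "t2 - 2 * pi < t" "t < t1" for t
      by (rule tendsto_of_crossing_paths[OF pn _ that]) (use B in \<open>auto simp: B_def Q_def\<close>)
    then show ?thesis by blast
  qed
qed

text \<open>Every common cluster point is the limit of \<open>ft\<close> along one of the two
  complementary arcs, in particular at its midpoint \<open>m1\<close> or \<open>m2\<close>. Limits
  there are unique, so three distinct points do not fit.\<close>

lemma at_most_two_common_cluster_points:
  assumes "t1 < t2" "t2 < t1 + 2 * pi"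
    and "p \<in> cl t1 \<inter> cl t2" "q \<in> cl t1 \<inter> cl t2" "r \<in> cl t1 \<inter> cl t2"
    and "p \<noteq> q" "p \<noteq> r" "q \<noteq> r"
  shows False
proof -
  define m1 m2 where "m1 = (t1 + t2) / 2" and "m2 = (t2 - 2 * pi + t1) / 2"
  have m: "t1 < m1" "m1 < t2" "t2 - 2 * pi < m2" "m2 < t1" using assms(1,2) by (auto simp: m1_def m2_def)
  have *: "(ft \<longlongrightarrow> x) (at (of_real m1) within HH) \<or> (ft \<longlongrightarrow> x) (at (of_real m2) within HH)"
    if "x \<in> cl t1 \<inter> cl t2" for x
    using common_cluster_point_arc[of x t1 t2] that assms(1) m by blast
  have u: "x = y" if "(ft \<longlongrightarrow> x) (at (of_real m) within HH)" "(ft \<longlongrightarrow> y) (at (of_real m) within HH)" for x y m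
    using tendsto_unique[OF at_within_HH_nontrivial that] .
  show False using *[OF assms(3)] *[OF assms(4)] *[OF assms(5)] u assms(6-8) by metis
qed

text \<open>The parameters at which \<open>f\<close> has no unrestricted limit. That they are
  exactly jumps is a result, obtained in \<open>E0_jump\<close>.\<close>

definition E0 :: "real set" where "E0 = {t. \<forall>p. cl t \<noteq> {p}}"

text \<open>
  Two cluster sets share at most two points, so three rational parameters of the boundary curve
  determine \<open>t\<close> modulo \<open>2 * pi\<close>.
\<close>

lemma cl_contains_rational_points:
  assumes "t \<in> E0"
  shows "\<exists>q1\<in>\<rat>. \<exists>q2\<in>\<rat>. \<exists>q3\<in>\<rat>. 0 < q1 \<and> q1 < q2 \<and> q2 < q3 \<and> q3 < 1 \<and>
    g q1 \<in> cl t \<and> g q2 \<in> cl t \<and> g q3 \<in> cl t"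
proof -
  obtain p where p: "p \<in> cl t" using cl_nonempty by blast
  then obtain q where q: "q \<in> cl t" "q \<noteq> p" using assms unfolding E0_def by blast
  have sub: "cl t \<subseteq> path_image g" using cl_subset_frontier dom(3) by simp
  have "\<exists>s s'. 0 \<le> s \<and> s < s' \<and> s' \<le> 1 \<and> g s \<in> cl t \<and> g s' \<in> cl t \<and> g s \<noteq> g s'"
  proof -
    obtain s s' where s: "s \<in> {0..1}" "s' \<in> {0..1}" "p = g s" "q = g s'"
      using p q sub unfolding path_image_def by blast
    then have "s \<noteq> s'" using q by auto
    then consider "s < s'" | "s' < s" by linarith
    then show ?thesis
    proof cases
      case 1 then show ?thesis using s p q by (intro exI[of _ s] exI[of _ s']) auto
    next
      case 2 then show ?thesis using s p q by (intro exI[of _ s'] exI[of _ s]) auto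
    qed
  qed
  then obtain s s' where s: "0 \<le> s" "s < s'" "s' \<le> 1" "g s \<in> cl t" "g s' \<in> cl t" "g s \<noteq> g s'" by blast
  have "\<exists>x y. 0 \<le> x \<and> x < y \<and> y \<le> 1 \<and> g ` {x..y} \<subseteq> cl t"
    using connected_subset_simple_loop[OF loop connected_cl sub s]
  proof
    assume "g ` {s..s'} \<subseteq> cl t"
    then show ?thesis using s by blast
  next
    assume *: "g ` ({0..s} \<union> {s'..1}) \<subseteq> cl t"
    show ?thesis
    \<comment> \<open>One of the two end pieces may be a single point, but not both, since
      \<open>g 0 = g 1\<close> while \<open>g s\<close> and \<open>g s'\<close> differ.\<close>
    proof (cases "s = 0")
      case True
      then have "s' \<noteq> 1" using s(6) loop(2) by (auto simp: pathfinish_def pathstart_def)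
      then show ?thesis using * s by (intro exI[of _ s'] exI[of _ 1]) auto
    next
      case False
      then show ?thesis using * s by (intro exI[of _ 0] exI[of _ s]) auto
    qed
  qed
  then obtain x y where xy: "0 \<le> x" "x < y" "y \<le> 1" "g ` {x..y} \<subseteq> cl t" by blast
  obtain q1 where q1: "q1 \<in> \<rat>" "x < q1" "q1 < y" using Rats_dense_in_real[OF xy(2)] by blast
  obtain q2 where q2: "q2 \<in> \<rat>" "q1 < q2" "q2 < y" using Rats_dense_in_real[OF q1(3)] by blast
  obtain q3 where q3: "q3 \<in> \<rat>" "q2 < q3" "q3 < y" using Rats_dense_in_real[OF q2(3)] by blast
  have "q1 \<in> {x..y}" "q2 \<in> {x..y}" "q3 \<in> {x..y}" using q1 q2 q3 by auto
  then have "g q1 \<in> cl t" "g q2 \<in> cl t" "g q3 \<in> cl t" using xy(4) by blast+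
  then show ?thesis using q1 q2 q3 xy by (intro bexI[of _ q1] bexI[of _ q2] bexI[of _ q3]) auto
qed

text \<open>Within one period the chosen triple of rationals determines \<open>t\<close>: equal
  triples would produce three common cluster points. These are distinct because the rationals lie
  strictly between 0 and 1, where \<open>g\<close> is injective.\<close>

lemma countable_E0: "countable E0"
proof -
  have "\<exists>qs. \<forall>t\<in>E0. qs t \<in> \<rat> \<times> \<rat> \<times> \<rat> \<and> 0 < fst (qs t) \<and> fst (qs t) < fst (snd (qs t)) \<and>
      fst (snd (qs t)) < snd (snd (qs t)) \<and> snd (snd (qs t)) < (1::real) \<and>
      g (fst (qs t)) \<in> cl t \<and> g (fst (snd (qs t))) \<in> cl t \<and> g (snd (snd (qs t))) \<in> cl t"
    (is "\<exists>qs. \<forall>t\<in>E0. ?P t (qs t)")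
  proof (rule bchoice, rule ballI)
    fix t assume "t \<in> E0"
    from cl_contains_rational_points[OF this] obtain q1 q2 q3 where q: "q1 \<in> \<rat>" "q2 \<in> \<rat>" "q3 \<in> \<rat>"
      "0 < q1" "q1 < q2" "q2 < q3" "q3 < 1" "g q1 \<in> cl t" "g q2 \<in> cl t" "g q3 \<in> cl t" by blast
    then show "\<exists>y. ?P t y" by (intro exI[of _ "(q1, q2, q3)"]) simp
  qed
  then obtain qs where qs: "\<And>t. t \<in> E0 \<Longrightarrow> ?P t (qs t)" by blast
  have injg: "g x \<noteq> g y" if "0 < x" "x < y" "y < 1" for x y
    using loop(1) that unfolding simple_path_def loop_free_def by fastforce
  have "countable (E0 \<inter> {x..<x + 2 * pi})" for x
  proof (rule countableI'[where f = "to_nat_on (\<rat> \<times> \<rat> \<times> \<rat>) \<circ> qs"])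
    have c: "countable (\<rat> \<times> \<rat> \<times> \<rat> :: (real \<times> real \<times> real) set)" by (intro countable_SIGMA countable_rat)
    show "inj_on (to_nat_on (\<rat> \<times> \<rat> \<times> \<rat>) \<circ> qs) (E0 \<inter> {x..<x + 2 * pi})"
    proof (rule linorder_inj_onI')
      fix t1 t2 assume t: "t1 \<in> E0 \<inter> {x..<x + 2 * pi}" "t2 \<in> E0 \<inter> {x..<x + 2 * pi}" "t1 < t2"
      show "(to_nat_on (\<rat> \<times> \<rat> \<times> \<rat>) \<circ> qs) t1 \<noteq> (to_nat_on (\<rat> \<times> \<rat> \<times> \<rat>) \<circ> qs) t2"
      proof
        assume eq: "(to_nat_on (\<rat> \<times> \<rat> \<times> \<rat>) \<circ> qs) t1 = (to_nat_on (\<rat> \<times> \<rat> \<times> \<rat>) \<circ> qs) t2"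
        have e: "t1 \<in> E0" "t2 \<in> E0" using t by auto
        note P1 = qs[OF e(1)] and P2 = qs[OF e(2)]
        have "qs t1 = qs t2" using eq c P1 P2 by (simp add: to_nat_on_inj)
        then have in2: "g (fst (qs t1)) \<in> cl t1 \<inter> cl t2" "g (fst (snd (qs t1))) \<in> cl t1 \<inter> cl t2"
          "g (snd (snd (qs t1))) \<in> cl t1 \<inter> cl t2" using P1 P2 by auto
        have "t2 < t1 + 2 * pi" using t by auto
        from at_most_two_common_cluster_points[OF t(3) this in2] injg P1 show False
          by (meson less_trans)
      qed
    qed
  qed
  then have "countable (\<Union>k::int. E0 \<inter> {2 * pi * k..<2 * pi * k + 2 * pi})" by blast
  moreover have "E0 \<subseteq> (\<Union>k::int. E0 \<inter> {2 * pi * k..<2 * pi * k + 2 * pi})"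
  proof
    fix t assume t: "t \<in> E0"
    define k where "k = \<lfloor>t / (2 * pi)\<rfloor>"
    have "of_int k \<le> t / (2 * pi)" "t / (2 * pi) < of_int k + 1" unfolding k_def by linarith+
    then have "2 * pi * k \<le> t" "t < 2 * pi * k + 2 * pi" by (auto simp: field_simps)
    then show "t \<in> (\<Union>k::int. E0 \<inter> {2 * pi * k..<2 * pi * k + 2 * pi})" using t by auto
  qed
  ultimately show ?thesis using countable_subset by blast
qed

definition bF :: "complex \<Rightarrow> complex" where "bF \<zeta> = (THE p. cluster_set f \<zeta> = {p})"

abbreviation Fb :: "real \<Rightarrow> complex" where "Fb t \<equiv> bF (cis t)"

lemma cl_eq_Fb: "t \<notin> E0 \<Longrightarrow> cl t = {Fb t}"
  unfolding E0_def bF_def by auto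

lemma tendsto_Fb: "t \<notin> E0 \<Longrightarrow> (ft \<longlongrightarrow> Fb t) (at (of_real t) within HH)"
  by (intro tendsto_if_cl_singleton cl_eq_Fb)

lemma Fb_in_frontier: "t \<notin> E0 \<Longrightarrow> Fb t \<in> frontier \<Omega>"
  using cl_eq_Fb cl_subset_frontier by blast

lemma notin_E0_if_tendsto: "(ft \<longlongrightarrow> p) (at (of_real t) within HH) \<Longrightarrow> t \<notin> E0"
  using cl_singleton_if_tendsto unfolding E0_def by blast

lemma limit_of_Fb_in_cl:
  assumes s: "\<And>n. s n \<notin> E0" "s \<longlonglongrightarrow> t" "(\<lambda>n. Fb (s n)) \<longlonglongrightarrow> z"
  shows "z \<in> cl t"
  unfolding cl_iff
proof (intro allI impI)
  fix \<epsilon> :: real assume e: "\<epsilon> > 0"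
  then have e2: "\<epsilon> / 2 > 0" by simp
  have "\<forall>\<^sub>F n in sequentially. dist (s n) t < \<epsilon> / 2" "\<forall>\<^sub>F n in sequentially. dist (Fb (s n)) z < \<epsilon> / 2"
    using tendstoD[OF s(2) e2] tendstoD[OF s(3) e2] .
  then have "\<forall>\<^sub>F n in sequentially. dist (s n) t < \<epsilon> / 2 \<and> dist (Fb (s n)) z < \<epsilon> / 2" by eventually_elim auto
  then obtain n where n: "dist (s n) t < \<epsilon> / 2" "dist (Fb (s n)) z < \<epsilon> / 2"
    using eventually_happens'[OF sequentially_bot] by blast
  have "Fb (s n) \<in> cl (s n)" using cl_eq_Fb[OF s(1)] by blast
  then obtain \<xi> where \<xi>: "Im \<xi> > 0" "dist \<xi> (of_real (s n)) < \<epsilon> / 2" "dist (ft \<xi>) (Fb (s n)) < \<epsilon> / 2"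
    using e2 unfolding cl_iff by blast
  have "dist (complex_of_real (s n)) (of_real t) < \<epsilon> / 2" using n(1) by (simp add: dist_norm flip: of_real_diff)
  then have "dist \<xi> (of_real t) < \<epsilon>" using \<xi>(2) dist_triangle[of \<xi> "of_real t" "of_real (s n)"] by linarith
  moreover have "dist (ft \<xi>) z < \<epsilon>" using \<xi>(3) n(2) dist_triangle[of "ft \<xi>" z "Fb (s n)"] by linarith
  ultimately show "\<exists>\<xi>. Im \<xi> > 0 \<and> dist \<xi> (of_real t) < \<epsilon> \<and> dist (ft \<xi>) z < \<epsilon>" using \<xi>(1) by blast
qed

end

section \<open>One-sided limits of the boundary function\<close>

text \<open>The Moebius map of the disc to the upper half plane with \<zeta> going to 0 and
  \<open>- \<zeta>\<close> to infinity. In contrast to the exponential lift it is injective, so a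
  crossing in the half plane is a crossing in the disc.\<close>

definition cayley :: "complex \<Rightarrow> complex \<Rightarrow> complex" where
  "cayley \<zeta> w = \<i> * (\<zeta> - w) / (\<zeta> + w)"

lemma cayley_cis:
  assumes "\<bar>x - t\<bar> < pi"
  shows "cayley (cis t) (cis x) = of_real (tan ((x - t) / 2))"
proof -
  define u where "u = (x - t) / 2"
  have c: "cos u > 0" using assms by (intro cos_gt_zero_pi) (auto simp: u_def)
  have x: "cis x = cis t * (cis u * cis u)" by (simp add: cis_mult u_def)
  have t1: "1 = cis u * cis (- u)" by (simp add: cis_mult)
  have "cis t - cis x = cis t * cis u * (cis (- u) - cis u)"
    unfolding x using t1 by (simp add: algebra_simps)
  also have "cis (- u) - cis u = - 2 * \<i> * of_real (sin u)" by (simp add: complex_eq_iff)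
  finally have 1: "cis t - cis x = cis t * cis u * (- 2 * \<i> * of_real (sin u))" .
  have "cis t + cis x = cis t * cis u * (cis (- u) + cis u)"
    unfolding x using t1 by (simp add: algebra_simps)
  also have "cis (- u) + cis u = 2 * of_real (cos u)" by (simp add: complex_eq_iff)
  finally have 2: "cis t + cis x = cis t * cis u * (2 * of_real (cos u))" .
  have "cayley (cis t) (cis x) = of_real (sin u) / of_real (cos u)"
    unfolding cayley_def 1 2 using c by (simp add: field_simps)
  then show ?thesis by (simp add: tan_def u_def)
qed

lemma add_nonzero_in_disc:
  assumes "cmod \<zeta> = 1" "w \<in> ball 0 1" shows "\<zeta> + w \<noteq> 0"
proof
  assume "\<zeta> + w = 0"
  then have "w = - \<zeta>" by (simp add: eq_neg_iff_add_eq_0 add.commute)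
  then show False using assms by simp
qed

lemma Im_cayley_pos:
  assumes "cmod \<zeta> = 1" "w \<in> ball 0 1" shows "Im (cayley \<zeta> w) > 0"
proof -
  have ne: "\<zeta> + w \<noteq> 0" by (rule add_nonzero_in_disc[OF assms])
  have "cayley \<zeta> w = \<i> * (\<zeta> - w) * cnj (\<zeta> + w) / of_real ((cmod (\<zeta> + w))\<^sup>2)"
  proof -
    have "x / v = x * cnj v / (v * cnj v)" if "v \<noteq> 0" for x v :: complex using that by simp
    from this[OF ne] show ?thesis unfolding cayley_def complex_norm_square .
  qed
  then have "Im (cayley \<zeta> w) = Re ((\<zeta> - w) * cnj (\<zeta> + w)) / (cmod (\<zeta> + w))\<^sup>2"
    by (simp only: Im_divide_of_real mult.assoc) simp
  moreover have "Re ((\<zeta> - w) * cnj (\<zeta> + w)) = (cmod \<zeta>)\<^sup>2 - (cmod w)\<^sup>2"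
    unfolding cmod_power2 by (simp add: power2_eq_square algebra_simps)
  moreover have "(cmod w)\<^sup>2 < 1" using assms(2) by (simp add: power_less_one_iff)
  ultimately show ?thesis using ne assms(1) by simp
qed

lemma cayley_inj:
  assumes "\<zeta> \<noteq> 0" "\<zeta> + w \<noteq> 0" "\<zeta> + z \<noteq> 0" "cayley \<zeta> w = cayley \<zeta> z"
  shows "w = z"
proof -
  have "\<i> * ((\<zeta> - w) * (\<zeta> + z)) = \<i> * ((\<zeta> - z) * (\<zeta> + w))"
    using assms(2-4) unfolding cayley_def by (simp add: field_simps)
  then have "(\<zeta> - w) * (\<zeta> + z) = (\<zeta> - z) * (\<zeta> + w)" by (simp only: mult_cancel_left) simp
  then have "2 * \<zeta> * (z - w) = 0" by (simp add: algebra_simps)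
  then show ?thesis using assms(1) by simp
qed

text \<open>The parameters lie within \<pi> of \<open>t\<close>, so the pole \<open>- cis t\<close>
  is off both paths, and the endpoints go to the reals \<open>tan ((x - t) / 2)\<close> in the same
  order. The crossing of the images cannot lie on the circle, where the paths have only their four
  distinct endpoints.\<close>

lemma disc_paths_interlace:
  assumes P: "path P" "pathstart P = cis x1" "pathfinish P = cis x3" "path_image P \<subseteq> ball 0 1 \<union> {cis x1, cis x3}"
    and Q: "path Q" "pathstart Q = cis x2" "pathfinish Q = cis x4" "path_image Q \<subseteq> ball 0 1 \<union> {cis x2, cis x4}"
    and x: "t - pi < x1" "x1 < x2" "x2 < x3" "x3 < x4" "x4 < t + pi"
  shows "path_image P \<inter> path_image Q \<inter> ball 0 1 \<noteq> {}"
proof -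
  let ?c = "cayley (cis t)"
  have ne: "cis t + w \<noteq> 0" if "w \<in> ball 0 1 \<or> (\<exists>y. w = cis y \<and> \<bar>y - t\<bar> < pi)" for w
    using that
  proof
    assume "w \<in> ball 0 1" then show ?thesis by (intro add_nonzero_in_disc) auto
  next
    assume "\<exists>y. w = cis y \<and> \<bar>y - t\<bar> < pi"
    then obtain y where y: "w = cis y" "\<bar>y - t\<bar> < pi" by blast
    define u where "u = (y - t) / 2"
    have c: "cos u > 0" using y by (intro cos_gt_zero_pi) (auto simp: u_def)
    have "cis t + cis y = cis t * cis u * (cis (- u) + cis u)"
      by (simp add: cis_mult u_def distrib_left)
    also have "cis (- u) + cis u = 2 * of_real (cos u)" by (simp add: complex_eq_iff)
    finally show ?thesis using c y by simp
  qed
  have ax: "\<bar>x1 - t\<bar> < pi" "\<bar>x2 - t\<bar> < pi" "\<bar>x3 - t\<bar> < pi" "\<bar>x4 - t\<bar> < pi" unfolding abs_less_iff using x by linarith+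
  have neP: "cis t + w \<noteq> 0" if "w \<in> path_image P \<union> path_image Q" for w
    using that P(4) Q(4) ne[of w] ax by blast
  have Im0: "Im (?c w) \<ge> 0" if "w \<in> path_image P \<union> path_image Q" for w
  proof -
    have "w \<in> ball 0 1 \<or> (\<exists>y. w = cis y \<and> \<bar>y - t\<bar> < pi)" using that P(4) Q(4) ax by blast
    then show ?thesis
    proof
      assume "w \<in> ball 0 1" then show ?thesis using Im_cayley_pos[of "cis t" w] by simp
    next
      assume "\<exists>y. w = cis y \<and> \<bar>y - t\<bar> < pi"
      then show ?thesis by (auto simp: cayley_cis)
    qed
  qed
  have cont: "continuous_on (path_image P \<union> path_image Q) ?c"
    unfolding cayley_def using neP by (intro continuous_intros) auto
  have "compact (?c ` (path_image P \<union> path_image Q))"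
    by (intro compact_continuous_image cont compact_Un compact_path_image P Q)
  then obtain A where A: "\<And>w. w \<in> path_image P \<union> path_image Q \<Longrightarrow> cmod (?c w) \<le> A"
    using compact_imp_bounded bounded_iff by (metis imageI)
  have box: "?c w \<in> {z. - A \<le> Re z \<and> Re z \<le> A \<and> 0 \<le> Im z \<and> Im z \<le> A}" if "w \<in> path_image P \<union> path_image Q" for w
    using A[OF that] Im0[OF that] abs_Re_le_cmod[of "?c w"] abs_Im_le_cmod[of "?c w"] by auto
  have mono: "tan ((a - t) / 2) < tan ((b - t) / 2)" if "a < b" "\<bar>a - t\<bar> < pi" "\<bar>b - t\<bar> < pi" for a b
    using that by (intro tan_monotone) auto
  have "\<exists>z. z \<in> path_image (?c \<circ> P) \<and> z \<in> path_image (?c \<circ> Q)"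
  proof (rule complex_paths_interlace[where a = "-A" and b = A and c = 0 and d = A])
    show "path (?c \<circ> P)" "path (?c \<circ> Q)"
      by (intro path_continuous_image P Q continuous_on_subset[OF cont]; blast)+
    show "path_image (?c \<circ> P) \<subseteq> {z. - A \<le> Re z \<and> Re z \<le> A \<and> 0 \<le> Im z \<and> Im z \<le> A}"
      "path_image (?c \<circ> Q) \<subseteq> {z. - A \<le> Re z \<and> Re z \<le> A \<and> 0 \<le> Im z \<and> Im z \<le> A}"
      unfolding path_image_compose using box by blast+
    have e: "pathstart (?c \<circ> P) = of_real (tan ((x1 - t) / 2))" "pathfinish (?c \<circ> P) = of_real (tan ((x3 - t) / 2))"
       "pathstart (?c \<circ> Q) = of_real (tan ((x2 - t) / 2))" "pathfinish (?c \<circ> Q) = of_real (tan ((x4 - t) / 2))"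
      using P(2,3) Q(2,3) ax by (simp_all add: pathstart_compose pathfinish_compose cayley_cis)
    show "Im (pathstart (?c \<circ> P)) = 0" "Im (pathfinish (?c \<circ> P)) = 0" "Im (pathstart (?c \<circ> Q)) = 0" "Im (pathfinish (?c \<circ> Q)) = 0"
      "Re (pathstart (?c \<circ> P)) < Re (pathstart (?c \<circ> Q))" "Re (pathstart (?c \<circ> Q)) < Re (pathfinish (?c \<circ> P))"
      "Re (pathfinish (?c \<circ> P)) < Re (pathfinish (?c \<circ> Q))"
      unfolding e using mono x ax by auto
  qed
  then obtain w z where wz: "w \<in> path_image P" "z \<in> path_image Q" "?c w = ?c z"
    unfolding path_image_compose by force
  have "w = z" by (rule cayley_inj[of "cis t", OF _ neP neP wz(3)]) (use wz in simp_all)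
  have "w \<in> ball 0 1"
  proof (rule ccontr)
    assume "w \<notin> ball 0 1"
    then have "w \<in> {cis x1, cis x3} \<inter> {cis x2, cis x4}" using wz P(4) Q(4) \<open>w = z\<close> by blast
    then obtain a b where ab: "w = cis a" "w = cis b" "a \<in> {x1, x3}" "b \<in> {x2, x4}" by blast
    have aa: "\<bar>a - t\<bar> < pi" "\<bar>b - t\<bar> < pi" using ab ax by auto
    have "tan ((a - t) / 2) = tan ((b - t) / 2)"
      using cayley_cis[OF aa(1)] cayley_cis[OF aa(2)] ab(1,2) by simp
    then have "\<not> a < b" "\<not> b < a" using mono[of a b] mono[of b a] aa by auto
    then show False using ab x by auto
  qed
  then show ?thesis using wz \<open>w = z\<close> by blast
qed

text \<open>The argument on the upper half plane, 0 on the positive and \<open>pi\<close> on the negative axis.\<close>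

definition harg :: "complex \<Rightarrow> real" where "harg \<xi> = pi / 2 + Im (Ln (- \<i> * \<xi>))"

lemma harg_eq: "harg \<xi> = Re (of_real (pi / 2) - \<i> * Ln (- \<i> * \<xi>))"
  by (simp add: harg_def)

lemma harg_holomorphic: "(\<lambda>\<xi>. of_real (pi / 2) - \<i> * Ln (- \<i> * (\<xi> - of_real t))) holomorphic_on HH"
  by (intro holomorphic_intros) (auto simp: complex_nonpos_Reals_iff)

lemma harg_bounds:
  assumes "Im \<xi> > 0" shows "0 < harg \<xi>" "harg \<xi> < pi"
proof -
  have "Re (- \<i> * \<xi>) > 0" using assms by simp
  then have "\<bar>Im (Ln (- \<i> * \<xi>))\<bar> < pi / 2" by (intro Re_Ln_pos_lt_imp) auto
  then show "0 < harg \<xi>" "harg \<xi> < pi" unfolding harg_def by linarith+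
qed

lemma harg_tendsto:
  assumes "s \<noteq> t"
  shows "((\<lambda>\<xi>. harg (\<xi> - of_real t)) \<longlongrightarrow> (if s > t then 0 else pi)) (at (of_real s) within HH)"
proof -
  have nn: "- \<i> * (of_real s - of_real t) \<notin> \<real>\<^sub>\<le>\<^sub>0" using assms by (auto simp: complex_nonpos_Reals_iff)
  have "((\<lambda>\<xi>. harg (\<xi> - of_real t)) \<longlongrightarrow> harg (of_real s - of_real t)) (at (of_real s) within HH)"
    unfolding harg_def by (intro tendsto_intros) (use nn in auto)
  moreover have "harg (of_real s - of_real t) = (if s > t then 0 else pi)"
  proof (cases "s > t")
    case True
    have "- \<i> * (of_real s - of_real t) = of_real (s - t) * (- \<i>)" by (simp add: algebra_simps)
    moreover have "Ln (of_real (s - t) * (- \<i>)) = of_real (ln (s - t)) + Ln (- \<i>)"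
      using True by (simp only: Ln_times_of_real Ln_of_real diff_gt_0_iff_gt complex_i_not_zero neg_equal_0_iff_equal not_False_eq_True)
    ultimately have "Ln (- \<i> * (of_real s - of_real t)) = of_real (ln (s - t)) + Ln (- \<i>)" by (simp only:)
    then have "Im (Ln (- \<i> * (of_real s - of_real t))) = - pi / 2" by (simp add: Ln_minus_ii)
    then show ?thesis using True unfolding harg_def by simp
  next
    case False
    have "- \<i> * (of_real s - of_real t) = of_real (t - s) * \<i>" by (simp add: algebra_simps)
    moreover have "t - s > 0" using False assms by simp
    moreover have "Ln (of_real (t - s) * \<i>) = of_real (ln (t - s)) + Ln \<i>"
      using \<open>t - s > 0\<close> by (simp only: Ln_times_of_real Ln_of_real complex_i_not_zero not_False_eq_True)
    ultimately have "Ln (- \<i> * (of_real s - of_real t)) = of_real (ln (t - s)) + Ln \<i>" by (simp only:)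
    then have "Im (Ln (- \<i> * (of_real s - of_real t))) = pi / 2" by simp
    then show ?thesis using False unfolding harg_def by simp
  qed
  ultimately show ?thesis by simp
qed

context harmonic_jordan_map
begin

text \<open>The ends of the path are radial segments, on which \<open>f\<close> is near
  \<open>r\<close> because it has unrestricted limits at \<open>cis x\<close> and
  \<open>cis y\<close>. They are joined by the preimage of a path in \<Omega> near
  \<open>r\<close>.\<close>

lemma boundary_path:
  assumes conn: "\<forall>x\<in>\<Omega> \<inter> ball r \<delta>. \<forall>y\<in>\<Omega> \<inter> ball r \<delta>.
     \<exists>q. path q \<and> path_image q \<subseteq> \<Omega> \<inter> ball r \<epsilon> \<and> pathstart q = x \<and> pathfinish q = y" "\<delta> \<le> \<epsilon>"
    and x: "x \<notin> E0" "dist (Fb x) r < \<delta>" and y: "y \<notin> E0" "dist (Fb y) r < \<delta>"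
  obtains P where "path P" "pathstart P = cis x" "pathfinish P = cis y"
    "path_image P \<subseteq> ball 0 1 \<union> {cis x, cis y}" "\<forall>w\<in>path_image P \<inter> ball 0 1. f w \<in> ball r \<epsilon>"
proof -
  have radial: "\<exists>w. w \<in> ball 0 1 \<and> f w \<in> ball r \<delta> \<and> (\<forall>z\<in>closed_segment (cis x) w. z \<noteq> cis x \<longrightarrow> z \<in> ball 0 1 \<and> f z \<in> ball r \<delta>)"
    if x: "x \<notin> E0" "dist (Fb x) r < \<delta>" for x
  proof -
    have "(f \<longlongrightarrow> Fb x) (at (cis x) within ball 0 1)"
      using tendsto_Fb[OF x(1)] tendsto_ft_iff by blast
    then have "\<forall>\<^sub>F w in at (cis x) within ball 0 1. dist (f w) (Fb x) < \<delta> - dist (Fb x) r"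
      by (rule tendstoD) (use x(2) in simp)
    then obtain d where d: "d > 0" "\<And>w. w \<in> ball 0 1 \<Longrightarrow> w \<noteq> cis x \<Longrightarrow> dist w (cis x) < d \<Longrightarrow> dist (f w) (Fb x) < \<delta> - dist (Fb x) r"
      unfolding eventually_at by blast
    define s where "s = min d 1 / 2"
    have s: "0 < s" "s < d" "s < 1" using d(1) by (auto simp: s_def)
    have pt: "of_real (1 - u) * cis x \<in> ball 0 1 \<and> f (of_real (1 - u) * cis x) \<in> ball r \<delta>" if u: "0 < u" "u \<le> s" for u
    proof -
      have 1: "of_real (1 - u) * cis x \<in> ball 0 1" using u s by (simp add: norm_mult del: of_real_diff)
      have "of_real (1 - u) * cis x - cis x = - of_real u * cis x" by (simp add: algebra_simps)
      then have 2: "dist (of_real (1 - u) * cis x) (cis x) = u" using u by (simp add: dist_norm norm_mult)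
      then have "dist (f (of_real (1 - u) * cis x)) (Fb x) < \<delta> - dist (Fb x) r"
        using d(2)[OF 1] u s by fastforce
      then show ?thesis using 1 dist_triangle[of "f (of_real (1 - u) * cis x)" r "Fb x"]
        by (simp add: dist_commute)
    qed
    show ?thesis
    proof (intro exI[of _ "of_real (1 - s) * cis x"] conjI ballI impI)
      fix z assume z: "z \<in> closed_segment (cis x) (of_real (1 - s) * cis x)" "z \<noteq> cis x"
      obtain v where v: "0 \<le> v" "v \<le> 1" "z = (1 - v) *\<^sub>R cis x + v *\<^sub>R (of_real (1 - s) * cis x)"
        using z(1)[unfolded in_segment] by blast
      have zz: "z = of_real (1 - v * s) * cis x" unfolding v(3) by (simp add: scaleR_conv_of_real algebra_simps)
      have "v \<noteq> 0" using z(2) zz by auto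
      then have "0 < v * s" "v * s \<le> s" using v s by (auto simp: mult_left_le_one_le)
      then show "z \<in> ball 0 1" "f z \<in> ball r \<delta>" unfolding zz using pt by blast+
    qed (use pt[of s] s in auto)
  qed
  obtain w where w: "w \<in> ball 0 1" "f w \<in> ball r \<delta>" "\<forall>z\<in>closed_segment (cis x) w. z \<noteq> cis x \<longrightarrow> z \<in> ball 0 1 \<and> f z \<in> ball r \<delta>"
    using radial[OF x] by blast
  obtain v where v: "v \<in> ball 0 1" "f v \<in> ball r \<delta>" "\<forall>z\<in>closed_segment (cis y) v. z \<noteq> cis y \<longrightarrow> z \<in> ball 0 1 \<and> f z \<in> ball r \<delta>"
    using radial[OF y] by blast
  have "f w \<in> \<Omega> \<inter> ball r \<delta>" "f v \<in> \<Omega> \<inter> ball r \<delta>" using w v img by blast+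
  then obtain q where q: "path q" "path_image q \<subseteq> \<Omega> \<inter> ball r \<epsilon>" "pathstart q = f w" "pathfinish q = f v"
    using conn(1) by blast
  have q': "path_image q \<subseteq> \<Omega>" using q(2) by blast
  obtain p where p: "path p" "path_image p \<subseteq> ball 0 1" "\<forall>s\<in>{0..1}. f (p s) = q s"
    by (rule pullback_path[OF q(1) q'])
  have pb: "p s \<in> ball 0 1" if "s \<in> {0..1}" for s using p(2) that unfolding path_image_def by blast
  have p0: "p 0 = w" "p 1 = v"
    using inj pb[of 0] pb[of 1] w(1) v(1) p(3) q(3,4) by (auto simp: inj_on_def pathstart_def pathfinish_def)
  define P where "P = linepath (cis x) w +++ p +++ linepath v (cis y)"
  show ?thesis
  proof (rule that[of P])
    have ends: "pathstart p = w" "pathfinish p = v" using p0 by (auto simp: pathstart_def pathfinish_def)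
    show "path P" unfolding P_def using p(1) ends by simp
    show "pathstart P = cis x" "pathfinish P = cis y" by (simp_all add: P_def)
    have im: "path_image P \<subseteq> closed_segment (cis x) w \<union> path_image p \<union> closed_segment (cis y) v"
      unfolding P_def using path_image_join_subset[of "linepath (cis x) w" "p +++ linepath v (cis y)"]
        path_image_join_subset[of p "linepath v (cis y)"] by (auto simp: closed_segment_commute)
    have fp: "f z \<in> ball r \<epsilon>" if "z \<in> path_image p" for z
    proof -
      from that have "\<exists>s\<in>{0..1}. z = p s" by (auto simp: path_image_def)
      then have "f z \<in> path_image q" using p(3) by (auto simp: path_image_def)
      then show ?thesis using q(2) by blast
    qed
    show "path_image P \<subseteq> ball 0 1 \<union> {cis x, cis y}" using im p(2) w(3) v(3) by blast
    show "\<forall>w\<in>path_image P \<inter> ball 0 1. f w \<in> ball r \<epsilon>"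
    proof
      fix z assume z: "z \<in> path_image P \<inter> ball 0 1"
      have "cis x \<notin> ball 0 1" "cis y \<notin> ball 0 1" by simp_all
      then have "z \<noteq> cis x" "z \<noteq> cis y" using z by (metis IntD2)+
      then have "f z \<in> ball r \<delta> \<or> f z \<in> ball r \<epsilon>" using z im w(3) v(3) fp by blast
      then show "f z \<in> ball r \<epsilon>" using conn(2) by auto
    qed
  qed
qed

text \<open>Boundary paths for \<open>r\<close> and for \<open>r'\<close> with interlacing ends
  would meet in the disc, at a point where \<open>f\<close> is within \<epsilon> of both values,
  although \<epsilon> is half their distance.\<close>

lemma boundary_values_not_interlaced:
  assumes r: "r \<in> frontier \<Omega>" "r' \<in> frontier \<Omega>" "r \<noteq> r'"
  shows "\<exists>\<delta>>0. \<forall>x1 x2 x3 x4. t - pi < x1 \<and> x1 < x2 \<and> x2 < x3 \<and> x3 < x4 \<and> x4 < t + pi \<longrightarrow>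
     x1 \<notin> E0 \<longrightarrow> x2 \<notin> E0 \<longrightarrow> x3 \<notin> E0 \<longrightarrow> x4 \<notin> E0 \<longrightarrow>
     \<not> (dist (Fb x1) r < \<delta> \<and> dist (Fb x3) r < \<delta> \<and> dist (Fb x2) r' < \<delta> \<and> dist (Fb x4) r' < \<delta>)"
proof -
  define \<epsilon> where "\<epsilon> = dist r r' / 2"
  have \<epsilon>: "\<epsilon> > 0" using r by (simp add: \<epsilon>_def)
  obtain \<delta>1 where \<delta>1: "\<delta>1 > 0" "\<delta>1 \<le> \<epsilon>" "\<forall>x\<in>\<Omega> \<inter> ball r \<delta>1. \<forall>y\<in>\<Omega> \<inter> ball r \<delta>1.
     \<exists>q. path q \<and> path_image q \<subseteq> \<Omega> \<inter> ball r \<epsilon> \<and> pathstart q = x \<and> pathfinish q = y"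
    by (rule connecting_paths[OF r(1) \<epsilon>])
  obtain \<delta>2 where \<delta>2: "\<delta>2 > 0" "\<delta>2 \<le> \<epsilon>" "\<forall>x\<in>\<Omega> \<inter> ball r' \<delta>2. \<forall>y\<in>\<Omega> \<inter> ball r' \<delta>2.
     \<exists>q. path q \<and> path_image q \<subseteq> \<Omega> \<inter> ball r' \<epsilon> \<and> pathstart q = x \<and> pathfinish q = y"
    by (rule connecting_paths[OF r(2) \<epsilon>])
  show ?thesis
  proof (intro exI[of _ "min \<delta>1 \<delta>2"] conjI allI impI notI)
    fix x1 x2 x3 x4
    assume x: "t - pi < x1 \<and> x1 < x2 \<and> x2 < x3 \<and> x3 < x4 \<and> x4 < t + pi"
      and E: "x1 \<notin> E0" "x2 \<notin> E0" "x3 \<notin> E0" "x4 \<notin> E0"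
      and d: "dist (Fb x1) r < min \<delta>1 \<delta>2 \<and> dist (Fb x3) r < min \<delta>1 \<delta>2 \<and>
        dist (Fb x2) r' < min \<delta>1 \<delta>2 \<and> dist (Fb x4) r' < min \<delta>1 \<delta>2"
    have d': "dist (Fb x1) r < \<delta>1" "dist (Fb x3) r < \<delta>1" "dist (Fb x2) r' < \<delta>2" "dist (Fb x4) r' < \<delta>2"
      using d by auto
    obtain P where P: "path P" "pathstart P = cis x1" "pathfinish P = cis x3"
      "path_image P \<subseteq> ball 0 1 \<union> {cis x1, cis x3}" "\<forall>w\<in>path_image P \<inter> ball 0 1. f w \<in> ball r \<epsilon>"
      by (rule boundary_path[OF \<delta>1(3,2) E(1) d'(1) E(3) d'(2)])
    obtain Q where Q: "path Q" "pathstart Q = cis x2" "pathfinish Q = cis x4"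
      "path_image Q \<subseteq> ball 0 1 \<union> {cis x2, cis x4}" "\<forall>w\<in>path_image Q \<inter> ball 0 1. f w \<in> ball r' \<epsilon>"
      by (rule boundary_path[OF \<delta>2(3,2) E(2) d'(3) E(4) d'(4)])
    obtain w where w: "w \<in> path_image P" "w \<in> path_image Q" "w \<in> ball 0 1"
      using disc_paths_interlace[OF P(1-4) Q(1-4)] x by blast
    have "f w \<in> ball r \<epsilon>" "f w \<in> ball r' \<epsilon>" using P(5) Q(5) w by blast+
    then show False using dist_triangle2[of r r' "f w"] unfolding \<epsilon>_def by (simp add: dist_commute)
  qed (use \<delta>1 \<delta>2 in auto)
qed

lemma Fb_subsequence_limit:
  assumes s: "\<And>n. s n \<notin> E0"
  obtains \<rho> z where "strict_mono (\<rho> :: nat \<Rightarrow> nat)" "(\<lambda>n. Fb (s (\<rho> n))) \<longlonglongrightarrow> z" "z \<in> frontier \<Omega>"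
proof -
  have "compact (frontier \<Omega>)" using dom(4) by (simp add: compact_frontier_bounded)
  moreover have "\<forall>n. Fb (s n) \<in> frontier \<Omega>" using Fb_in_frontier[OF s] by blast
  ultimately have "\<exists>l\<in>frontier \<Omega>. \<exists>\<rho>. strict_mono (\<rho> :: nat \<Rightarrow> nat) \<and> ((\<lambda>n. Fb (s n)) \<circ> \<rho>) \<longlonglongrightarrow> l"
    unfolding compact_def by (elim allE[of _ "\<lambda>n. Fb (s n)"] impE) blast+
  then show ?thesis using that unfolding o_def by blast
qed

text \<open>If the values did not converge, compactness would give two limit values \<open>r\<close>
  and \<open>r'\<close> along the same side of \<open>t\<close>. Choosing points ever closer to
  \<open>t\<close> with values alternately near the two produces four interlacing
  parameters.\<close>

lemma one_sided_limit:
  assumes ne: "at t within S \<noteq> bot" and S: "S \<inter> E0 = {}" and side: "S \<subseteq> {t<..} \<or> S \<subseteq> {..<t}"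
  shows "\<exists>r\<in>frontier \<Omega>. (Fb \<longlongrightarrow> r) (at t within S)"
proof -
  have pick: "\<exists>s\<in>S. \<bar>s - t\<bar> < e" if "e > 0" for e
  proof -
    have "t islimpt S" using ne by (simp add: trivial_limit_within)
    then obtain s where "s \<in> S" "dist s t < e" using \<open>e > 0\<close> unfolding islimpt_approachable by blast
    then show ?thesis by (auto simp: dist_real_def)
  qed
  have "\<exists>s\<in>S. \<bar>s - t\<bar> < inverse (real (Suc n))" for n by (rule pick) simp
  then obtain s where s: "\<And>n. s n \<in> S" "\<And>n. \<bar>s n - t\<bar> < inverse (real (Suc n))" by metis
  have SE: "x \<notin> E0" if "x \<in> S" for x using S that by blast
  obtain \<rho> r where r: "strict_mono (\<rho> :: nat \<Rightarrow> nat)" "(\<lambda>n. Fb (s (\<rho> n))) \<longlonglongrightarrow> r" "r \<in> frontier \<Omega>"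
    by (rule Fb_subsequence_limit[OF SE[OF s(1)]])
  have near_r: "\<exists>x\<in>S. \<bar>x - t\<bar> < e \<and> dist (Fb x) r < e" if e: "e > 0" for e
  proof -
    obtain N where N: "inverse (real (Suc N)) < e" using reals_Archimedean[OF e] by blast
    have "\<forall>\<^sub>F n in sequentially. dist (Fb (s (\<rho> n))) r < e" using r(2) e by (rule tendstoD)
    then have "\<forall>\<^sub>F n in sequentially. dist (Fb (s (\<rho> n))) r < e \<and> n \<ge> N"
      using eventually_ge_at_top[of N] by eventually_elim auto
    then obtain n where n: "dist (Fb (s (\<rho> n))) r < e" "n \<ge> N" using eventually_happens'[OF sequentially_bot] by blast
    have "\<rho> n \<ge> N" using seq_suble[OF r(1), of n] n(2) by linarith
    then have "inverse (real (Suc (\<rho> n))) \<le> inverse (real (Suc N))" by (intro le_imp_inverse_le) auto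
    then have "\<bar>s (\<rho> n) - t\<bar> < e" using s(2)[of "\<rho> n"] N by linarith
    then show ?thesis using n(1) s(1) by blast
  qed
  have "(Fb \<longlongrightarrow> r) (at t within S)"
  proof (rule ccontr)
    assume "\<not> ?thesis"
    then obtain \<epsilon> where \<epsilon>: "\<epsilon> > 0" "\<not> (\<forall>\<^sub>F x in at t within S. dist (Fb x) r < \<epsilon>)"
      unfolding tendsto_iff by blast
    have "\<exists>x\<in>S. \<bar>x - t\<bar> < d \<and> \<not> dist (Fb x) r < \<epsilon>" if "d > 0" for d
      using \<epsilon>(2) \<open>d > 0\<close> unfolding eventually_at dist_real_def by blast
    then have "\<exists>x\<in>S. \<bar>x - t\<bar> < inverse (real (Suc n)) \<and> \<not> dist (Fb x) r < \<epsilon>" for n by simp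
    then obtain s' where s': "\<And>n. s' n \<in> S" "\<And>n. \<bar>s' n - t\<bar> < inverse (real (Suc n))" "\<And>n. \<not> dist (Fb (s' n)) r < \<epsilon>" by metis
    obtain \<rho>' r' where r': "strict_mono (\<rho>' :: nat \<Rightarrow> nat)" "(\<lambda>n. Fb (s' (\<rho>' n))) \<longlonglongrightarrow> r'" "r' \<in> frontier \<Omega>"
      by (rule Fb_subsequence_limit[OF SE[OF s'(1)]])
    have near_r': "\<exists>x\<in>S. \<bar>x - t\<bar> < e \<and> dist (Fb x) r' < e" if e: "e > 0" for e
    proof -
      obtain N where N: "inverse (real (Suc N)) < e" using reals_Archimedean[OF e] by blast
      have "\<forall>\<^sub>F n in sequentially. dist (Fb (s' (\<rho>' n))) r' < e" using r'(2) e by (rule tendstoD)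
      then have "\<forall>\<^sub>F n in sequentially. dist (Fb (s' (\<rho>' n))) r' < e \<and> n \<ge> N"
        using eventually_ge_at_top[of N] by eventually_elim auto
      then obtain n where n: "dist (Fb (s' (\<rho>' n))) r' < e" "n \<ge> N" using eventually_happens'[OF sequentially_bot] by blast
      have "\<rho>' n \<ge> N" using seq_suble[OF r'(1), of n] n(2) by linarith
      then have "inverse (real (Suc (\<rho>' n))) \<le> inverse (real (Suc N))" by (intro le_imp_inverse_le) auto
      then have "\<bar>s' (\<rho>' n) - t\<bar> < e" using s'(2)[of "\<rho>' n"] N by linarith
      then show ?thesis using n(1) s'(1) by blast
    qed
    have "r \<noteq> r'"
    proof
      assume "r = r'"
      then have "\<forall>\<^sub>F n in sequentially. dist (Fb (s' (\<rho>' n))) r < \<epsilon>" using r'(2) \<epsilon>(1) by (auto intro: tendstoD)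
      then obtain n where "dist (Fb (s' (\<rho>' n))) r < \<epsilon>" using eventually_happens'[OF sequentially_bot] by blast
      then show False using s'(3) by blast
    qed
    \<comment> \<open>The points approach \<open>t\<close> with values near \<open>r\<close>,
      \<open>r'\<close>, \<open>r\<close>, \<open>r'\<close>. Read in increasing order this pattern
      starts with \<open>r\<close> on the left of \<open>t\<close> and with \<open>r'\<close> on the
      right, hence both versions are needed.\<close>
    from boundary_values_not_interlaced[OF r(3) r'(3) this, of t] boundary_values_not_interlaced[OF r'(3) r(3) this[symmetric], of t]
    obtain \<delta>1 \<delta>2 where \<delta>1: "\<delta>1 > 0" "\<And>x1 x2 x3 x4. t - pi < x1 \<and> x1 < x2 \<and> x2 < x3 \<and> x3 < x4 \<and> x4 < t + pi \<longrightarrow>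
     x1 \<notin> E0 \<longrightarrow> x2 \<notin> E0 \<longrightarrow> x3 \<notin> E0 \<longrightarrow> x4 \<notin> E0 \<longrightarrow>
     \<not> (dist (Fb x1) r < \<delta>1 \<and> dist (Fb x3) r < \<delta>1 \<and> dist (Fb x2) r' < \<delta>1 \<and> dist (Fb x4) r' < \<delta>1)"
     and \<delta>2: "\<delta>2 > 0" "\<And>x1 x2 x3 x4. t - pi < x1 \<and> x1 < x2 \<and> x2 < x3 \<and> x3 < x4 \<and> x4 < t + pi \<longrightarrow>
     x1 \<notin> E0 \<longrightarrow> x2 \<notin> E0 \<longrightarrow> x3 \<notin> E0 \<longrightarrow> x4 \<notin> E0 \<longrightarrow>
     \<not> (dist (Fb x1) r' < \<delta>2 \<and> dist (Fb x3) r' < \<delta>2 \<and> dist (Fb x2) r < \<delta>2 \<and> dist (Fb x4) r < \<delta>2)"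
      by blast
    define d where "d = min \<delta>1 (min \<delta>2 pi)"
    have d: "d > 0" "d \<le> \<delta>1" "d \<le> \<delta>2" "d \<le> pi" using \<delta>1(1) \<delta>2(1) by (auto simp: d_def)
    have nt: "x \<noteq> t" if "x \<in> S" for x using side that by auto
    obtain a where a: "a \<in> S" "\<bar>a - t\<bar> < d" "dist (Fb a) r < d" using near_r[OF d(1)] by blast
    \<comment> \<open>Bounding by the distance already reached forces the next point strictly closer
      to \<open>t\<close>, while its value stays within \<open>d\<close>.\<close>
    define d1 where "d1 = min d \<bar>a - t\<bar>"
    have d1: "d1 > 0" using d nt[OF a(1)] by (simp add: d1_def)
    obtain b where b: "b \<in> S" "\<bar>b - t\<bar> < d1" "dist (Fb b) r' < d1" using near_r'[OF d1] by blast
    define d2 where "d2 = min d1 \<bar>b - t\<bar>"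
    have d2: "d2 > 0" using d1 nt[OF b(1)] by (simp add: d2_def)
    obtain c where c: "c \<in> S" "\<bar>c - t\<bar> < d2" "dist (Fb c) r < d2" using near_r[OF d2] by blast
    define d3 where "d3 = min d2 \<bar>c - t\<bar>"
    have d3: "d3 > 0" using d2 nt[OF c(1)] by (simp add: d3_def)
    obtain e where e: "e \<in> S" "\<bar>e - t\<bar> < d3" "dist (Fb e) r' < d3" using near_r'[OF d3] by blast
    have le: "\<bar>b - t\<bar> < \<bar>a - t\<bar>" "\<bar>c - t\<bar> < \<bar>b - t\<bar>" "\<bar>e - t\<bar> < \<bar>c - t\<bar>"
      and dd: "dist (Fb b) r' < d" "dist (Fb c) r < d" "dist (Fb e) r' < d"
      using b c e by (auto simp: d1_def d2_def d3_def)
    note nE = SE[OF a(1)] SE[OF b(1)] SE[OF c(1)] SE[OF e(1)]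
    from side show False
    proof
      assume "S \<subseteq> {t<..}"
      then have "t < e" "t < c" "t < b" "t < a" using a b c e by auto
      then have o: "t - pi < e \<and> e < c \<and> c < b \<and> b < a \<and> a < t + pi" using le a(2) d pi_gt_zero by linarith
      show False using \<delta>2(2)[rule_format, OF o nE(4,3,2,1)] dd a(3) d by linarith
    next
      assume "S \<subseteq> {..<t}"
      then have "e < t" "c < t" "b < t" "a < t" using a b c e by auto
      then have o: "t - pi < a \<and> a < b \<and> b < c \<and> c < e \<and> e < t + pi" using le a(2) d pi_gt_zero by linarith
      show False using \<delta>1(2)[rule_format, OF o nE] dd a(3) d by linarith
    qed
  qed
  then show ?thesis using r(3) by blast
qed

text \<open>The bounded harmonic function on the upper half plane with boundary value
  \<open>r\<close> to the right of \<open>t\<close> and \<open>l\<close> to the left.\<close>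

definition jump_model :: "complex \<Rightarrow> complex \<Rightarrow> real \<Rightarrow> complex \<Rightarrow> complex" where
  "jump_model l r t \<xi> = r + of_real (harg (\<xi> - of_real t) / pi) * (l - r)"

text \<open>The difference of \<open>ft\<close> and its model is bounded, and near \<open>t\<close>
  its boundary values are smaller than \<epsilon> off a countable set. The barrier, which vanishes
  at \<open>t\<close>, carries this smallness into the half plane in all directions of
  approach.\<close>

lemma asymptotic_jump:
  assumes r: "(Fb \<longlongrightarrow> r) (at t within {s. s > t \<and> s \<notin> E0})"
    and l: "(Fb \<longlongrightarrow> l) (at t within {s. s < t \<and> s \<notin> E0})"
  shows "((\<lambda>\<xi>. ft \<xi> - jump_model l r t \<xi>) \<longlongrightarrow> 0) (at (of_real t) within HH)"
proof (rule tendstoI)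
  fix e :: real assume e: "e > 0"
  \<comment> \<open>Each of the two coordinates costs one \<epsilon>, and the barrier has to stay
    below the third.\<close>
  define \<epsilon> where "\<epsilon> = e / 3"
  have \<epsilon>: "\<epsilon> > 0" using e by (simp add: \<epsilon>_def)
  obtain d1 where d1: "d1 > 0" "\<And>s. s > t \<Longrightarrow> s \<notin> E0 \<Longrightarrow> \<bar>s - t\<bar> < d1 \<Longrightarrow> dist (Fb s) r < \<epsilon>"
    using tendstoD[OF r \<epsilon>] unfolding eventually_at dist_real_def by auto
  obtain d2 where d2: "d2 > 0" "\<And>s. s < t \<Longrightarrow> s \<notin> E0 \<Longrightarrow> \<bar>s - t\<bar> < d2 \<Longrightarrow> dist (Fb s) l < \<epsilon>"
    using tendstoD[OF l \<epsilon>] unfolding eventually_at dist_real_def by auto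
  define L where "L = min d1 d2"
  have L: "L > 0" using d1 d2 by (simp add: L_def)
  define D where "D \<xi> = ft \<xi> - jump_model l r t \<xi>" for \<xi>
  obtain M0 where M0: "M0 > 0" "\<forall>\<xi>. Im \<xi> > 0 \<longrightarrow> cmod (ft \<xi>) \<le> M0" using ft_bounded by auto
  define M where "M = M0 + cmod r + cmod (l - r)"
  have M: "M \<ge> 0" using M0 by (simp add: M_def)
  have DM: "cmod (D \<xi>) \<le> M" if "Im \<xi> > 0" for \<xi>
  proof -
    have h: "0 < harg (\<xi> - of_real t)" "harg (\<xi> - of_real t) < pi" using harg_bounds[of "\<xi> - of_real t"] that by auto
    have "cmod (of_real (harg (\<xi> - of_real t) / pi) * (l - r)) \<le> 1 * cmod (l - r)"
      unfolding norm_mult using h by (intro mult_right_mono) (auto simp: norm_divide)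
    then have "cmod (jump_model l r t \<xi>) \<le> cmod r + cmod (l - r)"
      unfolding jump_model_def using norm_triangle_ineq[of r "of_real (harg (\<xi> - of_real t) / pi) * (l - r)"] by linarith
    then show ?thesis using M0(2) that norm_triangle_ineq4[of "ft \<xi>" "jump_model l r t \<xi>"] unfolding D_def M_def by force
  qed
  have Dlim: "\<forall>\<^sub>F \<xi> in at (of_real s) within HH. cmod (D \<xi>) < \<epsilon>" if s: "\<bar>s - t\<bar> < L" "s \<notin> insert t E0" for s
  proof -
    have st: "s \<noteq> t" "s \<notin> E0" using s by auto
    have "((\<lambda>\<xi>. D \<xi>) \<longlongrightarrow> Fb s - (r + of_real ((if s > t then 0 else pi) / pi) * (l - r))) (at (of_real s) within HH)"
      unfolding D_def jump_model_def using harg_tendsto[OF st(1)] tendsto_Fb[OF st(2)]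
      by (intro tendsto_intros) auto
    moreover have "cmod (Fb s - (r + of_real ((if s > t then 0 else pi) / pi) * (l - r))) < \<epsilon>"
      using d1(2)[of s] d2(2)[of s] s st by (cases "s > t") (auto simp: dist_norm L_def)
    ultimately show ?thesis using order_tendstoD(2)[OF tendsto_norm] by blast
  qed
  have key: "Re (H z) \<le> \<epsilon> + M * Re (barrier t L z)"
    if H: "H holomorphic_on HH" "\<And>\<xi>. Im \<xi> > 0 \<Longrightarrow> Re (H \<xi>) \<le> cmod (D \<xi>)" and z: "z \<in> hbox t L" for H z
  proof -
    have "Re (H z - of_real \<epsilon>) \<le> M * Re (barrier t L z)"
    proof (rule Re_le_barrier_countable[OF L _ M _ _ _ z, where E = "insert t E0"])
      show "(\<lambda>z. H z - of_real \<epsilon>) holomorphic_on hbox t L"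
        using H(1) hbox_subset_HH holomorphic_on_subset by (intro holomorphic_intros) blast
      show "Re (H x - of_real \<epsilon>) \<le> M" if "x \<in> hbox t L" for x
      proof -
        have "Im x > 0" using that by (simp add: hbox_def)
        then show ?thesis using H(2)[of x] DM[of x] \<epsilon> by simp
      qed
      show "countable (insert t E0)" using countable_E0 by simp
      fix s \<eta> :: real assume s: "\<bar>s - t\<bar> < L" "s \<notin> insert t E0" and "\<eta> > 0"
      have "\<forall>\<^sub>F z in at (of_real s) within HH. z \<in> HH" by (simp add: eventually_at_filter)
      then show "\<forall>\<^sub>F z in at (of_real s) within HH. Re (H z - of_real \<epsilon>) < \<eta>"
        using Dlim[OF s]
      proof eventually_elim
        fix x assume "x \<in> HH" "cmod (D x) < \<epsilon>"
        then show "Re (H x - of_real \<epsilon>) < \<eta>" using H(2)[of x] \<open>\<eta> > 0\<close> by simp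
      qed
    qed
    then show ?thesis by simp
  qed
  have bound: "cmod (D z) \<le> 2 * \<epsilon> + 2 * M * Re (barrier t L z)" if z: "z \<in> hbox t L" for z
  proof -
    have Imz: "Im z > 0" using z by (simp add: hbox_def)
    \<comment> \<open>A holomorphic function whose real part is a multiple of the argument at
      \<open>t\<close>; subtracting it makes both coordinates of \<open>D\<close> real parts of
      holomorphic functions.\<close>
    define W where "W c \<xi> = of_real (c / pi) * (of_real (pi / 2) - \<i> * Ln (- \<i> * (\<xi> - of_real t)))" for c \<xi>
    have holW: "W c holomorphic_on HH" for c
      unfolding W_def by (intro holomorphic_intros harg_holomorphic)
    have ReW: "Re (W c \<xi>) = c / pi * harg (\<xi> - of_real t)" for c \<xi>
      unfolding W_def harg_eq by simp
    have ReD: "Re (D \<xi>) = Re (Ut \<xi> - of_real (Re r) - W (Re (l - r)) \<xi>)"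
      "Im (D \<xi>) = Re (Vt \<xi> - of_real (Im r) - W (Im (l - r)) \<xi>)" if "Im \<xi> > 0" for \<xi>
      using that by (auto simp: D_def jump_model_def ft_eq ReW)
    define H1 H2 where "H1 \<xi> = Ut \<xi> - of_real (Re r) - W (Re (l - r)) \<xi>"
      and "H2 \<xi> = Vt \<xi> - of_real (Im r) - W (Im (l - r)) \<xi>" for \<xi>
    have hol12: "H1 holomorphic_on HH" "H2 holomorphic_on HH"
      unfolding H1_def H2_def by (intro holomorphic_intros hol_t holW)+
    have hol12': "(\<lambda>\<xi>. - H1 \<xi>) holomorphic_on HH" "(\<lambda>\<xi>. - H2 \<xi>) holomorphic_on HH"
      by (intro holomorphic_on_minus hol12)+
    note ReD = ReD[folded H1_def H2_def]
    have re: "Re (H1 \<xi>) \<le> cmod (D \<xi>)" "Re (- H1 \<xi>) \<le> cmod (D \<xi>)"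
       "Re (H2 \<xi>) \<le> cmod (D \<xi>)" "Re (- H2 \<xi>) \<le> cmod (D \<xi>)" if "Im \<xi> > 0" for \<xi>
      using abs_Re_le_cmod[of "D \<xi>"] abs_Im_le_cmod[of "D \<xi>"] unfolding ReD[OF that] uminus_complex.sel by linarith+
    have "Re (H1 z) \<le> \<epsilon> + M * Re (barrier t L z)" by (rule key[OF hol12(1) re(1) z])
    moreover have "Re (- H1 z) \<le> \<epsilon> + M * Re (barrier t L z)" by (rule key[OF hol12'(1) re(2) z])
    moreover have "Re (H2 z) \<le> \<epsilon> + M * Re (barrier t L z)" by (rule key[OF hol12(2) re(3) z])
    moreover have "Re (- H2 z) \<le> \<epsilon> + M * Re (barrier t L z)" by (rule key[OF hol12'(2) re(4) z])
    ultimately have "\<bar>Re (D z)\<bar> \<le> \<epsilon> + M * Re (barrier t L z)" "\<bar>Im (D z)\<bar> \<le> \<epsilon> + M * Re (barrier t L z)"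
      unfolding ReD[OF Imz] by (auto simp: abs_le_iff)
    then show ?thesis using cmod_le[of "D z"] by linarith
  qed
  have "((\<lambda>z. 2 * \<epsilon> + 2 * M * Re (barrier t L z)) \<longlongrightarrow> 2 * \<epsilon> + 2 * M * 0) (at (of_real t) within HH)"
    by (intro tendsto_intros tendsto_Re_barrier L)
  moreover have "2 * \<epsilon> + 2 * M * 0 < e" using e by (simp add: \<epsilon>_def)
  ultimately have "\<forall>\<^sub>F z in at (of_real t) within HH. 2 * \<epsilon> + 2 * M * Re (barrier t L z) < e"
    by (rule order_tendstoD(2))
  then show "\<forall>\<^sub>F x in at (of_real t) within HH. dist (ft x - jump_model l r t x) 0 < e"
    using eventually_hbox[OF L, of t]
  proof eventually_elim
    fix x assume "2 * \<epsilon> + 2 * M * Re (barrier t L x) < e" "x \<in> hbox t L"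
    then show "dist (ft x - jump_model l r t x) 0 < e" using bound[of x] unfolding D_def by simp
  qed
qed

end

section \<open>Jumps, the boundary function and the collapse of a segment\<close>

lemma cis_real_representative:
  obtains s where "cis s = cis t'" "t \<le> s" "s < t + 2 * pi"
proof -
  define k where "k = \<lfloor>(t' - t) / (2 * pi)\<rfloor>"
  have "of_int k \<le> (t' - t) / (2 * pi)" "(t' - t) / (2 * pi) < of_int k + 1" unfolding k_def by linarith+
  then have "2 * pi * k \<le> t' - t" "t' - t < 2 * pi * k + 2 * pi" by (auto simp: field_simps)
  moreover have "cis (t' - 2 * pi * k) = cis t'"
  proof -
    have "cis (t' - 2 * pi * k) = cis t' / cis (2 * pi * k)" by (rule cis_divide[symmetric])
    moreover have "cis (2 * pi * k) = 1" by (rule cis_multiple_2pi) simp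
    ultimately show ?thesis by simp
  qed
  ultimately show ?thesis by (intro that[of "t' - 2 * pi * k"]) auto
qed

lemma unit_circle_cis: "cmod \<zeta> = 1 \<Longrightarrow> \<exists>t. \<zeta> = cis t"
  by (intro exI[of _ "Arg \<zeta>"]) (subst cis_Arg, auto simp: sgn_div_norm)

lemma dense_one_sided:
  fixes E :: "real set"
  assumes "countable E"
  shows "at t within {s. s > t \<and> s \<notin> E} \<noteq> bot" "at t within {s. s < t \<and> s \<notin> E} \<noteq> bot"
proof -
  have ex: "\<exists>x. a < x \<and> x < b \<and> x \<notin> E" if "a < b" for a b
  proof (rule ccontr)
    assume "\<not> ?thesis"
    then have "{a<..<b} \<subseteq> E" by auto
    then have "countable {a<..<b}" using assms countable_subset by blast
    then show False using uncountable_open_interval \<open>a < b\<close> by blast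
  qed
  have "t islimpt {s. s > t \<and> s \<notin> E}" unfolding islimpt_approachable dist_real_def
  proof (intro allI impI)
    fix e :: real assume "e > 0"
    then obtain x where "t < x" "x < t + e" "x \<notin> E" using ex[of t "t + e"] by auto
    then show "\<exists>x'\<in>{s. s > t \<and> s \<notin> E}. x' \<noteq> t \<and> \<bar>x' - t\<bar> < e" by (intro bexI[of _ x]) auto
  qed
  moreover have "t islimpt {s. s < t \<and> s \<notin> E}" unfolding islimpt_approachable dist_real_def
  proof (intro allI impI)
    fix e :: real assume "e > 0"
    then obtain x where "t - e < x" "x < t" "x \<notin> E" using ex[of "t - e" t] by auto
    then show "\<exists>x'\<in>{s. s < t \<and> s \<notin> E}. x' \<noteq> t \<and> \<bar>x' - t\<bar> < e" by (intro bexI[of _ x]) auto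
  qed
  ultimately show "at t within {s. s > t \<and> s \<notin> E} \<noteq> bot" "at t within {s. s < t \<and> s \<notin> E} \<noteq> bot"
    by (simp_all add: trivial_limit_within)
qed

lemma Im_eq_sin_harg:
  assumes "Im x > 0" shows "Im x = cmod x * sin (harg x)"
proof -
  have ne: "- \<i> * x \<noteq> 0" using assms by auto
  have "- \<i> * x = exp (Ln (- \<i> * x))" using ne by simp
  then have "Re (- \<i> * x) = exp (Re (Ln (- \<i> * x))) * cos (Im (Ln (- \<i> * x)))"
    by (metis Re_exp)
  moreover have "exp (Re (Ln (- \<i> * x))) = cmod x" using ne by (simp add: norm_mult)
  moreover have "cos (Im (Ln (- \<i> * x))) = sin (harg x)"
    by (simp add: harg_def sin_add)
  ultimately show ?thesis by simp
qed

context harmonic_jordan_map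
begin

text \<open>If \<open>l\<close> and \<open>r\<close> agreed, the jump model would be constant and
  \<open>ft\<close> would converge at \<open>t\<close>. The model takes its values on the segment
  from \<open>l\<close> to \<open>r\<close>, which therefore contains the cluster set; conversely
  the cluster set is connected and contains both ends as limits of boundary values.\<close>

lemma E0_jump:
  assumes "t \<in> E0"
  obtains l r where "l \<in> frontier \<Omega>" "r \<in> frontier \<Omega>" "l \<noteq> r"
    "(Fb \<longlongrightarrow> r) (at t within {s. s > t \<and> s \<notin> E0})" "(Fb \<longlongrightarrow> l) (at t within {s. s < t \<and> s \<notin> E0})"
    "cl t = closed_segment l r"
proof -
  note ne = dense_one_sided[OF countable_E0, of t]
  obtain r where r: "r \<in> frontier \<Omega>" "(Fb \<longlongrightarrow> r) (at t within {s. s > t \<and> s \<notin> E0})"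
    using one_sided_limit[OF ne(1)] by blast
  obtain l where l: "l \<in> frontier \<Omega>" "(Fb \<longlongrightarrow> l) (at t within {s. s < t \<and> s \<notin> E0})"
    using one_sided_limit[OF ne(2)] by blast
  have asy: "((\<lambda>\<xi>. ft \<xi> - jump_model l r t \<xi>) \<longlongrightarrow> 0) (at (of_real t) within HH)"
    by (rule asymptotic_jump[OF r(2) l(2)])
  have "l \<noteq> r"
  proof
    assume "l = r"
    then have "(ft \<longlongrightarrow> r) (at (of_real t) within HH)" using LIM_zero_cancel[of ft r] asy by (simp add: jump_model_def)
    then show False using notin_E0_if_tendsto assms by blast
  qed
  have in_cl: "z \<in> cl t" if ne: "at t within S \<noteq> bot" and S: "S \<inter> E0 = {}" and z: "(Fb \<longlongrightarrow> z) (at t within S)" for S z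
  proof -
    have "t islimpt S" using ne by (simp add: trivial_limit_within)
    then obtain s where s: "\<And>n. s n \<in> S - {t}" "s \<longlonglongrightarrow> t" unfolding islimpt_sequential by blast
    have "filterlim s (at t within S) sequentially"
      unfolding filterlim_at using s by (auto intro!: always_eventually)
    then have "(\<lambda>n. Fb (s n)) \<longlonglongrightarrow> z" using filterlim_compose[OF z] by blast
    moreover have "s n \<notin> E0" for n using s(1)[of n] S by blast
    ultimately show ?thesis using limit_of_Fb_in_cl s(2) by blast
  qed
  have rl: "r \<in> cl t" "l \<in> cl t" using in_cl[OF ne(1) _ r(2)] in_cl[OF ne(2) _ l(2)] by blast+
  have sub: "cl t \<subseteq> closed_segment l r"
  proof
    fix z assume z: "z \<in> cl t"
    have "infdist z (closed_segment l r) \<le> 0"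
    proof (rule field_le_epsilon)
      fix e :: real assume "e > 0"
      define e2 where "e2 = e / 2"
      have e2: "e2 > 0" using \<open>e > 0\<close> by (simp add: e2_def)
      obtain d where d: "d > 0" "\<And>\<xi>. Im \<xi> > 0 \<Longrightarrow> \<xi> \<noteq> of_real t \<Longrightarrow> dist \<xi> (of_real t) < d \<Longrightarrow> dist (ft \<xi> - jump_model l r t \<xi>) 0 < e2"
        using tendstoD[OF asy e2] unfolding eventually_at by auto
      obtain \<xi> where \<xi>: "Im \<xi> > 0" "dist \<xi> (of_real t) < min d e2" "dist (ft \<xi>) z < min d e2"
        using z[unfolded cl_iff, rule_format, of "min d e2"] d(1) e2 by auto
      have "\<xi> \<noteq> of_real t" using \<xi>(1) by auto
      then have 1: "cmod (ft \<xi> - jump_model l r t \<xi>) < e2" using d(2)[OF \<xi>(1)] \<xi>(2) by simp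
      define c where "c = harg (\<xi> - of_real t) / pi"
      have c: "0 \<le> c" "c \<le> 1" using harg_bounds[of "\<xi> - of_real t"] \<xi>(1) by (auto simp: c_def)
      have "jump_model l r t \<xi> = (1 - (1 - c)) *\<^sub>R l + (1 - c) *\<^sub>R r"
        unfolding jump_model_def c_def[symmetric] by (simp add: scaleR_conv_of_real algebra_simps)
      then have "jump_model l r t \<xi> \<in> closed_segment l r"
        unfolding in_segment using c by (intro exI[of _ "1 - c"]) auto
      then have "infdist z (closed_segment l r) \<le> dist z (jump_model l r t \<xi>)" by (rule infdist_le)
      also have "\<dots> \<le> dist (ft \<xi>) z + dist (ft \<xi>) (jump_model l r t \<xi>)" by (rule dist_triangle3)
      also have "\<dots> \<le> 0 + e" using 1 \<xi>(3) by (simp add: dist_norm e2_def)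
      finally show "infdist z (closed_segment l r) \<le> 0 + e" .
    qed
    then have "infdist z (closed_segment l r) = 0" using infdist_nonneg[of z "closed_segment l r"] by linarith
    then show "z \<in> closed_segment l r" by (simp add: in_closed_iff_infdist_zero)
  qed
  have "cl t = closed_segment l r" by (rule connected_subset_segment_eq[OF connected_cl sub rl(2,1)])
  then show ?thesis using that[OF l(1) r(1) \<open>l \<noteq> r\<close> r(2) l(2)] by blast
qed

lemma E0_mod: "cis s = cis t \<Longrightarrow> s \<in> E0 \<longleftrightarrow> t \<in> E0"
  by (simp add: E0_def)

lemma in_cis_E0: "cis s \<in> cis ` E0 \<longleftrightarrow> s \<in> E0"
  using E0_mod by blast

text \<open>Continuity off the jumps comes from the unrestricted limits: near \<zeta> all values of
  \<open>f\<close> in the disc are close to \<open>bF \<zeta>\<close>, and so are their limits at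
  neighbouring boundary points.\<close>

lemma is_boundary_function_bF: "is_boundary_function \<Omega> f (cis ` E0) bF"
  unfolding is_boundary_function_def
proof (intro conjI ballI)
  show "countable (cis ` E0)" using countable_E0 by simp
  show "cis ` E0 \<subseteq> sphere 0 1" by auto
  have rep: "\<exists>t. \<zeta> = cis t" if "\<zeta> \<in> sphere 0 1" for \<zeta> :: complex
    using that unit_circle_cis[of \<zeta>] by simp
  show "(f \<longlongrightarrow> bF \<zeta>) (at \<zeta> within ball 0 1)" "bF \<zeta> \<in> frontier \<Omega>" if \<zeta>: "\<zeta> \<in> sphere 0 1 - cis ` E0" for \<zeta>
  proof -
    obtain t where t: "\<zeta> = cis t" using rep[of \<zeta>] \<zeta> by blast
    then have "t \<notin> E0" using \<zeta> by blast
    then show "(f \<longlongrightarrow> bF \<zeta>) (at \<zeta> within ball 0 1)" "bF \<zeta> \<in> frontier \<Omega>"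
      using tendsto_Fb[of t] tendsto_ft_iff Fb_in_frontier[of t] t by auto
  qed
  note lim = this
  show "continuous_on (sphere 0 1 - cis ` E0) bF"
    unfolding continuous_on_iff
  proof (intro ballI allI impI)
    fix \<zeta> e assume \<zeta>: "\<zeta> \<in> sphere 0 1 - cis ` E0" and e: "(e::real) > 0"
    have e2: "e / 2 > 0" using e by simp
    obtain d where d: "d > 0" "\<And>w. w \<in> ball 0 1 \<Longrightarrow> w \<noteq> \<zeta> \<Longrightarrow> dist w \<zeta> < d \<Longrightarrow> dist (f w) (bF \<zeta>) < e / 2"
      using tendstoD[OF lim(1)[OF \<zeta>] e2] unfolding eventually_at by blast
    show "\<exists>d>0. \<forall>x'\<in>sphere 0 1 - cis ` E0. dist x' \<zeta> < d \<longrightarrow> dist (bF x') (bF \<zeta>) < e"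
    proof (intro exI[of _ "d / 2"] conjI ballI impI)
      fix \<eta> assume \<eta>: "\<eta> \<in> sphere 0 1 - cis ` E0" "dist \<eta> \<zeta> < d / 2"
      obtain t where t: "\<eta> = cis t" using rep[of \<eta>] \<eta> by blast
      have nt: "at \<eta> within ball 0 1 \<noteq> bot"
        using filterlim_exp[of t] at_within_HH_nontrivial[of t] unfolding t filterlim_def
        by (auto simp: bot_unique filtermap_bot_iff)
      have "\<forall>\<^sub>F w in at \<eta> within ball 0 1. dist w \<eta> < d / 2"
        unfolding eventually_at using d(1) by (intro exI[of _ "d / 2"]) auto
      moreover have "\<forall>\<^sub>F w in at \<eta> within ball 0 1. w \<in> ball 0 1" by (simp add: eventually_at_filter)
      ultimately have "\<forall>\<^sub>F w in at \<eta> within ball 0 1. dist (f w) (bF \<zeta>) \<le> e / 2"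
      proof eventually_elim
        fix w assume w: "dist w \<eta> < d / 2" "w \<in> ball 0 1"
        have "w \<noteq> \<zeta>" using w(2) \<zeta> by auto
        moreover have "dist w \<zeta> < d" using w(1) \<eta>(2) dist_triangle[of w \<zeta> \<eta>] by linarith
        ultimately show "dist (f w) (bF \<zeta>) \<le> e / 2" using d(2)[of w] w(2) by auto
      qed
      moreover have "((\<lambda>w. dist (f w) (bF \<zeta>)) \<longlongrightarrow> dist (bF \<eta>) (bF \<zeta>)) (at \<eta> within ball 0 1)"
        by (intro tendsto_intros lim(1) \<eta>)
      ultimately have "dist (bF \<eta>) (bF \<zeta>) \<le> e / 2" using nt tendsto_upperbound by blast
      then show "dist (bF \<eta>) (bF \<zeta>) < e" using e by linarith
    qed (use d in auto)
  qed
  show "\<exists>l r. l \<in> frontier \<Omega> \<and> r \<in> frontier \<Omega> \<and> l \<noteq> r \<and>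
      ((\<lambda>s::real. bF (\<zeta> * cis s)) \<longlongrightarrow> l) (at 0 within {s. s > 0 \<and> \<zeta> * cis s \<notin> cis ` E0}) \<and>
      ((\<lambda>s::real. bF (\<zeta> * cis s)) \<longlongrightarrow> r) (at 0 within {s. s < 0 \<and> \<zeta> * cis s \<notin> cis ` E0})"
    if \<zeta>: "\<zeta> \<in> cis ` E0" for \<zeta>
  proof -
    obtain t where t: "t \<in> E0" "\<zeta> = cis t" using \<zeta> by blast
    obtain l r where lr: "l \<in> frontier \<Omega>" "r \<in> frontier \<Omega>" "l \<noteq> r"
      "(Fb \<longlongrightarrow> r) (at t within {s. s > t \<and> s \<notin> E0})" "(Fb \<longlongrightarrow> l) (at t within {s. s < t \<and> s \<notin> E0})"
      "cl t = closed_segment l r" by (rule E0_jump[OF t(1)])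
    have eq: "\<zeta> * cis s = cis (t + s)" for s by (simp add: t cis_mult)
    have sh: "filterlim (\<lambda>s. t + s) (at t within B) (at 0 within A)" if "\<And>s. s \<in> A \<Longrightarrow> s \<noteq> 0 \<Longrightarrow> t + s \<in> B" for A B :: "real set"
      unfolding filterlim_at
    proof
      have "((\<lambda>s. t + s) \<longlongrightarrow> t + 0) (at 0 within A)" by (intro tendsto_intros)
      then show "((\<lambda>s. t + s) \<longlongrightarrow> t) (at 0 within A)" by simp
      show "\<forall>\<^sub>F x in at 0 within A. t + x \<in> B \<and> t + x \<noteq> t" using that by (auto simp: eventually_at_filter)
    qed
    show ?thesis
    \<comment> \<open>The first witness in \<open>is_boundary_function\<close> is the limit for
      positive parameters, which is \<open>r\<close> here.\<close>
    proof (rule exI[of _ r], rule exI[of _ l], intro conjI)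
      show "((\<lambda>s::real. bF (\<zeta> * cis s)) \<longlongrightarrow> r) (at 0 within {s. s > 0 \<and> \<zeta> * cis s \<notin> cis ` E0})"
        unfolding eq in_cis_E0 by (rule filterlim_compose[OF lr(4) sh]) auto
      show "((\<lambda>s::real. bF (\<zeta> * cis s)) \<longlongrightarrow> l) (at 0 within {s. s < 0 \<and> \<zeta> * cis s \<notin> cis ` E0})"
        unfolding eq in_cis_E0 by (rule filterlim_compose[OF lr(5) sh]) auto
    qed (use lr in auto)
  qed
qed

lemma boundary_limit_point:
  assumes w: "\<And>n. w n \<in> ball 0 1" and p: "(\<lambda>n. f (w n)) \<longlonglongrightarrow> p" "p \<in> frontier \<Omega>"
  obtains t \<rho> where "p \<in> cl t" "strict_mono (\<rho> :: nat \<Rightarrow> nat)" "(w \<circ> \<rho>) \<longlonglongrightarrow> cis t"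
proof -
  have "compact (cball (0::complex) 1)" by simp
  moreover have wn: "\<forall>n. w n \<in> cball 0 1"
  proof
    fix n show "w n \<in> cball 0 1" using w[of n] by simp
  qed
  ultimately have "\<exists>l\<in>cball 0 1. \<exists>\<rho>. strict_mono (\<rho> :: nat \<Rightarrow> nat) \<and> (w \<circ> \<rho>) \<longlonglongrightarrow> l"
    unfolding compact_def by (elim allE[of _ w] impE) blast+
  then obtain \<zeta> \<rho> where \<rho>: "\<zeta> \<in> cball 0 1" "strict_mono (\<rho> :: nat \<Rightarrow> nat)" "(w \<circ> \<rho>) \<longlonglongrightarrow> \<zeta>" by blast
  have p': "(\<lambda>n. f ((w \<circ> \<rho>) n)) \<longlonglongrightarrow> p" using LIMSEQ_subseq_LIMSEQ[OF p(1) \<rho>(2)] by (simp add: o_def)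
  have "\<zeta> \<notin> ball 0 1"
  proof
    assume z: "\<zeta> \<in> ball 0 1"
    have "isCont f \<zeta>" using cont_f z by (meson continuous_on_eq_continuous_at open_ball)
    then have "(\<lambda>n. f ((w \<circ> \<rho>) n)) \<longlonglongrightarrow> f \<zeta>" using \<rho>(3) by (rule isCont_tendsto_compose)
    then have "p = f \<zeta>" using p' LIMSEQ_unique by blast
    then show False using z img frontier_notin[OF p(2)] by blast
  qed
  then have "cmod \<zeta> = 1" using \<rho>(1) by simp
  then obtain t where t: "\<zeta> = cis t" using unit_circle_cis[of \<zeta>] by blast
  have "p \<in> cl t" unfolding cluster_set_def
    using w \<rho>(3) p' t by (auto intro!: exI[of _ "w \<circ> \<rho>"])
  then show ?thesis using that[OF _ \<rho>(2)] \<rho>(3) t by blast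
qed

lemma cluster_point_exists:
  assumes "p \<in> frontier \<Omega>" obtains t where "p \<in> cl t"
proof -
  have "p \<in> closure \<Omega>" using assms by (simp add: frontier_def)
  then obtain z where z: "\<And>n. z n \<in> \<Omega>" "z \<longlonglongrightarrow> p" unfolding closure_sequential by blast
  have "\<exists>w\<in>ball 0 1. f w = z n" for n using z(1)[of n] img by (metis image_iff)
  then obtain w where w: "\<And>n. w n \<in> ball 0 1" "\<And>n. f (w n) = z n" by metis
  obtain t \<rho> where "p \<in> cl t" "strict_mono (\<rho> :: nat \<Rightarrow> nat)" "(w \<circ> \<rho>) \<longlonglongrightarrow> cis t"
    by (rule boundary_limit_point[OF w(1) _ assms]) (use w(2) z(2) in simp)
  then show ?thesis using that by blast
qed

text \<open>The ends \<open>l\<close> and \<open>r\<close> are limits of boundary values that avoid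
  the open segment, hence they lie outside it, because the remaining boundary is closed. The segment
  from \<open>l\<close> to \<open>r\<close> passes through \<open>p\<close> and consists of boundary
  points, so near \<open>p\<close> it runs inside \<open>open_segment a b\<close> and is collinear
  with it. Having its ends outside, it covers the whole of it.\<close>

lemma jump_segment_covers:
  assumes I: "open_segment a b \<subseteq> frontier \<Omega>" "a \<noteq> b"
    and avoid: "\<And>s. s \<notin> E0 \<Longrightarrow> Fb s \<notin> open_segment a b"
    and p: "p \<in> open_segment a b" "p \<in> cl t"
  shows "t \<in> E0 \<and> open_segment a b \<subseteq> cl t"
proof
  let ?I = "open_segment a b"
  show tE: "t \<in> E0"
  proof (rule ccontr)
    assume "t \<notin> E0"
    then show False using cl_eq_Fb[of t] avoid[of t] p by auto
  qed
  obtain l r where lr: "l \<in> frontier \<Omega>" "r \<in> frontier \<Omega>" "l \<noteq> r"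
      "(Fb \<longlongrightarrow> r) (at t within {s. s > t \<and> s \<notin> E0})" "(Fb \<longlongrightarrow> l) (at t within {s. s < t \<and> s \<notin> E0})"
      "cl t = closed_segment l r" by (rule E0_jump[OF tE])
  define K where "K = frontier \<Omega> - ?I"
  have clK: "closed K" unfolding K_def dom(3)
    by (rule closed_loop_minus_open_segment[OF loop I(1)[unfolded dom(3)] I(2)])
  have FK: "Fb s \<in> K" if "s \<notin> E0" for s using Fb_in_frontier[OF that] avoid[OF that] by (simp add: K_def)
  note ne = dense_one_sided[OF countable_E0, of t]
  have "\<forall>\<^sub>F s in at t within {s. s > t \<and> s \<notin> E0}. Fb s \<in> K"
    using FK by (auto simp: eventually_at_filter)
  then have rK: "r \<in> K" using Lim_in_closed_set[OF clK _ ne(1) lr(4)] by blast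
  have "\<forall>\<^sub>F s in at t within {s. s < t \<and> s \<notin> E0}. Fb s \<in> K"
    using FK by (auto simp: eventually_at_filter)
  then have lK: "l \<in> K" using Lim_in_closed_set[OF clK _ ne(2) lr(5)] by blast
  obtain v where v: "0 \<le> v" "v \<le> 1" "p = (1 - v) *\<^sub>R l + v *\<^sub>R r" using p(2) lr(6) by (auto simp: in_segment)
  have "v \<noteq> 0" "v \<noteq> 1" using v p(1) lK rK by (auto simp: K_def)
  then have v01: "0 < v" "v < 1" using v by auto
  have "p \<notin> K" using p(1) by (simp add: K_def)
  then obtain e where e: "e > 0" "ball p e \<subseteq> - K" using clK open_Compl openE by (metis ComplI)
  \<comment> \<open>The step to a second point \<open>p'\<close> of the cluster segment, short
    enough to remain in the ball that meets no other boundary; two common points fix the direction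
    of \<open>r - l\<close>.\<close>
  define s where "s = min (1 - v) (e / (2 * cmod (r - l)))"
  have nrl: "cmod (r - l) > 0" using lr(3) by simp
  have s: "0 < s" "s \<le> 1 - v" "s * cmod (r - l) < e"
  proof -
    show "0 < s" "s \<le> 1 - v" using v01 e nrl by (auto simp: s_def)
    have "s * cmod (r - l) \<le> e / (2 * cmod (r - l)) * cmod (r - l)" using nrl by (intro mult_right_mono) (auto simp: s_def)
    also have "\<dots> = e / 2" using nrl by simp
    finally show "s * cmod (r - l) < e" using e by simp
  qed
  define p' where "p' = p + s *\<^sub>R (r - l)"
  have "p' = (1 - (v + s)) *\<^sub>R l + (v + s) *\<^sub>R r" unfolding p'_def v(3) by (simp add: algebra_simps)
  then have "p' \<in> closed_segment l r" unfolding in_segment using v s by (intro exI[of _ "v + s"]) auto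
  then have "p' \<in> frontier \<Omega>" using lr(6) cl_subset_frontier by blast
  moreover have "p' \<in> ball p e" using s by (simp add: p'_def dist_norm)
  ultimately have p'I: "p' \<in> ?I" using e(2) by (auto simp: K_def)
  obtain u where u: "p = (1 - u) *\<^sub>R a + u *\<^sub>R b" "0 < u" "u < 1" using p(1) by (auto simp: in_segment)
  obtain u' where u': "p' = (1 - u') *\<^sub>R a + u' *\<^sub>R b" using p'I by (auto simp: in_segment)
  define m where "m = (u' - u) / s"
  have "s *\<^sub>R (r - l) = p' - p" by (simp add: p'_def)
  also have "\<dots> = (u' - u) *\<^sub>R (b - a)" unfolding u(1) u' by (simp add: algebra_simps)
  finally have "(1 / s) *\<^sub>R (s *\<^sub>R (r - l)) = (1 / s) *\<^sub>R ((u' - u) *\<^sub>R (b - a))" by simp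
  then have rl: "r - l = m *\<^sub>R (b - a)" using s(1) by (simp add: m_def)
  have pl: "p - l = v *\<^sub>R (r - l)" unfolding v(3) by (simp add: algebra_simps)
  \<comment> \<open>\<open>ul\<close> and \<open>ur\<close> are the affine coordinates of
    \<open>l\<close> and \<open>r\<close> on the line with \<open>a\<close> at 0 and
    \<open>b\<close> at 1. Both lie outside the open unit interval and enclose the coordinate
    \<open>u\<close> of \<open>p\<close>, so they lie on opposite sides of the interval.\<close>
  define ul where "ul = u - v * m"
  define ur where "ur = ul + m"
  have "l = p - v *\<^sub>R (r - l)" using pl by (simp add: algebra_simps)
  then have l: "l = (1 - ul) *\<^sub>R a + ul *\<^sub>R b" unfolding rl u(1) ul_def by (simp add: algebra_simps)
  have "r = l + m *\<^sub>R (b - a)" using rl by (simp add: algebra_simps)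
  then have r: "r = (1 - ur) *\<^sub>R a + ur *\<^sub>R b" unfolding l ur_def by (simp add: algebra_simps)
  have nI: "\<not> (0 < x \<and> x < 1)" if "(1 - x) *\<^sub>R a + x *\<^sub>R b \<in> K" for x
    using that I(2) by (auto simp: K_def in_segment)
  have nul: "\<not> (0 < ul \<and> ul < 1)" "\<not> (0 < ur \<and> ur < 1)" using nI lK rK l r by auto
  have uu: "u = (1 - v) * ul + v * ur" by (simp add: ul_def ur_def algebra_simps)
  have hull: "\<exists>w. 0 \<le> w \<and> w \<le> 1 \<and> x = (1 - w) * ul + w * ur" if x: "0 < x" "x < 1" for x
  proof (cases "ul \<le> 0")
    case True
    have "ur > 0"
    proof (rule ccontr)
      assume "\<not> ur > 0"
      then have "(1 - v) * ul \<le> 0" "v * ur \<le> 0" using True v01 by (auto simp: mult_le_0_iff)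
      then show False using uu u by linarith
    qed
    then have "ur \<ge> 1" using nul by auto
    then have h: "0 \<le> (x - ul) / (ur - ul)" "(x - ul) / (ur - ul) \<le> 1" "ur - ul \<noteq> 0"
      using True x by (auto simp: field_simps)
    have "k * (ur - ul) = x - ul \<Longrightarrow> x = (1 - k) * ul + k * ur" for k by (simp add: algebra_simps)
    from this[of "(x - ul) / (ur - ul)"] show ?thesis using h by auto
  next
    case False
    then have ul: "ul \<ge> 1" using nul by auto
    have "ur < 1"
    proof (rule ccontr)
      assume "\<not> ur < 1"
      then have "(1 - v) * ul \<ge> (1 - v) * 1" "v * ur \<ge> v * 1" using ul v01 by (auto intro!: mult_left_mono)
      then show False using uu u by (simp add: algebra_simps)
    qed
    then have "ur \<le> 0" using nul by auto
    then have h: "0 \<le> (ul - x) / (ul - ur)" "(ul - x) / (ul - ur) \<le> 1" "ul - ur \<noteq> 0"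
      using ul x by (auto simp: field_simps)
    have "k * (ul - ur) = ul - x \<Longrightarrow> x = (1 - k) * ul + k * ur" for k by (simp add: algebra_simps)
    from this[of "(ul - x) / (ul - ur)"] show ?thesis using h by auto
  qed
  show "?I \<subseteq> cl t"
  proof
    fix z assume "z \<in> ?I"
    then obtain x where x: "0 < x" "x < 1" "z = (1 - x) *\<^sub>R a + x *\<^sub>R b" by (auto simp: in_segment)
    obtain w where w: "0 \<le> w" "w \<le> 1" "x = (1 - w) * ul + w * ur" using hull[OF x(1,2)] by blast
    have "z = (1 - w) *\<^sub>R l + w *\<^sub>R r" unfolding x(3) w(3) l r by (simp add: algebra_simps)
    then show "z \<in> cl t" unfolding lr(6) in_segment using w by blast
  qed
qed

text \<open>Distinct points of the circle share at most two cluster points, whereas a nondegenerate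
  segment offers three.\<close>

lemma unique_collapse_point:
  assumes I: "open_segment a b \<subseteq> cl t1" "open_segment a b \<subseteq> cl t2" "a \<noteq> b"
  shows "cis t1 = cis t2"
proof (rule ccontr)
  assume ne: "cis t1 \<noteq> cis t2"
  obtain s where s: "cis s = cis t2" "t1 \<le> s" "s < t1 + 2 * pi" by (rule cis_real_representative)
  then have "t1 < s" using ne by (cases "s = t1") auto
  define P where "P u = (1 - u) *\<^sub>R a + u *\<^sub>R b" for u
  have Pne: "P u \<noteq> P v" if "u \<noteq> v" for u v
  proof
    assume "P u = P v"
    then have "(u - v) *\<^sub>R (b - a) = 0" by (simp add: P_def algebra_simps)
    then show False using I(3) that by simp
  qed
  have "P u \<in> cl t1 \<inter> cl s" if "0 < u" "u < 1" for u
  proof -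
    have "P u \<in> open_segment a b" unfolding in_segment P_def using that I(3) by blast
    then show ?thesis using I(1,2) s(1) by auto
  qed
  then show False
    using at_most_two_common_cluster_points[OF \<open>t1 < s\<close> s(3), of "P (1/4)" "P (1/2)" "P (3/4)"] Pne by auto
qed

text \<open>A boundary value inside the segment would, by the unrestricted limit and the isolation
  of the segment from the other boundary, put the cluster sets of all neighbouring parameters into
  the segment. Then \<open>Re (T (exp (\<i> * \<xi>)))\<close> would have infinite limits on an
  interval.\<close>

lemma boundary_values_avoid_infinity_segment:
  assumes T: "T holomorphic_on ball 0 1" "\<And>w. w \<in> ball 0 1 \<Longrightarrow> \<phi> (f w) = Re (T w)"
    and I: "open_segment a b \<subseteq> frontier \<Omega>" "a \<noteq> b"
    and inf: "tends_to_plus_infinity_on \<Omega> \<phi> (open_segment a b)"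
    and s: "s \<notin> E0"
  shows "Fb s \<notin> open_segment a b"
proof
  let ?I = "open_segment a b"
  assume sI: "Fb s \<in> ?I"
  define K where "K = frontier \<Omega> - ?I"
  have clK: "closed K" unfolding K_def dom(3)
    by (rule closed_loop_minus_open_segment[OF loop I(1)[unfolded dom(3)] I(2)])
  have "Fb s \<in> - K" using sI by (simp add: K_def)
  then obtain e where e: "e > 0" "ball (Fb s) e \<subseteq> - K" using clK open_Compl openE by metis
  have e2: "e / 2 > 0" using e by simp
  obtain d where d: "d > 0" "\<And>\<xi>. Im \<xi> > 0 \<Longrightarrow> \<xi> \<noteq> of_real s \<Longrightarrow> dist \<xi> (of_real s) < d \<Longrightarrow> dist (ft \<xi>) (Fb s) < e / 2"
    using tendstoD[OF tendsto_Fb[OF s] e2] unfolding eventually_at by auto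
  have clI: "cl t \<subseteq> ?I" if t: "\<bar>t - s\<bar> \<le> d / 2" for t
  proof
    fix q assume q: "q \<in> cl t"
    obtain \<xi> where \<xi>: "Im \<xi> > 0" "dist \<xi> (of_real t) < min (d/2) (e/2)" "dist (ft \<xi>) q < min (d/2) (e/2)"
      using q[unfolded cl_iff, rule_format, of "min (d/2) (e/2)"] d(1) e2 by auto
    have "dist (complex_of_real t) (of_real s) \<le> d / 2" using t by (simp add: dist_norm flip: of_real_diff)
    then have "dist \<xi> (of_real s) < d" using \<xi>(2) dist_triangle[of \<xi> "of_real s" "of_real t"] by linarith
    moreover have "\<xi> \<noteq> of_real s" using \<xi>(1) by auto
    ultimately have "dist (ft \<xi>) (Fb s) < e / 2" using d(2) \<xi>(1) by blast
    then have "dist (Fb s) q < e" using \<xi>(3) dist_triangle3[of "Fb s" q "ft \<xi>"] by linarith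
    then have "q \<notin> K" using e(2) by auto
    then show "q \<in> ?I" using q cl_subset_frontier by (auto simp: K_def)
  qed
  define Tt where "Tt \<xi> = T (exp (\<i> * \<xi>))" for \<xi>
  have "(T \<circ> (\<lambda>\<xi>. exp (\<i> * \<xi>))) holomorphic_on HH"
    using exp_in_ball by (auto intro!: holomorphic_on_compose_gen[OF _ T(1)] holomorphic_intros)
  then have holTt: "Tt holomorphic_on HH" by (simp add: Tt_def[abs_def] o_def)
  have Tt: "Re (Tt \<xi>) = \<phi> (ft \<xi>)" if "Im \<xi> > 0" for \<xi>
    unfolding Tt_def ft_def using T(2)[OF exp_in_ball[OF that]] by simp
  have "filterlim (\<lambda>z. Re (Tt z)) at_top (at (of_real t) within HH)" if t: "\<bar>t - s\<bar> \<le> d / 2" for t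
    unfolding filterlim_at_top_dense
  proof
    fix C
    have "\<forall>\<^sub>F \<xi> in at (of_real t) within HH. \<phi> (ft \<xi>) > C"
    proof (rule eventually_near_cl[where P = "\<lambda>z. \<phi> z > C"])
      fix p assume p: "p \<in> cl t"
      then have "p \<in> ?I" using clI[OF t] by blast
      then have "\<forall>\<^sub>F z in at p within \<Omega>. \<phi> z > C"
        using inf unfolding tends_to_plus_infinity_on_def filterlim_at_top_dense by blast
      then obtain \<epsilon> where \<epsilon>: "\<epsilon> > 0" "\<And>z. z \<in> \<Omega> \<Longrightarrow> z \<noteq> p \<Longrightarrow> dist z p < \<epsilon> \<Longrightarrow> \<phi> z > C"
        unfolding eventually_at by blast
      have "p \<notin> \<Omega>" using p cl_subset_frontier frontier_notin by blast
      then show "\<exists>\<epsilon>>0. \<forall>z\<in>\<Omega>. dist z p < \<epsilon> \<longrightarrow> \<phi> z > C" using \<epsilon> by blast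
    qed
    moreover have "\<forall>\<^sub>F z in at (complex_of_real t) within HH. z \<in> HH" by (simp add: eventually_at_filter)
    ultimately show "\<forall>\<^sub>F z in at (of_real t) within HH. Re (Tt z) > C"
      by eventually_elim (simp add: Tt)
  qed
  then show False using no_infinite_limit_on_interval[OF holTt, of "d / 2" s] d(1) by simp
qed

text \<open>By compactness, points whose values approach \<open>J\<close> accumulate only where the
  cluster set meets \<open>J\<close>. This makes the local analysis at the collapse point uniform:
  all points of \<Omega> near \<open>J\<close> have their preimages near \<zeta>.\<close>

lemma near_collapse_point:
  assumes J: "compact J" "J \<subseteq> frontier \<Omega>" "J \<noteq> {}"
    and uniq: "\<And>t. cl t \<inter> J \<noteq> {} \<Longrightarrow> cis t = \<zeta>" and "\<delta> > 0"
  shows "\<exists>\<eta>>0. \<forall>w\<in>ball 0 1. infdist (f w) J < \<eta> \<longrightarrow> dist w \<zeta> < \<delta>"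
proof (rule ccontr)
  assume neg: "\<not> ?thesis"
  have "\<exists>w\<in>ball 0 1. infdist (f w) J < inverse (real (Suc n)) \<and> \<not> dist w \<zeta> < \<delta>" for n
  proof (rule ccontr)
    assume "\<not> ?thesis"
    then show False using neg by (metis inverse_positive_iff_positive of_nat_0_less_iff zero_less_Suc)
  qed
  then obtain w where w: "\<And>n. w n \<in> ball 0 1" "\<And>n. infdist (f (w n)) J < inverse (real (Suc n))" "\<And>n. \<not> dist (w n) \<zeta> < \<delta>"
    by metis
  have "\<exists>x\<in>J. dist (f (w n)) x < inverse (real (Suc n))" for n
    using w(2) infdist_less_iff[OF J(1,3)] by blast
  then obtain x where x: "\<And>n. x n \<in> J" "\<And>n. dist (f (w n)) (x n) < inverse (real (Suc n))" by metis
  have "\<forall>n. x n \<in> J" using x(1) by blast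
  then have "\<exists>l\<in>J. \<exists>\<rho>. strict_mono (\<rho> :: nat \<Rightarrow> nat) \<and> (x \<circ> \<rho>) \<longlonglongrightarrow> l"
    using J(1) unfolding compact_def by (elim allE[of _ x] impE) blast+
  then obtain p \<rho> where \<rho>: "p \<in> J" "strict_mono (\<rho> :: nat \<Rightarrow> nat)" "(x \<circ> \<rho>) \<longlonglongrightarrow> p" by blast
  have "(\<lambda>n. f (w n) - x n) \<longlonglongrightarrow> 0"
    using x(2) by (intro LIMSEQ_norm_0) (simp add: dist_norm inverse_eq_divide)
  then have "((\<lambda>n. f (w n) - x n) \<circ> \<rho>) \<longlonglongrightarrow> 0" using \<rho>(2) by (rule LIMSEQ_subseq_LIMSEQ)
  from tendsto_add[OF this \<rho>(3)] have lim: "(\<lambda>n. f ((w \<circ> \<rho>) n)) \<longlonglongrightarrow> p" by (simp add: o_def)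
  have "p \<in> frontier \<Omega>" using \<rho>(1) J by blast
  moreover have "(w \<circ> \<rho>) n \<in> ball 0 1" for n using w(1)[of "\<rho> n"] by (simp only: o_apply)
  ultimately obtain t \<sigma> where t: "p \<in> cl t" "strict_mono (\<sigma> :: nat \<Rightarrow> nat)" "((w \<circ> \<rho>) \<circ> \<sigma>) \<longlonglongrightarrow> cis t"
    using boundary_limit_point[OF _ lim] by blast
  have "cis t = \<zeta>" using uniq[of t] t(1) \<rho>(1) by blast
  then have "\<forall>\<^sub>F n in sequentially. dist (((w \<circ> \<rho>) \<circ> \<sigma>) n) \<zeta> < \<delta>" using tendstoD[OF t(3) \<open>\<delta> > 0\<close>] by simp
  then obtain n where "dist (((w \<circ> \<rho>) \<circ> \<sigma>) n) \<zeta> < \<delta>" using eventually_happens'[OF sequentially_bot] by blast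
  then show False using w(3) by auto
qed

end

section \<open>Derivatives near the collapsed segment\<close>

text \<open>\<open>P\<close> and \<open>Y\<close> are the complex derivatives of the tangential and
  the normal coordinate, \<alpha> and \<beta> the derivatives of the height in these directions.
  Dividing by \<open>P\<close> gives a quadratic equation for \<open>m = p + \<i> * q\<close>. Since
  orientation excludes \<open>q = 0\<close>, its imaginary part is a linear relation, and with the
  real part it forces \<open>1 \<le> k\<^sup>2 * (1 + \<beta>\<^sup>2)\<close>: a small ratio means
  a steep normal slope. The linear relation also bounds \<alpha> squared by a multiple of
  \<open>k\<^sup>2 * (1 + \<beta>\<^sup>2)\<close>, and the left side of the claim is \<open>(1 +
  \<alpha>\<^sup>2) / (1 + \<alpha>\<^sup>2 + \<beta>\<^sup>2)\<close>.\<close>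

lemma conformal_slope_estimate:
  fixes P Y :: complex and \<alpha> \<beta> k :: real
  assumes conf: "P\<^sup>2 + Y\<^sup>2 + (of_real \<alpha> * P + of_real \<beta> * Y)\<^sup>2 = 0"
    and orient: "Im (P * cnj Y) > 0" and small: "cmod Y \<le> k * cmod P" and k: "k \<le> 1 / 2"
  shows "1 - \<beta>\<^sup>2 / (1 + \<alpha>\<^sup>2 + \<beta>\<^sup>2) \<le> 3 * k\<^sup>2"
proof -
  have P0: "P \<noteq> 0" using orient by auto
  define m where "m = Y / P"
  define p q where "p = Re m" and "q = Im m"
  have Ym: "Y = m * P" using P0 by (simp add: m_def)
  have mk: "cmod m \<le> k" using small P0 by (simp add: m_def norm_divide divide_le_eq)
  then have k0: "k \<ge> 0" using norm_ge_zero[of m] by linarith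
  have pqk: "p\<^sup>2 + q\<^sup>2 \<le> k\<^sup>2"
    using power_mono[OF mk norm_ge_zero, of 2] by (simp add: cmod_power2 p_def q_def)
  have "P\<^sup>2 * (1 + m\<^sup>2 + (of_real \<alpha> + of_real \<beta> * m)\<^sup>2) = 0"
    using conf unfolding Ym by (simp add: power2_eq_square algebra_simps)
  then have eq: "1 + m\<^sup>2 + (of_real \<alpha> + of_real \<beta> * m)\<^sup>2 = 0" using P0 by simp
  have re: "1 + p\<^sup>2 - q\<^sup>2 + (\<alpha> + \<beta> * p)\<^sup>2 - \<beta>\<^sup>2 * q\<^sup>2 = 0"
    using arg_cong[OF eq, of Re] by (simp add: p_def q_def power2_eq_square algebra_simps)
  have im: "2 * q * (p + (\<alpha> + \<beta> * p) * \<beta>) = 0"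
    using arg_cong[OF eq, of Im] by (simp add: p_def q_def power2_eq_square algebra_simps)
  have "Im (P * cnj Y) = (cmod P)\<^sup>2 * (- q)"
    unfolding Ym q_def cmod_power2 by (simp add: power2_eq_square algebra_simps)
  then have q0: "q \<noteq> 0" using orient by auto
  then have lin: "p + (\<alpha> + \<beta> * p) * \<beta> = 0" using im by simp
  define B where "B = \<beta>\<^sup>2"
  have k4: "k\<^sup>2 \<le> 1 / 4" using power_mono[OF k k0, of 2] by (simp add: power2_eq_square)
  have q4: "q\<^sup>2 \<le> k\<^sup>2" "p\<^sup>2 \<le> k\<^sup>2" using pqk by (auto intro: order_trans[rotated])
  have sq: "((\<alpha> + \<beta> * p) * \<beta>)\<^sup>2 = p\<^sup>2" using lin by (metis add.inverse_unique add.commute power2_minus)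
  \<comment> \<open>The real part times \<beta> squared, with \<alpha> eliminated by the linear
    relation.\<close>
  have main: "B * (1 + p\<^sup>2) + p\<^sup>2 = q\<^sup>2 * B * (1 + B)"
  proof -
    have "\<beta>\<^sup>2 * (1 + p\<^sup>2 - q\<^sup>2 + (\<alpha> + \<beta> * p)\<^sup>2 - \<beta>\<^sup>2 * q\<^sup>2) = 0" using re by simp
    moreover have "\<beta>\<^sup>2 * (\<alpha> + \<beta> * p)\<^sup>2 = p\<^sup>2" using sq by (simp add: power_mult_distrib mult.commute)
    ultimately show ?thesis unfolding B_def by (simp add: algebra_simps)
  qed
  have B0: "B > 0"
  proof (rule ccontr)
    assume "\<not> B > 0"
    then have "\<beta> = 0" by (simp add: B_def)
    then have "1 + p\<^sup>2 + \<alpha>\<^sup>2 = q\<^sup>2" using re by simp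
    then have "1 \<le> q\<^sup>2" using zero_le_power2[of p] zero_le_power2[of \<alpha>] by linarith
    then show False using q4 k4 by linarith
  qed
  have "B \<le> q\<^sup>2 * B * (1 + B)" using main B0 by (simp add: algebra_simps) (smt (verit) mult_nonneg_nonneg zero_le_power2)
  then have "1 \<le> q\<^sup>2 * (1 + B)" using B0 by (simp add: mult.assoc mult.left_commute)
  then have kB: "1 \<le> k\<^sup>2 * (1 + B)" using q4(1) B0 by (smt (verit) mult_right_mono)
  have "k\<^sup>2 * (1 + B) \<le> 1 / 4 * (1 + B)" using k4 B0 by (intro mult_right_mono) auto
  then have "1 \<le> 1 / 4 * (1 + B)" using kB by (rule order_trans[rotated])
  \<comment> \<open>Thus \<open>1 + B \<le> 4 / 3 * B\<close>, the source of the factor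
    \<open>4 / 3\<close>; adding the bound for 1 gives \<open>7 / 3\<close>, rounded up to
    3.\<close>
  then have B3: "B \<ge> 3" by simp
  have A: "\<alpha>\<^sup>2 * B = p\<^sup>2 * (1 + B)\<^sup>2"
  proof -
    have "\<alpha> * \<beta> = - p * (1 + B)" using lin unfolding B_def by (simp add: power2_eq_square algebra_simps)
    then have "(\<alpha> * \<beta>)\<^sup>2 = (p * (1 + B))\<^sup>2" by simp
    then show ?thesis by (simp add: power_mult_distrib B_def)
  qed
  have "\<alpha>\<^sup>2 * B \<le> k\<^sup>2 * (1 + B)\<^sup>2" unfolding A using q4(2) by (intro mult_right_mono) auto
  also have "\<dots> \<le> k\<^sup>2 * ((1 + B) * (4 / 3 * B))"
    using B3 by (intro mult_left_mono) (auto simp: power2_eq_square)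
  finally have "\<alpha>\<^sup>2 * B \<le> (4 / 3 * k\<^sup>2 * (1 + B)) * B" by (simp add: algebra_simps)
  then have a2: "\<alpha>\<^sup>2 \<le> 4 / 3 * k\<^sup>2 * (1 + B)" using B0 by (simp only: mult_le_cancel_right_pos)
  have "1 + \<alpha>\<^sup>2 \<le> 3 * k\<^sup>2 * (1 + B)" using a2 kB by (simp add: algebra_simps)
  also have "\<dots> \<le> 3 * k\<^sup>2 * (1 + \<alpha>\<^sup>2 + B)" by (intro mult_left_mono) auto
  finally have f: "1 + \<alpha>\<^sup>2 \<le> 3 * k\<^sup>2 * (1 + \<alpha>\<^sup>2 + B)" .
  have pos: "1 + \<alpha>\<^sup>2 + B > 0" using B0 by (simp add: add_pos_nonneg)
  have "1 - B / (1 + \<alpha>\<^sup>2 + B) = (1 + \<alpha>\<^sup>2) / (1 + \<alpha>\<^sup>2 + B)" using pos by (simp add: field_simps)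
  also have "\<dots> \<le> 3 * k\<^sup>2" using f pos by (simp add: divide_le_eq)
  finally show ?thesis by (simp add: B_def)
qed

context harmonic_jordan_map
begin

text \<open>At height \<open>Im \<xi>\<close> the derivatives are at most a constant over
  \<open>Im \<xi>\<close>, so the oscillation on a disc of radius \<open>\<kappa> * Im \<xi>\<close>
  does not depend on the height. Hence closeness to \<open>J\<close> persists on discs whose size is
  comparable to the distance from the axis.\<close>

lemma ft_oscillation:
  obtains M where "M > 0" "\<And>\<xi> \<xi>' \<kappa>. Im \<xi> > 0 \<Longrightarrow> 0 < \<kappa> \<Longrightarrow> \<kappa> \<le> 1 / 2 \<Longrightarrow> dist \<xi> \<xi>' < \<kappa> * Im \<xi> \<Longrightarrow>
     Im \<xi>' > 0 \<and> dist (ft \<xi>) (ft \<xi>') \<le> M * \<kappa>"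
proof -
  obtain M0 where M0: "M0 > 0" "\<forall>\<xi>. Im \<xi> > 0 \<longrightarrow> cmod (ft \<xi>) \<le> M0" using ft_bounded by auto
  have sub: "ball \<xi> (Im \<xi>) \<subseteq> HH" for \<xi>
  proof
    fix x assume "x \<in> ball \<xi> (Im \<xi>)"
    then show "x \<in> HH" using abs_Im_le_cmod[of "\<xi> - x"] by (auto simp: dist_norm)
  qed
  have osc: "cmod (H \<xi> - H \<xi>') \<le> 12 * M0 * \<kappa>"
    if H: "H holomorphic_on HH" "\<And>\<xi>. Im \<xi> > 0 \<Longrightarrow> \<bar>Re (H \<xi>)\<bar> \<le> M0"
      and \<xi>: "Im \<xi> > 0" "0 < \<kappa>" "\<kappa> \<le> 1 / 2" "dist \<xi> \<xi>' < \<kappa> * Im \<xi>" for H \<xi> \<xi>' \<kappa>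
  proof -
    let ?B = "ball \<xi> (\<kappa> * Im \<xi>)"
    have half: "\<kappa> * Im \<xi> \<le> 1 / 2 * Im \<xi>" using \<xi> by (intro mult_right_mono) auto
    have BH: "?B \<subseteq> HH" using sub[of \<xi>] half \<xi>(1) subset_ball[of "\<kappa> * Im \<xi>" "Im \<xi>" \<xi>] by auto
    have der: "cmod (deriv H x) \<le> 12 * M0 / Im \<xi>" if x: "x \<in> ?B" for x
    proof -
      have b: "ball x (Im \<xi> / 2) \<subseteq> ball \<xi> (Im \<xi>)"
      proof
        fix y assume "y \<in> ball x (Im \<xi> / 2)"
        then show "y \<in> ball \<xi> (Im \<xi>)" using x half dist_triangle[of \<xi> y x] by auto
      qed
      have bH: "ball x (Im \<xi> / 2) \<subseteq> HH" using b sub[of \<xi>] by blast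
      have "cmod (deriv H x) \<le> 6 * M0 / (Im \<xi> / 2)"
      proof (rule norm_deriv_le_of_abs_Re)
        show "H holomorphic_on ball x (Im \<xi> / 2)" using H(1) bH holomorphic_on_subset by blast
        show "\<bar>Re (H y)\<bar> \<le> M0" if "y \<in> ball x (Im \<xi> / 2)" for y using H(2) bH that by blast
      qed (use \<xi> M0 in auto)
      then show ?thesis by (simp add: field_simps)
    qed
    have "cmod (H \<xi> - H \<xi>') \<le> 12 * M0 / Im \<xi> * cmod (\<xi> - \<xi>')"
    proof (rule field_differentiable_bound[of ?B])
      show "(H has_field_derivative deriv H x) (at x within ?B)" if "x \<in> ?B" for x
        using holomorphic_derivI[OF H(1), of x] BH that open_halfspace_Im_gt[of 0]
        by (auto intro: has_field_derivative_at_within)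
      show "cmod (deriv H x) \<le> 12 * M0 / Im \<xi>" if "x \<in> ?B" for x using der[OF that] .
    qed (use \<xi> in auto)
    also have "\<dots> \<le> 12 * M0 / Im \<xi> * (\<kappa> * Im \<xi>)" using \<xi> M0 by (intro mult_left_mono) (auto simp: dist_norm)
    also have "\<dots> = 12 * M0 * \<kappa>" using \<xi> by simp
    finally show ?thesis .
  qed
  show ?thesis
  proof (rule that[of "24 * M0"])
    fix \<xi> \<xi>' \<kappa> assume \<xi>: "Im \<xi> > 0" "0 < \<kappa>" "\<kappa> \<le> 1 / 2" "dist \<xi> \<xi>' < \<kappa> * Im \<xi>"
    have "\<kappa> * Im \<xi> \<le> 1 / 2 * Im \<xi>" using \<xi> by (intro mult_right_mono) auto
    moreover have "Im \<xi> - Im \<xi>' < \<kappa> * Im \<xi>" using \<xi>(4) abs_Im_le_cmod[of "\<xi> - \<xi>'"] by (simp add: dist_norm)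
    ultimately have Im': "Im \<xi>' > 0" using \<xi>(1) by linarith
    have bd: "\<bar>Re (Ut x)\<bar> \<le> M0" "\<bar>Re (Vt x)\<bar> \<le> M0" if "Im x > 0" for x
      using M0(2) that ft_eq[OF that] abs_Re_le_cmod[of "ft x"] abs_Im_le_cmod[of "ft x"] by (auto intro: order_trans)
    have "cmod (Ut \<xi> - Ut \<xi>') \<le> 12 * M0 * \<kappa>" "cmod (Vt \<xi> - Vt \<xi>') \<le> 12 * M0 * \<kappa>"
      using osc[OF hol_t(1) bd(1) \<xi>] osc[OF hol_t(2) bd(2) \<xi>] by auto
    then have "\<bar>Re (ft \<xi> - ft \<xi>')\<bar> \<le> 12 * M0 * \<kappa>" "\<bar>Im (ft \<xi> - ft \<xi>')\<bar> \<le> 12 * M0 * \<kappa>"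
      using abs_Re_le_cmod[of "Ut \<xi> - Ut \<xi>'"] abs_Re_le_cmod[of "Vt \<xi> - Vt \<xi>'"] \<xi>(1) Im' by (auto simp: ft_eq)
    then show "Im \<xi>' > 0 \<and> dist (ft \<xi>) (ft \<xi>') \<le> 24 * M0 * \<kappa>"
      using Im' cmod_le[of "ft \<xi> - ft \<xi>'"] by (simp add: dist_norm)
  qed (use M0 in simp)
qed

lemma deriv_ft_chain:
  assumes "Im \<xi> > 0"
  shows "deriv (\<lambda>\<xi>. of_real a * Ut \<xi> + of_real b * Vt \<xi> + c) \<xi> =
    (of_real a * deriv U (exp (\<i> * \<xi>)) + of_real b * deriv V (exp (\<i> * \<xi>))) * (\<i> * exp (\<i> * \<xi>))"
proof (rule DERIV_imp_deriv)
  have w: "exp (\<i> * \<xi>) \<in> ball 0 1" by (rule exp_in_ball[OF assms])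
  have d: "(U has_field_derivative deriv U (exp (\<i> * \<xi>))) (at (exp (\<i> * \<xi>)))"
     "(V has_field_derivative deriv V (exp (\<i> * \<xi>))) (at (exp (\<i> * \<xi>)))"
    using holomorphic_derivI[OF hol(1) open_ball w] holomorphic_derivI[OF hol(2) open_ball w] by auto
  have e: "((\<lambda>\<xi>. exp (\<i> * \<xi>)) has_field_derivative (\<i> * exp (\<i> * \<xi>))) (at \<xi>)"
    by (auto intro!: derivative_eq_intros)
  have "(Ut has_field_derivative (deriv U (exp (\<i> * \<xi>)) * (\<i> * exp (\<i> * \<xi>)))) (at \<xi>)"
    "(Vt has_field_derivative (deriv V (exp (\<i> * \<xi>)) * (\<i> * exp (\<i> * \<xi>)))) (at \<xi>)"
    unfolding Ut_def[abs_def] Vt_def[abs_def] using DERIV_chain2[OF d(1) e] DERIV_chain2[OF d(2) e] .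
  then show "((\<lambda>\<xi>. of_real a * Ut \<xi> + of_real b * Vt \<xi> + c) has_field_derivative
    ((of_real a * deriv U (exp (\<i> * \<xi>)) + of_real b * deriv V (exp (\<i> * \<xi>))) * (\<i> * exp (\<i> * \<xi>)))) (at \<xi>)"
    by (auto intro!: derivative_eq_intros simp: algebra_simps)
qed

text \<open>Values near \<open>J\<close> stay away from \<open>l\<close> and \<open>r\<close>, so
  the argument of \<open>\<xi> - t\<close> stays away from 0 and \<pi>, and \<open>Im \<xi>\<close>
  is comparable to the distance from \<open>t\<close>. On a disc of comparable radius Harnack's
  inequality bounds the derivative of the normal coordinate. The tangential coordinate differs from
  a multiple of the argument by a function with small real part, so its derivative has at least half
  the size of that of the model. Both bounds carry the same inverse distance to \<open>t\<close> and
  the same factor \<open>\<i> * w\<close> from the lift, and these cancel.\<close>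

lemma collapse_deriv_ratio:
  assumes asy: "((\<lambda>\<xi>. ft \<xi> - jump_model l r t \<xi>) \<longlongrightarrow> 0) (at (of_real t) within HH)"
    and \<tau>: "cmod \<tau> = 1" and lr: "l - r = of_real \<Lambda> * \<tau>" "\<Lambda> \<noteq> 0"
    and J: "compact J" "J \<noteq> {}" and \<theta>0: "0 < \<theta>0" "\<theta>0 \<le> 1 / 2"
    and J\<theta>: "\<And>p. p \<in> J \<Longrightarrow> \<exists>\<theta>. \<theta>0 \<le> \<theta> \<and> \<theta> \<le> 1 - \<theta>0 \<and> p = r + of_real \<theta> * (l - r)"
    and pos: "\<rho> > 0" "\<And>z. z \<in> \<Omega> \<Longrightarrow> infdist z J < \<rho> \<Longrightarrow> (z - a) \<bullet> (\<i> * \<tau>) > 0"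
    and near: "\<And>\<delta>. \<delta> > 0 \<Longrightarrow> \<exists>\<eta>>0. \<forall>w\<in>ball 0 1. infdist (f w) J < \<eta> \<longrightarrow> dist w (cis t) < \<delta>"
  shows "\<exists>K\<ge>0. \<exists>\<eta>>0. \<forall>w\<in>ball 0 1. infdist (f w) J < \<eta> \<longrightarrow>
    cmod (of_real (Re \<tau>) * deriv V w - of_real (Im \<tau>) * deriv U w) \<le>
    K * ((f w - a) \<bullet> (\<i> * \<tau>)) * cmod (of_real (Re \<tau>) * deriv U w + of_real (Im \<tau>) * deriv V w)"
proof -
  obtain M where M: "M > 0" "\<And>\<xi> \<xi>' \<kappa>. Im \<xi> > 0 \<Longrightarrow> 0 < \<kappa> \<Longrightarrow> \<kappa> \<le> 1 / 2 \<Longrightarrow> dist \<xi> \<xi>' < \<kappa> * Im \<xi> \<Longrightarrow>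
     Im \<xi>' > 0 \<and> dist (ft \<xi>) (ft \<xi>') \<le> M * \<kappa>"
    using ft_oscillation by metis
  \<comment> \<open>On the disc of radius \<open>\<kappa> * Im \<xi>\<close> the values of
    \<open>ft\<close> move by less than \<open>\<rho> / 2\<close>, hence stay where the normal
    coordinate is positive.\<close>
  define \<kappa> where "\<kappa> = min (1 / 2) (\<rho> / (4 * M))"
  have \<kappa>: "0 < \<kappa>" "\<kappa> \<le> 1 / 2" using pos(1) M(1) by (auto simp: \<kappa>_def)
  have "M * \<kappa> \<le> M * (\<rho> / (4 * M))" using M(1) by (intro mult_left_mono) (auto simp: \<kappa>_def)
  then have M\<kappa>: "M * \<kappa> < \<rho> / 2" using M(1) pos(1) by simp
  \<comment> \<open>The sine of the smallest angle left to the argument, after half of the margin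
    \<theta>0 has been given up.\<close>
  define s1 where "s1 = sin (pi * \<theta>0 / 2)"
  have th: "0 < pi * \<theta>0 / 2" "pi * \<theta>0 / 2 \<le> pi / 2"
    using \<theta>0 mult_left_mono[of \<theta>0 1 pi] by auto
  have s1: "s1 > 0" unfolding s1_def using th by (intro sin_gt_zero) auto
  define L where "L = \<bar>\<Lambda>\<bar>"
  have L: "L > 0" using lr by (simp add: L_def)
  \<comment> \<open>The first bound keeps the derivative of the error \<open>D\<close> at most half
    that of the model. The second, together with the same bound on \<eta>, keeps the normalised
    argument \<open>c\<close> within \<open>\<theta>0 / 4\<close> of \<theta>.\<close>
  define \<epsilon> where "\<epsilon> = min (\<kappa> * s1 * L / (12 * pi)) (\<theta>0 * L / 8)"
  have \<epsilon>: "\<epsilon> > 0" "\<epsilon> \<le> \<kappa> * s1 * L / (12 * pi)" "\<epsilon> \<le> \<theta>0 * L / 8"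
    using \<kappa> s1 L \<theta>0 by (auto simp: \<epsilon>_def)
  obtain d where d: "d > 0" "\<And>\<xi>. Im \<xi> > 0 \<Longrightarrow> \<xi> \<noteq> of_real t \<Longrightarrow> dist \<xi> (of_real t) < d \<Longrightarrow> dist (ft \<xi> - jump_model l r t \<xi>) 0 < \<epsilon>"
    using tendstoD[OF asy \<epsilon>(1)] unfolding eventually_at by auto
  have dd: "cmod (ft \<xi> - jump_model l r t \<xi>) < \<epsilon>" if "Im \<xi> > 0" "dist \<xi> (of_real t) < d" for \<xi>
  proof -
    have "\<xi> \<noteq> of_real t" using that(1) by auto
    then show ?thesis using d(2) that by simp
  qed
  have d2: "d / 2 > 0" using d by simp
  have "(lift_at t \<longlongrightarrow> of_real t) (at (cis t) within ball 0 1)" using filterlim_lift_at by (simp add: filterlim_at)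
  from tendstoD[OF this d2] obtain \<delta>0 where \<delta>0: "\<delta>0 > 0"
     "\<And>w. w \<in> ball 0 1 \<Longrightarrow> w \<noteq> cis t \<Longrightarrow> dist w (cis t) < \<delta>0 \<Longrightarrow> dist (lift_at t w) (of_real t) < d / 2"
    unfolding eventually_at by blast
  define \<delta> where "\<delta> = min \<delta>0 1"
  have \<delta>: "\<delta> > 0" using \<delta>0 by (simp add: \<delta>_def)
  obtain \<eta>1 where \<eta>1: "\<eta>1 > 0" "\<And>w. w \<in> ball 0 1 \<Longrightarrow> infdist (f w) J < \<eta>1 \<Longrightarrow> dist w (cis t) < \<delta>"
    using near[OF \<delta>] by blast
  define \<eta> where "\<eta> = min \<eta>1 (min (\<rho> / 2) (\<theta>0 * L / 8))"
  have \<eta>: "\<eta> > 0" "\<eta> \<le> \<eta>1" "\<eta> \<le> \<rho> / 2" "\<eta> \<le> \<theta>0 * L / 8" using \<eta>1(1) pos(1) \<theta>0 L by (auto simp: \<eta>_def)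
  \<comment> \<open>The quotient of the upper bound \<open>2 / (\<kappa> * s1 * cmod x)\<close> and
    the lower bound \<open>L / (2 * pi * cmod x)\<close>.\<close>
  define K where "K = 4 * pi / (\<kappa> * s1 * L)"
  have K: "K \<ge> 0" using \<kappa> s1 L by (simp add: K_def)
  show ?thesis
  proof (rule exI[of _ K], intro conjI K, rule exI[of _ \<eta>], intro conjI \<eta>(1) ballI impI)
    fix w :: complex assume w: "w \<in> ball 0 1" and wJ: "infdist (f w) J < \<eta>"
    have dw: "dist w (cis t) < \<delta>" using \<eta>1(2)[OF w] wJ \<eta>(2) by simp
    have w0: "w \<noteq> 0" using dw by (auto simp: \<delta>_def)
    have "w \<noteq> cis t" using w by auto
    define \<xi> where "\<xi> = lift_at t w"
    have \<xi>: "Im \<xi> > 0" "exp (\<i> * \<xi>) = w" "ft \<xi> = f w" "dist \<xi> (of_real t) < d / 2"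
      using Im_lift_at[OF w w0] exp_lift_at[OF w0] ft_lift_at[OF w0] \<delta>0(2)[OF w \<open>w \<noteq> cis t\<close>] dw
      by (auto simp: \<xi>_def \<delta>_def)
    define x where "x = \<xi> - of_real t"
    have x: "Im x > 0" "cmod x < d / 2" "x \<noteq> 0" using \<xi> by (auto simp: x_def dist_norm)
    define c where "c = harg x / pi"
    have model: "jump_model l r t \<xi> = r + of_real c * (l - r)" by (simp add: jump_model_def c_def x_def)
    obtain p where p: "p \<in> J" "dist (f w) p < \<eta>" using wJ infdist_less_iff[OF J] by blast
    obtain \<theta> where \<theta>: "\<theta>0 \<le> \<theta>" "\<theta> \<le> 1 - \<theta>0" "p = r + of_real \<theta> * (l - r)" using J\<theta>[OF p(1)] by blast
    have "cmod (p - jump_model l r t \<xi>) = \<bar>\<theta> - c\<bar> * L"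
    proof -
      have "p - jump_model l r t \<xi> = of_real (\<theta> - c) * (l - r)" unfolding \<theta>(3) model by (simp add: algebra_simps)
      then show ?thesis by (simp add: lr norm_mult \<tau> L_def del: of_real_diff)
    qed
    moreover have "cmod (p - jump_model l r t \<xi>) < \<eta> + \<epsilon>"
    proof -
      have "cmod (ft \<xi> - jump_model l r t \<xi>) < \<epsilon>"
        by (rule dd[OF \<xi>(1)]) (use \<xi>(4) d(1) in linarith)
      then show ?thesis using p(2) \<xi>(3) norm_triangle_ineq[of "p - ft \<xi>" "ft \<xi> - jump_model l r t \<xi>"]
        by (simp add: dist_norm norm_minus_commute)
    qed
    moreover have "\<eta> + \<epsilon> \<le> \<theta>0 / 4 * L" using \<eta>(4) \<epsilon>(3) by simp
    ultimately have "\<bar>\<theta> - c\<bar> * L < \<theta>0 / 4 * L" by linarith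
    then have "\<bar>\<theta> - c\<bar> < \<theta>0 / 4" using L by (simp only: mult_less_cancel_right_pos)
    then have c: "\<theta>0 / 2 \<le> c" "c \<le> 1 - \<theta>0 / 2" using \<theta> \<theta>0 by linarith+
    have hx: "harg x = pi * c" by (simp add: c_def)
    have "pi * (\<theta>0 / 2) \<le> pi * c" "pi * c \<le> pi * (1 - \<theta>0 / 2)" using c by (intro mult_left_mono; simp)+
    then have h: "pi * \<theta>0 / 2 \<le> harg x" "harg x \<le> pi - pi * \<theta>0 / 2" unfolding hx by (auto simp: algebra_simps)
    have sinh: "s1 \<le> sin (harg x)"
    proof (cases "harg x \<le> pi / 2")
      case True
      then show ?thesis unfolding s1_def using h th by (intro sin_monotone_2pi_le) auto
    next
      case False
      have "sin (pi * \<theta>0 / 2) \<le> sin (pi - harg x)" using h th False by (intro sin_monotone_2pi_le) auto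
      then show ?thesis by (simp add: s1_def)
    qed
    have Imx: "Im \<xi> = Im x" by (simp add: x_def)
    have Imge: "Im \<xi> \<ge> s1 * cmod x"
      unfolding Imx Im_eq_sin_harg[OF x(1)] using mult_left_mono[OF sinh norm_ge_zero[of x]] by (simp add: mult.commute)
    define R where "R = \<kappa> * Im \<xi>"
    have R: "R > 0" using \<kappa> \<xi> by (simp add: R_def)
    have Rge: "R \<ge> \<kappa> * s1 * cmod x" unfolding R_def using mult_left_mono[OF Imge, of \<kappa>] \<kappa> by (simp add: mult.assoc)
    have kx: "\<kappa> * s1 * cmod x > 0" using \<kappa> s1 x by simp
    have inB: "Im y > 0" "infdist (ft y) J < \<rho>" "dist y (of_real t) < d" if y: "y \<in> ball \<xi> R" for y
    proof -
      have *: "Im y > 0 \<and> dist (ft \<xi>) (ft y) \<le> M * \<kappa>" using M(2)[OF \<xi>(1) \<kappa>, of y] y by (simp add: R_def)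
      then show "Im y > 0" ..
      have "infdist (ft y) J \<le> infdist (ft \<xi>) J + dist (ft y) (ft \<xi>)" by (rule infdist_triangle)
      then show "infdist (ft y) J < \<rho>" using * M\<kappa> wJ \<xi>(3) \<eta>(3) by (simp add: dist_commute)
      have "R \<le> 1 / 2 * Im \<xi>" unfolding R_def using \<kappa> \<xi>(1) by (intro mult_right_mono) auto
      also have "\<dots> \<le> 1 / 2 * cmod x" using abs_Im_le_cmod[of x] Imx by simp
      finally have "dist y \<xi> < 1 / 2 * cmod x" using y by (simp add: dist_commute)
      then show "dist y (of_real t) < d"
        using dist_triangle[of y "of_real t" \<xi>] x(2) norm_ge_zero[of x] unfolding x_def dist_norm[of \<xi>] by linarith
    qed
    have BH: "ball \<xi> R \<subseteq> HH" using inB(1) by blast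
    let ?P = "of_real (Re \<tau>) * deriv U w + of_real (Im \<tau>) * deriv V w"
    let ?Y = "of_real (Re \<tau>) * deriv V w - of_real (Im \<tau>) * deriv U w"
    let ?y = "(f w - a) \<bullet> (\<i> * \<tau>)"
    \<comment> \<open>The real part is the signed distance of \<open>ft\<close> from the line
      through \<open>a\<close> in direction \<tau>, positive on the disc.\<close>
    define Yh where "Yh \<xi> = of_real (- Im \<tau>) * Ut \<xi> + of_real (Re \<tau>) * Vt \<xi> + of_real (- (a \<bullet> (\<i> * \<tau>)))" for \<xi>
    have ReYh: "Re (Yh y) = (ft y - a) \<bullet> (\<i> * \<tau>)" if "Im y > 0" for y
      using that by (simp add: Yh_def ft_eq inner_complex_def algebra_simps)
    have "cmod (deriv Yh \<xi>) \<le> 2 * Re (Yh \<xi>) / R"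
    proof (rule norm_deriv_le_of_Re_pos[OF _ R])
      show "Yh holomorphic_on ball \<xi> R" unfolding Yh_def
        using BH by (intro holomorphic_intros holomorphic_on_subset[OF hol_t(1)] holomorphic_on_subset[OF hol_t(2)])
      show "0 < Re (Yh y)" if "y \<in> ball \<xi> R" for y
        unfolding ReYh[OF inB(1)[OF that]] using pos(2) ft_in inB(1,2)[OF that] by blast
    qed
    moreover have "deriv Yh \<xi> = ?Y * (\<i> * w)"
      unfolding Yh_def deriv_ft_chain[OF \<xi>(1)] \<xi>(2) by simp
    moreover have ypos: "?y > 0" using pos(2)[of "f w"] img w wJ \<eta>(1,3) by force
    moreover have "2 * Re (Yh \<xi>) / R \<le> 2 * ?y / (\<kappa> * s1 * cmod x)"
      unfolding ReYh[OF \<xi>(1)] \<xi>(3) using Rge kx ypos by (intro divide_left_mono) auto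
    ultimately have Yle: "cmod (?Y * (\<i> * w)) \<le> 2 * ?y / (\<kappa> * s1 * cmod x)" by simp
    \<comment> \<open>The real part of \<open>Ph\<close> is the tangential coordinate measured from
      \<open>r\<close>, that of \<open>W\<close> its jump model, and that of \<open>D\<close> the
      error.\<close>
    define Ph where "Ph \<xi> = of_real (Re \<tau>) * Ut \<xi> + of_real (Im \<tau>) * Vt \<xi> + of_real (- (r \<bullet> \<tau>))" for \<xi>
    define W where "W \<xi> = of_real (\<Lambda> / pi) * (of_real (pi / 2) - \<i> * Ln (- \<i> * (\<xi> - of_real t)))" for \<xi>
    define D where "D \<xi> = Ph \<xi> - W \<xi>" for \<xi>
    have holPW: "Ph holomorphic_on HH" "W holomorphic_on HH"
      unfolding Ph_def W_def by (intro holomorphic_intros hol_t harg_holomorphic)+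
    have "\<tau> \<bullet> \<tau> = 1" using \<tau> by (simp add: dot_square_norm)
    have ReD: "Re (D y) = (ft y - jump_model l r t y) \<bullet> \<tau>" if "Im y > 0" for y
    proof -
      have "Re (W y) = \<Lambda> / pi * harg (y - of_real t)" unfolding W_def harg_eq by simp
      moreover have "jump_model l r t y = r + (\<Lambda> / pi * harg (y - of_real t)) *\<^sub>R \<tau>"
        by (simp add: jump_model_def lr scaleR_conv_of_real)
      then have "jump_model l r t y \<bullet> \<tau> = r \<bullet> \<tau> + \<Lambda> / pi * harg (y - of_real t)"
        using \<open>\<tau> \<bullet> \<tau> = 1\<close> by (simp add: inner_add_left)
      moreover have "Re (Ph y) = ft y \<bullet> \<tau> - r \<bullet> \<tau>"
        using that by (simp add: Ph_def ft_eq inner_complex_def algebra_simps)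
      ultimately show ?thesis by (simp add: D_def inner_diff_left)
    qed
    have "cmod (deriv D \<xi>) \<le> 6 * \<epsilon> / R"
    proof (rule norm_deriv_le_of_abs_Re[OF _ R \<epsilon>(1)])
      show "D holomorphic_on ball \<xi> R" unfolding D_def
        using BH by (intro holomorphic_intros holomorphic_on_subset[OF holPW(1)] holomorphic_on_subset[OF holPW(2)])
      show "\<bar>Re (D y)\<bar> \<le> \<epsilon>" if "y \<in> ball \<xi> R" for y
      proof -
        have "\<bar>Re (D y)\<bar> \<le> cmod (ft y - jump_model l r t y) * cmod \<tau>"
          unfolding ReD[OF inB(1)[OF that]] by (rule Cauchy_Schwarz_ineq2)
        then show ?thesis using dd[of y] inB[OF that] \<tau> by simp
      qed
    qed
    also have "6 * \<epsilon> / R \<le> 6 * \<epsilon> / (\<kappa> * s1 * cmod x)" using Rge kx \<epsilon>(1) by (intro divide_left_mono) auto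
    also have "\<dots> \<le> L / (2 * pi * cmod x)"
    proof -
      have "6 * \<epsilon> / (\<kappa> * s1 * cmod x) \<le> 6 * (\<kappa> * s1 * L / (12 * pi)) / (\<kappa> * s1 * cmod x)"
        using \<epsilon>(2) kx by (intro divide_right_mono mult_left_mono) auto
      also have "\<dots> = L / (2 * pi * cmod x)" using kx x(3) \<kappa> s1 by (simp add: field_simps)
      finally show ?thesis .
    qed
    finally have Dle: "cmod (deriv D \<xi>) \<le> L / (2 * pi * cmod x)" .
    have dP: "(Ph has_field_derivative deriv Ph \<xi>) (at \<xi>)"
      using holomorphic_derivI[OF holPW(1) open_halfspace_Im_gt] \<xi>(1) by auto
    have dW: "(W has_field_derivative of_real (\<Lambda> / pi) * (- \<i> / x)) (at \<xi>)"
    proof -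
      have nn: "- \<i> * (\<xi> - of_real t) \<notin> \<real>\<^sub>\<le>\<^sub>0" using \<xi>(1) by (simp add: complex_nonpos_Reals_iff)
      have 1: "((\<lambda>\<xi>. - \<i> * (\<xi> - of_real t)) has_field_derivative - \<i>) (at \<xi>)"
        by (auto intro!: derivative_eq_intros)
      have "((\<lambda>\<xi>. Ln (- \<i> * (\<xi> - of_real t))) has_field_derivative (inverse (- \<i> * (\<xi> - of_real t)) * - \<i>)) (at \<xi>)"
        by (rule DERIV_chain2[OF has_field_derivative_Ln[OF nn] 1])
      moreover have "inverse (- \<i> * (\<xi> - of_real t)) * - \<i> = 1 / x" using x(3) by (simp add: x_def field_simps)
      ultimately have 2: "((\<lambda>\<xi>. Ln (- \<i> * (\<xi> - of_real t))) has_field_derivative 1 / x) (at \<xi>)" by simp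
      have "(W has_field_derivative of_real (\<Lambda> / pi) * (0 - \<i> * (1 / x))) (at \<xi>)"
        unfolding W_def by (intro DERIV_cmult DERIV_diff DERIV_const 2)
      then show ?thesis by simp
    qed
    have "deriv D \<xi> = deriv Ph \<xi> - of_real (\<Lambda> / pi) * (- \<i> / x)"
      unfolding D_def by (rule DERIV_imp_deriv[OF DERIV_diff[OF dP dW]])
    then have "of_real (\<Lambda> / pi) * (- \<i> / x) = deriv Ph \<xi> - deriv D \<xi>" by simp
    then have "cmod (of_real (\<Lambda> / pi) * (- \<i> / x)) \<le> cmod (deriv Ph \<xi>) + cmod (deriv D \<xi>)"
      by (simp only: norm_triangle_ineq4)
    moreover have "cmod (of_real (\<Lambda> / pi) * (- \<i> / x)) = L / (pi * cmod x)"
      by (simp add: norm_mult norm_divide L_def)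
    moreover have "L / (pi * cmod x) = 2 * (L / (2 * pi * cmod x))" by simp
    ultimately have "L / (2 * pi * cmod x) \<le> cmod (deriv Ph \<xi>)" using Dle by linarith
    moreover have "deriv Ph \<xi> = ?P * (\<i> * w)"
      unfolding Ph_def deriv_ft_chain[OF \<xi>(1)] \<xi>(2) ..
    ultimately have Pge: "L / (2 * pi * cmod x) \<le> cmod (?P * (\<i> * w))" by simp
    have "2 * ?y / (\<kappa> * s1 * cmod x) = K * ?y * (L / (2 * pi * cmod x))"
      using L x(3) \<kappa> s1 by (simp add: K_def field_simps)
    also have "\<dots> \<le> K * ?y * cmod (?P * (\<i> * w))"
      using Pge K ypos by (intro mult_left_mono) auto
    finally have "cmod (?Y * (\<i> * w)) \<le> K * ?y * cmod (?P * (\<i> * w))" using Yle by linarith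
    then have "cmod ?Y * cmod w \<le> K * ?y * cmod ?P * cmod w" by (simp add: norm_mult mult.assoc)
    then show "cmod ?Y \<le> K * ?y * cmod ?P" using w0 by simp
  qed
qed

end

section \<open>From tame degeneration to an infinite boundary value\<close>

lemma dir_deriv_bounded_linear:
  assumes "bounded_linear L" "F differentiable (at z)"
  shows "dir_deriv v (\<lambda>z. L (F z)) z = L (dir_deriv v F z)"
proof -
  obtain F' where F': "(F has_derivative F') (at z)" using assms(2) by (auto simp: differentiable_def)
  have "((\<lambda>z. L (F z)) has_derivative (\<lambda>h. L (F' h))) (at z)"
    by (rule bounded_linear.has_derivative[OF assms(1) F'])
  then show ?thesis using dir_deriv_eq[OF F', of v] dir_deriv_eq[of "\<lambda>z. L (F z)" _ z v] by simp
qed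

lemma C1_on_bounded_linear:
  fixes F :: "complex \<Rightarrow> 'a::real_normed_vector" and L :: "'a \<Rightarrow> 'b::real_normed_vector"
  assumes L: "bounded_linear L" and F: "C1_on F S"
  shows "C1_on (\<lambda>z. L (F z)) S"
proof -
  have d: "F differentiable (at z)" if "z \<in> S" for z using F that by (simp add: C1_on_def)
  have "(\<lambda>z. L (F z)) differentiable (at z)" if "z \<in> S" for z
    using d[OF that] bounded_linear.has_derivative[OF L] unfolding differentiable_def by blast
  moreover have "continuous_on S (\<lambda>z. L (dx F z))" "continuous_on S (\<lambda>z. L (dy F z))"
    using F bounded_linear.continuous_on[OF L] unfolding C1_on_def by blast+
  moreover have "dx (\<lambda>z. L (F z)) z = L (dx F z)" "dy (\<lambda>z. L (F z)) z = L (dy F z)" if "z \<in> S" for z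
    using dir_deriv_bounded_linear[OF L d[OF that]] by (simp_all add: dx_def dy_def)
  ultimately show ?thesis unfolding C1_on_def by (simp cong: continuous_on_cong)
qed

lemma Re_of_gradient_primitive:
  fixes u :: "complex \<Rightarrow> real"
  assumes G: "G holomorphic_on ball 0 1"
    and u: "\<And>w. w \<in> ball 0 1 \<Longrightarrow> (u has_derivative (\<lambda>h. Re (G w * h))) (at w)"
  obtains U where "U holomorphic_on ball 0 1" "\<And>w. w \<in> ball 0 1 \<Longrightarrow> u w = Re (U w)"
    "\<And>w. w \<in> ball 0 1 \<Longrightarrow> deriv U w = G w"
proof -
  obtain U0 where U0: "\<And>w. w \<in> ball 0 1 \<Longrightarrow> (U0 has_field_derivative G w) (at w within ball 0 1)"
    using holomorphic_convex_primitive'[OF convex_ball open_ball G] by metis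
  have U0': "(U0 has_field_derivative G w) (at w)" if "w \<in> ball 0 1" for w
    using U0[OF that] at_within_open[OF that open_ball] by simp
  have "\<exists>c. \<forall>w\<in>ball 0 1. u w - Re (U0 w) = c"
  proof (rule has_derivative_zero_constant[OF convex_ball])
    fix w :: complex assume w: "w \<in> ball 0 1"
    have "(U0 has_derivative (*) (G w)) (at w)" using U0'[OF w] by (simp add: has_field_derivative_def)
    then have "((\<lambda>w. Re (U0 w)) has_derivative (\<lambda>h. Re (G w * h))) (at w)"
      by (rule has_derivative_Re)
    then have "((\<lambda>w. u w - Re (U0 w)) has_derivative (\<lambda>h. Re (G w * h) - Re (G w * h))) (at w)"
      by (intro has_derivative_diff u w)
    then show "((\<lambda>w. u w - Re (U0 w)) has_derivative (\<lambda>h. 0)) (at w within ball 0 1)"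
      by (simp add: has_derivative_at_withinI)
  qed
  then obtain c where c: "\<And>w. w \<in> ball 0 1 \<Longrightarrow> u w - Re (U0 w) = c" by blast
  have dU: "((\<lambda>w. U0 w + of_real c) has_field_derivative G w) (at w)" if "w \<in> ball 0 1" for w
    using U0'[OF that] by (auto intro!: derivative_eq_intros)
  show ?thesis
  proof (rule that[of "\<lambda>w. U0 w + of_real c"])
    show "(\<lambda>w. U0 w + of_real c) holomorphic_on ball 0 1"
      unfolding holomorphic_on_open[OF open_ball] using dU by blast
    show "u w = Re (U0 w + of_real c)" if "w \<in> ball 0 1" for w using c[OF that] by simp
    show "deriv (\<lambda>w. U0 w + of_real c) w = G w" if "w \<in> ball 0 1" for w
      using DERIV_imp_deriv[OF dU[OF that]] .
  qed
qed

text \<open>The Cauchy-Riemann equations for \<open>dx u - \<i> * dy u\<close> are Laplace's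
  equation and the symmetry of the mixed derivatives; a primitive on the disc, adjusted by a real
  constant, has real part \<open>u\<close>.\<close>

lemma harmonic_eq_Re_holomorphic:
  fixes u :: "complex \<Rightarrow> real"
  assumes u: "C2_on u (ball 0 1)" and lap: "\<And>w. w \<in> ball 0 1 \<Longrightarrow> dx (dx u) w + dy (dy u) w = 0"
  obtains U where "U holomorphic_on ball 0 1" "\<And>w. w \<in> ball 0 1 \<Longrightarrow> u w = Re (U w)"
    "\<And>w. w \<in> ball 0 1 \<Longrightarrow> deriv U w = Complex (dx u w) (- dy u w)"
proof -
  define G where "G w = Complex (dx u w) (- dy u w)" for w
  have C1: "C1_on u (ball 0 1)" "C1_on (dx u) (ball 0 1)" "C1_on (dy u) (ball 0 1)"
    using u by (auto simp: C2_on_def)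
  have "(G has_field_derivative Complex (dx (dx u) w) (- dx (dy u) w)) (at w)" if w: "w \<in> ball 0 1" for w
  proof -
    have mix: "dx (dy u) w = dy (dx u) w" by (rule mixed_partials_eq[OF open_ball u w])
    have yy: "dy (dy u) w = - dx (dx u) w" using lap[OF w] by simp
    have "((\<lambda>w. of_real (dx u w) - \<i> * of_real (dy u w)) has_derivative
        (\<lambda>h. of_real (Re h * dx (dx u) w + Im h * dy (dx u) w) - \<i> * of_real (Re h * dx (dy u) w + Im h * dy (dy u) w))) (at w)"
      by (intro has_derivative_diff has_derivative_mult_right has_derivative_of_real
          C1_onD[OF C1(2) w] C1_onD[OF C1(3) w])
    moreover have "(\<lambda>w. of_real (dx u w) - \<i> * of_real (dy u w)) = G"
      by (simp add: fun_eq_iff G_def complex_eq_iff)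
    moreover have "(\<lambda>h. of_real (Re h * dx (dx u) w + Im h * dy (dx u) w) - \<i> * of_real (Re h * dx (dy u) w + Im h * dy (dy u) w))
      = (*) (Complex (dx (dx u) w) (- dx (dy u) w))"
      unfolding mix yy by (simp add: fun_eq_iff complex_eq_iff algebra_simps)
    ultimately show ?thesis by (simp add: has_field_derivative_def)
  qed
  then have holG: "G holomorphic_on ball 0 1" unfolding holomorphic_on_open[OF open_ball] by blast
  have "(u has_derivative (\<lambda>h. Re (G w * h))) (at w)" if "w \<in> ball 0 1" for w
    using C1_onD[OF C1(1) that] by (simp add: G_def mult.commute)
  from Re_of_gradient_primitive[OF holG this] show ?thesis
    using that unfolding G_def by metis
qed

lemma C2_on_bounded_linear:
  fixes F :: "complex \<Rightarrow> 'a::real_normed_vector" and L :: "'a \<Rightarrow> 'b::real_normed_vector"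
  assumes S: "open S" and L: "bounded_linear L" and F: "C2_on F S"
  shows "C2_on (\<lambda>z. L (F z)) S"
    "z \<in> S \<Longrightarrow> dx (\<lambda>z. L (F z)) z = L (dx F z)" "z \<in> S \<Longrightarrow> dy (\<lambda>z. L (F z)) z = L (dy F z)"
    "z \<in> S \<Longrightarrow> dx (dx (\<lambda>z. L (F z))) z = L (dx (dx F) z)"
    "z \<in> S \<Longrightarrow> dy (dy (\<lambda>z. L (F z))) z = L (dy (dy F) z)"
proof -
  have C1: "C1_on F S" "C1_on (dx F) S" "C1_on (dy F) S" using F by (auto simp: C2_on_def)
  have d: "F differentiable (at z)" "dx F differentiable (at z)" "dy F differentiable (at z)" if "z \<in> S" for z
    using C1 that by (auto simp: C1_on_def)
  have e: "dx (\<lambda>z. L (F z)) z = L (dx F z)" "dy (\<lambda>z. L (F z)) z = L (dy F z)" if "z \<in> S" for z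
    using dir_deriv_bounded_linear[OF L d(1)[OF that]] by (simp_all add: dx_def dy_def)
  then show "z \<in> S \<Longrightarrow> dx (\<lambda>z. L (F z)) z = L (dx F z)" "z \<in> S \<Longrightarrow> dy (\<lambda>z. L (F z)) z = L (dy F z)" by auto
  show "C2_on (\<lambda>z. L (F z)) S" unfolding C2_on_def
    using C1_on_bounded_linear[OF L C1(1)] C1_on_cong[OF S e(1) C1_on_bounded_linear[OF L C1(2)]]
      C1_on_cong[OF S e(2) C1_on_bounded_linear[OF L C1(3)]] by simp
  show "dx (dx (\<lambda>z. L (F z))) z = L (dx (dx F) z)" if z: "z \<in> S"
  proof -
    have "dx (dx (\<lambda>z. L (F z))) z = dx (\<lambda>z. L (dx F z)) z"
      unfolding dx_def[of "dx _"] dx_def[of "\<lambda>z. L (dx F z)"] by (rule dir_deriv_cong[OF S z e(1)])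
    then show ?thesis using dir_deriv_bounded_linear[OF L d(2)[OF z]] by (simp add: dx_def[of "\<lambda>z. L (dx F z)"] dx_def[of "dx F"])
  qed
  show "dy (dy (\<lambda>z. L (F z))) z = L (dy (dy F) z)" if z: "z \<in> S"
  proof -
    have "dy (dy (\<lambda>z. L (F z))) z = dy (\<lambda>z. L (dy F z)) z"
      unfolding dy_def[of "dy _"] dy_def[of "\<lambda>z. L (dy F z)"] by (rule dir_deriv_cong[OF S z e(2)])
    then show ?thesis using dir_deriv_bounded_linear[OF L d(3)[OF z]] by (simp add: dy_def[of "\<lambda>z. L (dy F z)"] dy_def[of "dy F"])
  qed
qed

text \<open>Where \<open>H\<close> does not vanish, the difference quotient of \<open>F\<close> at
  \<open>z\<close> is that of \<open>H\<close> divided by \<open>F w + F z\<close>. Unless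
  \<open>H\<close> vanishes identically, its zeros are isolated, and an isolated singularity of a
  continuous function is removable. The lemma makes the complex gradient of the height along
  \<open>f\<close> holomorphic, as its square is known from conformality.\<close>

lemma continuous_square_root_holomorphic:
  assumes S: "open S" "connected S" and F: "continuous_on S F"
    and H: "H holomorphic_on S" and sq: "\<And>z. z \<in> S \<Longrightarrow> (F z)\<^sup>2 = H z"
  shows "F holomorphic_on S"
proof (cases "\<exists>\<beta>\<in>S. H \<beta> \<noteq> 0")
  case False
  then have "F z = 0" if "z \<in> S" for z using sq[OF that] that by auto
  then show ?thesis using holomorphic_transform[of "\<lambda>_. 0" S F] by simp
next
  case True
  then obtain \<beta> where \<beta>: "\<beta> \<in> S" "H \<beta> \<noteq> 0" by blast
  have nz: "F field_differentiable (at z)" if z: "z \<in> S" "H z \<noteq> 0" for z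
  proof -
    have Fz: "F z \<noteq> 0" using sq[OF z(1)] z(2) by auto
    have cF: "(F \<longlongrightarrow> F z) (at z)" using F S(1) z(1) by (simp add: continuous_on_eq_continuous_at isCont_def)
    have "(H has_field_derivative deriv H z) (at z)" by (rule holomorphic_derivI[OF H S(1) z(1)])
    then have "((\<lambda>w. (H w - H z) / (w - z)) \<longlongrightarrow> deriv H z) (at z)" by (simp add: has_field_derivative_iff)
    moreover have sl: "((\<lambda>w. F w + F z) \<longlongrightarrow> F z + F z) (at z)" by (intro tendsto_intros cF)
    ultimately have lim: "((\<lambda>w. (H w - H z) / (w - z) / (F w + F z)) \<longlongrightarrow> deriv H z / (F z + F z)) (at z)"
      using Fz by (intro tendsto_divide) auto
    have "\<forall>\<^sub>F w in at z. w \<in> S" using S(1) z(1) by (metis eventually_at_topological)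
    moreover have "\<forall>\<^sub>F w in at z. F w + F z \<noteq> 0"
      by (rule tendsto_imp_eventually_ne[OF sl]) (use Fz in simp)
    ultimately have "\<forall>\<^sub>F w in at z. (H w - H z) / (w - z) / (F w + F z) = (F w - F z) / (w - z)"
    proof eventually_elim
      fix w assume w: "w \<in> S" "F w + F z \<noteq> 0"
      have "H w - H z = (F w - F z) * (F w + F z)"
        unfolding sq[OF w(1), symmetric] sq[OF z(1), symmetric] by (simp add: power2_eq_square algebra_simps)
      then show "(H w - H z) / (w - z) / (F w + F z) = (F w - F z) / (w - z)" using w(2) by simp
    qed
    then have "((\<lambda>w. (F w - F z) / (w - z)) \<longlongrightarrow> deriv H z / (F z + F z)) (at z)"
      by (rule Lim_transform_eventually[OF lim])
    then show ?thesis unfolding field_differentiable_def has_field_derivative_iff by blast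
  qed
  have "F field_differentiable (at z)" if z: "z \<in> S" for z
  proof (cases "H z = 0")
    case True
    obtain r where r: "0 < r" "ball z r \<subseteq> S" "\<And>w. w \<in> ball z r - {z} \<Longrightarrow> H w \<noteq> 0"
      using isolated_zeros[OF H S z True \<beta>] by metis
    have "F holomorphic_on ball z r"
    proof (rule no_isolated_singularity[OF _ _ open_ball, of _ _ _ "{z}"])
      show "continuous_on (ball z r) F" using F r(2) continuous_on_subset by blast
      have "F field_differentiable (at w)" if "w \<in> ball z r - {z}" for w using nz r that by blast
      then show "F holomorphic_on ball z r - {z}"
        unfolding holomorphic_on_def by (blast intro: field_differentiable_at_within)
    qed simp
    then show ?thesis using r(1) by (intro holomorphic_on_imp_differentiable_at[of _ "ball z r"]) auto
  qed (use nz z in blast)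
  then show ?thesis unfolding holomorphic_on_def by (blast intro: field_differentiable_at_within)
qed

section \<open>Logarithmic divergence from a quadratic slope bound\<close>

text \<open>By Pythagoras, moving along the normal toward the line, at most up to it, does not
  increase the distance to a point of the line. This keeps normal paths ending on the segment inside
  a given neighbourhood of it.\<close>

lemma dist_toward_segment_le:
  fixes \<nu> p z a :: "'a::real_inner"
  assumes \<nu>: "norm \<nu> = 1" and p: "(p - a) \<bullet> \<nu> = 0" and s: "0 \<le> s" "s \<le> - ((z - a) \<bullet> \<nu>)"
  shows "dist (z + s *\<^sub>R \<nu>) p \<le> dist z p" "- ((z - a) \<bullet> \<nu>) \<le> dist z p"
proof -
  define y where "y = - ((z - a) \<bullet> \<nu>)"
  have zp: "(z - p) \<bullet> \<nu> = - y"
  proof -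
    have "(z - p) \<bullet> \<nu> = (z - a) \<bullet> \<nu> - (p - a) \<bullet> \<nu>" by (simp add: inner_diff_left)
    then show ?thesis using p by (simp add: y_def)
  qed
  have "\<nu> \<bullet> \<nu> = 1" using \<nu> by (simp add: dot_square_norm)
  have "z + s *\<^sub>R \<nu> - p = (z - p) + s *\<^sub>R \<nu>" by simp
  then have "(norm (z + s *\<^sub>R \<nu> - p))\<^sup>2 = (norm (z - p))\<^sup>2 + 2 * s * ((z - p) \<bullet> \<nu>) + s\<^sup>2"
    using \<open>\<nu> \<bullet> \<nu> = 1\<close>
    by (simp only: power2_norm_eq_inner inner_add_left inner_add_right) (simp add: inner_commute power2_eq_square)
  also have "\<dots> = (norm (z - p))\<^sup>2 - s * (2 * y - s)" unfolding zp by (simp add: power2_eq_square algebra_simps)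
  also have "\<dots> \<le> (norm (z - p))\<^sup>2" using s by (simp add: y_def)
  finally show "dist (z + s *\<^sub>R \<nu>) p \<le> dist z p" unfolding dist_norm by (rule power2_le_imp_le) simp
  have "y \<le> \<bar>(z - p) \<bullet> \<nu>\<bar>" unfolding zp by simp
  also have "\<dots> \<le> norm (z - p) * norm \<nu>" by (rule Cauchy_Schwarz_ineq2)
  finally show "- ((z - a) \<bullet> \<nu>) \<le> dist z p" using \<nu> by (simp add: y_def dist_norm)
qed

text \<open>The dual differential is rotated by a right angle: the derivative of \<psi> along the
  boundary becomes the derivative of \<phi> across it, divided by the area element.\<close>

lemma is_dual_tangential:
  assumes "is_dual \<Omega> \<phi> \<psi>" "z \<in> \<Omega>"
  shows "dir_deriv (\<i> * \<nu>) \<psi> z = (Re \<nu> * dx \<phi> z + Im \<nu> * dy \<phi> z) / sqrt (1 + (norm (grad \<phi> z))\<^sup>2)"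
  using dir_deriv_eq[OF assms(1)[unfolded is_dual_def, rule_format, OF assms(2)], of "\<i> * \<nu>"]
  by (simp add: add_divide_distrib mult.commute)

lemma dir_deriv_C1:
  fixes \<phi> :: "complex \<Rightarrow> real"
  assumes "C1_on \<phi> \<Omega>" "z \<in> \<Omega>"
  shows "dir_deriv v \<phi> z = Re v * dx \<phi> z + Im v * dy \<phi> z"
  using dir_deriv_eq[OF C1_onD[OF assms]] .

text \<open>The relation between \<open>m\<close>, \<open>N\<close> and \<open>W\<close> gives
  \<open>m\<^sup>2 \<le> N\<^sup>2 * (1 - m\<^sup>2)\<close>. Here \<open>m \<ge> 1 / 2\<close> and
  \<open>1 - m\<^sup>2 \<le> 2 * (C * s\<^sup>2)\<close>, hence
  \<open>1 / 4 \<le> 2 * C * (N * s)\<^sup>2\<close>, which explains the 8.\<close>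

lemma slope_lower_bound:
  fixes m N W C s :: real
  assumes m: "m = N / W" "W > 0" "W\<^sup>2 \<ge> 1 + N\<^sup>2" and C: "C > 0" and s: "s > 0" "C * s\<^sup>2 \<le> 1 / 2"
    and close: "\<bar>m - 1\<bar> \<le> C * s\<^sup>2"
  shows "N \<ge> 1 / sqrt (8 * C) / s"
proof -
  have m2: "m \<ge> 1 / 2" using close s by linarith
  have N: "N = m * W" using m by simp
  then have N0: "N > 0" using m2 m by simp
  have "m\<^sup>2 * (1 + N\<^sup>2) \<le> m\<^sup>2 * W\<^sup>2" using m by (intro mult_left_mono) auto
  then have 1: "m\<^sup>2 \<le> N\<^sup>2 * (1 - m\<^sup>2)" unfolding N by (simp add: power_mult_distrib algebra_simps)
  have "1 - m\<^sup>2 = 2 * (1 - m) - (1 - m)\<^sup>2" by (simp add: power2_eq_square algebra_simps)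
  then have "1 - m\<^sup>2 \<le> 2 * (1 - m)" using zero_le_power2[of "1 - m"] by (simp only:)
  moreover have "1 - m \<le> C * s\<^sup>2" using close unfolding abs_le_iff by simp
  then have "2 * (1 - m) \<le> 2 * (C * s\<^sup>2)" by (rule mult_left_mono) simp
  ultimately have "1 - m\<^sup>2 \<le> 2 * (C * s\<^sup>2)" by (rule order_trans)
  then have "N\<^sup>2 * (1 - m\<^sup>2) \<le> N\<^sup>2 * (2 * (C * s\<^sup>2))" by (intro mult_left_mono) auto
  moreover have "1 / 4 \<le> m\<^sup>2" using power_mono[OF m2, of 2] by (simp add: power2_eq_square)
  ultimately have "1 \<le> 8 * C * (N * s)\<^sup>2" using 1 by (simp add: power_mult_distrib algebra_simps)
  then have "sqrt 1 \<le> sqrt (8 * C * (N * s)\<^sup>2)" by (simp only: real_sqrt_le_iff)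
  then have "1 \<le> sqrt (8 * C) * (N * s)" using N0 s C by (simp add: real_sqrt_mult)
  then show ?thesis using C s by (simp add: field_simps)
qed

text \<open>Along every normal to a closed subsegment around \<open>p\<close> the slope of \<phi> at
  height \<open>s\<close> is at least \<open>k / s\<close>, and integration from height
  \<open>h\<close> down to \<open>y\<close> gains \<open>k * ln (h / y)\<close>. The starting values
  at height \<open>h\<close> are bounded by compactness, so the gain is uniform in the foot point,
  as an arbitrary approach to \<open>p\<close> requires.\<close>

lemma tame_degeneration_imp_infinity:
  fixes g :: "real \<Rightarrow> complex"
  assumes g: "simple_path g" "pathfinish g = pathstart g"
    and \<Omega>: "open \<Omega>" "connected \<Omega>" "frontier \<Omega> = path_image g"
    and I: "open_segment a b \<subseteq> frontier \<Omega>" "a \<noteq> b"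
    and \<phi>: "C1_on \<phi> \<Omega>" and dual: "is_dual \<Omega> \<phi> \<psi>"
    and tame: "tamely_degenerates_on \<Omega> \<psi> (open_segment a b)"
  shows "tends_to_plus_infinity_on \<Omega> \<phi> (open_segment a b)"
  unfolding tends_to_plus_infinity_on_def
proof
  let ?I = "open_segment a b"
  fix p assume p: "p \<in> ?I"
  obtain \<nu> where \<nu>: "outward_unit_normal \<Omega> ?I \<nu>" and tm: "\<And>c d. c \<noteq> d \<Longrightarrow> closed_segment c d \<subseteq> ?I \<Longrightarrow>
     \<exists>C. \<exists>\<delta>>0. \<forall>z\<in>\<Omega>. infdist z (closed_segment c d) < \<delta> \<longrightarrow>
        \<bar>dir_deriv (\<i> * \<nu>) \<psi> z - 1\<bar> \<le> C * (infdist z (closed_segment c d))\<^sup>2"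
    using tame unfolding tamely_degenerates_on_def by blast
  have n1: "norm \<nu> = 1" using \<nu> by (simp add: outward_unit_normal_def)
  then have nn: "\<nu> \<bullet> \<nu> = 1" by (simp add: dot_square_norm)
  have perp: "\<nu> \<bullet> (b - a) = 0" by (rule outward_unit_normal_perp[OF \<nu> I(2)])
  define P where "P u = (1 - u) *\<^sub>R a + u *\<^sub>R b" for u
  have Pdiff: "P u - P v = (u - v) *\<^sub>R (b - a)" for u v by (simp add: P_def algebra_simps)
  have Pa: "(P u - a) \<bullet> \<nu> = 0" for u
  proof -
    have "P u - a = u *\<^sub>R (b - a)" by (simp add: P_def algebra_simps)
    then show ?thesis using perp by (simp add: inner_commute)
  qed
  have PI: "P u \<in> ?I" if "0 < u" "u < 1" for u using that I(2) by (auto simp: in_segment P_def)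
  obtain u where u: "0 < u" "u < 1" "p = P u" using p by (auto simp: in_segment P_def)
  \<comment> \<open>A closed subsegment of the open segment with \<open>p\<close> in its interior,
    so that foot points of nearby \<open>z\<close> lie in it.\<close>
  define c d where "c = P (u / 2)" and "d = P ((1 + u) / 2)"
  let ?J = "closed_segment c d"
  have "c - d = (u / 2 - (1 + u) / 2) *\<^sub>R (b - a)" unfolding c_def d_def by (rule Pdiff)
  then have cd: "c \<noteq> d" using I(2) by auto
  have JI: "?J \<subseteq> ?I" using PI[of "u/2"] PI[of "(1+u)/2"] u convex_open_segment
    by (intro closed_segment_subset) (auto simp: c_def d_def)
  have inJ: "P v \<in> ?J" if "u / 2 \<le> v" "v \<le> (1 + u) / 2" for v
  proof -
    have "P v = (1 - (2 * v - u)) *\<^sub>R c + (2 * v - u) *\<^sub>R d"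
    proof -
      have "(1 - x) *\<^sub>R P \<alpha> + x *\<^sub>R P \<beta> = P ((1 - x) * \<alpha> + x * \<beta>)" for x \<alpha> \<beta>
        by (simp add: P_def algebra_simps)
      moreover have "(1 - (2 * v - u)) * (u / 2) + (2 * v - u) * ((1 + u) / 2) = v" by (simp add: field_simps)
      ultimately show ?thesis unfolding c_def d_def by simp
    qed
    then show ?thesis unfolding in_segment using that by (intro exI[of _ "2 * v - u"]) auto
  qed
  obtain C0 \<delta> where C0: "\<delta> > 0" "\<And>z. z \<in> \<Omega> \<Longrightarrow> infdist z ?J < \<delta> \<Longrightarrow>
        \<bar>dir_deriv (\<i> * \<nu>) \<psi> z - 1\<bar> \<le> C0 * (infdist z ?J)\<^sup>2"
    using tm[OF cd JI] by blast
  obtain r where r: "r > 0"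
    "\<forall>z. infdist z ?J < r \<longrightarrow> (z - a) \<bullet> \<nu> = 0 \<longrightarrow> z \<in> ?I"
    "\<forall>z. infdist z ?J < r \<longrightarrow> (z \<in> \<Omega> \<longleftrightarrow> (z - a) \<bullet> \<nu> < 0)"
    by (rule outward_unit_normal_side[OF g \<Omega> I \<nu> JI])
  \<comment> \<open>Tameness permits any real constant; the square root below needs a positive
    one.\<close>
  define C where "C = max C0 1"
  have C: "C > 0" "C0 \<le> C" by (auto simp: C_def)
  \<comment> \<open>The last bound ensures \<open>C * s\<^sup>2 \<le> 1 / 2\<close> for all heights
    up to \<open>h\<close>, as \<open>slope_lower_bound\<close> demands.\<close>
  define h where "h = min (min \<delta> r) (1 / sqrt (2 * C)) / 2"
  have h: "h > 0" "h < \<delta>" "h < r" "h \<le> 1 / sqrt (2 * C)"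
  proof -
    have "1 / sqrt (2 * C) > 0" using C by simp
    moreover have "x > 0 \<Longrightarrow> h = min (min \<delta> r) x / 2 \<Longrightarrow> h > 0 \<and> h < \<delta> \<and> h < r \<and> h \<le> x" for x
      using C0(1) r(1) by linarith
    ultimately show "h > 0" "h < \<delta>" "h < r" "h \<le> 1 / sqrt (2 * C)" using h_def by blast+
  qed
  have Ch: "C * s\<^sup>2 \<le> 1 / 2" if "0 < s" "s \<le> h" for s
  proof -
    have "s\<^sup>2 \<le> (1 / sqrt (2 * C))\<^sup>2" using that h by (intro power_mono) auto
    also have "\<dots> = 1 / (2 * C)" using C by (simp add: power_divide)
    finally have "C * s\<^sup>2 \<le> C * (1 / (2 * C))" using C by (intro mult_left_mono) auto
    then show ?thesis using C by simp
  qed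
  have seg: "q - s *\<^sub>R \<nu> \<in> \<Omega> \<and> infdist (q - s *\<^sub>R \<nu>) ?J \<le> s" if q: "q \<in> ?J" and s: "0 < s" "s \<le> h" for q s
  proof -
    have "infdist (q - s *\<^sub>R \<nu>) ?J \<le> dist (q - s *\<^sub>R \<nu>) q" by (rule infdist_le[OF q])
    then have le: "infdist (q - s *\<^sub>R \<nu>) ?J \<le> s" using s n1 by (simp add: dist_norm)
    have "q \<in> ?I" using q JI by blast
    then obtain v where "q = P v" by (auto simp: in_segment P_def)
    then have "(q - a) \<bullet> \<nu> = 0" using Pa by simp
    moreover have "q - s *\<^sub>R \<nu> - a = (q - a) - s *\<^sub>R \<nu>" by simp
    ultimately have "(q - s *\<^sub>R \<nu> - a) \<bullet> \<nu> = - s" using nn by (simp only: inner_diff_left) simp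
    then show ?thesis using r(3) le s h by auto
  qed
  define k where "k = 1 / sqrt (8 * C)"
  have k: "k > 0" using C by (simp add: k_def)
  have slope: "dir_deriv \<nu> \<phi> (q - s *\<^sub>R \<nu>) \<ge> k / s" if q: "q \<in> ?J" and s: "0 < s" "s \<le> h" for q s
  proof -
    let ?z = "q - s *\<^sub>R \<nu>"
    have z: "?z \<in> \<Omega>" "infdist ?z ?J \<le> s" using seg[OF q s] by auto
    let ?N = "dir_deriv \<nu> \<phi> ?z" let ?W = "sqrt (1 + (norm (grad \<phi> ?z))\<^sup>2)"
    have N: "?N = Re \<nu> * dx \<phi> ?z + Im \<nu> * dy \<phi> ?z" by (rule dir_deriv_C1[OF \<phi> z(1)])
    have "?N = \<nu> \<bullet> grad \<phi> ?z" unfolding N by (simp add: inner_complex_def grad_def)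
    then have "\<bar>?N\<bar> \<le> norm (grad \<phi> ?z)" using Cauchy_Schwarz_ineq2[of \<nu> "grad \<phi> ?z"] n1 by simp
    then have "?N\<^sup>2 \<le> (norm (grad \<phi> ?z))\<^sup>2" using abs_le_square_iff[of ?N "norm (grad \<phi> ?z)"] by simp
    then have W: "?W > 0" "?W\<^sup>2 \<ge> 1 + ?N\<^sup>2" by (auto simp: add_pos_nonneg)
    have m: "dir_deriv (\<i> * \<nu>) \<psi> ?z = ?N / ?W" unfolding N by (rule is_dual_tangential[OF dual z(1)])
    have "infdist ?z ?J < \<delta>" using z(2) s h by linarith
    then have "\<bar>?N / ?W - 1\<bar> \<le> C0 * (infdist ?z ?J)\<^sup>2" using C0(2)[OF z(1)] unfolding m by blast
    also have "\<dots> \<le> C * (infdist ?z ?J)\<^sup>2" using C(2) by (intro mult_right_mono) auto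
    also have "\<dots> \<le> C * s\<^sup>2" using C(1) z(2) by (intro mult_left_mono power_mono infdist_nonneg) auto
    finally have "\<bar>?N / ?W - 1\<bar> \<le> C * s\<^sup>2" .
    then show ?thesis unfolding k_def by (intro slope_lower_bound[OF refl W C(1) s(1) Ch[OF s]])
  qed
  \<comment> \<open>The function \<open>\<phi> (q - s *\<^sub>R \<nu>) + k * ln s\<close> decreases
    in \<open>s\<close>, because its derivative is \<open>k / s\<close> minus the slope.\<close>
  have grow: "\<phi> (q - y *\<^sub>R \<nu>) \<ge> \<phi> (q - h *\<^sub>R \<nu>) + k * ln h - k * ln y" if q: "q \<in> ?J" and y: "0 < y" "y \<le> h" for q y
  proof -
    have "\<phi> (q - h *\<^sub>R \<nu>) + k * ln h \<le> \<phi> (q - y *\<^sub>R \<nu>) + k * ln y"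
    proof (rule DERIV_nonpos_imp_nonincreasing[OF y(2)])
      fix s assume s: "y \<le> s" "s \<le> h"
      then have s0: "0 < s" using y by simp
      have "\<phi> differentiable (at (q + s *\<^sub>R (- \<nu>)))"
        using seg[OF q s0 s(2)] \<phi> by (simp add: C1_on_def)
      then have "((\<lambda>s. \<phi> (q + s *\<^sub>R (- \<nu>))) has_real_derivative dir_deriv (- \<nu>) \<phi> (q + s *\<^sub>R (- \<nu>))) (at s)"
        by (rule DERIV_along)
      moreover have "dir_deriv (- \<nu>) \<phi> (q + s *\<^sub>R (- \<nu>)) = - dir_deriv \<nu> \<phi> (q - s *\<^sub>R \<nu>)"
        using dir_deriv_C1[OF \<phi>, of "q - s *\<^sub>R \<nu>"] seg[OF q s0 s(2)] by simp
      ultimately have "((\<lambda>s. \<phi> (q - s *\<^sub>R \<nu>) + k * ln s) has_real_derivative - dir_deriv \<nu> \<phi> (q - s *\<^sub>R \<nu>) + k * (1 / s)) (at s)"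
        using s0 by (intro DERIV_add DERIV_cmult DERIV_ln_divide) simp_all
      moreover have "- dir_deriv \<nu> \<phi> (q - s *\<^sub>R \<nu>) + k * (1 / s) \<le> 0" using slope[OF q s0 s(2)] by simp
      ultimately show "\<exists>y. ((\<lambda>s. \<phi> (q - s *\<^sub>R \<nu>) + k * ln s) has_real_derivative y) (at s) \<and> y \<le> 0" by blast
    qed
    then show ?thesis by simp
  qed
  have "continuous_on ?J (\<lambda>q. \<phi> (q - h *\<^sub>R \<nu>))"
    by (rule continuous_on_compose2[OF C1_on_continuous[OF \<phi>]]) (use seg h in \<open>auto intro!: continuous_intros\<close>)
  then have "compact ((\<lambda>q. \<phi> (q - h *\<^sub>R \<nu>)) ` ?J)" by (intro compact_continuous_image) auto
  then obtain B where B: "\<And>q. q \<in> ?J \<Longrightarrow> \<bar>\<phi> (q - h *\<^sub>R \<nu>)\<bar> \<le> B"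
    using compact_imp_bounded bounded_iff by (metis imageI real_norm_def)
  show "filterlim \<phi> at_top (at p within \<Omega>)"
    unfolding filterlim_at_top
  proof
    fix Z :: real
    \<comment> \<open>\<epsilon>1 keeps the foot point of \<open>z\<close> in the subsegment, and
      \<epsilon>2 is the height at which the guaranteed value
      \<open>- B + k * ln h - k * ln y\<close> equals \<open>Z\<close>.\<close>
    define \<epsilon>1 where "\<epsilon>1 = min (u / 2) ((1 - u) / 2) * norm (b - a)"
    define \<epsilon>2 where "\<epsilon>2 = exp ((- B + k * ln h - Z) / k)"
    define \<epsilon> where "\<epsilon> = min (min \<epsilon>1 \<epsilon>2) h"
    have \<epsilon>: "\<epsilon> > 0" "\<epsilon> \<le> \<epsilon>1" "\<epsilon> \<le> \<epsilon>2" "\<epsilon> \<le> h"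
      using u I(2) h by (auto simp: \<epsilon>_def \<epsilon>1_def \<epsilon>2_def)
    show "\<forall>\<^sub>F z in at p within \<Omega>. Z \<le> \<phi> z"
      unfolding eventually_at
    proof (intro exI[of _ \<epsilon>] conjI ballI impI \<epsilon>(1))
      fix z assume z: "z \<in> \<Omega>" "z \<noteq> p \<and> dist z p < \<epsilon>"
      have pJ: "p \<in> ?J" unfolding u(3) using u by (intro inJ) auto
      have "infdist z ?J \<le> dist z p" by (rule infdist_le[OF pJ])
      then have "infdist z ?J < r" using z \<epsilon> h by linarith
      then have neg: "(z - a) \<bullet> \<nu> < 0" using r(3) z(1) by blast
      define y where "y = - ((z - a) \<bullet> \<nu>)"
      have y0: "y > 0" using neg by (simp add: y_def)
      have pa: "(p - a) \<bullet> \<nu> = 0" unfolding u(3) by (rule Pa)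
      have near: "dist (z + y *\<^sub>R \<nu>) p \<le> dist z p" "y \<le> dist z p"
        using dist_toward_segment_le[OF n1 pa, of y z] y0 by (auto simp: y_def)
      define q where "q = z + y *\<^sub>R \<nu>"
      have zq: "z = q - y *\<^sub>R \<nu>" by (simp add: q_def)
      have "q - a = (z - a) + y *\<^sub>R \<nu>" by (simp add: q_def)
      then have "(q - a) \<bullet> \<nu> = 0" using nn by (simp only: inner_add_left) (simp add: y_def)
      moreover have "\<nu> \<noteq> 0" using n1 by auto
      ultimately obtain v where v: "q - a = v *\<^sub>R (b - a)"
        using parallel_of_common_normal[of "q - a" \<nu> "b - a"] perp n1 I(2) by (auto simp: inner_commute)
      then have qP: "q = P v" by (simp add: P_def algebra_simps)
      have "\<bar>v - u\<bar> * norm (b - a) = dist q p" unfolding qP u(3) dist_norm Pdiff by simp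
      also have "\<dots> < \<epsilon>1" using near(1) z(2) \<epsilon>(2) unfolding q_def by linarith
      finally have "\<bar>v - u\<bar> < min (u / 2) ((1 - u) / 2)" using I(2) unfolding \<epsilon>1_def by (simp add: mult_less_cancel_right_pos)
      then have "v - u < (1 - u) / 2" "u - v < u / 2" unfolding abs_less_iff by simp_all
      then have "u / 2 \<le> v" "v \<le> (1 + u) / 2" by (simp_all add: field_simps)
      then have qJ: "q \<in> ?J" unfolding qP by (rule inJ)
      have yh: "y \<le> h" "y < \<epsilon>2" using near(2) z(2) \<epsilon> by auto
      have "\<epsilon>2 > 0" by (simp add: \<epsilon>2_def)
      then have "ln y < ln \<epsilon>2" using y0 yh(2) by simp
      then have "ln y < (- B + k * ln h - Z) / k" unfolding \<epsilon>2_def ln_exp .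
      then have "ln y * k < - B + k * ln h - Z" using k by (simp only: pos_less_divide_eq)
      then have "k * ln y < - B + k * ln h - Z" by (simp only: mult.commute)
      moreover have "\<phi> z \<ge> \<phi> (q - h *\<^sub>R \<nu>) + k * ln h - k * ln y" unfolding zq by (rule grow[OF qJ y0 yh(1)])
      moreover have "\<phi> (q - h *\<^sub>R \<nu>) \<ge> - B" using B[OF qJ] by linarith
      ultimately show "Z \<le> \<phi> z" by linarith
    qed
  qed
qed

section \<open>From an infinite boundary value to tame degeneration\<close>

context harmonic_jordan_map
begin

text \<open>A closed subsegment of the open segment keeps a positive distance from \<open>l\<close>
  and \<open>r\<close> even when these are the ends of the open segment. The margin \<theta>0 is
  what later keeps the argument away from 0 and \<pi>; it is attained at \<open>c\<close> or
  \<open>d\<close> by convexity.\<close>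

lemma segment_in_cluster_segment:
  fixes a b c d l r :: complex
  assumes sub: "open_segment a b \<subseteq> closed_segment l r" and ab: "a \<noteq> b"
    and J: "closed_segment c d \<subseteq> open_segment a b"
  obtains \<theta>0 where "0 < \<theta>0" "\<theta>0 \<le> 1 / 2"
    "\<And>p. p \<in> closed_segment c d \<Longrightarrow> \<exists>\<theta>. \<theta>0 \<le> \<theta> \<and> \<theta> \<le> 1 - \<theta>0 \<and> p = r + of_real \<theta> * (l - r)"
proof -
  define Q where "Q \<theta> = r + of_real \<theta> * (l - r)" for \<theta>
  have aff: "(1 - x) *\<^sub>R Q \<alpha> + x *\<^sub>R Q \<beta> = Q ((1 - x) * \<alpha> + x * \<beta>)" for x \<alpha> \<beta>
    by (simp add: Q_def scaleR_conv_of_real algebra_simps)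
  have segQ: "\<exists>\<theta>. 0 \<le> \<theta> \<and> \<theta> \<le> 1 \<and> p = Q \<theta>" if "p \<in> closed_segment l r" for p
  proof -
    from that have "\<exists>v. 0 \<le> v \<and> v \<le> 1 \<and> p = (1 - v) *\<^sub>R l + v *\<^sub>R r" by (auto simp: in_segment)
    then obtain v where v: "0 \<le> v" "v \<le> 1" "p = (1 - v) *\<^sub>R l + v *\<^sub>R r" by blast
    then have "p = Q (1 - v)" by (simp add: Q_def scaleR_conv_of_real algebra_simps)
    then show ?thesis using v by (intro exI[of _ "1 - v"]) auto
  qed
  have "closure (open_segment a b) \<subseteq> closed_segment l r" by (intro closure_minimal sub closed_segment)
  then have ends: "a \<in> closed_segment l r" "b \<in> closed_segment l r" using ab by auto
  obtain \<alpha> \<beta> where \<alpha>: "0 \<le> \<alpha>" "\<alpha> \<le> 1" "a = Q \<alpha>" and \<beta>: "0 \<le> \<beta>" "\<beta> \<le> 1" "b = Q \<beta>"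
    using segQ[OF ends(1)] segQ[OF ends(2)] by blast
  have "\<alpha> \<noteq> \<beta>" using ab \<alpha> \<beta> by auto
  have int: "\<exists>\<theta>. 0 < \<theta> \<and> \<theta> < 1 \<and> p = Q \<theta>" if p: "p \<in> open_segment a b" for p
  proof -
    obtain x where x: "0 < x" "x < 1" "p = (1 - x) *\<^sub>R a + x *\<^sub>R b" using p by (auto simp: in_segment)
    have "(1 - x) * \<alpha> + x * \<beta> > 0"
    proof (cases "\<alpha> > 0")
      case True
      then show ?thesis using x \<beta> by (simp add: add_pos_nonneg)
    next
      case False
      then have "\<beta> > 0" using \<alpha> \<beta> \<open>\<alpha> \<noteq> \<beta>\<close> by linarith
      then show ?thesis using x \<alpha> by (simp add: add_nonneg_pos)
    qed
    moreover have "(1 - x) * (1 - \<alpha>) + x * (1 - \<beta>) > 0"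
    proof (cases "\<alpha> < 1")
      case True
      then show ?thesis using x \<beta> by (simp add: add_pos_nonneg)
    next
      case False
      then have "\<beta> < 1" using \<alpha> \<beta> \<open>\<alpha> \<noteq> \<beta>\<close> by linarith
      then show ?thesis using x \<alpha> by (simp add: add_nonneg_pos)
    qed
    ultimately show ?thesis unfolding x(3) \<alpha>(3) \<beta>(3) aff
      by (intro exI[of _ "(1 - x) * \<alpha> + x * \<beta>"]) (simp add: algebra_simps)
  qed
  have cdI: "c \<in> open_segment a b" "d \<in> open_segment a b" using J by auto
  obtain \<gamma> \<delta> where \<gamma>: "0 < \<gamma>" "\<gamma> < 1" "c = Q \<gamma>" and \<delta>: "0 < \<delta>" "\<delta> < 1" "d = Q \<delta>"
    using int[OF cdI(1)] int[OF cdI(2)] by blast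
  define \<theta>0 where "\<theta>0 = min (min \<gamma> (1 - \<gamma>)) (min \<delta> (1 - \<delta>))"
  have t0: "0 < \<theta>0" "\<theta>0 \<le> \<gamma>" "\<gamma> \<le> 1 - \<theta>0" "\<theta>0 \<le> \<delta>" "\<delta> \<le> 1 - \<theta>0" using \<gamma> \<delta> by (auto simp: \<theta>0_def)
  show ?thesis
  proof (rule that[OF t0(1)])
    show "\<theta>0 \<le> 1 / 2" using t0 by linarith
    fix p assume "p \<in> closed_segment c d"
    then obtain x where x: "0 \<le> x" "x \<le> 1" "p = (1 - x) *\<^sub>R c + x *\<^sub>R d" by (auto simp: in_segment)
    have "p = Q ((1 - x) * \<gamma> + x * \<delta>)" unfolding x(3) \<gamma>(3) \<delta>(3) aff ..
    moreover have "(1 - x) * \<theta>0 + x * \<theta>0 \<le> (1 - x) * \<gamma> + x * \<delta>"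
      using x t0 by (intro add_mono mult_left_mono) auto
    moreover have "(1 - x) * \<gamma> + x * \<delta> \<le> (1 - x) * (1 - \<theta>0) + x * (1 - \<theta>0)"
      using x t0 by (intro add_mono mult_left_mono) auto
    ultimately show "\<exists>\<theta>. \<theta>0 \<le> \<theta> \<and> \<theta> \<le> 1 - \<theta>0 \<and> p = r + of_real \<theta> * (l - r)"
      by (intro exI[of _ "(1 - x) * \<gamma> + x * \<delta>"]) (simp add: Q_def algebra_simps)
  qed
qed

text \<open>Any cluster point in the segment brings the entire segment with it, so the parameter
  found for the midpoint serves all of it, and a second one would contradict
  \<open>unique_collapse_point\<close>.\<close>

lemma infinity_imp_collapse:
  assumes T: "T holomorphic_on ball 0 1" "\<And>w. w \<in> ball 0 1 \<Longrightarrow> \<phi> (f w) = Re (T w)"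
    and I: "open_segment a b \<subseteq> frontier \<Omega>" "a \<noteq> b"
    and inf: "tends_to_plus_infinity_on \<Omega> \<phi> (open_segment a b)"
  obtains t where "t \<in> E0" "open_segment a b \<subseteq> cl t"
    "\<And>s. cl s \<inter> open_segment a b \<noteq> {} \<Longrightarrow> cis s = cis t"
proof -
  let ?I = "open_segment a b"
  have avoid: "Fb s \<notin> ?I" if "s \<notin> E0" for s
    by (rule boundary_values_avoid_infinity_segment[OF T I inf that])
  have m: "midpoint a b \<in> ?I" using I(2) by simp
  then have "midpoint a b \<in> frontier \<Omega>" using I(1) by blast
  then obtain t where "midpoint a b \<in> cl t" by (rule cluster_point_exists)
  then have t: "t \<in> E0" "?I \<subseteq> cl t" using jump_segment_covers[OF I avoid m] by auto
  have "cis s = cis t" if s: "cl s \<inter> ?I \<noteq> {}" for s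
  proof -
    obtain p where "p \<in> ?I" "p \<in> cl s" using s by blast
    then have "?I \<subseteq> cl s" using jump_segment_covers[OF I avoid] by blast
    then show ?thesis using unique_collapse_point[OF _ t(2) I(2)] by blast
  qed
  then show ?thesis using that t by blast
qed

text \<open>With \<open>?N\<close> the normal slope of \<phi> and \<open>?W\<close> the area
  element, the derivative of \<psi> along the boundary is \<open>?N z / ?W z\<close>. The ratio of
  the complex derivatives is at most \<open>K\<close> times the distance to the boundary line, and
  \<open>conformal_slope_estimate\<close> bounds one minus the square of this quotient. Its sign has
  to be found separately.\<close>

lemma infinity_imp_tame_degeneration:
  assumes T: "T holomorphic_on ball 0 1" "\<And>w. w \<in> ball 0 1 \<Longrightarrow> \<phi> (f w) = Re (T w)"
    and I: "open_segment a b \<subseteq> frontier \<Omega>" "a \<noteq> b"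
    and inf: "tends_to_plus_infinity_on \<Omega> \<phi> (open_segment a b)"
    and \<phi>: "C1_on \<phi> \<Omega>" and dual: "is_dual \<Omega> \<phi> \<psi>"
    and conf: "\<And>w. w \<in> ball 0 1 \<Longrightarrow> (deriv U w)\<^sup>2 + (deriv V w)\<^sup>2 +
      (of_real (dx \<phi> (f w)) * deriv U w + of_real (dy \<phi> (f w)) * deriv V w)\<^sup>2 = 0"
    and orient: "\<And>w. w \<in> ball 0 1 \<Longrightarrow> Im (deriv U w * cnj (deriv V w)) > 0"
  shows "tamely_degenerates_on \<Omega> \<psi> (open_segment a b)"
proof -
  let ?I = "open_segment a b"
  obtain \<nu> where \<nu>: "outward_unit_normal \<Omega> ?I \<nu>"
    using outward_unit_normal_exists[OF loop dom(1,2,3) I] by blast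
  have n1: "norm \<nu> = 1" using \<nu> by (simp add: outward_unit_normal_def)
  have perp: "\<nu> \<bullet> (b - a) = 0" by (rule outward_unit_normal_perp[OF \<nu> I(2)])
  define \<tau> where "\<tau> = \<i> * \<nu>"
  have \<tau>: "cmod \<tau> = 1" "\<i> * \<tau> = - \<nu>" using n1 by (simp_all add: \<tau>_def norm_mult)
  have \<tau>2: "(Re \<tau>)\<^sup>2 + (Im \<tau>)\<^sup>2 = 1" using \<tau>(1) by (simp flip: cmod_power2)
  obtain t where t: "t \<in> E0" "?I \<subseteq> cl t" "\<And>s. cl s \<inter> ?I \<noteq> {} \<Longrightarrow> cis s = cis t"
    by (rule infinity_imp_collapse[OF T I inf]) blast+
  obtain l r where lr: "l \<in> frontier \<Omega>" "r \<in> frontier \<Omega>" "l \<noteq> r"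
    "(Fb \<longlongrightarrow> r) (at t within {s. s > t \<and> s \<notin> E0})" "(Fb \<longlongrightarrow> l) (at t within {s. s < t \<and> s \<notin> E0})"
    "cl t = closed_segment l r" by (rule E0_jump[OF t(1)])
  have asy: "((\<lambda>\<xi>. ft \<xi> - jump_model l r t \<xi>) \<longlongrightarrow> 0) (at (of_real t) within HH)"
    by (rule asymptotic_jump[OF lr(4,5)])
  have Ilr: "?I \<subseteq> closed_segment l r" using t(2) lr(6) by simp
  obtain \<Lambda> where \<Lambda>: "l - r = of_real \<Lambda> * \<tau>" "\<Lambda> \<noteq> 0"
  proof -
    have "closure ?I \<subseteq> closed_segment l r" by (intro closure_minimal Ilr closed_segment)
    then have ends: "a \<in> closed_segment l r" "b \<in> closed_segment l r" using I(2) by auto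
    then obtain u v where u: "a = (1 - u) *\<^sub>R l + u *\<^sub>R r" and v: "b = (1 - v) *\<^sub>R l + v *\<^sub>R r"
      unfolding in_segment by blast
    have "b - a = (u - v) *\<^sub>R (l - r)" unfolding u v by (simp add: algebra_simps)
    then have "(u - v) * (\<nu> \<bullet> (l - r)) = 0" "u \<noteq> v" using perp I(2) by auto
    then have "(l - r) \<bullet> \<nu> = 0" by (simp add: inner_commute)
    moreover have "\<tau> \<bullet> \<nu> = 0" "\<tau> \<noteq> 0" "\<nu> \<noteq> 0" using n1 by (auto simp: \<tau>_def inner_complex_def)
    ultimately obtain s where "l - r = s *\<^sub>R \<tau>" using parallel_of_common_normal by blast
    then have "l - r = of_real s * \<tau>" "s \<noteq> 0" using lr(3) by (auto simp: scaleR_conv_of_real)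
    then show ?thesis by (rule that)
  qed
  show ?thesis unfolding tamely_degenerates_on_def
  proof (rule exI[of _ \<nu>], intro conjI allI impI \<nu>)
    fix c d assume cd: "c \<noteq> d \<and> closed_segment c d \<subseteq> ?I"
    let ?J = "closed_segment c d"
    have JI: "?J \<subseteq> ?I" using cd by blast
    obtain \<rho> where \<rho>: "\<rho> > 0"
      "\<forall>z. infdist z ?J < \<rho> \<longrightarrow> (z - a) \<bullet> \<nu> = 0 \<longrightarrow> z \<in> ?I"
      "\<forall>z. infdist z ?J < \<rho> \<longrightarrow> (z \<in> \<Omega> \<longleftrightarrow> (z - a) \<bullet> \<nu> < 0)"
      by (rule outward_unit_normal_side[OF loop dom(1,2,3) I \<nu> JI])
    obtain \<theta>0 where \<theta>0: "0 < \<theta>0" "\<theta>0 \<le> 1 / 2"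
      "\<And>p. p \<in> ?J \<Longrightarrow> \<exists>\<theta>. \<theta>0 \<le> \<theta> \<and> \<theta> \<le> 1 - \<theta>0 \<and> p = r + of_real \<theta> * (l - r)"
      by (rule segment_in_cluster_segment[OF Ilr I(2) JI]) blast
    have Jc: "compact ?J" "?J \<noteq> {}" by auto
    have JF: "?J \<subseteq> frontier \<Omega>" using JI I(1) by blast
    have pos: "(z - a) \<bullet> (\<i> * \<tau>) > 0" if "z \<in> \<Omega>" "infdist z ?J < \<rho>" for z
      using \<rho>(3) that unfolding \<tau>(2) by simp
    have uniq: "cis s = cis t" if "cl s \<inter> ?J \<noteq> {}" for s using t(3)[of s] that JI by blast
    have near: "\<exists>\<eta>>0. \<forall>w\<in>ball 0 1. infdist (f w) ?J < \<eta> \<longrightarrow> dist w (cis t) < \<delta>" if "\<delta> > 0" for \<delta>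
      by (rule near_collapse_point[OF Jc(1) JF Jc(2) uniq that])
    from collapse_deriv_ratio[OF asy \<tau>(1) \<Lambda> Jc \<theta>0 \<rho>(1) pos near]
    obtain K \<eta> where K: "K \<ge> 0" and \<eta>: "\<eta> > 0" and ratio: "\<And>w. w \<in> ball 0 1 \<Longrightarrow> infdist (f w) ?J < \<eta> \<Longrightarrow>
      cmod (of_real (Re \<tau>) * deriv V w - of_real (Im \<tau>) * deriv U w) \<le>
      K * ((f w - a) \<bullet> (\<i> * \<tau>)) * cmod (of_real (Re \<tau>) * deriv U w + of_real (Im \<tau>) * deriv V w)" by blast
    \<comment> \<open>The last bound makes \<open>K * y\<close> at most \<open>1 / 2\<close>, as the
      conformal estimate requires.\<close>
    define \<delta> where "\<delta> = min (min \<eta> \<rho>) (1 / (2 * (K + 1)))"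
    have \<delta>: "\<delta> > 0" "\<delta> \<le> \<eta>" "\<delta> \<le> \<rho>" "\<delta> \<le> 1 / (2 * (K + 1))" using \<eta> \<rho>(1) K by (auto simp: \<delta>_def)
    have Pa: "(p - a) \<bullet> \<nu> = 0" if p: "p \<in> ?I" for p
    proof -
      obtain u where "p = (1 - u) *\<^sub>R a + u *\<^sub>R b" using p by (auto simp: in_segment)
      then have "p - a = u *\<^sub>R (b - a)" by (simp add: algebra_simps)
      then show ?thesis using perp by (simp add: inner_commute)
    qed
    have side: "(z - a) \<bullet> \<nu> < 0 \<and> - ((z - a) \<bullet> \<nu>) \<le> infdist z ?J" if z: "z \<in> \<Omega>" "infdist z ?J < \<delta>" for z
    proof -
      have neg: "(z - a) \<bullet> \<nu> < 0" using \<rho>(3) z \<delta>(3) by auto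
      obtain p where p: "p \<in> ?J" "infdist z ?J = dist z p"
        using infdist_attains_inf[of ?J z] Jc compact_imp_closed by metis
      have "- ((z - a) \<bullet> \<nu>) \<le> dist z p"
        by (rule dist_toward_segment_le(2)[OF n1 Pa order_refl]) (use p JI neg in auto)
      then show ?thesis using p neg by simp
    qed
    let ?N = "\<lambda>z. dir_deriv \<nu> \<phi> z" let ?W = "\<lambda>z. sqrt (1 + (norm (grad \<phi> z))\<^sup>2)"
    have Wpos: "?W z > 0" for z by (simp add: add_pos_nonneg)
    have N: "?N z = Re \<nu> * dx \<phi> z + Im \<nu> * dy \<phi> z" if "z \<in> \<Omega>" for z by (rule dir_deriv_C1[OF \<phi> that])
    have psi: "dir_deriv (\<i> * \<nu>) \<psi> z = ?N z / ?W z" if "z \<in> \<Omega>" for z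
      unfolding N[OF that] by (rule is_dual_tangential[OF dual that])
    have est: "1 - (?N z / ?W z)\<^sup>2 \<le> 3 * (K * infdist z ?J)\<^sup>2 \<and> ?N z \<noteq> 0" if z: "z \<in> \<Omega>" "infdist z ?J < \<delta>" for z
    proof -
      obtain w where w: "w \<in> ball 0 1" "f w = z" using z(1) img by blast
      define y where "y = - ((z - a) \<bullet> \<nu>)"
      have y: "0 < y" "y \<le> infdist z ?J" using side[OF z] by (auto simp: y_def)
      define k where "k = K * y"
      have "k \<le> K * (1 / (2 * (K + 1)))" unfolding k_def using K y z(2) \<delta>(4) by (intro mult_left_mono) auto
      also have "\<dots> \<le> 1 / 2" using K by (simp add: field_simps)
      finally have k: "k \<le> 1 / 2" .
      let ?U = "deriv U w" let ?V = "deriv V w"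
      define P Y where "P = of_real (Re \<tau>) * ?U + of_real (Im \<tau>) * ?V" and "Y = of_real (Re \<tau>) * ?V - of_real (Im \<tau>) * ?U"
      \<comment> \<open>The derivatives of \<phi> along \<tau> and along
        \<open>\<i> * \<tau>\<close>; the latter is the inward normal, so \<beta> is minus
        \<open>?N z\<close>.\<close>
      define \<alpha> \<beta> where "\<alpha> = Re \<tau> * dx \<phi> z + Im \<tau> * dy \<phi> z" and "\<beta> = Re \<tau> * dy \<phi> z - Im \<tau> * dx \<phi> z"
      have \<tau>2c: "(of_real (Re \<tau>))\<^sup>2 + (of_real (Im \<tau>))\<^sup>2 = (1::complex)"
        using \<tau>2 by (metis of_real_1 of_real_add of_real_power)
      have Yk: "cmod Y \<le> k * cmod P"
        using ratio[OF w(1)] w(2) z(2) \<delta>(2) unfolding \<tau>(2) Y_def P_def k_def y_def by simp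
      \<comment> \<open>The pair \<open>P\<close>, \<open>Y\<close> arises from the derivatives of
        \<open>U\<close> and \<open>V\<close> by the rotation given by the unit vector \<tau>, which
        preserves the conformal relation and the orientation.\<close>
      have PY: "P\<^sup>2 + Y\<^sup>2 = ?U\<^sup>2 + ?V\<^sup>2"
      proof -
        have "P\<^sup>2 + Y\<^sup>2 = ((of_real (Re \<tau>))\<^sup>2 + (of_real (Im \<tau>))\<^sup>2) * (?U\<^sup>2 + ?V\<^sup>2)"
          unfolding P_def Y_def by (simp add: power2_eq_square algebra_simps)
        then show ?thesis unfolding \<tau>2c by simp
      qed
      have aP: "of_real \<alpha> * P + of_real \<beta> * Y = of_real (dx \<phi> z) * ?U + of_real (dy \<phi> z) * ?V"
      proof -
        have "of_real \<alpha> * P + of_real \<beta> * Y =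
          ((of_real (Re \<tau>))\<^sup>2 + (of_real (Im \<tau>))\<^sup>2) * (of_real (dx \<phi> z) * ?U + of_real (dy \<phi> z) * ?V)"
          unfolding P_def Y_def \<alpha>_def \<beta>_def by (simp add: power2_eq_square algebra_simps)
        then show ?thesis unfolding \<tau>2c by simp
      qed
      have c0: "P\<^sup>2 + Y\<^sup>2 + (of_real \<alpha> * P + of_real \<beta> * Y)\<^sup>2 = 0"
        unfolding PY aP using conf[OF w(1)] w(2) by simp
      have o0: "Im (P * cnj Y) > 0"
      proof -
        have "Im (P * cnj Y) = ((Re \<tau>)\<^sup>2 + (Im \<tau>)\<^sup>2) * Im (?U * cnj ?V)"
          unfolding P_def Y_def by (simp add: power2_eq_square algebra_simps)
        then show ?thesis unfolding \<tau>2 using orient[OF w(1)] by simp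
      qed
      have fin: "1 - \<beta>\<^sup>2 / (1 + \<alpha>\<^sup>2 + \<beta>\<^sup>2) \<le> 3 * k\<^sup>2"
        by (rule conformal_slope_estimate[OF c0 o0 Yk k])
      have "\<beta> = - ?N z" unfolding \<beta>_def N[OF z(1)] by (simp add: \<tau>_def)
      moreover have W2: "1 + \<alpha>\<^sup>2 + \<beta>\<^sup>2 = (?W z)\<^sup>2"
      proof -
        have "\<alpha>\<^sup>2 + \<beta>\<^sup>2 = ((Re \<tau>)\<^sup>2 + (Im \<tau>)\<^sup>2) * ((dx \<phi> z)\<^sup>2 + (dy \<phi> z)\<^sup>2)"
          unfolding \<alpha>_def \<beta>_def by (simp add: power2_eq_square algebra_simps)
        then show ?thesis unfolding \<tau>2 by (simp add: norm_grad)
      qed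
      ultimately have fin2: "1 - (?N z / ?W z)\<^sup>2 \<le> 3 * k\<^sup>2"
        using fin[unfolded W2] by (simp add: power_divide)
      have k0: "k \<ge> 0" using K y by (simp add: k_def)
      have "k\<^sup>2 \<le> (K * infdist z ?J)\<^sup>2"
        using k0 K y by (intro power_mono) (auto simp: k_def intro: mult_left_mono)
      moreover have "?N z \<noteq> 0"
      proof
        assume "?N z = 0"
        then have "1 \<le> 3 * k\<^sup>2" using fin2 by simp
        moreover have "k\<^sup>2 \<le> (1 / 2)\<^sup>2" using k k0 by (intro power_mono) auto
        ultimately show False by (simp add: power2_eq_square)
      qed
      ultimately show ?thesis using fin2 by auto
    qed
    \<comment> \<open>By \<open>est\<close> the normal slope has no zero near \<open>?J\<close>. If
      it were negative at \<open>z\<close>, it would stay negative along the normal from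
      \<open>z\<close> to the segment, and \<phi> would not increase on a path along which it has to
      tend to plus infinity.\<close>
    have sign: "?N z > 0" if z: "z \<in> \<Omega>" "infdist z ?J < \<delta>" for z
    proof (rule ccontr)
      assume "\<not> ?N z > 0"
      then have Nz: "?N z < 0" using est[OF z] by auto
      define y where "y = - ((z - a) \<bullet> \<nu>)"
      have y: "y > 0" using side[OF z] by (simp add: y_def)
      obtain p where p: "p \<in> ?J" "infdist z ?J = dist z p"
        using infdist_attains_inf[of ?J z] Jc compact_imp_closed by metis
      have nn: "\<nu> \<bullet> \<nu> = 1" using n1 by (simp add: dot_square_norm)
      have zs: "infdist (z + s *\<^sub>R \<nu>) ?J < \<delta>" "(z + s *\<^sub>R \<nu> - a) \<bullet> \<nu> = s - y" if s: "0 \<le> s" "s \<le> y" for s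
      proof -
        have "dist (z + s *\<^sub>R \<nu>) p \<le> dist z p"
          by (rule dist_toward_segment_le(1)[OF n1 Pa]) (use p JI s in \<open>auto simp: y_def\<close>)
        then show "infdist (z + s *\<^sub>R \<nu>) ?J < \<delta>" using infdist_le[OF p(1), of "z + s *\<^sub>R \<nu>"] z(2) p(2) by linarith
        have "z + s *\<^sub>R \<nu> - a = (z - a) + s *\<^sub>R \<nu>" by simp
        then show "(z + s *\<^sub>R \<nu> - a) \<bullet> \<nu> = s - y" using nn by (simp only: inner_add_left) (simp add: y_def)
      qed
      have zO: "z + s *\<^sub>R \<nu> \<in> \<Omega>" if s: "0 \<le> s" "s < y" for s
        using \<rho>(3) zs[of s] s \<delta>(3) by auto
      have contN: "continuous_on {0..<y} (\<lambda>s. ?N (z + s *\<^sub>R \<nu>))"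
      proof -
        have 1: "continuous_on \<Omega> (\<lambda>z. Re \<nu> * dx \<phi> z + Im \<nu> * dy \<phi> z)"
          using \<phi> unfolding C1_on_def by (intro continuous_intros) auto
        have "continuous_on {0..<y} (\<lambda>s. Re \<nu> * dx \<phi> (z + s *\<^sub>R \<nu>) + Im \<nu> * dy \<phi> (z + s *\<^sub>R \<nu>))"
          by (rule continuous_on_compose2[OF 1]) (use zO in \<open>auto intro!: continuous_intros\<close>)
        moreover have "?N (z + s *\<^sub>R \<nu>) = Re \<nu> * dx \<phi> (z + s *\<^sub>R \<nu>) + Im \<nu> * dy \<phi> (z + s *\<^sub>R \<nu>)" if "s \<in> {0..<y}" for s
          using N[OF zO[of s]] that by auto
        ultimately show ?thesis by (subst continuous_on_cong[OF refl]) auto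
      qed
      have Nneg: "?N (z + s *\<^sub>R \<nu>) < 0" if s: "0 \<le> s" "s < y" for s
      proof (rule ccontr)
        assume "\<not> ?thesis"
        then have "?N (z + 0 *\<^sub>R \<nu>) \<le> 0" "0 \<le> ?N (z + s *\<^sub>R \<nu>)" using Nz by auto
        moreover have "continuous_on {0..s} (\<lambda>s. ?N (z + s *\<^sub>R \<nu>))"
          by (rule continuous_on_subset[OF contN]) (use s in auto)
        ultimately have "\<exists>x\<ge>0. x \<le> s \<and> ?N (z + x *\<^sub>R \<nu>) = 0" using s(1) by (intro IVT') auto
        then obtain x where x: "0 \<le> x" "x \<le> s" "?N (z + x *\<^sub>R \<nu>) = 0" by blast
        then show False using est[OF zO[of x] zs(1)[of x]] s by auto
      qed
      have dec: "\<phi> (z + s *\<^sub>R \<nu>) \<le> \<phi> z" if s: "0 \<le> s" "s < y" for s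
      proof -
        have "\<phi> (z + s *\<^sub>R \<nu>) \<le> \<phi> (z + 0 *\<^sub>R \<nu>)"
        proof (rule DERIV_nonpos_imp_nonincreasing[OF s(1)])
          fix x assume x: "0 \<le> x" "x \<le> s"
          then have xs: "0 \<le> x" "x < y" using s by auto
          have "((\<lambda>s. \<phi> (z + s *\<^sub>R \<nu>)) has_real_derivative ?N (z + x *\<^sub>R \<nu>)) (at x)"
            using zO[OF xs] \<phi> by (intro DERIV_along) (simp add: C1_on_def)
          then show "\<exists>y. ((\<lambda>s. \<phi> (z + s *\<^sub>R \<nu>)) has_real_derivative y) (at x) \<and> y \<le> 0"
            using Nneg[OF xs] by (auto intro!: exI[of _ "?N (z + x *\<^sub>R \<nu>)"])
        qed
        then show ?thesis by simp
      qed
      define q where "q = z + y *\<^sub>R \<nu>"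
      have qI: "q \<in> ?I" using \<rho>(2) zs[of y] y \<delta>(3) unfolding q_def by auto
      have fl: "filterlim (\<lambda>s. z + s *\<^sub>R \<nu>) (at q within \<Omega>) (at_left y)"
        unfolding filterlim_at
      proof
        have "((\<lambda>s. z + s *\<^sub>R \<nu>) \<longlongrightarrow> z + y *\<^sub>R \<nu>) (at_left y)" by (intro tendsto_intros)
        then show "((\<lambda>s. z + s *\<^sub>R \<nu>) \<longlongrightarrow> q) (at_left y)" by (simp add: q_def)
        have "\<forall>\<^sub>F s in at_left y. s \<in> {0<..<y}" using eventually_at_left_real[OF y] .
        then show "\<forall>\<^sub>F s in at_left y. z + s *\<^sub>R \<nu> \<in> \<Omega> \<and> z + s *\<^sub>R \<nu> \<noteq> q"
        proof eventually_elim
          fix s assume "s \<in> {0<..<y}"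
          moreover have "\<nu> \<noteq> 0" using n1 by auto
          ultimately show "z + s *\<^sub>R \<nu> \<in> \<Omega> \<and> z + s *\<^sub>R \<nu> \<noteq> q" using zO[of s] by (auto simp: q_def)
        qed
      qed
      have "filterlim \<phi> at_top (at q within \<Omega>)" using inf qI by (simp add: tends_to_plus_infinity_on_def)
      then have "filterlim (\<lambda>s. \<phi> (z + s *\<^sub>R \<nu>)) at_top (at_left y)" using fl by (rule filterlim_compose)
      then have "\<forall>\<^sub>F s in at_left y. \<phi> (z + s *\<^sub>R \<nu>) > \<phi> z" unfolding filterlim_at_top_dense by blast
      moreover have "\<forall>\<^sub>F s in at_left y. s \<in> {0<..<y}" using eventually_at_left_real[OF y] .
      ultimately have "\<forall>\<^sub>F s in at_left y. False"
      proof eventually_elim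
        fix s assume "\<phi> (z + s *\<^sub>R \<nu>) > \<phi> z" "s \<in> {0<..<y}"
        then show False using dec[of s] by auto
      qed
      then show False by (simp add: trivial_limit_at_left_real)
    qed
    show "\<exists>C. \<exists>\<delta>>0. \<forall>z\<in>\<Omega>. infdist z ?J < \<delta> \<longrightarrow> \<bar>dir_deriv (\<i> * \<nu>) \<psi> z - 1\<bar> \<le> C * (infdist z ?J)\<^sup>2"
    proof (rule exI[of _ "3 * K\<^sup>2"], rule exI[of _ \<delta>], intro conjI \<delta>(1) ballI impI)
      fix z assume z: "z \<in> \<Omega>" "infdist z ?J < \<delta>"
      define m where "m = ?N z / ?W z"
      have m0: "m > 0" using sign[OF z] Wpos[of z] by (simp add: m_def)
      have "?N z = \<nu> \<bullet> grad \<phi> z" unfolding N[OF z(1)] by (simp add: inner_complex_def grad_def)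
      then have "\<bar>?N z\<bar> \<le> norm (grad \<phi> z)" using Cauchy_Schwarz_ineq2[of \<nu> "grad \<phi> z"] n1 by simp
      also have "\<dots> \<le> ?W z" by (intro real_le_rsqrt) simp
      finally have m1: "m \<le> 1" using Wpos[of z] by (simp add: m_def divide_le_eq)
      \<comment> \<open>For \<open>m\<close> between 0 and 1 the defect \<open>1 - m\<close> is at
        most \<open>1 - m\<^sup>2\<close>; here the sign of the slope enters.\<close>
      have "m * m \<le> m * 1" using m0 m1 by (intro mult_left_mono) auto
      then have "1 - m \<le> 1 - m\<^sup>2" by (simp add: power2_eq_square)
      also have "\<dots> \<le> 3 * (K * infdist z ?J)\<^sup>2" using est[OF z] by (simp add: m_def)
      finally show "\<bar>dir_deriv (\<i> * \<nu>) \<psi> z - 1\<bar> \<le> 3 * K\<^sup>2 * (infdist z ?J)\<^sup>2"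
        unfolding psi[OF z(1)] m_def[symmetric] using m1 by (simp add: power_mult_distrib)
    qed
  qed
qed

end

section \<open>Holomorphic data of the surface and conclusion\<close>

text \<open>The chain rule makes \<open>T'\<close> the complex gradient of
  \<open>\<phi> (f w)\<close>, continuous because \<phi> is continuously differentiable.
  Conformality says that its square is minus the sum of the squares of the derivatives of
  \<open>U\<close> and \<open>V\<close>, hence holomorphic. So \<open>T'\<close> is holomorphic
  itself, and its primitive provides \<open>T\<close>. The last claim is the positivity of the
  Jacobian of \<open>f\<close> in complex form.\<close>

lemma corresponding_harmonic_mapping_holomorphic_data:
  assumes \<Omega>: "open \<Omega>" and \<phi>: "C1_on \<phi> \<Omega>" and f: "corresponding_harmonic_mapping \<Omega> \<phi> f"
  obtains U V T where "U holomorphic_on ball 0 1" "V holomorphic_on ball 0 1" "T holomorphic_on ball 0 1"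
    "\<And>w. w \<in> ball 0 1 \<Longrightarrow> f w = Complex (Re (U w)) (Re (V w))"
    "\<And>w. w \<in> ball 0 1 \<Longrightarrow> \<phi> (f w) = Re (T w)"
    "\<And>w. w \<in> ball 0 1 \<Longrightarrow> (deriv U w)\<^sup>2 + (deriv V w)\<^sup>2 +
      (of_real (dx \<phi> (f w)) * deriv U w + of_real (dy \<phi> (f w)) * deriv V w)\<^sup>2 = 0"
    "\<And>w. w \<in> ball 0 1 \<Longrightarrow> Im (deriv U w * cnj (deriv V w)) > 0"
proof -
  have har: "C2_on f (ball 0 1)" "\<And>w. w \<in> ball 0 1 \<Longrightarrow> dx (dx f) w + dy (dy f) w = 0"
    and ori: "\<And>w. w \<in> ball 0 1 \<Longrightarrow> Re (dx f w) * Im (dy f w) - Im (dx f w) * Re (dy f w) > 0"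
    and img: "f ` ball 0 1 = \<Omega>"
    and iso: "\<And>w. w \<in> ball 0 1 \<Longrightarrow> dx (\<lambda>w. (f w, \<phi> (f w))) w \<bullet> dx (\<lambda>w. (f w, \<phi> (f w))) w
        = dy (\<lambda>w. (f w, \<phi> (f w))) w \<bullet> dy (\<lambda>w. (f w, \<phi> (f w))) w \<and>
        dx (\<lambda>w. (f w, \<phi> (f w))) w \<bullet> dy (\<lambda>w. (f w, \<phi> (f w))) w = 0"
    using f unfolding corresponding_harmonic_mapping_def harmonic_on_def orientation_preserving_on_def
      isothermal_parametrization_def by blast+
  have harL: "dx (dx (\<lambda>w. L (f w))) w + dy (dy (\<lambda>w. L (f w))) w = 0"
    if L: "bounded_linear L" and w: "w \<in> ball 0 1" for L :: "complex \<Rightarrow> real" and w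
  proof -
    have "L (dx (dx f) w + dy (dy f) w) = L 0" using har(2)[OF w] by simp
    then show ?thesis
      using C2_on_bounded_linear(4,5)[OF open_ball L har(1) w]
        linear_simps(1)[OF L, of "dx (dx f) w" "dy (dy f) w"] linear_simps(3)[OF L] by simp
  qed
  obtain U where U: "U holomorphic_on ball 0 1" "\<And>w. w \<in> ball 0 1 \<Longrightarrow> Re (f w) = Re (U w)"
    "\<And>w. w \<in> ball 0 1 \<Longrightarrow> deriv U w = Complex (dx (\<lambda>w. Re (f w)) w) (- dy (\<lambda>w. Re (f w)) w)"
    by (rule harmonic_eq_Re_holomorphic[OF C2_on_bounded_linear(1)[OF open_ball bounded_linear_Re har(1)]
        harL[OF bounded_linear_Re]]) blast+
  obtain V where V: "V holomorphic_on ball 0 1" "\<And>w. w \<in> ball 0 1 \<Longrightarrow> Im (f w) = Re (V w)"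
    "\<And>w. w \<in> ball 0 1 \<Longrightarrow> deriv V w = Complex (dx (\<lambda>w. Im (f w)) w) (- dy (\<lambda>w. Im (f w)) w)"
    by (rule harmonic_eq_Re_holomorphic[OF C2_on_bounded_linear(1)[OF open_ball bounded_linear_Im har(1)]
        harL[OF bounded_linear_Im]]) blast+
  have dU: "deriv U w = Complex (Re (dx f w)) (- Re (dy f w))" and dV: "deriv V w = Complex (Im (dx f w)) (- Im (dy f w))"
    if "w \<in> ball 0 1" for w
    using U(3)[OF that] V(3)[OF that] C2_on_bounded_linear(2,3)[OF open_ball bounded_linear_Re har(1) that]
      C2_on_bounded_linear(2,3)[OF open_ball bounded_linear_Im har(1) that] by simp_all
  have fUV: "f w = Complex (Re (U w)) (Re (V w))" if "w \<in> ball 0 1" for w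
    using U(2)[OF that] V(2)[OF that] by (simp add: complex_eq_iff)
  define T' where "T' w = of_real (dx \<phi> (f w)) * deriv U w + of_real (dy \<phi> (f w)) * deriv V w" for w
  have df: "(f has_derivative (\<lambda>h. of_real (Re (deriv U w * h)) + \<i> * of_real (Re (deriv V w * h)))) (at w)"
    if w: "w \<in> ball 0 1" for w
  proof -
    have "(U has_derivative (*) (deriv U w)) (at w)" "(V has_derivative (*) (deriv V w)) (at w)"
      using holomorphic_derivI[OF U(1) open_ball w] holomorphic_derivI[OF V(1) open_ball w]
      by (simp_all add: has_field_derivative_def)
    then have "((\<lambda>w. of_real (Re (U w)) + \<i> * of_real (Re (V w))) has_derivative
        (\<lambda>h. of_real (Re (deriv U w * h)) + \<i> * of_real (Re (deriv V w * h)))) (at w)"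
      by (intro has_derivative_add has_derivative_mult_right has_derivative_of_real has_derivative_Re)
    then show ?thesis
      by (rule has_derivative_transform_within_open[OF _ open_ball w]) (simp add: fUV complex_eq_iff)
  qed
  have dt: "((\<lambda>w. \<phi> (f w)) has_derivative (\<lambda>h. Re (T' w * h))) (at w)" if w: "w \<in> ball 0 1" for w
  proof -
    have fw: "f w \<in> \<Omega>" using w img by blast
    have "((\<lambda>w. \<phi> (f w)) has_derivative (\<lambda>h. Re (of_real (Re (deriv U w * h)) + \<i> * of_real (Re (deriv V w * h))) * dx \<phi> (f w)
       + Im (of_real (Re (deriv U w * h)) + \<i> * of_real (Re (deriv V w * h))) * dy \<phi> (f w))) (at w)"
      by (rule has_derivative_compose[OF df[OF w] C1_onD[OF \<phi> fw]])
    moreover have "(\<lambda>h. Re (of_real (Re (deriv U w * h)) + \<i> * of_real (Re (deriv V w * h))) * dx \<phi> (f w)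
       + Im (of_real (Re (deriv U w * h)) + \<i> * of_real (Re (deriv V w * h))) * dy \<phi> (f w)) = (\<lambda>h. Re (T' w * h))"
      by (simp add: fun_eq_iff T'_def algebra_simps)
    ultimately show ?thesis by simp
  qed
  \<comment> \<open>The two partial derivatives of the parametrization are the real part and minus
    the imaginary part of the vector of complex derivatives. Equal length and orthogonality are
    therefore the real and the imaginary part of one complex equation.\<close>
  have sq: "(deriv U w)\<^sup>2 + (deriv V w)\<^sup>2 + (T' w)\<^sup>2 = 0" if w: "w \<in> ball 0 1" for w
  proof -
    have "((\<lambda>w. (f w, \<phi> (f w))) has_derivative (\<lambda>h. (of_real (Re (deriv U w * h)) + \<i> * of_real (Re (deriv V w * h)), Re (T' w * h)))) (at w)"
      by (rule has_derivative_Pair[OF df[OF w] dt[OF w]])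
    from dir_deriv_eq[OF this]
    have X: "dx (\<lambda>w. (f w, \<phi> (f w))) w = (Complex (Re (deriv U w)) (Re (deriv V w)), Re (T' w))"
      "dy (\<lambda>w. (f w, \<phi> (f w))) w = (Complex (- Im (deriv U w)) (- Im (deriv V w)), - Im (T' w))"
      by (simp_all add: dx_def dy_def complex_eq_iff)
    show ?thesis using iso[OF w] unfolding X
      by (simp add: inner_complex_def complex_eq_iff power2_eq_square mult.commute)
  qed
  have T'hol: "T' holomorphic_on ball 0 1"
  proof (rule continuous_square_root_holomorphic[OF open_ball _ _ _ , where H = "\<lambda>w. - ((deriv U w)\<^sup>2 + (deriv V w)\<^sup>2)"])
    have hd: "deriv U holomorphic_on ball 0 1" "deriv V holomorphic_on ball 0 1"
      using U(1) V(1) by (auto intro: holomorphic_deriv)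
    have cf: "continuous_on (ball 0 1) f" using har(1) C1_on_continuous by (auto simp: C2_on_def)
    have c: "continuous_on \<Omega> (dx \<phi>)" "continuous_on \<Omega> (dy \<phi>)" using \<phi> by (auto simp: C1_on_def)
    have c2: "continuous_on (ball 0 1) (\<lambda>w. dx \<phi> (f w))" "continuous_on (ball 0 1) (\<lambda>w. dy \<phi> (f w))"
      using continuous_on_compose2[OF c(1) cf] continuous_on_compose2[OF c(2) cf] img by auto
    show "continuous_on (ball 0 1) T'" unfolding T'_def
      by (intro continuous_intros c2 holomorphic_on_imp_continuous_on hd)
    show "(\<lambda>w. - ((deriv U w)\<^sup>2 + (deriv V w)\<^sup>2)) holomorphic_on ball 0 1" by (intro holomorphic_intros hd)
    show "(T' w)\<^sup>2 = - ((deriv U w)\<^sup>2 + (deriv V w)\<^sup>2)" if "w \<in> ball 0 1" for w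
    proof -
      have "x + y + t = 0 \<Longrightarrow> t = - (x + y)" for x y t :: complex
        unfolding eq_neg_iff_add_eq_0 by (simp add: ac_simps)
      from this[OF sq[OF that]] show ?thesis .
    qed
  qed simp
  obtain T where T: "T holomorphic_on ball 0 1" "\<And>w. w \<in> ball 0 1 \<Longrightarrow> \<phi> (f w) = Re (T w)"
    by (rule Re_of_gradient_primitive[OF T'hol dt]) blast+
  show ?thesis
  proof (rule that[OF U(1) V(1) T(1) fUV T(2)])
    show "(deriv U w)\<^sup>2 + (deriv V w)\<^sup>2 +
      (of_real (dx \<phi> (f w)) * deriv U w + of_real (dy \<phi> (f w)) * deriv V w)\<^sup>2 = 0" if "w \<in> ball 0 1" for w
      using sq[OF that] by (simp add: T'_def)
    show "Im (deriv U w * cnj (deriv V w)) > 0" if "w \<in> ball 0 1" for w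
      using ori[OF that] unfolding dU[OF that] dV[OF that] by (simp add: algebra_simps)
  qed
qed

theorem theorem1p1:
  fixes \<Omega> I :: "complex set" and a b :: complex
    and \<phi> \<psi> :: "complex \<Rightarrow> real" and f :: "complex \<Rightarrow> complex"
  assumes "jordan_domain \<Omega>" and "bounded \<Omega>" and "simply_connected \<Omega>"
    and "a \<noteq> b" and "I = open_segment a b" and "I \<subseteq> frontier \<Omega>"
    and "minimal_surface_solution \<Omega> \<phi>"
    and "is_dual \<Omega> \<phi> \<psi>"
    and "corresponding_harmonic_mapping \<Omega> \<phi> f"
  shows "(tends_to_plus_infinity_on \<Omega> \<phi> I \<longleftrightarrow> tamely_degenerates_on \<Omega> \<psi> I) \<and>
    (tends_to_plus_infinity_on \<Omega> \<phi> I \<longrightarrow>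
      (\<exists>E F. is_boundary_function \<Omega> f E F \<and> (\<exists>w\<^sub>0\<in>E. I \<subseteq> cluster_set f w\<^sub>0)))"
proof -
  obtain g where g: "simple_path g" "pathfinish g = pathstart g"
    and \<Omega>: "open \<Omega>" "connected \<Omega>" "frontier \<Omega> = path_image g"
    using assms(1) unfolding jordan_domain_def by blast
  have I: "open_segment a b \<subseteq> frontier \<Omega>" using assms(5,6) by simp
  have \<phi>: "C1_on \<phi> \<Omega>" using assms(7) by (simp add: minimal_surface_solution_def C2_on_def)
  obtain U V T where UV: "U holomorphic_on ball 0 1" "V holomorphic_on ball 0 1" and T: "T holomorphic_on ball 0 1"
    and fUV: "\<And>w. w \<in> ball 0 1 \<Longrightarrow> f w = Complex (Re (U w)) (Re (V w))"
    and \<phi>T: "\<And>w. w \<in> ball 0 1 \<Longrightarrow> \<phi> (f w) = Re (T w)"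
    and conf: "\<And>w. w \<in> ball 0 1 \<Longrightarrow> (deriv U w)\<^sup>2 + (deriv V w)\<^sup>2 +
      (of_real (dx \<phi> (f w)) * deriv U w + of_real (dy \<phi> (f w)) * deriv V w)\<^sup>2 = 0"
    and orient: "\<And>w. w \<in> ball 0 1 \<Longrightarrow> Im (deriv U w * cnj (deriv V w)) > 0"
    by (rule corresponding_harmonic_mapping_holomorphic_data[OF \<Omega>(1) \<phi> assms(9)]) blast
  interpret harmonic_jordan_map f U V \<Omega> g
  proof
    show "inj_on f (ball 0 1)" "f ` ball 0 1 = \<Omega>"
      using assms(9) by (simp_all add: corresponding_harmonic_mapping_def)
  qed (fact g \<Omega> UV fUV assms(2))+
  have "tamely_degenerates_on \<Omega> \<psi> (open_segment a b)" if inf: "tends_to_plus_infinity_on \<Omega> \<phi> (open_segment a b)"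
    by (rule infinity_imp_tame_degeneration[OF T \<phi>T I assms(4) inf \<phi> assms(8) conf orient])
  moreover have "tends_to_plus_infinity_on \<Omega> \<phi> (open_segment a b)" if "tamely_degenerates_on \<Omega> \<psi> (open_segment a b)"
    by (rule tame_degeneration_imp_infinity[OF g \<Omega> I assms(4) \<phi> assms(8) that])
  moreover have "\<exists>E F. is_boundary_function \<Omega> f E F \<and> (\<exists>w\<^sub>0\<in>E. open_segment a b \<subseteq> cluster_set f w\<^sub>0)"
    if inf: "tends_to_plus_infinity_on \<Omega> \<phi> (open_segment a b)"
  proof -
    obtain t where t: "t \<in> E0" "open_segment a b \<subseteq> cl t"
      "\<And>s. cl s \<inter> open_segment a b \<noteq> {} \<Longrightarrow> cis s = cis t"
      by (rule infinity_imp_collapse[OF T \<phi>T I assms(4) inf]) blast+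
    then have "cis t \<in> cis ` E0 \<and> open_segment a b \<subseteq> cluster_set f (cis t)" by blast
    then show ?thesis using is_boundary_function_bF by blast
  qed
  ultimately show ?thesis unfolding assms(5) by blast
qed

end
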